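(* Let $p,r\ge1$ be integers and let $(a_n)_{n\ge0}$ be positive real numbers with $\lim_{n\to\infty}a_{rn+j}=b_j>0$ for $j\in[0:r-1]$. Fix $k\in[0:p-1]$, let $\Gamma_k$ be as in the context and put $\widetilde\Gamma_k=\{x^{p+1}: x\in\Gamma_k\}$. Then: (a) $\widetilde\Gamma_k\subset\mathbb R_+$ if $k$ is even, and $\widetilde\Gamma_k\subset\mathbb R_-$ if $k$ is odd. (b) $\widetilde\Gamma_k$ is the union of $n_k$ intervals, $\widetilde\Gamma_k=\bigcup_{j=1}^{n_k}I_{j,k}$, with $$n_k=\left\lceil\frac{k+1}{p+1}\,r\right\rceil-\left\lfloor\frac{kr}{p}\right\rfloor,$$ and the intervals $I_{j,k}$, $j\in[1:n_k]$, are pairwise disjoint except maybe for common endpoints. (c) If $\frac{k+1}{p+1}r\notin\mathbb N$, then $0\in\widetilde\Gamma_k$. If $\frac{kr}{p}\notin\mathbb N\cup\{0\}$, then $(-1)^k\infty\in\widetilde\Gamma_k$.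
   Context: Notation: $[i:j]=\{i,i+1,\dots,j\}$, $\mathbb N=\{1,2,3,\dots\}$; $\lceil\cdot\rceil$, $\lfloor\cdot\rfloor$ are the ceiling and floor functions. Saying that $(-1)^k\infty\in\widetilde\Gamma_k$ means that one of the intervals constituting $\widetilde\Gamma_k$ is unbounded, extending to $+\infty$ ($k$ even) or $-\infty$ ($k$ odd). Let $Z=\begin{pmatrix}0&z\\ I_{r-1}&0\end{pmatrix}$ be the $r\times r$ cyclic shift matrix ($Z=z$ if $r=1$), $F(z,x)=Z^{-1}+Z^p\,\mathrm{diag}(b_0,\dots,b_{r-1})-xI_r$, and $f(z,x)=\det F(z,x)$. For each $x\in\mathbb C$ the equation $f(z,x)=0$ has exactly $p+1$ roots $z_k(x)$, $k\in[0:p]$ (counting multiplicities), ordered so that $|z_0(x)|\le|z_1(x)|\le\dots\le|z_p(x)|$ (ties labelled arbitrarily). For $k\in[0:p-1]$, $\Gamma_k=\{x\in\mathbb C:|z_k(x)|=|z_{k+1}(x)|\}$. *)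

theory Defs
  imports
    "HOL-Complex_Analysis.Complex_Analysis"
    "Jordan_Normal_Form.Gauss_Jordan_Elimination"
    "Jordan_Normal_Form.Determinant"
begin

definition cyclic_shift :: "nat \<Rightarrow> complex \<Rightarrow> complex Matrix.mat" where
  "cyclic_shift r z = Matrix.mat r r
     (\<lambda>(i, j). if i = 0 \<and> j = r - 1 then z else if i = j + 1 then 1 else 0)"

(* The cyclic shift is invertible exactly for z \<noteq> 0, so F and f are only meaningful for
   z \<noteq> 0; every use of f below is restricted to such z. *)
definition symbol_F ::
  "nat \<Rightarrow> nat \<Rightarrow> (nat \<Rightarrow> real) \<Rightarrow> complex \<Rightarrow> complex \<Rightarrow> complex Matrix.mat" where
  "symbol_F p r b z x =
     the (mat_inverse (cyclic_shift r z))
     + cyclic_shift r z ^\<^sub>m p * mat_diag r (\<lambda>i. complex_of_real (b i))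
     - x \<cdot>\<^sub>m 1\<^sub>m r"

definition symbol_f ::
  "nat \<Rightarrow> nat \<Rightarrow> (nat \<Rightarrow> real) \<Rightarrow> complex \<Rightarrow> complex \<Rightarrow> complex" where
  "symbol_f p r b z x = Determinant.det (symbol_F p r b z x)"

(* zs lists the p + 1 roots of f(., x), each as often as its multiplicity (the order of
   the zero of the holomorphic function f(., x) on the punctured plane), by
   nondecreasing modulus. *)
definition ordered_roots ::
  "nat \<Rightarrow> nat \<Rightarrow> (nat \<Rightarrow> real) \<Rightarrow> complex \<Rightarrow> complex list \<Rightarrow> bool" where
  "ordered_roots p r b x zs \<longleftrightarrow>
     length zs = p + 1 \<and> sorted (map cmod zs) \<and>
     (\<forall>z\<in>set zs. z \<noteq> 0 \<and> symbol_f p r b z x = 0) \<and>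
     (\<forall>z. z \<noteq> 0 \<and> symbol_f p r b z x = 0 \<longrightarrow>
        int (count_list zs z) = zorder (\<lambda>w. symbol_f p r b w x) z)"

(* Ties in modulus are broken arbitrarily by the choice operator; the moduli
   of the roots do not depend on it. *)
definition z_root ::
  "nat \<Rightarrow> nat \<Rightarrow> (nat \<Rightarrow> real) \<Rightarrow> nat \<Rightarrow> complex \<Rightarrow> complex" where
  "z_root p r b k x = (SOME zs. ordered_roots p r b x zs) ! k"

definition Gamma_set :: "nat \<Rightarrow> nat \<Rightarrow> (nat \<Rightarrow> real) \<Rightarrow> nat \<Rightarrow> complex set" where
  "Gamma_set p r b k = {x. cmod (z_root p r b k x) = cmod (z_root p r b (k + 1) x)}"

definition Gamma_tilde :: "nat \<Rightarrow> nat \<Rightarrow> (nat \<Rightarrow> real) \<Rightarrow> nat \<Rightarrow> complex set" where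
  "Gamma_tilde p r b k = (\<lambda>x. x ^ (p + 1)) ` Gamma_set p r b k"

definition interval_count :: "nat \<Rightarrow> nat \<Rightarrow> nat \<Rightarrow> int" where
  "interval_count p r k =
     \<lceil>real (k + 1) / real (p + 1) * real r\<rceil> - \<lfloor>real (k * r) / real p\<rfloor>"

(* Closed intervals of the real line, possibly unbounded. Empty and one-point
   intervals are excluded: otherwise the number of intervals in a decomposition
   would carry no information. *)
definition proper_interval :: "real set \<Rightarrow> bool" where
  "proper_interval I \<longleftrightarrow> is_interval I \<and> closed I \<and> interior I \<noteq> {}"

(* The frontier of an interval of the real line consists of its finite endpoints. *)
definition disjoint_up_to_endpoints :: "real set \<Rightarrow> real set \<Rightarrow> bool" where
  "disjoint_up_to_endpoints I J \<longleftrightarrow> I \<inter> J \<subseteq> frontier I \<inter> frontier J"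

(* I extends to (-1)^k * infinity. *)
definition extends_to_signed_infinity :: "nat \<Rightarrow> real set \<Rightarrow> bool" where
  "extends_to_signed_infinity k I \<longleftrightarrow>
     (if even k then \<not> bdd_above I else \<not> bdd_below I)"

end

theory Submission
  imports Defs "HOL-Computational_Algebra.Fundamental_Theorem_Algebra"
begin

text \<open>
  A root \<open>z\<close> of the symbol corresponds to a solution \<open>u (n + p + 1) = x * u (n + p) - b n * u n\<close> with
  \<open>u (n + r) = u n / z\<close>. When the arguments of two powers \<open>x ^ (p + 1)\<close> are distinct rational multiples
  of \<open>pi\<close>, two such solutions with equal growth give cyclic real sequences evolving by a
  variation-diminishing recursion, and counting sign changes shows that this is impossible. Deforming
  the weights to constant ones, where the moduli are those of the roots of a trinomial, one obtains
  that for fixed \<open>cmod x\<close> the modulus of the root \<open>k\<close> is strictly monotone in the argument of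
  \<open>x ^ (p + 1)\<close>, decreasing for even and increasing for odd \<open>k\<close>, and that the ranges of different
  roots do not overlap. Hence ties between the roots \<open>k\<close> and \<open>k + 1\<close> lie on one ray.

  By the Cauchy-Riemann equations the phase of the root \<open>k\<close> is monotone along this ray. Its total
  variation follows from the sizes of the roots near \<open>0\<close> and \<open>\<infinity>\<close>: measured in units of \<open>pi\<close> it runs
  from \<open>(k + 1) * r / (p + 1)\<close> down to \<open>k * r / p\<close>. Where the phase is not an integer the root is not
  real, so its conjugate is the root \<open>k + 1\<close> and there is a tie; the intervals are the closures of
  the sets where the phase lies strictly between two consecutive integers. There are no further ties
  because the quotient of two real roots extends by reflection across the ray and
  would attain its maximal modulus.
\<close>

text \<open>Commensurable arguments make counting possible: the unimodular factor of the recursion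
  becomes a root of unity, and the infinite sequence closes up into a ring of finitely many real
  numbers. Two solutions carry four real parameters, enough to force zeros at two adjacent places of
  the ring. Equal growth lets the state return, up to a positive factor, arbitrarily close to
  itself, so the count, which never increases, cannot drop; two adjacent zeros in a nonzero state
  would have made it drop earlier. Only a dense set of arguments is reached in this way; strictness
  elsewhere comes from squeezing between points of that set. The second obstacle is that tied roots
  are labelled arbitrarily, so a priori only their moduli are continuous. Inside a sector the roots
  are holomorphic, and on its edges they are replaced by limits from inside. On an edge a phase is
  known only for products of the smallest roots up to a strict gap in modulus: for the first
  \<open>k\<close> roots on one edge, for the first \<open>k + 1\<close> on the other. This is why a
  whole sector is needed to follow the phase of root \<open>k\<close> along one ray.\<close>

section \<open>Cyclic sign changes\<close>

definition ring_periodic :: "nat \<Rightarrow> (int \<Rightarrow> 'a) \<Rightarrow> bool" where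
  "ring_periodic N f \<longleftrightarrow> (\<forall>j. f (j + int N) = f j)"

text \<open>Zero entries may receive either value; \<open>sign_changes\<close> takes its minimum
  over this freedom.\<close>

definition fills :: "(int \<Rightarrow> real) \<Rightarrow> (int \<Rightarrow> bool) \<Rightarrow> bool" where
  "fills V b \<longleftrightarrow> (\<forall>j. (0 < V j \<longrightarrow> b j) \<and> (V j < 0 \<longrightarrow> \<not> b j))"

definition changes :: "nat \<Rightarrow> (int \<Rightarrow> bool) \<Rightarrow> nat" where
  "changes N b = (\<Sum>i<N. of_bool (b (int i) \<noteq> b (int i - 1)))"

text \<open>The weak count: zeros are filled so as to create as few changes as possible. This makes
  it lower semicontinuous, since perturbing zeros can only add changes.\<close>

definition sign_changes :: "nat \<Rightarrow> (int \<Rightarrow> real) \<Rightarrow> nat" where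
  "sign_changes N V = (LEAST n. \<exists>b. ring_periodic N b \<and> fills V b \<and> changes N b = n)"

lemma sum_ring_window:
  fixes f :: "int \<Rightarrow> nat"
  assumes "ring_periodic N f"
  shows "(\<Sum>i<N. f (w + int i)) = (\<Sum>i<N. f (int i))"
proof -
  have step: "(\<Sum>i<N. f (v + 1 + int i)) = (\<Sum>i<N. f (v + int i))" for v
  proof -
    have "(\<Sum>i<Suc N. f (v + int i)) = f v + (\<Sum>i<N. f (v + 1 + int i))"
      by (subst sum.lessThan_Suc_shift) (simp add: algebra_simps)
    moreover have "(\<Sum>i<Suc N. f (v + int i)) = (\<Sum>i<N. f (v + int i)) + f v"
      using assms by (simp add: ring_periodic_def)
    ultimately show ?thesis by simp
  qed
  show ?thesis
  proof (induction w rule: int_induct[where k = 0])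
    case (step1 i) then show ?case using step[of i] by simp
  next
    case (step2 i) then show ?case using step[of "i - 1"] by simp
  qed simp
qed

lemma changes_window:
  assumes "ring_periodic N b"
  shows "changes N b = (\<Sum>i<N. of_bool (b (w + int i) \<noteq> b (w + int i - 1)))"
proof -
  have "b (j + int N - 1) = b (j - 1)" for j
    using assms unfolding ring_periodic_def by (metis diff_add_eq)
  then have "ring_periodic N (\<lambda>j. of_bool (b j \<noteq> b (j - 1)) :: nat)"
    using assms by (auto simp: ring_periodic_def)
  from sum_ring_window[OF this, of w] show ?thesis by (simp add: changes_def)
qed

text \<open>Two updated places are never adjacent because \<open>d \<ge> 2\<close>. Copying the left
  neighbour moves a change from the left side of a place to its right side, or removes both changes
  there if the two neighbours agree.\<close>

lemma changes_update:
  fixes d :: nat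
  assumes d: "d \<ge> 2" "d dvd N" and per: "ring_periodic N b" "ring_periodic N b'"
    and off: "\<And>j. j mod int d \<noteq> l mod int d \<Longrightarrow> b' j = b j"
    and on: "\<And>j. j mod int d = l mod int d \<Longrightarrow> b' j = b j \<or> b' j = b (j - 1)"
  shows "changes N b' \<le> changes N b"
    and "N > 0 \<Longrightarrow> b' l = b (l - 1) \<Longrightarrow> b l \<noteq> b (l - 1) \<Longrightarrow> b (l + 1) = b (l - 1)
      \<Longrightarrow> changes N b' < changes N b"
proof -
  obtain M where N: "N = M * d" using d(2) by (metis dvd_div_mult_self)
  define g where "g c i = (of_bool (c (l + int i) \<noteq> c (l + int i - 1)) :: nat)" for c :: "int \<Rightarrow> bool" and i
  \<comment> \<open>Cutting the ring at \<open>l\<close> into blocks of length \<open>d\<close> puts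
    the updated place first in each block, so only the first two comparisons of a block are
    affected.\<close>
  have blk: "changes N c = (\<Sum>m<M. sum (g c) {m*d..<m*d+d})" if "ring_periodic N c" for c
    using changes_window[OF that, of l] unfolding g_def N by (subst sum.nat_group) simp
  have split: "sum (g c) {m*d..<m*d+d} = g c (m*d) + g c (m*d+1) + sum (g c) {m*d+2..<m*d+d}" for c m
  proof -
    have "{m*d..<m*d+d} = {m*d, m*d+1} \<union> {m*d+2..<m*d+d}" using d(1) by auto
    moreover have "sum (g c) ({m*d, m*d+1} \<union> {m*d+2..<m*d+d}) = sum (g c) {m*d, m*d+1} + sum (g c) {m*d+2..<m*d+d}"
      by (rule sum.union_disjoint) auto
    ultimately show ?thesis by simp
  qed
  have modne: "(l + int (m*d+e)) mod int d \<noteq> l mod int d" if "0 < e" "e < d" for m e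
  proof
    assume "(l + int (m*d+e)) mod int d = l mod int d"
    then have "int d dvd (l + int (m*d+e)) - l" by (simp add: mod_eq_dvd_iff)
    then have "int d dvd int m * int d + int e" by simp
    then have "int d dvd int e" by (simp add: dvd_add_right_iff)
    then show False using that by (simp add: nat_dvd_not_less)
  qed
  have rest: "sum (g b') {m*d+2..<m*d+d} = sum (g b) {m*d+2..<m*d+d}" for m
  proof (rule sum.cong[OF refl])
    fix i assume "i \<in> {m*d+2..<m*d+d}"
    then obtain e where e: "i = m*d+e" "2 \<le> e" "e < d"
      by (metis atLeastLessThan_iff le_Suc_ex add.assoc add_less_cancel_left le_add1)
    have "b' (l + int i) = b (l + int i)" unfolding e(1) using e by (intro off modne) auto
    moreover have sh1: "l + int i - 1 = l + int (m*d+(e-1))" using e by simp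
    moreover have "b' (l + int (m*d+(e-1))) = b (l + int (m*d+(e-1)))" using e by (intro off modne) auto
    ultimately show "g b' i = g b i" unfolding g_def sh1 by presburger
  qed
  have b1: "b' (l + int (m*d+1)) = b (l + int (m*d+1))" for m using off modne[of 1 m] d by simp
  have bm1: "b' (l + int (m*d) - 1) = b (l + int (m*d) - 1)" for m
  proof -
    have "(l + int (m*d) - 1) mod int d \<noteq> l mod int d"
    proof
      assume "(l + int (m*d) - 1) mod int d = l mod int d"
      then have "int d dvd (l + int (m*d) - 1) - l" by (simp add: mod_eq_dvd_iff)
      then have "int d dvd int m * int d - 1" by (simp add: algebra_simps)
      then have "int d dvd 1" by (metis dvd_diff_right_iff dvd_triv_right)
      then show False using d by simp
    qed
    then show ?thesis using off by blast
  qed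
  have b0: "b' (l + int (m*d)) = b (l + int (m*d)) \<or> b' (l + int (m*d)) = b (l + int (m*d) - 1)" for m
    using on[of "l + int (m*d)"] by simp
  have sh: "l + int (m*d+1) - 1 = l + int (m*d)" for m by simp
  have le: "g b' (m*d) + g b' (m*d+1) \<le> g b (m*d) + g b (m*d+1)" for m
    using b0[of m] unfolding g_def sh b1 bm1 by auto
  show "changes N b' \<le> changes N b"
    unfolding blk[OF per(1)] blk[OF per(2)] by (rule sum_mono) (simp only: split rest add_le_cancel_right le)
  assume s: "N > 0" "b' l = b (l - 1)" "b l \<noteq> b (l - 1)" "b (l + 1) = b (l - 1)"
  have "M > 0" using s(1) N by (cases M) auto
  have "g b' (0*d) + g b' (0*d+1) < g b (0*d) + g b (0*d+1)"
    using s b1[of 0] bm1[of 0] unfolding g_def by auto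
  then show "changes N b' < changes N b"
    unfolding blk[OF per(1)] blk[OF per(2)]
  proof (intro sum_strict_mono_ex1)
    assume lt: "g b' (0*d) + g b' (0*d+1) < g b (0*d) + g b (0*d+1)"
    show "\<forall>m\<in>{..<M}. sum (g b') {m*d..<m*d+d} \<le> sum (g b) {m*d..<m*d+d}"
      by (simp only: split rest add_le_cancel_right le) simp
    have "sum (g b') {0*d..<0*d+d} < sum (g b) {0*d..<0*d+d}"
      by (simp only: split rest add_less_cancel_right lt)
    then show "\<exists>m\<in>{..<M}. sum (g b') {m*d..<m*d+d} < sum (g b) {m*d..<m*d+d}"
      using \<open>M > 0\<close> by blast
  qed simp
qed

text \<open>Both ends of the arc already carry \<open>s\<close>, so filling it creates no change and
  removes the one at its first entry different from \<open>s\<close>. The bound on \<open>k\<close>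
  keeps the arc from overlapping itself; \<open>k\<close> may be the place \<open>l - 1\<close> one
  turn later.\<close>

lemma changes_flip:
  assumes per: "ring_periodic N b" and lk: "l < k" "k \<le> l - 1 + int N"
    and ends: "b (l - 1) = s" "b k = s" and j: "l \<le> j" "j < k" "b j \<noteq> s"
  shows "changes N (\<lambda>j. if (j - l) mod int N < k - l then s else b j) < changes N b" (is "changes N ?c < _")
proof -
  have perc: "ring_periodic N ?c"
    unfolding ring_periodic_def
  proof
    fix j
    have "(j + int N - l) mod int N = (j - l) mod int N" by (metis add_diff_eq add.commute mod_add_self2)
    then show "?c (j + int N) = ?c j" using per by (simp add: ring_periodic_def)
  qed
  have N: "int N > 0" using lk by linarith
  have cv: "?c (l + int i) = (if int i < k - l then s else b (l + int i))" if "i < N" for i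
    using that by simp
  have cv0: "?c (l - 1) = s" using ends by simp
  have cv1: "?c (l + int i - 1) = (if int i \<le> k - l then s else b (l + int i - 1))" if "i < N" for i
  proof (cases i)
    case 0 then show ?thesis using ends lk by simp
  next
    case (Suc n) then show ?thesis using cv[of n] that by (auto simp: algebra_simps)
  qed
  have le: "of_bool (?c (l + int i) \<noteq> ?c (l + int i - 1)) \<le> (of_bool (b (l + int i) \<noteq> b (l + int i - 1)) :: nat)" if "i < N" for i
  proof -
    consider "int i < k - l" | "int i = k - l" | "int i > k - l" by linarith
    then show ?thesis
    proof cases
      case 2
      then have "l + int i = k" by simp
      then show ?thesis using cv[OF that] cv1[OF that] 2 ends by simp
    qed (use cv[OF that] cv1[OF that] in simp_all)
  qed
  define i where "i = (LEAST i. b (l + int i) \<noteq> s)"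
  have ex: "b (l + int (nat (j - l))) \<noteq> s" using j by simp
  have bi: "b (l + int i) \<noteq> s" unfolding i_def using ex by (rule LeastI)
  have ij: "i \<le> nat (j - l)" unfolding i_def using ex by (rule Least_le)
  have ib: "int i < k - l" "i < N" using ij j lk by linarith+
  have bi1: "b (l + int i - 1) = s"
  proof (cases i)
    case (Suc n)
    then have "n < i" by simp
    then have "\<not> (b (l + int n) \<noteq> s)" unfolding i_def by (rule not_less_Least)
    then show ?thesis using Suc by (simp add: algebra_simps)
  qed (use ends in simp)
  have lt: "of_bool (?c (l + int i) \<noteq> ?c (l + int i - 1)) < (of_bool (b (l + int i) \<noteq> b (l + int i - 1)) :: nat)"
  proof -
    have c0: "?c (l + int i) = s" unfolding cv[OF ib(2)] using ib(1) by (rule if_P)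
    have "int i \<le> k - l" using ib(1) by linarith
    then have c1: "?c (l + int i - 1) = s" unfolding cv1[OF ib(2)] by (rule if_P)
    show ?thesis unfolding c0 c1 bi1 using bi by simp
  qed
  show ?thesis
    unfolding changes_window[OF per, of l] changes_window[OF perc, of l]
  proof (rule sum_strict_mono_ex1)
    show "\<forall>i\<in>{..<N}. of_bool (?c (l + int i) \<noteq> ?c (l + int i - 1)) \<le> (of_bool (b (l + int i) \<noteq> b (l + int i - 1)) :: nat)"
      using le by blast
    show "\<exists>i\<in>{..<N}. of_bool (?c (l + int i) \<noteq> ?c (l + int i - 1)) < (of_bool (b (l + int i) \<noteq> b (l + int i - 1)) :: nat)"
      using lt ib(2) by blast
  qed simp
qed

lemma sign_changes_le:
  assumes "ring_periodic N b" "fills V b"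
  shows "sign_changes N V \<le> changes N b"
  unfolding sign_changes_def using assms by (intro Least_le) auto

lemma sign_changes_attained:
  assumes "ring_periodic N V"
  obtains b where "ring_periodic N b" "fills V b" "changes N b = sign_changes N V"
proof -
  have "\<exists>n b. ring_periodic N b \<and> fills V b \<and> changes N b = n"
    using assms by (intro exI[of _ "changes N (\<lambda>j. 0 < V j)"] exI[of _ "\<lambda>j. 0 < V j"]) (auto simp: ring_periodic_def fills_def)
  from LeastI_ex[OF this] show thesis using that unfolding sign_changes_def by blast
qed

text \<open>Every filling of \<open>W\<close> also fills \<open>V\<close>, because the nonzero
  entries of \<open>V\<close> have the same signs in \<open>W\<close>.\<close>

lemma sign_changes_semicont:
  assumes W: "ring_periodic N W" and "c > 0" and pos: "\<And>j. V j \<noteq> 0 \<Longrightarrow> V j * W j > 0"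
  shows "sign_changes N V \<le> sign_changes N W"
proof -
  obtain b where b: "ring_periodic N b" "fills W b" "changes N b = sign_changes N W"
    using sign_changes_attained[OF W] .
  have "fills V b"
    using b(2) pos unfolding fills_def by (metis less_irrefl zero_less_mult_iff not_less_iff_gr_or_eq)
  then show ?thesis using sign_changes_le b by metis
qed

section \<open>A variation-diminishing recursion on the ring\<close>

text \<open>The form that a recurrence \<open>u (n + d) = u (n + d - 1) + \<delta> n * u n\<close>
  takes when its solution is written around a ring: step \<open>n\<close> replaces only the entries
  that are due. \<open>d dvd N\<close> makes the residue classes well defined on the ring.\<close>

locale smoothing =
  fixes N d :: nat and V :: "nat \<Rightarrow> int \<Rightarrow> real" and \<delta> :: "nat \<Rightarrow> real"
  assumes d: "d \<ge> 2" "d dvd N" "N > 0" and \<delta>: "\<And>n. \<delta> n > 0"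
    and per: "\<And>n. ring_periodic N (V n)"
    and step: "\<And>n j. V (Suc n) j =
      (if j mod int d = int n mod int d then V n (j - 1) + \<delta> n * V n j else V n j)"
begin

lemma neighbour_mod: "j mod int d = c mod int d \<Longrightarrow> (j - 1) mod int d \<noteq> c mod int d"
  "j mod int d = c mod int d \<Longrightarrow> (j + 1) mod int d \<noteq> c mod int d"
proof -
  assume a: "j mod int d = c mod int d"
  { assume "(j - 1) mod int d = c mod int d"
    then have "int d dvd j - (j - 1)" using a by (metis mod_eq_dvd_iff)
    then have False using d by simp }
  then show "(j - 1) mod int d \<noteq> c mod int d" by blast
  { assume "(j + 1) mod int d = c mod int d"
    then have "int d dvd (j + 1) - j" using a by (metis mod_eq_dvd_iff)
    then have False using d by simp }
  then show "(j + 1) mod int d \<noteq> c mod int d" by blast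
qed

text \<open>A fresh zero inherits the sign to its left, so that the new value is always the old one
  or the left one, as \<open>changes_update\<close> requires.\<close>

definition next_filling :: "nat \<Rightarrow> (int \<Rightarrow> bool) \<Rightarrow> int \<Rightarrow> bool" where
  "next_filling n b j = (if j mod int d = int n mod int d
     then (if V (Suc n) j > 0 then True else if V (Suc n) j < 0 then False else b (j - 1)) else b j)"

lemma next_filling:
  assumes b: "ring_periodic N b" "fills (V n) b"
  shows "ring_periodic N (next_filling n b)" "fills (V (Suc n)) (next_filling n b)"
    "j mod int d \<noteq> int n mod int d \<Longrightarrow> next_filling n b j = b j"
    "j mod int d = int n mod int d \<Longrightarrow> next_filling n b j = b j \<or> next_filling n b j = b (j - 1)"
proof -
  obtain q where q: "int N = int d * q" using d(2) by (metis dvd_def of_nat_mult)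
  have "(j + int N) mod int d = j mod int d" for j by (simp add: q)
  moreover have "b (j + int N - 1) = b (j - 1)" for j
    using b(1) unfolding ring_periodic_def by (metis diff_add_eq)
  ultimately show "ring_periodic N (next_filling n b)"
    using b(1) per[of "Suc n"] unfolding ring_periodic_def next_filling_def by simp
  show "fills (V (Suc n)) (next_filling n b)"
    using b(2) unfolding fills_def next_filling_def by (auto simp: step)
  show "j mod int d \<noteq> int n mod int d \<Longrightarrow> next_filling n b j = b j" by (simp add: next_filling_def)
  assume j: "j mod int d = int n mod int d"
  show "next_filling n b j = b j \<or> next_filling n b j = b (j - 1)"
  proof (rule ccontr)
    assume "\<not> ?thesis"
    \<comment> \<open>If both choices fail, \<open>b\<close> agrees at \<open>j\<close> and
      \<open>j - 1\<close>; then both summands have the same weak sign, and so has their positive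
      combination.\<close>
    then have eq: "b j = b (j - 1)" "next_filling n b j \<noteq> b j" by auto
    show False
    proof (cases "b j")
      case True
      then have "V n j \<ge> 0" "V n (j - 1) \<ge> 0" using b(2) eq unfolding fills_def by (metis not_less)+
      then have "V (Suc n) j \<ge> 0" using j \<delta>[of n] by (simp add: step)
      then show False using True eq j unfolding next_filling_def by (auto split: if_splits)
    next
      case False
      then have "V n j \<le> 0" "V n (j - 1) \<le> 0" using b(2) eq unfolding fills_def by (metis not_less)+
      then have "V (Suc n) j \<le> 0" using j \<delta>[of n] by (simp add: step mult_nonneg_nonpos add_nonpos_nonpos)
      then show False using False eq j unfolding next_filling_def by (auto split: if_splits)
    qed
  qed
qed

lemma sign_changes_step: "sign_changes N (V (Suc n)) \<le> sign_changes N (V n)"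
proof -
  obtain b where b: "ring_periodic N b" "fills (V n) b" "changes N b = sign_changes N (V n)"
    using sign_changes_attained[OF per] .
  have "changes N (next_filling n b) \<le> changes N b"
    using next_filling[OF b(1,2)] by (intro changes_update(1)[OF d(1,2) b(1), of _ "int n"]) auto
  then show ?thesis using sign_changes_le next_filling(1,2)[OF b(1,2)] b(3) by (metis le_trans)
qed

lemma sign_changes_antimono: "m \<le> n \<Longrightarrow> sign_changes N (V n) \<le> sign_changes N (V m)"
  by (induction n rule: dec_induct) (use sign_changes_step le_trans in blast)+

text \<open>At \<open>l\<close> the terms \<open>V n (l - 1)\<close> and
  \<open>\<delta> n * V n l\<close> have just cancelled, so the old signs at \<open>l - 1\<close>
  and \<open>l\<close> were opposite. As equal signs bound the run, that change is lost: either the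
  update has removed it, or the new filling still deviates inside the run and can be
  flattened.\<close>

lemma sign_changes_drop:
  assumes l: "l mod int d = int n mod int d" "l < k" and z: "\<And>j. l \<le> j \<Longrightarrow> j < k \<Longrightarrow> V (Suc n) j = 0"
    and same: "V n (l - 1) * V (Suc n) k > 0"
  shows "sign_changes N (V (Suc n)) < sign_changes N (V n)"
proof -
  obtain b where b: "ring_periodic N b" "fills (V n) b" "changes N b = sign_changes N (V n)"
    using sign_changes_attained[OF per] .
  define b' where "b' = next_filling n b"
  note nf = next_filling[OF b(1,2), folded b'_def]
  define s where "s = (V n (l - 1) > 0)"
  have ne: "V n (l - 1) \<noteq> 0" "V (Suc n) k \<noteq> 0" using same by auto
  have l1: "V (Suc n) (l - 1) = V n (l - 1)" using neighbour_mod(1)[OF l(1)] by (simp add: step)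
  \<comment> \<open>A longer run would contain the nonzero entry at \<open>l - 1\<close> one turn
    later.\<close>
  have kb: "k \<le> l - 1 + int N"
  proof (rule ccontr)
    assume "\<not> ?thesis"
    moreover have "V (Suc n) (l - 1 + int N) = V (Suc n) (l - 1)" using per[of "Suc n"] by (simp add: ring_periodic_def)
    ultimately show False using z[of "l - 1 + int N"] l1 ne d(3) by auto
  qed
  have sk: "(0 < V (Suc n) k) = s" using same ne by (auto simp: s_def zero_less_mult_iff)
  have fs: "c j = (0 < W j)" if "fills W c" "W j \<noteq> 0" for W c j
  proof (cases "0 < W j")
    case False
    then have "W j < 0" using that(2) by linarith
    then show ?thesis using that(1) False by (auto simp: fills_def)
  qed (use that in \<open>auto simp: fills_def\<close>)
  have bl1: "b (l - 1) = s" using fs[OF b(2) ne(1)] by (simp add: s_def)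
  have b'l1: "b' (l - 1) = s" using nf(3) neighbour_mod(1)[OF l(1)] bl1 by simp
  have b'k: "b' k = s" using fs[OF nf(2) ne(2)] sk by simp
  have b'l: "b' l = s" using z[of l] l bl1 by (simp add: b'_def next_filling_def)
  have le: "changes N b' \<le> changes N b"
    using nf by (intro changes_update(1)[OF d(1,2) b(1), of _ "int n"]) auto
  show ?thesis
  proof (cases "\<exists>j. l \<le> j \<and> j < k \<and> b' j \<noteq> s")
    case True
    then obtain j where j: "l \<le> j" "j < k" "b' j \<noteq> s" by blast
    define c where "c = (\<lambda>j. if (j - l) mod int N < k - l then s else b' j)"
    have "changes N c < changes N b'" unfolding c_def by (rule changes_flip[OF nf(1) l(2) kb b'l1 b'k j])
    moreover have "ring_periodic N c"
      unfolding ring_periodic_def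
    proof
      fix j
      have "(j + int N - l) mod int N = (j - l) mod int N" by (metis add_diff_eq add.commute mod_add_self2)
      then show "c (j + int N) = c j" using nf(1) by (simp add: ring_periodic_def c_def)
    qed
    moreover have "fills (V (Suc n)) c"
      unfolding fills_def
    proof
      fix j
      show "(0 < V (Suc n) j \<longrightarrow> c j) \<and> (V (Suc n) j < 0 \<longrightarrow> \<not> c j)"
      proof (cases "(j - l) mod int N < k - l")
        case True
        have "V (Suc n) (i + int N * q) = V (Suc n) i" for i and q :: int
        proof (induction q rule: int_induct[where k = 0])
          case (step1 q)
          have "V (Suc n) (i + int N * q + int N) = V (Suc n) (i + int N * q)"
            using per[of "Suc n"] unfolding ring_periodic_def by blast
          then show ?case using step1 by (simp add: algebra_simps)
        next
          case (step2 q)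
          have "V (Suc n) (i + int N * (q - 1) + int N) = V (Suc n) (i + int N * (q - 1))"
            using per[of "Suc n"] unfolding ring_periodic_def by blast
          then show ?case using step2 by (simp add: algebra_simps)
        qed simp
        from this[of "l + (j - l) mod int N" "(j - l) div int N"]
        have "V (Suc n) j = V (Suc n) (l + (j - l) mod int N)" by (simp add: add.assoc)
        also have "\<dots> = 0" using True d(3) by (intro z) auto
        finally show ?thesis by simp
      qed (use nf(2) in \<open>auto simp: c_def fills_def\<close>)
    qed
    ultimately have "changes N c < changes N b'" "sign_changes N (V (Suc n)) \<le> changes N c"
      using sign_changes_le[of N c "V (Suc n)"] by blast+
    then show ?thesis using le b(3) by linarith
  next
    case False
    then have all: "b' j = s" if "l \<le> j" "j \<le> k" for j using that b'k by (cases "j = k") auto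
    have "V n l \<noteq> 0 \<and> (V n l > 0) \<noteq> s"
    proof -
      have "V n (l - 1) + \<delta> n * V n l = 0" using z[of l] l by (simp add: step)
      then have eq: "V n (l - 1) = - (\<delta> n * V n l)" by linarith
      show ?thesis using ne \<delta>[of n] unfolding s_def eq by (auto simp: zero_less_mult_iff mult_less_0_iff)
    qed
    then have "b l \<noteq> b (l - 1)" using fs[OF b(2), of l] bl1 by auto
    moreover have "b (l + 1) = b (l - 1)"
      using all[of "l + 1"] nf(3)[OF neighbour_mod(2)[OF l(1)]] l bl1 by simp
    moreover have "b' l = b (l - 1)" using b'l bl1 by simp
    moreover have "b' j = b j" if "j mod int d \<noteq> l mod int d" for j using nf(3) that l(1) by metis
    moreover have "b' j = b j \<or> b' j = b (j - 1)" if "j mod int d = l mod int d" for j using nf(4) that l(1) by metis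
    ultimately have "changes N b' < changes N b"
      using changes_update(2)[OF d(1,2) b(1) nf(1) _ _ d(3)] by blast
    then show ?thesis using sign_changes_le[OF nf(1,2)] b(3) by linarith
  qed
qed

text \<open>Zeros propagate from left to right when a step is undone: at a due place, a zero result
  next to a zero left neighbour forces the old entry to be zero. Only the first place of the run
  lacks such a neighbour, so it must not be due.\<close>

lemma undo_step:
  assumes z: "\<And>j. i < j \<Longrightarrow> j < k \<Longrightarrow> V (Suc n) j = 0" and ne: "int n mod int d \<noteq> (i + 1) mod int d"
  shows "i < j \<Longrightarrow> j < k \<Longrightarrow> V n j = 0"
    and "i + 1 < k \<Longrightarrow> sgn (V n k) = sgn (V (Suc n) k)"
proof -
  show A: "V n j = 0" if "i < j" "j < k" for j
    using that
  proof (induction j rule: int_gr_induct)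
    case base then show ?case using z[of "i + 1"] ne by (auto simp: step)
  next
    case (step j)
    have "V n j = 0" using step by auto
    then show ?case using z[of "j + 1"] step \<delta>[of n] by (auto simp: smoothing.step[OF smoothing_axioms] split: if_splits)
  qed
  assume "i + 1 < k"
  then have "V n (k - 1) = 0" by (intro A) auto
  then show "sgn (V n k) = sgn (V (Suc n) k)" using \<delta>[of n] by (simp add: step sgn_mult)
qed

lemma undo_steps:
  assumes "m0 \<le> m" and ik: "i + 1 < k" and z: "\<And>j. i < j \<Longrightarrow> j < k \<Longrightarrow> V m j = 0"
    and ne: "\<And>n. m0 \<le> n \<Longrightarrow> n < m \<Longrightarrow> int n mod int d \<noteq> (i + 1) mod int d \<and> int n mod int d \<noteq> i mod int d"
  shows "(\<forall>j. i < j \<longrightarrow> j < k \<longrightarrow> V m0 j = 0) \<and> V m0 i = V m i \<and> sgn (V m0 k) = sgn (V m k)"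
  using \<open>m0 \<le> m\<close> ne
proof (induction m0 rule: inc_induct)
  case (step n)
  have "(\<forall>j. i < j \<longrightarrow> j < k \<longrightarrow> V (Suc n) j = 0) \<and> V (Suc n) i = V m i \<and> sgn (V (Suc n) k) = sgn (V m k)"
    by (rule step.IH) (rule step.prems, simp_all)
  then have IH: "\<And>j. i < j \<Longrightarrow> j < k \<Longrightarrow> V (Suc n) j = 0" "V (Suc n) i = V m i" "sgn (V (Suc n) k) = sgn (V m k)"
    by simp_all
  have "int n mod int d \<noteq> (i + 1) mod int d \<and> int n mod int d \<noteq> i mod int d"
    using step.hyps by (intro step.prems) auto
  then have ne': "int n mod int d \<noteq> (i + 1) mod int d" "i mod int d \<noteq> int n mod int d" by auto
  from undo_step[OF IH(1) ne'(1)] show ?case using IH(2,3) ne'(2) ik by (simp add: smoothing.step[OF smoothing_axioms])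
qed (use z in auto)

text \<open>Go back to the last update of \<open>i + 1\<close>. As the count did not drop there, the
  run has opposite signs at its ends; undoing this update makes the entry at \<open>i + 1\<close>
  nonzero with the sign of the right end. The shorter run beyond \<open>i + 1\<close> then has equal
  signs at its ends, and the preceding update of \<open>i + 2\<close> must have lowered the
  count.\<close>

lemma no_zero_run_aux:
  assumes const: "\<And>n. n < m \<Longrightarrow> sign_changes N (V (Suc n)) = sign_changes N (V n)"
    and m: "m \<ge> 2 * d" "int m mod int d \<noteq> (i + 1) mod int d"
    and ik: "i + 2 < k" and z: "\<And>j. i < j \<Longrightarrow> j < k \<Longrightarrow> V m j = 0" and ne: "V m i \<noteq> 0" "V m k \<noteq> 0"
  shows False
proof -
  have modshift: "(a + t) mod int d \<noteq> a mod int d" if "0 < \<bar>t\<bar>" "\<bar>t\<bar> < int d" for a t :: int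
  proof
    assume "(a + t) mod int d = a mod int d"
    then have "int d dvd (a + t) - a" by (metis mod_eq_dvd_iff)
    then have "int d dvd t" by simp
    then show False using that zdvd_not_zless[of "\<bar>t\<bar>" "int d"] by simp
  qed
  \<comment> \<open>The place \<open>i + 1\<close> was last due at time \<open>m - e\<close>; the
    hypothesis on \<open>m\<close> makes \<open>e\<close> positive.\<close>
  define e where "e = nat ((int m - (i + 1)) mod int d)"
  have dpos: "int d > 0" using d by simp
  have e: "int e = (int m - (i + 1)) mod int d" "e < d" unfolding e_def using dpos by (auto simp: nat_less_iff)
  have "e \<noteq> 0" using m(2) e(1) by (metis dvd_imp_mod_0 mod_eq_dvd_iff mod_0_imp_dvd of_nat_0)
  define m' where "m' = m - e"
  have m'm: "int m' = int m - int e" "Suc m' \<le> m" "m' \<ge> d" using e(2) m(1) \<open>e \<noteq> 0\<close> by (auto simp: m'_def)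
  have m'mod: "int m' mod int d = (i + 1) mod int d"
    unfolding m'm e(1) by (metis add_diff_cancel_left' diff_add_cancel mod_diff_right_eq)
  have U1: "(\<forall>j. i < j \<longrightarrow> j < k \<longrightarrow> V (Suc m') j = 0) \<and> V (Suc m') i = V m i \<and> sgn (V (Suc m') k) = sgn (V m k)"
  proof (rule undo_steps[OF m'm(2) _ z])
    fix n assume n: "Suc m' \<le> n" "n < m"
    define t where "t = int n - int m'"
    have t: "1 \<le> t" "t + 1 < int d" using n m'm e(2) by (auto simp: t_def)
    have nm: "int n mod int d = (i + 1 + t) mod int d"
      using m'mod unfolding t_def by (metis add.commute diff_add_cancel mod_add_left_eq)
    have "int n mod int d \<noteq> (i + 1) mod int d" unfolding nm using modshift[of t "i + 1"] t by auto
    moreover have "int n mod int d \<noteq> i mod int d" unfolding nm using modshift[of "1 + t" i] t by (auto simp: algebra_simps)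
    ultimately show "int n mod int d \<noteq> (i + 1) mod int d \<and> int n mod int d \<noteq> i mod int d" by blast
  qed (use ik in auto)
  have sg: "V (Suc m') i \<noteq> 0" "V (Suc m') k \<noteq> 0" using U1 ne by (auto simp: sgn_zero_iff)
  have i_same: "V m' i = V (Suc m') i" using modshift[of "-1" "i+1"] m'mod d by (simp add: step)
  have opp: "V (Suc m') i * V (Suc m') k < 0"
  proof (rule ccontr)
    assume "\<not> ?thesis"
    then have "V (Suc m') i * V (Suc m') k > 0" using sg by (simp add: not_less order_less_le)
    then have "sign_changes N (V (Suc m')) < sign_changes N (V m')"
      using U1 m'mod ik i_same by (intro sign_changes_drop[of "i + 1" m' k]) auto
    then show False using const[of m'] m'm by simp
  qed
  have vi1: "V m' i + \<delta> m' * V m' (i + 1) = 0"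
  proof -
    have "V (Suc m') (i + 1) = 0" using U1 ik by auto
    then show ?thesis using m'mod by (simp add: step)
  qed
  have ne1: "int m' mod int d \<noteq> (i + 1 + 1) mod int d" using modshift[of 1 "i + 1"] m'mod d by auto
  have U2: "i + 1 < j \<Longrightarrow> j < k \<Longrightarrow> V m' j = 0" "sgn (V m' k) = sgn (V (Suc m') k)" for j
    using undo_step[of "i + 1" k m', OF _ ne1] U1 ik by auto
  \<comment> \<open>The due class advances by one per step, so \<open>i + 2\<close> was last due
    \<open>d - 1\<close> steps before \<open>i + 1\<close>.\<close>
  define m'' where "m'' = m' - (d - 1)"
  have m'': "int m'' = int m' - (int d - 1)" "Suc m'' \<le> m'" using m'm d by (auto simp: m''_def)
  have m''mod: "int m'' mod int d = (i + 2) mod int d"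
  proof -
    have eq: "int m'' = int m' + 1 - int d" using m''(1) by simp
    have "int m'' mod int d = (int m' + 1 - int d) mod int d" unfolding eq ..
    also have "\<dots> = (int m' + 1) mod int d" by simp
    also have "\<dots> = (i + 1 + 1) mod int d" using m'mod by (metis mod_add_left_eq)
    finally show ?thesis by (simp add: add.assoc)
  qed
  have U3: "(\<forall>j. i + 1 < j \<longrightarrow> j < k \<longrightarrow> V (Suc m'') j = 0) \<and> V (Suc m'') (i + 1) = V m' (i + 1) \<and> sgn (V (Suc m'') k) = sgn (V m' k)"
  proof (rule undo_steps[OF m''(2) _ U2(1)])
    fix n assume n: "Suc m'' \<le> n" "n < m'"
    define t where "t = int n - int m'"
    have t: "t \<le> -1" "- t + 1 < int d" using n m'' d by (auto simp: t_def)
    have nm: "int n mod int d = (i + 1 + t) mod int d"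
      using m'mod unfolding t_def by (metis add.commute diff_add_cancel mod_add_left_eq)
    have "int n mod int d \<noteq> (i + 1) mod int d" unfolding nm using modshift[of t "i + 1"] t by auto
    moreover have "int n mod int d \<noteq> (i + 1 + 1) mod int d" unfolding nm using modshift[of "t - 1" "i + 1 + 1"] t by (auto simp: algebra_simps)
    ultimately show "int n mod int d \<noteq> (i + 1 + 1) mod int d \<and> int n mod int d \<noteq> (i + 1) mod int d" by blast
  qed (use ik in auto)
  have i1_same: "V m'' (i + 1) = V (Suc m'') (i + 1)" using modshift[of 1 "i+1"] m''mod d by (simp add: step add.assoc)
  have "V m' (i + 1) * V (Suc m') k > 0"
  proof -
    have "V (Suc m') i = - (\<delta> m' * V m' (i + 1))" using vi1 i_same by linarith
    then have "\<delta> m' * (V m' (i + 1) * V (Suc m') k) > 0" using opp by (simp add: algebra_simps)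
    then show ?thesis using \<delta>[of m'] by (simp add: zero_less_mult_iff)
  qed
  then have "V m'' (i + 1) * V (Suc m'') k > 0"
    using U3 U2(2) i1_same by (metis sgn_1_pos sgn_mult)
  then have "sign_changes N (V (Suc m'')) < sign_changes N (V m'')"
    using U3 m''mod ik by (intro sign_changes_drop[of "i + 2" m'' k]) (auto simp: algebra_simps)
  then show False using const[of m''] m'' m'm by simp
qed

text \<open>The residue that \<open>no_zero_run_aux\<close> leaves over is that of a run whose first
  place is due next. One step earlier its left end was due, so the run then either had the same left
  end, now in good position, or extended further left. \<open>M\<close> bounds the number of places
  outside the run, so the latter happens only finitely often.\<close>

lemma no_zero_run:
  assumes "m \<ge> 2 * d + M"
    and "\<And>n. n < m \<Longrightarrow> sign_changes N (V (Suc n)) = sign_changes N (V n)"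
    and "i + 2 < k" "\<And>j. i < j \<Longrightarrow> j < k \<Longrightarrow> V m j = 0" "V m i \<noteq> 0" "V m k \<noteq> 0" "int N \<le> int M + (k - i - 1)"
  shows False
  using assms
proof (induction M arbitrary: m i rule: less_induct)
  case (less M)
  show False
  proof (cases "int m mod int d = (i + 1) mod int d")
    case False
    then show False using no_zero_run_aux[of m i k] less.prems by auto
  next
    case True
    have kN: "V n (k - int N) = V n k" for n
      using per[of n] unfolding ring_periodic_def by (metis diff_add_cancel)
    have "k - int N \<le> i"
    proof (rule ccontr)
      assume "\<not> ?thesis"
      then show False using less.prems(4)[of "k - int N"] kN less.prems(6) d by auto
    qed
    then have "M > 0" using less.prems(7) by linarith
    obtain n where n: "m = Suc n" using less.prems(1) d by (cases m) auto
    have nmod: "int n mod int d = i mod int d"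
      using True unfolding n by (metis add_diff_cancel_right' mod_diff_left_eq of_nat_Suc add.commute)
    have nmod': "int n mod int d \<noteq> (i + 1) mod int d" using neighbour_mod(2)[of i "int n"] nmod by auto
    have zn: "\<And>j. i < j \<Longrightarrow> j < k \<Longrightarrow> V n j = 0" and sk: "sgn (V n k) = sgn (V m k)"
      using undo_step[of i k n, OF _ nmod'] less.prems(3,4) n by auto
    have kne: "V n k \<noteq> 0" using sk less.prems(6) by (metis sgn_0_0)
    show False
    proof (cases "V n i = 0")
      case False
      show False
        by (rule no_zero_run_aux[of n i k]) (use less.prems \<open>M > 0\<close> n nmod' zn kne False in auto)
    next
      case True
      define S where "S = {j. k - int N \<le> j \<and> j \<le> i \<and> V n j \<noteq> 0}"
      have fS: "finite S" by (rule finite_subset[of _ "{k - int N..i}"]) (auto simp: S_def)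
      have "k - int N \<in> S" using \<open>k - int N \<le> i\<close> kN kne by (auto simp: S_def)
      define i' where "i' = Max S"
      have i'S: "i' \<in> S" unfolding i'_def using fS \<open>k - int N \<in> S\<close> by (intro Max_in) auto
      have "i' < i" using i'S True by (auto simp: S_def order_less_le)
      have z': "V n j = 0" if "i' < j" "j < k" for j
      proof (cases "j > i")
        case False
        show ?thesis
        proof (rule ccontr)
          assume "V n j \<noteq> 0"
          then have "j \<in> S" using False that i'S by (auto simp: S_def)
          then show False using Max_ge[OF fS] that unfolding i'_def by fastforce
        qed
      qed (use zn that in auto)
      show False
        by (rule less.IH[of "M - 1" n i']) (use \<open>M > 0\<close> less.prems n z' \<open>i' < i\<close> kne i'S in \<open>auto simp: S_def\<close>)
    qed
  qed
qed

text \<open>Periodicity supplies nonzero entries on both sides of the two zeros as soon as there is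
  one at all; the maximal run between them is then excluded. The time \<open>2 * d + N\<close>
  leaves \<open>2 * d\<close> steps for looking back and one more for each place of the
  ring.\<close>

theorem adjacent_zeros_imp_zero:
  assumes m: "m \<ge> 2 * d + N" and const: "\<And>n. n < m \<Longrightarrow> sign_changes N (V (Suc n)) = sign_changes N (V n)"
    and z: "V m j = 0" "V m (j + 1) = 0"
  shows "V m i = 0"
proof (rule ccontr)
  assume i: "V m i \<noteq> 0"
  have tr: "V m (a + int N * int q) = V m a" for a q
  proof (induction q)
    case (Suc q)
    have "V m (a + int N * int (Suc q)) = V m ((a + int N * int q) + int N)" by (simp add: algebra_simps)
    then show ?case using Suc per[of m] by (simp add: ring_periodic_def)
  qed simp
  define k0 where "k0 = i + int N * int (nat \<bar>j - i\<bar> + 1)"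
  have Nq: "int N * int q \<ge> int q" for q using d(3) by (cases q) auto
  have k0: "V m k0 \<noteq> 0" unfolding k0_def tr by (rule i)
  have k0': "k0 > j" using Nq[of "nat \<bar>j - i\<bar> + 1"] unfolding k0_def by auto
  define i0 where "i0 = i - int N * int (nat \<bar>j - i\<bar> + 1)"
  have "V m i0 = V m i" using tr[of i0 "nat \<bar>j - i\<bar> + 1"] unfolding i0_def by simp
  then have i0: "V m i0 \<noteq> 0" using i by simp
  have i0': "i0 < j" using Nq[of "nat \<bar>j - i\<bar> + 1"] unfolding i0_def by auto
  define S where "S = {a. i0 \<le> a \<and> a < j \<and> V m a \<noteq> 0}"
  define T where "T = {a. j < a \<and> a \<le> k0 \<and> V m a \<noteq> 0}"
  have fin: "finite S" "finite T"
    by (rule finite_subset[of _ "{i0..j}"], auto simp: S_def) (rule finite_subset[of _ "{j..k0}"], auto simp: T_def)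
  have mem: "i0 \<in> S" "k0 \<in> T" using i0 i0' k0 k0' by (auto simp: S_def T_def)
  define a where "a = Max S" define k where "k = Min T"
  have aS: "a \<in> S" and kT: "k \<in> T" unfolding a_def k_def using fin mem by (auto intro: Max_in Min_in)
  have zz: "V m l = 0" if "a < l" "l < k" for l
  proof (rule ccontr)
    assume "V m l \<noteq> 0"
    then have "l \<in> S \<or> l \<in> T" using that aS kT z by (auto simp: S_def T_def) (metis not_less_iff_gr_or_eq)
    then show False using Max_ge[OF fin(1), of l] Min_le[OF fin(2), of l] that unfolding a_def k_def by fastforce
  qed
  have "k > j + 1" using kT z by (auto simp: T_def) (metis add1_zle_eq order_less_le)
  then show False
    using no_zero_run[of N m a k] m const zz aS kT by (auto simp: S_def T_def)
qed

end

section \<open>The symbol\<close>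

locale shift_symbol =
  fixes p r :: nat
  assumes p: "p \<ge> 1" and r: "r \<ge> 1"
begin

text \<open>\<open>cyclic_shift\<close> over any commutative ring, so that the same matrix can be
  formed with the polynomial \<open>[:0, 1:]\<close> as its corner entry.\<close>

definition down_shift :: "'a \<Rightarrow> 'a :: comm_ring_1 Matrix.mat" where
  "down_shift c = Matrix.mat r r (\<lambda>(i, j). if i = 0 \<and> j = r - 1 then c else if i = j + 1 then 1 else 0)"

definition up_shift :: "'a \<Rightarrow> 'a :: comm_ring_1 Matrix.mat" where
  "up_shift c = Matrix.mat r r (\<lambda>(i, j). if i = r - 1 \<and> j = 0 then c else if j = i + 1 then 1 else 0)"

lemma shift_dim [simp]: "down_shift c \<in> carrier_mat r r" "up_shift c \<in> carrier_mat r r"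
  "dim_row (down_shift c) = r" "dim_col (down_shift c) = r" "dim_row (up_shift c) = r" "dim_col (up_shift c) = r"
  by (auto simp: down_shift_def up_shift_def)

lemma shift_pow_dim [simp]: "down_shift c ^\<^sub>m m \<in> carrier_mat r r" "up_shift c ^\<^sub>m m \<in> carrier_mat r r"
  by (auto intro: pow_carrier_mat)

lemma cyclic_shift_eq: "cyclic_shift r z = down_shift z"
  by (simp add: cyclic_shift_def down_shift_def)

lemma down_shift_mult_vec:
  assumes "v \<in> carrier_vec r" "i < r"
  shows "(down_shift c *\<^sub>v v) $ i = (if i = 0 then c * v $ (r - 1) else v $ (i - 1))"
proof -
  have "(down_shift c *\<^sub>v v) $ i = (\<Sum>j\<in>{0..<r}. (if i = 0 \<and> j = r - 1 then c else if i = j + 1 then 1 else 0) * v $ j)"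
    using assms by (simp add: scalar_prod_def down_shift_def)
  also have "\<dots> = (\<Sum>j\<in>{0..<r}. if j = (if i = 0 then r - 1 else i - 1) then (if i = 0 then c * v $ (r - 1) else v $ (i - 1)) else 0)"
    using assms by (intro sum.cong) auto
  also have "\<dots> = (if i = 0 then c * v $ (r - 1) else v $ (i - 1))"
    using assms r by (subst sum.delta) auto
  finally show ?thesis .
qed

lemma shift_inverse:
  fixes z :: "'a :: field"
  assumes "z \<noteq> 0"
  shows "down_shift z * up_shift (1 / z) = 1\<^sub>m r" "up_shift (1 / z) * down_shift z = 1\<^sub>m r"
proof -
  show *: "down_shift z * up_shift (1 / z) = 1\<^sub>m r"
  proof (rule eq_matI)
    fix i j assume ij: "i < dim_row (1\<^sub>m r :: 'a Matrix.mat)" "j < dim_col (1\<^sub>m r :: 'a Matrix.mat)"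
    have "(down_shift z * up_shift (1 / z)) $$ (i, j) = (down_shift z *\<^sub>v Matrix.col (up_shift (1 / z)) j) $ i"
      using ij by simp
    also have "\<dots> = (if i = 0 then z * up_shift (1 / z) $$ (r - 1, j) else up_shift (1 / z) $$ (i - 1, j))"
      using ij down_shift_mult_vec[of "Matrix.col (up_shift (1 / z)) j" i z] by (simp del: index_mult_mat_vec)
    also have "\<dots> = 1\<^sub>m r $$ (i, j)"
      using ij assms by (cases "i = 0") (auto simp: up_shift_def)
    finally show "(down_shift z * up_shift (1 / z)) $$ (i, j) = 1\<^sub>m r $$ (i, j)" .
  qed auto
  show "up_shift (1 / z) * down_shift z = 1\<^sub>m r"
    by (rule mat_mult_left_right_inverse[OF _ _ *]) auto
qed

lemma the_mat_inverse:
  assumes "z \<noteq> 0"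
  shows "the (mat_inverse (cyclic_shift r z)) = up_shift (1 / z)"
proof -
  have U: "cyclic_shift r z \<in> Units (ring_mat TYPE(complex) r ())"
    unfolding cyclic_shift_eq Units_def using shift_inverse[OF assms] by (auto simp: ring_mat_simps intro!: bexI[of _ "up_shift (1/z)"])
  have c: "cyclic_shift r z \<in> carrier_mat r r" by (simp add: cyclic_shift_eq)
  obtain B where B: "mat_inverse (cyclic_shift r z) = Some B"
    using mat_inverse(1)[OF c, where b = "()"] U by (cases "mat_inverse (cyclic_shift r z)") auto
  have BB: "B * down_shift z = 1\<^sub>m r" "B \<in> carrier_mat r r"
    using mat_inverse(2)[OF c B] by (auto simp: cyclic_shift_eq)
  have "B = B * (down_shift z * up_shift (1/z))" using shift_inverse[OF assms] BB by simp
  also have "\<dots> = (B * down_shift z) * up_shift (1/z)"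
    by (rule assoc_mult_mat[symmetric]) (use BB in auto)
  also have "\<dots> = up_shift (1/z)" using BB by simp
  finally show ?thesis using B by simp
qed

abbreviation weights :: "(nat \<Rightarrow> real) \<Rightarrow> complex Matrix.mat" where
  "weights b \<equiv> mat_diag r (\<lambda>i. complex_of_real (b i))"

lemma symbol_F_eq:
  "z \<noteq> 0 \<Longrightarrow> symbol_F p r b z x = up_shift (1 / z) + down_shift z ^\<^sub>m p * weights b - x \<cdot>\<^sub>m 1\<^sub>m r"
  by (simp add: symbol_F_def the_mat_inverse[unfolded cyclic_shift_eq] cyclic_shift_eq)

lemma symbol_F_dim [simp]: "z \<noteq> 0 \<Longrightarrow> symbol_F p r b z x \<in> carrier_mat r r"
  by (auto simp: symbol_F_eq)

subsection \<open>Kernel vectors as solutions of a recurrence\<close>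

text \<open>Continues a vector of length \<open>r\<close> to a sequence that is multiplied by
  \<open>1 / z\<close> after each period; on such sequences both shift matrices act as ordinary
  shifts of the index.\<close>

definition unroll :: "complex \<Rightarrow> complex Matrix.vec \<Rightarrow> nat \<Rightarrow> complex" where
  "unroll z v n = v $ (n mod r) / z ^ (n div r)"

lemma unroll_period: "unroll z v (n + r) = unroll z v n / z"
  using r by (simp add: unroll_def)

lemma unroll_down_shift:
  assumes "v \<in> carrier_vec r" "z \<noteq> 0"
  shows "unroll z (down_shift z *\<^sub>v v) (Suc n) = unroll z v n"
proof -
  have lt: "n mod r < r" using r by simp
  show ?thesis
  proof (cases "Suc (n mod r) = r")
    case True
    then have "Suc n mod r = 0" "Suc n div r = Suc (n div r)" "n mod r = r - 1"
      using lt by (auto simp: mod_Suc div_Suc)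
    then show ?thesis using assms r by (simp add: unroll_def down_shift_mult_vec del: index_mult_mat_vec)
  next
    case False
    then have "Suc n mod r = Suc (n mod r)" "Suc n div r = n div r"
      using lt by (auto simp: mod_Suc div_Suc)
    moreover have "Suc (n mod r) < r" using False lt by simp
    ultimately show ?thesis using assms r by (simp add: unroll_def down_shift_mult_vec del: index_mult_mat_vec)
  qed
qed

lemma unroll_up_shift:
  assumes "v \<in> carrier_vec r" "z \<noteq> 0"
  shows "unroll z (up_shift (1/z) *\<^sub>v v) n = unroll z v (Suc n)"
proof -
  have "down_shift z *\<^sub>v (up_shift (1/z) *\<^sub>v v) = v"
    using assms shift_inverse(1)[OF assms(2)]
    by (subst assoc_mult_mat_vec[symmetric, of _ r r _ r]) auto
  then show ?thesis using unroll_down_shift[of "up_shift (1/z) *\<^sub>v v" z n] assms by (simp add: mult_mat_vec_carrier[of _ r r])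
qed

lemma unroll_down_shift_pow:
  assumes "v \<in> carrier_vec r" "z \<noteq> 0"
  shows "unroll z (down_shift z ^\<^sub>m m *\<^sub>v v) (n + m) = unroll z v n"
  using assms
proof (induction m arbitrary: v n)
  case (Suc m)
  have "down_shift z ^\<^sub>m Suc m *\<^sub>v v = down_shift z ^\<^sub>m m *\<^sub>v (down_shift z *\<^sub>v v)"
    using Suc.prems by (simp, subst assoc_mult_mat_vec[of _ r r _ r]) auto
  then show ?case
    using Suc.IH[of "down_shift z *\<^sub>v v" "Suc n"] unroll_down_shift[OF Suc.prems] Suc.prems
    by (simp add: mult_mat_vec_carrier[of _ r r])
qed auto

lemma unroll_weights:
  assumes "v \<in> carrier_vec r"
  shows "unroll z (weights b *\<^sub>v v) n = of_real (b (n mod r)) * unroll z v n"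
proof -
  have lt: "n mod r < r" using r by simp
  have "(weights b *\<^sub>v v) $ (n mod r) = (\<Sum>j\<in>{0..<r}. (if n mod r = j then of_real (b j) else 0) * v $ j)"
    using assms lt by (simp add: mat_diag_def scalar_prod_def)
  also have "\<dots> = (\<Sum>j\<in>{0..<r}. if j = n mod r then of_real (b (n mod r)) * v $ (n mod r) else 0)"
    by (intro sum.cong) auto
  also have "\<dots> = of_real (b (n mod r)) * v $ (n mod r)" using lt by (subst sum.delta) auto
  finally show ?thesis by (simp add: unroll_def)
qed

lemma unroll_symbol:
  assumes v: "v \<in> carrier_vec r" and z: "z \<noteq> 0"
  shows "unroll z (symbol_F p r b z x *\<^sub>v v) (n + p) =
    unroll z v (n + p + 1) + of_real (b (n mod r)) * unroll z v n - x * unroll z v (n + p)"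
proof -
  let ?w = "down_shift z ^\<^sub>m p *\<^sub>v (weights b *\<^sub>v v)"
  have lt: "m mod r < r" for m using r by simp
  have Wv: "weights b *\<^sub>v v \<in> carrier_vec r" using v by (simp add: mult_mat_vec_carrier[of _ r r])
  have "symbol_F p r b z x *\<^sub>v v = (up_shift (1/z) *\<^sub>v v + ?w) - x \<cdot>\<^sub>v v"
  proof -
    have C: "down_shift z ^\<^sub>m p * weights b \<in> carrier_mat r r" by (rule mult_carrier_mat[of _ r r]) auto
    then have C': "up_shift (1/z) + down_shift z ^\<^sub>m p * weights b \<in> carrier_mat r r" by simp
    have sm: "(x \<cdot>\<^sub>m 1\<^sub>m r) *\<^sub>v v = x \<cdot>\<^sub>v v"
      using v by (intro eq_vecI) auto
    show ?thesis
      unfolding symbol_F_eq[OF z] minus_mult_distrib_mat_vec[OF C' smult_carrier_mat[OF one_carrier_mat] v] sm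
        add_mult_distrib_mat_vec[OF shift_dim(2) C v]
        assoc_mult_mat_vec[OF shift_pow_dim(1) mat_diag_dim v] ..
  qed
  moreover have "unroll z ((a + c) - x \<cdot>\<^sub>v v) m = unroll z a m + unroll z c m - x * unroll z v m"
    if "a \<in> carrier_vec r" "c \<in> carrier_vec r" for a c m
    using that v lt[of m] by (simp add: unroll_def diff_divide_distrib add_divide_distrib)
  ultimately show ?thesis
    using unroll_up_shift[OF v z, of "n + p"] unroll_down_shift_pow[OF Wv z, of p n] unroll_weights[OF v, of z b n] v Wv
    by (simp add: mult_mat_vec_carrier[of _ r r])
qed

lemma unroll_zero_iff:
  assumes "v \<in> carrier_vec r" "z \<noteq> 0"
  shows "v = 0\<^sub>v r \<longleftrightarrow> (\<forall>n. unroll z v (n + m) = 0)"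
proof
  assume "v = 0\<^sub>v r" then show "\<forall>n. unroll z v (n + m) = 0" using r by (simp add: unroll_def)
next
  assume a: "\<forall>n. unroll z v (n + m) = 0"
  show "v = 0\<^sub>v r"
  proof (rule eq_vecI)
    fix i assume "i < dim_vec (0\<^sub>v r :: complex Matrix.vec)"
    then have i: "i < r" by simp
    have "i + m * r = (i + m * r - m) + m" using r by (simp add: trans_le_add2)
    then have "unroll z v (i + m * r) = 0" using a by metis
    then show "v $ i = 0\<^sub>v r $ i" using i assms by (simp add: unroll_def)
  qed (use assms in auto)
qed

definition floquet_solution :: "(nat \<Rightarrow> real) \<Rightarrow> complex \<Rightarrow> complex \<Rightarrow> (nat \<Rightarrow> complex) \<Rightarrow> bool" where
  "floquet_solution b x z u \<longleftrightarrow>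
     (\<forall>n. u (n + p + 1) = x * u (n + p) - of_real (b (n mod r)) * u n) \<and>
     (\<forall>n. u (n + r) = u n / z) \<and> (\<exists>n. u n \<noteq> 0)"

theorem symbol_root_iff:
  assumes z: "z \<noteq> 0"
  shows "symbol_f p r b z x = 0 \<longleftrightarrow> (\<exists>u. floquet_solution b x z u)"
proof -
  have F: "symbol_F p r b z x \<in> carrier_mat r r" using z by simp
  have ker: "symbol_F p r b z x *\<^sub>v v = 0\<^sub>v r \<longleftrightarrow>
      (\<forall>n. unroll z v (n + p + 1) = x * unroll z v (n + p) - of_real (b (n mod r)) * unroll z v n)"
    if "v \<in> carrier_vec r" for v
  proof -
    have c: "symbol_F p r b z x *\<^sub>v v \<in> carrier_vec r" using mult_mat_vec_carrier[OF F that] .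
    show ?thesis
      unfolding unroll_zero_iff[OF c z, of p] unroll_symbol[OF that z] by (auto simp: algebra_simps eq_diff_eq)
  qed
  show ?thesis
  proof
    assume "symbol_f p r b z x = 0"
    then obtain v where v: "v \<in> carrier_vec r" "v \<noteq> 0\<^sub>v r" "symbol_F p r b z x *\<^sub>v v = 0\<^sub>v r"
      unfolding symbol_f_def det_0_iff_vec_prod_zero[OF F] by blast
    have "\<exists>n. unroll z v n \<noteq> 0" using unroll_zero_iff[OF v(1) z, of 0] v(2) by auto
    then show "\<exists>u. floquet_solution b x z u"
      using ker[OF v(1)] v(3) unroll_period by (intro exI[of _ "unroll z v"]) (simp add: floquet_solution_def)
  next
    assume "\<exists>u. floquet_solution b x z u"
    then obtain u where u: "floquet_solution b x z u" by blast
    define v where "v = Matrix.vec r u"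
    have v: "v \<in> carrier_vec r" by (simp add: v_def)
    have un: "u (m + r * q) = u m / z ^ q" for m q
    proof (induction q)
      case (Suc q)
      have "u (m + r * q + r) = u (m + r * q) / z" using u by (simp add: floquet_solution_def)
      then show ?case using Suc by (simp add: algebra_simps)
    qed simp
    have uv: "unroll z v n = u n" for n
      using un[of "n mod r" "n div r"] r by (simp add: unroll_def v_def)
    have "v \<noteq> 0\<^sub>v r" unfolding unroll_zero_iff[OF v z, of 0] uv using u by (auto simp: floquet_solution_def)
    then show "symbol_f p r b z x = 0"
      unfolding symbol_f_def det_0_iff_vec_prod_zero[OF F] using ker[OF v] v u
      by (intro exI[of _ v]) (simp add: uv floquet_solution_def)
  qed
qed

subsection \<open>The symbol as a polynomial\<close>

text \<open>The determinant of \<open>down_shift z\<close> times the symbol, a product in which no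
  inverse of the shift is left.\<close>

definition symbol_poly :: "(nat \<Rightarrow> real) \<Rightarrow> complex \<Rightarrow> complex poly" where
  "symbol_poly b x = Determinant.det (1\<^sub>m r - [:x:] \<cdot>\<^sub>m down_shift [:0, 1:]
     + down_shift [:0, 1:] ^\<^sub>m (p + 1) * mat_diag r (\<lambda>i. [:complex_of_real (b i):]))"

text \<open>What remains of the symbol after the factor \<open>down_shift z ^\<^sub>m p\<close> is
  taken out, written in \<open>1 / z\<close>. Its value at \<open>0\<close> controls the symbol for
  large \<open>z\<close>.\<close>

definition reversed_poly :: "(nat \<Rightarrow> real) \<Rightarrow> complex \<Rightarrow> complex poly" where
  "reversed_poly b x = Determinant.det (mat_diag r (\<lambda>i. [:complex_of_real (b i):])
     - [:x:] \<cdot>\<^sub>m up_shift [:0, 1:] ^\<^sub>m p + up_shift [:0, 1:] ^\<^sub>m (p + 1))"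

lemma (in -) map_mat_add:
  assumes "A \<in> carrier_mat m n" "B \<in> carrier_mat m n" "\<And>x y. f (x + y) = f x + f y"
  shows "map_mat f (A + B) = map_mat f A + map_mat f B"
  using assms by (intro eq_matI) auto

lemma (in -) map_mat_minus:
  assumes "A \<in> carrier_mat m n" "B \<in> carrier_mat m n" "\<And>x y. f (x - y) = f x - f y"
  shows "map_mat f (A - B) = map_mat f A - map_mat f B"
  using assms by (intro eq_matI) auto

lemma (in -) map_mat_smult:
  assumes "\<And>x y. f (x * y) = f x * f y"
  shows "map_mat f (c \<cdot>\<^sub>m A) = f c \<cdot>\<^sub>m map_mat f A"
  using assms by (intro eq_matI) auto

lemma (in -) map_mat_diag: "f 0 = 0 \<Longrightarrow> map_mat f (mat_diag n d) = mat_diag n (\<lambda>i. f (d i))"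
  by (auto simp: mat_diag_def)

lemma map_mat_shift:
  "map_mat (\<lambda>q. poly q z) (down_shift [:0, 1:]) = down_shift z"
  "map_mat (\<lambda>q. poly q z) (up_shift [:0, 1:]) = up_shift z"
  by (auto simp: down_shift_def up_shift_def)

lemma poly_symbol_poly:
  "poly (symbol_poly b x) z = Determinant.det (1\<^sub>m r - x \<cdot>\<^sub>m down_shift z + down_shift z ^\<^sub>m (p + 1) * weights b)"
proof -
  interpret h: comm_ring_hom "\<lambda>q::complex poly. poly q z" by unfold_locales auto
  show ?thesis
    unfolding symbol_poly_def h.hom_det[symmetric]
      map_mat_add[OF minus_carrier_mat[OF smult_carrier_mat[OF shift_dim(1)]] mult_carrier_mat[OF shift_pow_dim(1) mat_diag_dim] h.hom_add]
      map_mat_minus[OF one_carrier_mat smult_carrier_mat[OF shift_dim(1)] h.hom_minus]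
      h.mat_hom_mult[OF shift_pow_dim(1) mat_diag_dim]
    apply (simp only: h.mat_hom_one map_mat_smult[OF h.hom_mult] h.mat_hom_pow[OF shift_dim(1)] map_mat_shift map_mat_diag poly_pCons mult_zero_right poly_0 add_0_right)
    done
qed

lemma poly_reversed_poly:
  "poly (reversed_poly b x) w = Determinant.det (weights b - x \<cdot>\<^sub>m up_shift w ^\<^sub>m p + up_shift w ^\<^sub>m (p + 1))"
proof -
  interpret h: comm_ring_hom "\<lambda>q::complex poly. poly q w" by unfold_locales auto
  show ?thesis
    unfolding reversed_poly_def h.hom_det[symmetric]
      map_mat_add[OF minus_carrier_mat[OF smult_carrier_mat[OF shift_pow_dim(2)]] shift_pow_dim(2) h.hom_add]
      map_mat_minus[OF mat_diag_dim smult_carrier_mat[OF shift_pow_dim(2)] h.hom_minus]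
    apply (simp only: h.mat_hom_one map_mat_smult[OF h.hom_mult] h.mat_hom_pow[OF shift_dim(2)] map_mat_shift map_mat_diag poly_pCons mult_zero_right poly_0 add_0_right)
    done
qed

lemma shift_power_commute:
  fixes z :: complex
  shows "down_shift z * down_shift z ^\<^sub>m m = down_shift z ^\<^sub>m m * down_shift z"
  "up_shift z * up_shift z ^\<^sub>m m = up_shift z ^\<^sub>m m * up_shift z"
proof -
  have *: "A * A ^\<^sub>m m = A ^\<^sub>m m * A" if A: "A \<in> carrier_mat r r" for A :: "complex Matrix.mat"
  proof (induction m)
    case (Suc m)
    have "A * (A ^\<^sub>m m * A) = (A * A ^\<^sub>m m) * A" by (rule assoc_mult_mat[symmetric]) (use A in auto)
    then show ?case using Suc by simp
  qed (use A in auto)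
  show "down_shift z * down_shift z ^\<^sub>m m = down_shift z ^\<^sub>m m * down_shift z"
    "up_shift z * up_shift z ^\<^sub>m m = up_shift z ^\<^sub>m m * up_shift z" by (rule *, simp)+
qed

text \<open>Taking \<open>z\<close> out of the first row isolates the dependence on
  \<open>z\<close>; the constant is the determinant at \<open>z = 1\<close>, nonzero because that
  matrix is invertible.\<close>

lemma det_shift:
  obtains \<epsilon> :: complex where "\<epsilon> \<noteq> 0" "\<And>z. Determinant.det (down_shift z) = z * \<epsilon>"
proof
  define D where "D z = mat_diag r (\<lambda>i. if i = 0 then z else 1)" for z :: complex
  have "down_shift z = D z * down_shift 1" for z :: complex
    unfolding D_def by (subst mat_diag_mult_left[OF shift_dim(1)]) (auto simp: down_shift_def)
  moreover have "Determinant.det (D z) = z" for z :: complex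
  proof -
    have "Determinant.det (D z) = (\<Prod>i = 0..<r. if i = 0 then z else 1)"
      by (subst det_upper_triangular[of _ r]) (auto simp: D_def mat_diag_def prod_list_diag_prod)
    also have "\<dots> = z" using r by (subst prod.delta) auto
    finally show ?thesis .
  qed
  ultimately show "Determinant.det (down_shift z) = z * Determinant.det (down_shift 1)" for z :: complex
    using det_mult[of "D z" r "down_shift 1"] by (metis D_def mat_diag_dim shift_dim(1))
  have "Determinant.det (down_shift 1) * Determinant.det (up_shift (1/1) :: complex Matrix.mat) = 1"
    using det_mult[of "down_shift 1" r "up_shift (1/1) :: complex Matrix.mat"] shift_inverse(1)[of "1::complex"] by simp
  then show "Determinant.det (down_shift 1 :: complex Matrix.mat) \<noteq> 0" by auto
qed

lemma symbol_f_factor: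
  assumes z: "z \<noteq> 0"
  shows "Determinant.det (down_shift z) * symbol_f p r b z x = poly (symbol_poly b x) z"
    and "symbol_f p r b z x = Determinant.det (down_shift z) ^ p * poly (reversed_poly b x) (1 / z)"
proof -
  note inv = shift_inverse[OF z]
  have C: "down_shift z ^\<^sub>m p * weights b \<in> carrier_mat r r" by (rule mult_carrier_mat[OF shift_pow_dim(1) mat_diag_dim])
  have Cu: "up_shift (1/z) + down_shift z ^\<^sub>m p * weights b \<in> carrier_mat r r" using C by simp
  have C1: "x \<cdot>\<^sub>m 1\<^sub>m r \<in> carrier_mat r r" by simp
  have "down_shift z * symbol_F p r b z x = 1\<^sub>m r - x \<cdot>\<^sub>m down_shift z + down_shift z ^\<^sub>m (p + 1) * weights b"
  proof -
    have "down_shift z * symbol_F p r b z x =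
        (down_shift z * up_shift (1/z) + down_shift z * (down_shift z ^\<^sub>m p * weights b)) - down_shift z * (x \<cdot>\<^sub>m 1\<^sub>m r)"
      unfolding symbol_F_eq[OF z]
      by (simp only: mult_minus_distrib_mat[OF shift_dim(1) Cu C1] mult_add_distrib_mat[OF shift_dim(1) shift_dim(2) C])
    also have "down_shift z * (down_shift z ^\<^sub>m p * weights b) = down_shift z ^\<^sub>m (p + 1) * weights b"
      using shift_power_commute(1)[of z p] assoc_mult_mat[OF shift_dim(1) shift_pow_dim(1) mat_diag_dim, of z z p "\<lambda>i. complex_of_real (b i)"]
      by simp
    also have "down_shift z * (x \<cdot>\<^sub>m 1\<^sub>m r) = x \<cdot>\<^sub>m down_shift z"
      using mult_smult_distrib[OF shift_dim(1) one_carrier_mat] right_mult_one_mat[OF shift_dim(1)] by metis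
    finally show ?thesis unfolding inv(1)
      using mult_carrier_mat[OF shift_pow_dim(1) mat_diag_dim, of z "p+1" "\<lambda>i. complex_of_real (b i)"]
      by (intro eq_matI) (auto simp: down_shift_def simp del: pow_mat.simps)
  qed
  then show "Determinant.det (down_shift z) * symbol_f p r b z x = poly (symbol_poly b x) z"
    unfolding poly_symbol_poly symbol_f_def det_mult[OF shift_dim(1) symbol_F_dim[OF z], symmetric] by simp
  have pw: "down_shift z ^\<^sub>m m * up_shift (1/z) ^\<^sub>m m = 1\<^sub>m r" for m
  proof (induction m)
    case (Suc m)
    have "down_shift z ^\<^sub>m Suc m * up_shift (1/z) ^\<^sub>m Suc m
      = (down_shift z ^\<^sub>m m * down_shift z) * (up_shift (1/z) * up_shift (1/z) ^\<^sub>m m)"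
      by (simp add: shift_power_commute)
    also have "\<dots> = down_shift z ^\<^sub>m m * (down_shift z * (up_shift (1/z) * up_shift (1/z) ^\<^sub>m m))"
      by (rule assoc_mult_mat[of _ r r _ r _ r]) (auto intro: mult_carrier_mat[of _ r r])
    also have "down_shift z * (up_shift (1/z) * up_shift (1/z) ^\<^sub>m m) = (down_shift z * up_shift (1/z)) * up_shift (1/z) ^\<^sub>m m"
      by (rule assoc_mult_mat[symmetric, of _ r r _ r _ r]) auto
    finally show ?case using Suc by (simp add: inv left_mult_one_mat[OF shift_pow_dim(2)])
  qed simp
  let ?U = "up_shift (1/z) :: complex Matrix.mat"
  let ?R = "weights b - x \<cdot>\<^sub>m ?U ^\<^sub>m p + ?U ^\<^sub>m (p + 1)"
  have R: "?R \<in> carrier_mat r r" using shift_pow_dim(2)[of "1/z" "p+1"] by (simp del: pow_mat.simps)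
  have "symbol_F p r b z x = down_shift z ^\<^sub>m p * ?R"
  proof -
    have c1: "x \<cdot>\<^sub>m ?U ^\<^sub>m p \<in> carrier_mat r r" by simp
    have c2: "weights b - x \<cdot>\<^sub>m ?U ^\<^sub>m p \<in> carrier_mat r r" by (rule minus_carrier_mat[OF c1])
    have "down_shift z ^\<^sub>m p * ?R = (down_shift z ^\<^sub>m p * weights b - down_shift z ^\<^sub>m p * (x \<cdot>\<^sub>m ?U ^\<^sub>m p)) + down_shift z ^\<^sub>m p * ?U ^\<^sub>m (p + 1)"
      by (simp only: mult_add_distrib_mat[OF shift_pow_dim(1) c2 shift_pow_dim(2)] mult_minus_distrib_mat[OF shift_pow_dim(1) mat_diag_dim c1])
    also have "down_shift z ^\<^sub>m p * (x \<cdot>\<^sub>m ?U ^\<^sub>m p) = x \<cdot>\<^sub>m 1\<^sub>m r"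
      by (simp only: mult_smult_distrib[OF shift_pow_dim(1) shift_pow_dim(2)] pw)
    also have "down_shift z ^\<^sub>m p * ?U ^\<^sub>m (p + 1) = ?U"
    proof -
      have "down_shift z ^\<^sub>m p * ?U ^\<^sub>m (p + 1) = (down_shift z ^\<^sub>m p * ?U ^\<^sub>m p) * ?U"
        using assoc_mult_mat[OF shift_pow_dim(1) shift_pow_dim(2) shift_dim(2), of z p "1/z" p "1/z"] by simp
      then show ?thesis by (simp add: pw left_mult_one_mat[OF shift_dim(2)])
    qed
    finally show ?thesis unfolding symbol_F_eq[OF z] using C
      by (intro eq_matI) (auto simp: up_shift_def simp del: index_mult_mat)
  qed
  moreover have "Determinant.det (down_shift z ^\<^sub>m m) = Determinant.det (down_shift z) ^ m" for m
    by (induction m) (simp_all add: det_mult[OF shift_pow_dim(1) shift_dim(1)])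
  ultimately show "symbol_f p r b z x = Determinant.det (down_shift z) ^ p * poly (reversed_poly b x) (1 / z)"
    unfolding symbol_f_def poly_reversed_poly using det_mult[OF shift_pow_dim(1) R, of z p] by simp
qed

text \<open>With corner entry \<open>0\<close> the shifts are nilpotent, so that at \<open>0\<close>
  both polynomials become determinants of triangular matrices.\<close>

lemma shift_pow_zero_entry:
  fixes m :: nat
  assumes "i < r" "j < r"
  shows "(down_shift (0::complex) ^\<^sub>m m) $$ (i, j) = (if i = j + m then 1 else 0)"
    and "(up_shift (0::complex) ^\<^sub>m m) $$ (i, j) = (if j = i + m then 1 else 0)"
proof -
  show "(down_shift (0::complex) ^\<^sub>m m) $$ (i, j) = (if i = j + m then 1 else 0)"
    using assms
  proof (induction m arbitrary: i j)
    case (Suc m)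
    have "(down_shift (0::complex) ^\<^sub>m Suc m) $$ (i, j) = (\<Sum>k\<in>{0..<r}. (down_shift 0 ^\<^sub>m m) $$ (i, k) * (down_shift 0) $$ (k, j))"
      using Suc.prems by (simp add: scalar_prod_def)
    also have "\<dots> = (\<Sum>k\<in>{0..<r}. if k = j + 1 then (if i = j + Suc m then 1 else 0) else 0)"
      using Suc.prems Suc.IH by (intro sum.cong) (auto simp: down_shift_def)
    also have "\<dots> = (if i = j + Suc m then 1 else 0)" using Suc.prems by (subst sum.delta) auto
    finally show ?case .
  qed auto
  show "(up_shift (0::complex) ^\<^sub>m m) $$ (i, j) = (if j = i + m then 1 else 0)"
    using assms
  proof (induction m arbitrary: i j)
    case (Suc m)
    have "(up_shift (0::complex) ^\<^sub>m Suc m) $$ (i, j) = (\<Sum>k\<in>{0..<r}. (up_shift 0 ^\<^sub>m m) $$ (i, k) * (up_shift 0) $$ (k, j))"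
      using Suc.prems by (simp add: scalar_prod_def)
    also have "\<dots> = (\<Sum>k\<in>{0..<r}. if k = i + m then (if j = i + Suc m then 1 else 0) else 0)"
      using Suc.prems Suc.IH by (intro sum.cong) (auto simp: up_shift_def)
    also have "\<dots> = (if j = i + Suc m then 1 else 0)" using Suc.prems by (subst sum.delta) auto
    finally show ?case .
  qed auto
qed

lemma poly_symbol_poly_0: "poly (symbol_poly b x) 0 = 1"
proof -
  have pz: "(down_shift (0::complex) ^\<^sub>m m) $$ (i, j) = (if i = j + m then 1 else 0)"
    "down_shift (0::complex) $$ (i, j) = (if i = j + 1 then 1 else 0)" if "i < r" "j < r" for i j m
    using that shift_pow_zero_entry(1)[of i j] by (auto simp: down_shift_def)
  let ?A = "1\<^sub>m r - x \<cdot>\<^sub>m down_shift 0 + down_shift 0 ^\<^sub>m (p + 1) * weights b"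
  have A: "?A \<in> carrier_mat r r" by (rule add_carrier_mat) (rule mult_carrier_mat[OF shift_pow_dim(1) mat_diag_dim])
  have e: "?A $$ (i, j) = (if i = j then 1 else 0) - x * (if i = j + 1 then 1 else 0) + (if i = j + (p + 1) then 1 else 0) * of_real (b j)"
    if "i < r" "j < r" for i j
    unfolding mat_diag_mult_right[OF shift_pow_dim(1)] using that pz[OF that] by (simp del: pow_mat.simps)
  have "Determinant.det ?A = (\<Prod>i = 0..<r. ?A $$ (i, i))"
    using det_lower_triangular[OF _ A] A e unfolding prod_list_diag_prod by (simp del: pow_mat.simps)
  also have "\<dots> = (\<Prod>i = 0..<r. 1)" by (rule prod.cong) (use e in \<open>simp_all del: pow_mat.simps\<close>)
  finally show ?thesis unfolding poly_symbol_poly by simp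
qed

lemma poly_reversed_poly_0: "poly (reversed_poly b x) 0 = (\<Prod>i<r. of_real (b i))"
proof -
  let ?A = "weights b - x \<cdot>\<^sub>m up_shift 0 ^\<^sub>m p + up_shift 0 ^\<^sub>m (p + 1)"
  have A: "?A \<in> carrier_mat r r" using shift_pow_dim(2)[of 0 "p+1"] by (simp del: pow_mat.simps)
  have e: "?A $$ (i, j) = (if i = j then of_real (b i) else 0) - x * (if j = i + p then 1 else 0) + (if j = i + (p + 1) then 1 else 0)"
    if "i < r" "j < r" for i j
    using that shift_pow_zero_entry(2)[OF that, of p] shift_pow_zero_entry(2)[OF that, of "p+1"]
    by (simp add: mat_diag_def del: pow_mat.simps)
  have "upper_triangular ?A"
    using A e p by (intro upper_triangularI) (simp del: pow_mat.simps)
  then have "Determinant.det ?A = (\<Prod>i = 0..<r. ?A $$ (i, i))"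
    using det_upper_triangular[OF _ A] A unfolding prod_list_diag_prod by (simp del: pow_mat.simps)
  also have "\<dots> = (\<Prod>i = 0..<r. of_real (b i))" by (rule prod.cong) (use e p in \<open>simp_all del: pow_mat.simps\<close>)
  finally show ?thesis unfolding poly_reversed_poly by (simp add: atLeast0LessThan)
qed

lemma symbol_poly_reversed:
  obtains \<epsilon> :: complex where "\<epsilon> \<noteq> 0"
    "\<And>b x z. z \<noteq> 0 \<Longrightarrow> symbol_f p r b z x = poly (symbol_poly b x) z / (\<epsilon> * z)"
    "\<And>b x z. z \<noteq> 0 \<Longrightarrow> poly (symbol_poly b x) z = (\<epsilon> * z) ^ (p + 1) * poly (reversed_poly b x) (1 / z)"
proof -
  obtain \<epsilon> :: complex where \<epsilon>: "\<epsilon> \<noteq> 0" "\<And>z. Determinant.det (down_shift z) = z * \<epsilon>" using det_shift by blast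
  show thesis
  proof (rule that[OF \<epsilon>(1)])
    fix b x and z :: complex assume z: "z \<noteq> 0"
    show "symbol_f p r b z x = poly (symbol_poly b x) z / (\<epsilon> * z)"
      using symbol_f_factor(1)[OF z, of b x] \<epsilon> z by (simp add: field_simps)
    show "poly (symbol_poly b x) z = (\<epsilon> * z) ^ (p + 1) * poly (reversed_poly b x) (1 / z)"
      using symbol_f_factor[OF z, of b x] \<epsilon> z by (simp add: field_simps)
  qed
qed

text \<open>Both polynomials have a nonzero constant term and determine each other through
  \<open>z \<mapsto> 1 / z\<close>; comparing degrees and leading coefficients yields the claim.
  That the leading coefficient is independent of \<open>x\<close> later keeps the product of the
  roots constant.\<close>

lemma symbol_poly_degree_lead:
  assumes b: "\<And>j. j < r \<Longrightarrow> b j > 0"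
  obtains c where "c \<noteq> 0" "\<And>x. degree (symbol_poly b x) = p + 1" "\<And>x. lead_coeff (symbol_poly b x) = c"
proof -
  obtain \<epsilon> :: complex where \<epsilon>: "\<epsilon> \<noteq> 0"
    "\<And>b x z. z \<noteq> 0 \<Longrightarrow> poly (symbol_poly b x) z = (\<epsilon> * z) ^ (p + 1) * poly (reversed_poly b x) (1 / z)"
    using symbol_poly_reversed by metis
  define c where "c = \<epsilon> ^ (p + 1) * (\<Prod>i<r. of_real (b i))"
  have main: "degree (symbol_poly b x) = p + 1 \<and> lead_coeff (symbol_poly b x) = c" for x
  proof -
  let ?P = "symbol_poly b x" and ?R = "reversed_poly b x"
  have R0: "poly ?R 0 \<noteq> 0" using b unfolding poly_reversed_poly_0 by force
  have ne: "?P \<noteq> 0" using poly_symbol_poly_0[of b x] by auto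
  \<comment> \<open>The additional factor \<open>[:0, 1:]\<close> makes the identity hold at
    \<open>z = 0\<close> too, where the relation between the two polynomials says nothing.\<close>
  have "poly ([:0, 1:] * (monom 1 (degree ?R) * ?P)) = poly ([:0, 1:] * Polynomial.smult (\<epsilon> ^ (p + 1)) (monom 1 (p + 1) * reflect_poly ?R))"
  proof
    fix z show "poly ([:0, 1:] * (monom 1 (degree ?R) * ?P)) z = poly ([:0, 1:] * Polynomial.smult (\<epsilon> ^ (p + 1)) (monom 1 (p + 1) * reflect_poly ?R)) z"
      by (cases "z = 0") (simp_all add: poly_monom poly_reflect_poly_nz \<epsilon>(2) power_mult_distrib divide_inverse)
  qed
  then have "[:0, 1:] * (monom 1 (degree ?R) * ?P) = [:0, 1:] * Polynomial.smult (\<epsilon> ^ (p + 1)) (monom 1 (p + 1) * reflect_poly ?R)"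
    by (simp only: poly_eq_poly_eq_iff)
  then have eq: "monom 1 (degree ?R) * ?P = Polynomial.smult (\<epsilon> ^ (p + 1)) (monom 1 (p + 1) * reflect_poly ?R)"
    by (metis mult_cancel_left pCons_eq_0_iff zero_neq_one)
  have dR: "degree (reflect_poly ?R) = degree ?R" using R0 by (simp add: poly_0_coeff_0)
  have "degree (monom 1 (degree ?R) * ?P) = degree ?R + degree ?P"
    using ne by (subst degree_mult_eq) (auto simp: degree_monom_eq)
  moreover have "degree (Polynomial.smult (\<epsilon> ^ (p + 1)) (monom 1 (p + 1) * reflect_poly ?R)) = (p + 1) + degree ?R"
    using \<epsilon>(1) R0 dR by (subst degree_smult_eq, subst degree_mult_eq) (auto simp: degree_monom_eq)
  moreover have "lead_coeff (monom 1 (degree ?R) * ?P) = lead_coeff ?P"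
    by (simp add: lead_coeff_mult lead_coeff_monom degree_monom_eq)
  moreover have "lead_coeff (Polynomial.smult (\<epsilon> ^ (p + 1)) (monom 1 (p + 1) * reflect_poly ?R)) = c"
    using R0 unfolding c_def poly_reversed_poly_0[symmetric, of b x]
    by (simp add: lead_coeff_mult lead_coeff_monom poly_0_coeff_0 coeff_reflect_poly degree_monom_eq)
  ultimately show ?thesis using eq by simp
  qed
  have "c \<noteq> 0" unfolding c_def using \<epsilon>(1) b by force
  then show thesis using main that by blast
qed

lemma (in -) tendsto_det:
  assumes A: "\<And>n. A n \<in> carrier_mat m m" "B \<in> carrier_mat m m"
    and lim: "\<And>i j. i < m \<Longrightarrow> j < m \<Longrightarrow> ((\<lambda>n. A n $$ (i, j)) \<longlongrightarrow> (B $$ (i, j) :: complex)) F"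
  shows "((\<lambda>n. Determinant.det (A n)) \<longlongrightarrow> Determinant.det B) F"
proof -
  have d: "dim_row (A n) = m" "dim_col (A n) = m" "dim_row B = m" "dim_col B = m" for n using A(1)[of n] A(2) by auto
  have "((\<lambda>n. \<Sum>q | q permutes {0..<m}. signof q * (\<Prod>i = 0..<m. A n $$ (i, q i))) \<longlongrightarrow>
      (\<Sum>q | q permutes {0..<m}. signof q * (\<Prod>i = 0..<m. B $$ (i, q i)))) F"
    by (intro tendsto_intros lim) (auto dest!: permutes_in_image)
  then show ?thesis by (simp add: Determinant.det_def d)
qed

lemma symbol_poly_tendsto:
  assumes "\<And>j. j < r \<Longrightarrow> ((\<lambda>n. b' n j) \<longlongrightarrow> b j) F" "(x' \<longlongrightarrow> x) F"
  shows "((\<lambda>n. poly (symbol_poly (b' n) (x' n)) z) \<longlongrightarrow> poly (symbol_poly b x) z) F"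
proof -
  let ?A = "\<lambda>b x. 1\<^sub>m r - x \<cdot>\<^sub>m down_shift z + down_shift z ^\<^sub>m (p + 1) * weights b"
  have A: "?A b x \<in> carrier_mat r r" for b x
    by (rule add_carrier_mat) (rule mult_carrier_mat[OF shift_pow_dim(1) mat_diag_dim])
  have e: "?A b x $$ (i, j) = 1\<^sub>m r $$ (i, j) - x * down_shift z $$ (i, j) + (down_shift z ^\<^sub>m (p + 1)) $$ (i, j) * of_real (b j)"
    if "i < r" "j < r" for i j b x
    unfolding mat_diag_mult_right[OF shift_pow_dim(1)] using that by (simp del: pow_mat.simps)
  show ?thesis unfolding poly_symbol_poly
    by (rule tendsto_det[OF A A]) (simp only: e, intro tendsto_intros assms, auto)
qed

text \<open>The Leibniz formula builds the coefficients from those of linear expressions in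
  \<open>x\<close> by sums and products, and \<open>H\<close> is closed under both.\<close>

lemma symbol_poly_coeff_holomorphic: "(\<lambda>x. coeff (symbol_poly b x) k) holomorphic_on S"
proof -
  define H where "H q \<longleftrightarrow> (\<forall>k. (\<lambda>x. coeff (q x) k) holomorphic_on S)" for q :: "complex \<Rightarrow> complex poly"
  have Hc: "H (\<lambda>_. c)" for c by (simp add: H_def)
  have Hx: "H (\<lambda>x. [:x:] * c)" for c by (auto simp: H_def intro!: holomorphic_intros)
  have Ha: "H (\<lambda>x. f x + g x)" "H (\<lambda>x. f x - g x)" if "H f" "H g" for f g
    using that by (auto simp: H_def intro!: holomorphic_intros)
  have Hm: "H (\<lambda>x. f x * g x)" if "H f" "H g" for f g
    using that by (auto simp: H_def coeff_mult intro!: holomorphic_intros)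
  have Hp: "H (\<lambda>x. \<Prod>i\<in>I. f i x)" if "\<And>i. i \<in> I \<Longrightarrow> H (f i)" for f and I :: "nat set"
    using that by (induction I rule: infinite_finite_induct) (auto intro: Hc Hm)
  have Hs: "H (\<lambda>x. \<Sum>i\<in>I. f i x)" if "\<And>i. i \<in> I \<Longrightarrow> H (f i)" for f and I :: "(nat \<Rightarrow> nat) set"
    using that by (induction I rule: infinite_finite_induct) (auto intro: Hc Ha)
  let ?C = "down_shift [:0, 1:] ^\<^sub>m (p + 1) * mat_diag r (\<lambda>i. [:complex_of_real (b i):])"
  let ?A = "\<lambda>x. 1\<^sub>m r - [:x:] \<cdot>\<^sub>m down_shift [:0, 1:] + ?C"
  have C: "?C \<in> carrier_mat r r" by (rule mult_carrier_mat[OF shift_pow_dim(1) mat_diag_dim])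
  have A: "?A x \<in> carrier_mat r r" for x by (rule add_carrier_mat) (rule C)
  have d: "dim_row (?A x) = r" "dim_col (?A x) = r" for x using A[of x] by auto
  have e: "?A x $$ (i, j) = (1\<^sub>m r $$ (i, j) - [:x:] * down_shift [:0, 1:] $$ (i, j)) + ?C $$ (i, j)"
    if "i < r" "j < r" for i j x
    using that C by (simp del: pow_mat.simps index_mult_mat)
  have "H (symbol_poly b)"
    unfolding symbol_poly_def[abs_def] Determinant.det_def d
  proof (simp only: refl if_True, intro Hs Hm Hp Hc)
    fix q i assume "q \<in> {q. q permutes {0..<r}}" "i \<in> {0..<r}"
    then have qi: "i < r" "q i < r" using permutes_in_image[of q "{0..<r}" i] by auto
    show "H (\<lambda>x. ?A x $$ (i, q i))" unfolding e[OF qi] by (intro Ha Hx Hc)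
  qed
  then show ?thesis by (simp add: H_def)
qed

text \<open>Conjugation by the diagonal matrix of powers of \<open>g\<close> turns \<open>g\<close>
  times the shift with corner entry \<open>z\<close> into the shift with corner entry
  \<open>g ^ r * z\<close>. It commutes with the weights, and \<open>g ^ (p + 1) = 1\<close> removes
  the scalar from the highest power.\<close>

lemma symbol_poly_rotate:
  assumes g: "g ^ (p + 1) = 1"
  shows "poly (symbol_poly b x) (g ^ r * z) = poly (symbol_poly b (g * x)) z"
proof -
  have g0: "g \<noteq> 0" using g by auto
  define P where "P = mat_diag r (\<lambda>i. inverse g ^ i)"
  define Q where "Q = mat_diag r (\<lambda>i. g ^ i)"
  have PQ: "P \<in> carrier_mat r r" "Q \<in> carrier_mat r r" by (auto simp: P_def Q_def)
  have inv: "P * Q = 1\<^sub>m r" "Q * P = 1\<^sub>m r"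
    using g0 unfolding P_def Q_def by (simp_all flip: power_mult_distrib)
  let ?Z = "down_shift z" and ?Z' = "down_shift (g ^ r * z)"
  define S where "S = P * ?Z * Q"
  have S: "S \<in> carrier_mat r r" unfolding S_def using PQ by (intro mult_carrier_mat[of _ r r]) auto
  have Z': "?Z' = g \<cdot>\<^sub>m S"
  proof (rule eq_matI)
    fix i j assume "i < dim_row (g \<cdot>\<^sub>m S)" "j < dim_col (g \<cdot>\<^sub>m S)"
    then have ij: "i < r" "j < r" using S by auto
    have "S $$ (i, j) = inverse g ^ i * ?Z $$ (i, j) * g ^ j"
      unfolding S_def P_def Q_def mat_diag_mult_left[OF shift_dim(1)] using ij
      by (subst mat_diag_mult_right[of _ r]) auto
    then have gS: "(g \<cdot>\<^sub>m S) $$ (i, j) = g * (inverse g ^ i * ?Z $$ (i, j) * g ^ j)" using ij S by simp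
    have "inverse g ^ j * g ^ j = 1" using g0 by (simp flip: power_mult_distrib)
    then have "g * (inverse g ^ (j + 1) * g ^ j) = 1" using g0 by (simp add: mult.assoc)
    moreover have "g * g ^ (r - 1) = g ^ r" using r by (simp flip: power_Suc)
    ultimately show "?Z' $$ (i, j) = (g \<cdot>\<^sub>m S) $$ (i, j)"
      unfolding gS using ij by (auto simp: down_shift_def ac_simps)
  qed (use S in auto)
  have wit: "similar_mat_wit S ?Z P Q"
    by (rule similar_mat_witI[of _ _ r]) (use S PQ inv in \<open>auto simp: S_def\<close>)
  have Spow: "S ^\<^sub>m m = P * ?Z ^\<^sub>m m * Q" for m by (rule similar_mat_wit_pow_id[OF wit])
  have smp: "(g \<cdot>\<^sub>m S) ^\<^sub>m m = g ^ m \<cdot>\<^sub>m (S ^\<^sub>m m)" for m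
  proof (induction m)
    case (Suc m)
    have "(g \<cdot>\<^sub>m S) ^\<^sub>m Suc m = (g ^ m \<cdot>\<^sub>m S ^\<^sub>m m) * (g \<cdot>\<^sub>m S)" using Suc by simp
    also have "\<dots> = g \<cdot>\<^sub>m ((g ^ m \<cdot>\<^sub>m S ^\<^sub>m m) * S)" by (rule mult_smult_distrib[of _ r r _ r]) (use S in \<open>auto intro: pow_carrier_mat\<close>)
    also have "(g ^ m \<cdot>\<^sub>m S ^\<^sub>m m) * S = g ^ m \<cdot>\<^sub>m (S ^\<^sub>m m * S)" by (rule mult_smult_assoc_mat[of _ r r _ r]) (use S in \<open>auto intro: pow_carrier_mat\<close>)
    also have "g \<cdot>\<^sub>m (g ^ m \<cdot>\<^sub>m (S ^\<^sub>m m * S)) = g ^ Suc m \<cdot>\<^sub>m (S ^\<^sub>m m * S)"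
      by (intro eq_matI) (auto simp del: index_mult_mat simp: index_mult_mat(2,3))
    finally show ?case by simp
  qed (use S in auto)
  let ?A = "1\<^sub>m r - (g * x) \<cdot>\<^sub>m ?Z + ?Z ^\<^sub>m (p + 1) * weights b"
  have W: "?Z ^\<^sub>m (p + 1) * weights b \<in> carrier_mat r r" by (rule mult_carrier_mat[OF shift_pow_dim(1) mat_diag_dim])
  have A: "?A \<in> carrier_mat r r" by (rule add_carrier_mat[OF W])
  have A1: "1\<^sub>m r - (g * x) \<cdot>\<^sub>m ?Z \<in> carrier_mat r r" by (rule minus_carrier_mat) simp
  have "1\<^sub>m r - x \<cdot>\<^sub>m ?Z' + ?Z' ^\<^sub>m (p + 1) * weights b = P * ?A * Q"
  proof -
    have "P * ?A * Q = (P * 1\<^sub>m r * Q - P * ((g * x) \<cdot>\<^sub>m ?Z) * Q) + P * (?Z ^\<^sub>m (p + 1) * weights b) * Q"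
    proof -
      have "P * ?A = (P * 1\<^sub>m r - P * ((g * x) \<cdot>\<^sub>m ?Z)) + P * (?Z ^\<^sub>m (p + 1) * weights b)"
        by (simp only: mult_add_distrib_mat[OF PQ(1) A1 W] mult_minus_distrib_mat[OF PQ(1) one_carrier_mat smult_carrier_mat[OF shift_dim(1)]])
      moreover have c: "P * 1\<^sub>m r \<in> carrier_mat r r" "P * ((g * x) \<cdot>\<^sub>m ?Z) \<in> carrier_mat r r" "P * (?Z ^\<^sub>m (p + 1) * weights b) \<in> carrier_mat r r"
        using PQ W by (auto intro!: mult_carrier_mat[of _ r r])
      ultimately show ?thesis
        by (simp only: add_mult_distrib_mat[OF minus_carrier_mat[OF c(2)] c(3) PQ(2)] minus_mult_distrib_mat[OF c(1,2) PQ(2)])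
    qed
    also have "P * 1\<^sub>m r * Q = 1\<^sub>m r" using PQ inv by simp
    also have "P * ((g * x) \<cdot>\<^sub>m ?Z) * Q = x \<cdot>\<^sub>m ?Z'"
    proof -
      have "P * ((g * x) \<cdot>\<^sub>m ?Z) * Q = (g * x) \<cdot>\<^sub>m S"
        unfolding S_def using PQ mult_smult_distrib[OF PQ(1) shift_dim(1)]
          mult_smult_assoc_mat[OF mult_carrier_mat[OF PQ(1) shift_dim(1)] PQ(2)] by simp
      then show ?thesis unfolding Z' using S by (intro eq_matI) auto
    qed
    also have "P * (?Z ^\<^sub>m (p + 1) * weights b) * Q = ?Z' ^\<^sub>m (p + 1) * weights b"
    proof -
      have "P * (?Z ^\<^sub>m (p + 1) * weights b) * Q = P * ((?Z ^\<^sub>m (p + 1) * weights b) * Q)"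
        by (rule assoc_mult_mat[OF PQ(1) W PQ(2)])
      also have "(?Z ^\<^sub>m (p + 1) * weights b) * Q = ?Z ^\<^sub>m (p + 1) * (weights b * Q)"
        by (rule assoc_mult_mat[OF shift_pow_dim(1) mat_diag_dim PQ(2)])
      also have "weights b * Q = Q * weights b" unfolding Q_def by (simp add: mult.commute)
      also have "?Z ^\<^sub>m (p + 1) * (Q * weights b) = (?Z ^\<^sub>m (p + 1) * Q) * weights b"
        by (rule assoc_mult_mat[OF shift_pow_dim(1) PQ(2) mat_diag_dim, symmetric])
      also have "P * (?Z ^\<^sub>m (p + 1) * Q * weights b) = (P * (?Z ^\<^sub>m (p + 1) * Q)) * weights b"
        by (rule assoc_mult_mat[symmetric, OF PQ(1) mult_carrier_mat[OF shift_pow_dim(1) PQ(2)] mat_diag_dim])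
      also have "P * (?Z ^\<^sub>m (p + 1) * Q) = P * ?Z ^\<^sub>m (p + 1) * Q"
        by (rule assoc_mult_mat[symmetric, OF PQ(1) shift_pow_dim(1) PQ(2)])
      also have "\<dots> = ?Z' ^\<^sub>m (p + 1)"
        unfolding Z' smp Spow g using mult_carrier_mat[OF mult_carrier_mat[OF PQ(1) shift_pow_dim(1)] PQ(2)] by (intro eq_matI) (auto simp del: pow_mat.simps index_mult_mat)
      finally show ?thesis .
    qed
    finally show ?thesis ..
  qed
  moreover have "Determinant.det (P * ?A * Q) = Determinant.det P * Determinant.det ?A * Determinant.det Q"
    using det_mult[OF mult_carrier_mat[OF PQ(1) A] PQ(2)] det_mult[OF PQ(1) A] by simp
  moreover have "Determinant.det P * Determinant.det Q = 1" using det_mult[OF PQ] inv by simp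
  ultimately show ?thesis unfolding poly_symbol_poly by (simp del: pow_mat.simps add: ac_simps)
qed

lemma symbol_poly_cnj: "poly (symbol_poly b (cnj x)) (cnj z) = cnj (poly (symbol_poly b x) z)"
proof -
  interpret h: comm_ring_hom cnj by unfold_locales auto
  have m: "map_mat cnj (down_shift z) = down_shift (cnj z)" by (auto simp: down_shift_def)
  show ?thesis
    unfolding poly_symbol_poly h.hom_det[symmetric]
      map_mat_add[OF minus_carrier_mat[OF smult_carrier_mat[OF shift_dim(1)]] mult_carrier_mat[OF shift_pow_dim(1) mat_diag_dim] h.hom_add]
      map_mat_minus[OF one_carrier_mat smult_carrier_mat[OF shift_dim(1)] h.hom_minus]
      h.mat_hom_mult[OF shift_pow_dim(1) mat_diag_dim]
    by (simp only: h.mat_hom_one map_mat_smult[OF h.hom_mult] h.mat_hom_pow[OF shift_dim(1)] m map_mat_diag complex_cnj_zero complex_cnj_complex_of_real)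
qed

end

subsection \<open>Continuity of roots\<close>

lemma common_convergent_subsequence:
  fixes A :: "nat \<Rightarrow> nat \<Rightarrow> complex"
  assumes "\<And>n i. i < d \<Longrightarrow> cmod (A n i) \<le> B"
  shows "\<exists>q a. strict_mono q \<and> (\<forall>i<d. (\<lambda>n. A (q n) i) \<longlonglongrightarrow> a i)"
  using assms
proof (induction d)
  case 0 then show ?case by (intro exI[of _ id]) (auto simp: strict_mono_def)
next
  case (Suc d)
  then obtain q a where q: "strict_mono q" "\<forall>i<d. (\<lambda>n. A (q n) i) \<longlonglongrightarrow> a i"
    using less_SucI by blast
  have "bounded (range (\<lambda>n. A (q n) d))"
    using Suc.prems[of d] by (auto intro: boundedI)
  then obtain l s where s: "strict_mono s" "((\<lambda>n. A (q n) d) \<circ> s) \<longlonglongrightarrow> l"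
    using bounded_imp_convergent_subsequence by blast
  have "(\<lambda>n. A ((q \<circ> s) n) i) \<longlonglongrightarrow> (if i = d then l else a i)" if "i < Suc d" for i
  proof (cases "i = d")
    case False
    then have "(\<lambda>n. A (q n) i) \<longlonglongrightarrow> a i" using q that by simp
    from LIMSEQ_subseq_LIMSEQ[OF this s(1)] show ?thesis using False by (simp add: o_def)
  qed (use s in \<open>simp add: o_def\<close>)
  then show ?case using strict_mono_o[OF q(1) s(1)]
    by (intro exI[of _ "q \<circ> s"] exI[of _ "\<lambda>i. if i = d then l else a i"]) blast
qed

lemma linear_factors_eq_imp_mset_eq:
  fixes a a' :: "nat \<Rightarrow> complex"
  assumes eq: "\<And>z. z \<in> S \<Longrightarrow> (\<Prod>i<d. z - a i) = (\<Prod>i<d. z - a' i)" and S: "infinite S"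
  shows "mset (map a [0..<d]) = mset (map a' [0..<d])"
proof -
  define P where "P c = (\<Prod>i\<leftarrow>[0..<d]. [:- c i, 1:])" for c :: "nat \<Rightarrow> complex"
  have pP: "poly (P c) z = (\<Prod>i<d. z - c i)" for c z
    unfolding P_def by (induction d) (simp_all add: algebra_simps)
  have "P a - P a' = 0"
  proof (rule ccontr)
    assume "P a - P a' \<noteq> 0"
    then have "finite {z. poly (P a - P a') z = 0}" by (rule poly_roots_finite)
    moreover have "S \<subseteq> {z. poly (P a - P a') z = 0}" using eq by (auto simp: pP)
    ultimately show False using S finite_subset by blast
  qed
  then have "P a = P a'" by simp
  moreover have "proots (P c) = mset (map c [0..<d])" for c
  proof -
    have ne: "0 \<notin> set (map (\<lambda>i. [:- c i, 1:]) xs)" for xs by auto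
    have "proots (\<Prod>i\<leftarrow>xs. [:- c i, 1:]) = mset (map c xs)" for xs
    proof (induction xs)
      case (Cons x xs)
      have "(\<Prod>i\<leftarrow>xs. [:- c i, 1:]) \<noteq> 0" using ne by (simp add: prod_list_zero_iff)
      then have "proots ([:- c x, 1:] * (\<Prod>i\<leftarrow>xs. [:- c i, 1:])) = proots [:- c x, 1:] + proots (\<Prod>i\<leftarrow>xs. [:- c i, 1:])"
        by (intro proots_mult) auto
      then show ?case using Cons by simp
    qed simp
    then show ?thesis unfolding P_def .
  qed
  ultimately show ?thesis by metis
qed

lemma sorted_values_unique:
  fixes a a' :: "nat \<Rightarrow> 'a" and h :: "'a \<Rightarrow> real"
  assumes ms: "mset (map a [0..<d]) = mset (map a' [0..<d])"
    and "\<And>i j. i \<le> j \<Longrightarrow> j < d \<Longrightarrow> h (a i) \<le> h (a j)" "\<And>i j. i \<le> j \<Longrightarrow> j < d \<Longrightarrow> h (a' i) \<le> h (a' j)"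
    and "i < d"
  shows "h (a i) = h (a' i)"
proof -
  have s: "sorted (map (h \<circ> a) [0..<d])" "sorted (map (h \<circ> a') [0..<d])"
    using assms by (auto simp: sorted_iff_nth_mono)
  have "mset (map h (map a [0..<d])) = mset (map h (map a' [0..<d]))"
    using ms by (simp only: mset_map)
  then have "mset (map (h \<circ> a) [0..<d]) = mset (map (h \<circ> a') [0..<d])" by simp
  then have "map (h \<circ> a) [0..<d] = map (h \<circ> a') [0..<d]"
    using properties_for_sort s by (metis sorted_sort_id)
  then show ?thesis using \<open>i < d\<close> by (metis (no_types, lifting) comp_apply length_upt map_nth nth_map nth_upt add_0 diff_zero length_map)
qed

text \<open>Individual roots need not converge when values of \<open>h\<close> coincide. Along a
  subsequence that keeps its distance, compactness yields a convergent choice of all roots; its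
  limit has the same factors as \<open>a\<close>, and sorted values of \<open>h\<close> depend on
  the multiset alone.\<close>

theorem sorted_roots_tendsto:
  fixes A :: "nat \<Rightarrow> nat \<Rightarrow> complex" and h :: "complex \<Rightarrow> real"
  assumes bd: "\<And>n i. i < d \<Longrightarrow> cmod (A n i) \<le> B" and S: "infinite S"
    and lim: "\<And>z. z \<in> S \<Longrightarrow> (\<lambda>n. \<Prod>i<d. z - A n i) \<longlonglongrightarrow> (\<Prod>i<d. z - a i)"
    and h: "continuous_on UNIV h"
    and srt: "\<And>n i j. i \<le> j \<Longrightarrow> j < d \<Longrightarrow> h (A n i) \<le> h (A n j)" "\<And>i j. i \<le> j \<Longrightarrow> j < d \<Longrightarrow> h (a i) \<le> h (a j)"
    and k: "k < d"
  shows "(\<lambda>n. h (A n k)) \<longlonglongrightarrow> h (a k)"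
proof (rule ccontr)
  assume "\<not> ?thesis"
  then obtain e where e: "e > 0" "\<And>m. \<exists>n\<ge>m. \<not> dist (h (A n k)) (h (a k)) < e"
    unfolding lim_sequentially by blast
  then have "\<exists>n>m. \<not> dist (h (A n k)) (h (a k)) < e" for m by (meson Suc_le_lessD)
  then have "infinite {n. \<not> dist (h (A n k)) (h (a k)) < e}" by (auto simp: infinite_nat_iff_unbounded)
  then obtain q0 :: "nat \<Rightarrow> nat" where q0: "strict_mono q0" "\<And>n. \<not> dist (h (A (q0 n) k)) (h (a k)) < e"
    using infinite_enumerate by blast
  obtain q a' where q: "strict_mono q" "\<forall>i<d. (\<lambda>n. A (q0 (q n)) i) \<longlonglongrightarrow> a' i"
    using common_convergent_subsequence[of d "\<lambda>n. A (q0 n)" B] bd by auto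
  have hl: "(\<lambda>n. h (A (q0 (q n)) i)) \<longlonglongrightarrow> h (a' i)" if "i < d" for i
    using continuous_on_tendsto_compose[OF h] q that by auto
  have "(\<Prod>i<d. z - a' i) = (\<Prod>i<d. z - a i)" if "z \<in> S" for z
  proof (rule LIMSEQ_unique)
    show "(\<lambda>n. \<Prod>i<d. z - A (q0 (q n)) i) \<longlonglongrightarrow> (\<Prod>i<d. z - a' i)"
      using q(2) by (intro tendsto_intros) auto
    show "(\<lambda>n. \<Prod>i<d. z - A (q0 (q n)) i) \<longlonglongrightarrow> (\<Prod>i<d. z - a i)"
      using LIMSEQ_subseq_LIMSEQ[OF lim[OF that] strict_mono_o[OF q0(1) q(1)]] by (simp add: o_def)
  qed
  then have "mset (map a' [0..<d]) = mset (map a [0..<d])"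
    by (intro linear_factors_eq_imp_mset_eq[OF _ S])
  moreover have "h (a' i) \<le> h (a' j)" if "i \<le> j" "j < d" for i j
    using that srt(1) by (intro LIMSEQ_le[OF hl hl]) auto
  ultimately have "h (a' k) = h (a k)" using srt(2) k by (intro sorted_values_unique) auto
  then have "(\<lambda>n. h (A (q0 (q n)) k)) \<longlonglongrightarrow> h (a k)" using hl[OF k] by simp
  then obtain N where "dist (h (A (q0 (q N)) k)) (h (a k)) < e" using e(1) unfolding lim_sequentially by blast
  then show False using q0(2) by blast
qed

section \<open>Ordered roots of the symbol and their moduli\<close>

context shift_symbol
begin

definition pos_weights :: "(nat \<Rightarrow> real) \<Rightarrow> bool" where
  "pos_weights b \<longleftrightarrow> (\<forall>j<r. b j > 0)"

lemma symbol_poly_lead: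
  assumes "pos_weights b"
  shows "degree (symbol_poly b x) = p + 1" "lead_coeff (symbol_poly b x) \<noteq> 0"
    "lead_coeff (symbol_poly b x) = lead_coeff (symbol_poly b y)"
proof -
  have "\<And>j. j < r \<Longrightarrow> b j > 0" using assms by (simp add: pos_weights_def)
  then have "\<exists>c. c \<noteq> 0 \<and> (\<forall>x. degree (symbol_poly b x) = p + 1 \<and> lead_coeff (symbol_poly b x) = c)"
  proof (rule symbol_poly_degree_lead)
    fix c assume "c \<noteq> 0" "\<And>x. degree (symbol_poly b x) = p + 1" "\<And>x. lead_coeff (symbol_poly b x) = c"
    then show ?thesis by (intro exI[of _ c] conjI allI)
  qed
  then obtain c where "c \<noteq> 0" "\<And>x. degree (symbol_poly b x) = p + 1" "\<And>x. lead_coeff (symbol_poly b x) = c"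
    by blast
  then show "degree (symbol_poly b x) = p + 1" "lead_coeff (symbol_poly b x) \<noteq> 0"
    "lead_coeff (symbol_poly b x) = lead_coeff (symbol_poly b y)" by simp_all
qed

lemma symbol_zorder:
  assumes b: "pos_weights b" and z: "z \<noteq> 0"
  shows "zorder (\<lambda>w. symbol_f p r b w x) z = int (order z (symbol_poly b x))"
proof -
  obtain \<epsilon> where \<epsilon>: "\<epsilon> \<noteq> 0" "\<And>b x z. z \<noteq> 0 \<Longrightarrow> symbol_f p r b z x = poly (symbol_poly b x) z / (\<epsilon> * z)"
    using symbol_poly_reversed by metis
  have ne: "symbol_poly b x \<noteq> 0" using poly_symbol_poly_0[of b x] by auto
  obtain q where q: "symbol_poly b x = [:- z, 1:] ^ order z (symbol_poly b x) * q" "\<not> [:- z, 1:] dvd q"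
    using order_decomp[OF ne] by blast
  let ?g = "\<lambda>w. poly q w / (\<epsilon> * w)"
  show ?thesis
  proof (rule zorder_eqI[of "- {0}" z ?g])
    show "?g holomorphic_on - {0}" using \<epsilon>(1) by (auto intro!: holomorphic_intros)
    show "?g z \<noteq> 0" using q(2) \<epsilon>(1) z by (simp add: poly_eq_0_iff_dvd)
    fix w :: complex assume "w \<in> - {0}" "w \<noteq> z"
    moreover have "poly (symbol_poly b x) w = (w - z) ^ order z (symbol_poly b x) * poly q w"
      by (subst q(1)) simp
    ultimately show "symbol_f p r b w x = ?g w * (w - z) powi int (order z (symbol_poly b x))"
      using \<epsilon>(2) by simp
  qed (use z in auto)
qed

lemma symbol_root_iff_poly: "z \<noteq> 0 \<Longrightarrow> symbol_f p r b z x = 0 \<longleftrightarrow> poly (symbol_poly b x) z = 0"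
  using symbol_poly_reversed by (metis divide_eq_0_iff mult_eq_0_iff)

text \<open>The symbol and \<open>symbol_poly\<close> differ by a factor without zeros or poles off
  the origin, so orders of zeros are multiplicities of roots.\<close>

lemma ordered_roots_iff:
  assumes b: "pos_weights b"
  shows "ordered_roots p r b x zs \<longleftrightarrow> sorted (map cmod zs) \<and> mset zs = proots (symbol_poly b x)"
proof -
  let ?P = "symbol_poly b x"
  have ne: "?P \<noteq> 0" and nz: "poly ?P 0 \<noteq> 0" using poly_symbol_poly_0[of b x] by auto
  have deg: "degree ?P = p + 1" using symbol_poly_lead[OF b] by blast
  have cnt: "count (proots ?P) z = order z ?P" for z using ne by simp
  show ?thesis
  proof
    assume o: "ordered_roots p r b x zs"
    have "count (mset zs) z = count (proots ?P) z" for z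
    proof (cases "z \<noteq> 0 \<and> poly ?P z = 0")
      case True
      then have "int (count_list zs z) = int (order z ?P)"
        using o symbol_zorder[OF b, of z x] symbol_root_iff_poly by (auto simp: ordered_roots_def)
      then show ?thesis using ne by (simp add: count_mset)
    next
      case False
      then have "z \<notin> set zs" using o symbol_root_iff_poly by (auto simp: ordered_roots_def)
      moreover have "order z ?P = 0" using False nz order_root[of ?P z] ne by auto
      ultimately show ?thesis using ne by (simp add: count_mset count_list_0_iff)
    qed
    then show "sorted (map cmod zs) \<and> mset zs = proots ?P" using o by (auto simp: ordered_roots_def intro: multiset_eqI)
  next
    assume s: "sorted (map cmod zs) \<and> mset zs = proots ?P"
    have "length zs = p + 1" using s size_proots_complex[of ?P] deg by (metis size_mset)
    moreover have "set zs = {z. poly ?P z = 0}" using s ne by (metis set_mset_mset set_count_proots)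
    have cl: "count_list zs z = order z ?P" for z using s cnt by (metis count_mset)
    moreover have "z \<noteq> 0 \<and> symbol_f p r b z x = 0" if "z \<in> set zs" for z
    proof -
      have "poly ?P z = 0" using that \<open>set zs = _\<close> by blast
      moreover from this have "z \<noteq> 0" using nz by auto
      ultimately show ?thesis using symbol_root_iff_poly by blast
    qed
    moreover have "int (count_list zs z) = zorder (\<lambda>w. symbol_f p r b w x) z" if "z \<noteq> 0" for z
      using symbol_zorder[OF b that, of x] cl[of z] by simp
    ultimately show "ordered_roots p r b x zs"
      using s unfolding ordered_roots_def by blast
  qed
qed

abbreviation zroot :: "(nat \<Rightarrow> real) \<Rightarrow> complex \<Rightarrow> nat \<Rightarrow> complex" where
  "zroot b x k \<equiv> z_root p r b k x"

lemma root_mset: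
  assumes b: "pos_weights b"
  shows "mset (map (zroot b x) [0..<p + 1]) = proots (symbol_poly b x)"
    and "i \<le> j \<Longrightarrow> j \<le> p \<Longrightarrow> cmod (zroot b x i) \<le> cmod (zroot b x j)"
proof -
  obtain xs where "mset xs = proots (symbol_poly b x)" using ex_mset by blast
  then have "ordered_roots p r b x (sort_key cmod xs)"
    using ordered_roots_iff[OF b] by simp
  then have "ordered_roots p r b x (SOME zs. ordered_roots p r b x zs)" by (rule someI)
  then obtain zs where zs: "zs = (SOME zs. ordered_roots p r b x zs)" and o: "ordered_roots p r b x zs" by blast
  have len: "length zs = p + 1" using o by (simp add: ordered_roots_def)
  have zi: "zroot b x k = zs ! k" for k by (simp only: z_root_def zs)
  then have "zroot b x = (\<lambda>k. zs ! k)" by (intro ext)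
  then have "map (zroot b x) [0..<p + 1] = zs"
    using len map_nth[of zs] by metis
  moreover have "sorted (map cmod zs)" "mset zs = proots (symbol_poly b x)"
    using o unfolding ordered_roots_iff[OF b] by blast+
  ultimately show "mset (map (zroot b x) [0..<p + 1]) = proots (symbol_poly b x)" by metis
  assume "i \<le> j" "j \<le> p"
  then have "map cmod zs ! i \<le> map cmod zs ! j"
    using \<open>sorted (map cmod zs)\<close> len by (intro sorted_nth_mono) auto
  then show "cmod (zroot b x i) \<le> cmod (zroot b x j)"
    using \<open>i \<le> j\<close> \<open>j \<le> p\<close> len by (simp add: zi)
qed

lemma root_set:
  assumes b: "pos_weights b"
  shows "zroot b x ` {..p} = {z. poly (symbol_poly b x) z = 0}"
proof -
  have ne: "symbol_poly b x \<noteq> 0" using poly_symbol_poly_0[of b x] by auto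
  have "set (map (zroot b x) [0..<p + 1]) = {z. poly (symbol_poly b x) z = 0}"
    using root_mset(1)[OF b, of x] ne by (metis set_mset_mset set_count_proots)
  moreover have "set (map (zroot b x) [0..<p + 1]) = zroot b x ` {..p}"
    by (simp only: set_map set_upt atLeast0LessThan Suc_eq_plus1[symmetric] lessThan_Suc_atMost)
  ultimately show ?thesis by simp
qed

lemma root_props:
  assumes b: "pos_weights b" and "k \<le> p"
  shows "poly (symbol_poly b x) (zroot b x k) = 0" "zroot b x k \<noteq> 0" "symbol_f p r b (zroot b x k) x = 0"
proof -
  show *: "poly (symbol_poly b x) (zroot b x k) = 0" using root_set[OF b, of x] assms by blast
  show **: "zroot b x k \<noteq> 0" using * poly_symbol_poly_0[of b x] by auto
  show "symbol_f p r b (zroot b x k) x = 0" using * ** symbol_root_iff_poly by simp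
qed

lemma symbol_poly_prod_lead:
  assumes b: "pos_weights b"
  shows "poly (symbol_poly b x) z = lead_coeff (symbol_poly b x) * (\<Prod>i<p+1. z - zroot b x i)"
proof -
  let ?P = "symbol_poly b x"
  have "(\<Prod>a\<in>#proots ?P. [:- a, 1:]) = (\<Prod>a\<in>#mset (map (zroot b x) [0..<p + 1]). [:- a, 1:])"
    using root_mset(1)[OF b, of x] by simp
  also have "\<dots> = (\<Prod>i\<leftarrow>[0..<p + 1]. [:- zroot b x i, 1:])"
    by (simp only: prod_mset_prod_list map_map o_def flip: mset_map)
  finally have "?P = Polynomial.smult (lead_coeff ?P) (\<Prod>i\<leftarrow>[0..<p + 1]. [:- zroot b x i, 1:])"
    using complex_poly_decompose_multiset[of ?P] by simp
  then have "poly ?P z = lead_coeff ?P * poly (\<Prod>i\<leftarrow>[0..<p + 1]. [:- zroot b x i, 1:]) z" by (metis poly_smult)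
  moreover have "poly (\<Prod>i\<leftarrow>[0..<n]. [:- zroot b x i, 1:]) z = (\<Prod>i<n. z - zroot b x i)" for n
    by (induction n) (simp_all add: algebra_simps)
  ultimately show ?thesis by metis
qed

text \<open>Reciprocals are used because \<open>symbol_poly\<close> has constant term
  \<open>1\<close>: the polynomial with the reciprocal roots is monic whatever the weights
  are.\<close>

lemma symbol_poly_prod:
  assumes b: "pos_weights b" and s: "s \<noteq> 0"
  shows "(\<Prod>i<p+1. s - 1 / zroot b x i) = s ^ (p + 1) * poly (symbol_poly b x) (1 / s)"
proof -
  let ?c = "lead_coeff (symbol_poly b x)"
  have nz: "zroot b x i \<noteq> 0" if "i < p + 1" for i using root_props(2)[OF b] that by simp
  have "1 = ?c * (\<Prod>i<p+1. - zroot b x i)"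
    using symbol_poly_prod_lead[OF b, of x 0] poly_symbol_poly_0[of b x] by simp
  then have c: "?c = (\<Prod>i<p+1. 1 / (- zroot b x i))"
  proof -
    have "(\<Prod>i<p+1. - zroot b x i) \<noteq> 0" using nz by (simp only: prod_zero_iff finite_lessThan neg_equal_0_iff_equal) auto
    then have "?c = 1 / (\<Prod>i<p+1. - zroot b x i)" using \<open>1 = _\<close> by (metis nonzero_eq_divide_eq)
    also have "\<dots> = (\<Prod>i<p+1. 1 / (- zroot b x i))" by (simp only: prod_dividef prod.neutral_const)
    finally show ?thesis .
  qed
  have "s ^ (p + 1) * poly (symbol_poly b x) (1 / s) = (\<Prod>i<p+1. s) * ((\<Prod>i<p+1. 1 / (- zroot b x i)) * (\<Prod>i<p+1. 1 / s - zroot b x i))"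
    unfolding symbol_poly_prod_lead[OF b] c by simp
  also have "\<dots> = (\<Prod>i<p+1. s * (1 / (- zroot b x i) * (1 / s - zroot b x i)))"
    by (simp only: prod.distrib)
  also have "\<dots> = (\<Prod>i<p+1. s - 1 / zroot b x i)"
    using nz s by (intro prod.cong) (auto simp: field_simps)
  finally show ?thesis by simp
qed

lemma root_modulus_unique:
  assumes b: "pos_weights b"
    and a: "\<And>s. s \<noteq> 0 \<Longrightarrow> (\<Prod>i<p+1. s - 1 / a i) = s ^ (p + 1) * poly (symbol_poly b x) (1 / s)"
    and srt: "\<And>i j. i \<le> j \<Longrightarrow> j \<le> p \<Longrightarrow> cmod (a i) \<le> cmod (a j)" and nz: "\<And>i. i \<le> p \<Longrightarrow> a i \<noteq> 0" and k: "k \<le> p"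
  shows "cmod (a k) = cmod (zroot b x k)"
proof -
  have inf: "infinite (- {0::complex})" using infinite_UNIV_char_0[where 'a = complex]
    by (metis Compl_eq_Diff_UNIV finite.emptyI finite.insertI infinite_remove)
  have "mset (map (\<lambda>i. 1 / a i) [0..<p+1]) = mset (map (\<lambda>i. 1 / zroot b x i) [0..<p+1])"
    by (rule linear_factors_eq_imp_mset_eq[OF _ inf]) (use a symbol_poly_prod[OF b] in auto)
  then have "- cmod (1 / a k) = - cmod (1 / zroot b x k)"
    using k srt root_mset(2)[OF b] nz root_props(2)[OF b]
    by (intro sorted_values_unique[where h = "\<lambda>z. - cmod z" and d = "p + 1"])
       (auto simp: norm_divide intro!: divide_left_mono)
  then show ?thesis using nz[OF k] root_props(2)[OF b k] by (simp add: norm_divide field_simps)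
qed

lemma root_modulus_rotate:
  assumes b: "pos_weights b" and g: "g ^ (p + 1) = 1" and k: "k \<le> p"
  shows "cmod (zroot b (g * x) k) = cmod (zroot b x k)"
proof -
  have g1: "cmod g = 1" using g by (metis norm_one norm_power norm_ge_zero power_eq_1_iff nat.simps(3) Suc_eq_plus1)
  then have g0: "g \<noteq> 0" by auto
  have "cmod (g ^ r * zroot b (g * x) k) = cmod (zroot b x k)"
  proof (rule root_modulus_unique[OF b])
    fix s :: complex assume s: "s \<noteq> 0"
    have "(\<Prod>i<p+1. s - 1 / (g ^ r * zroot b (g * x) i)) = (\<Prod>i<p+1. (1 / g ^ r) * (g ^ r * s - 1 / zroot b (g * x) i))"
      using g0 by (intro prod.cong) (auto simp: field_simps)
    also have "\<dots> = (1 / g ^ r) ^ (p + 1) * ((g ^ r * s) ^ (p + 1) * poly (symbol_poly b (g * x)) (1 / (g ^ r * s)))"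
      using symbol_poly_prod[OF b, of "g ^ r * s" "g * x"] g0 s by (simp only: prod.distrib prod_constant) simp
    also have "poly (symbol_poly b (g * x)) (1 / (g ^ r * s)) = poly (symbol_poly b x) (1 / s)"
      using symbol_poly_rotate[OF g, of b x "1 / (g ^ r * s)"] g0 by simp
    finally show "(\<Prod>i<p+1. s - 1 / (g ^ r * zroot b (g * x) i)) = s ^ (p + 1) * poly (symbol_poly b x) (1 / s)"
      using g0 by (simp add: field_simps power_mult_distrib)
  qed (use root_mset(2)[OF b] root_props(2)[OF b] g1 g0 k in \<open>auto simp: norm_mult norm_power\<close>)
  then show ?thesis using g1 by (simp add: norm_mult norm_power)
qed

lemma root_modulus_cnj:
  assumes b: "pos_weights b" and k: "k \<le> p"
  shows "cmod (zroot b (cnj x) k) = cmod (zroot b x k)"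
proof -
  have "cmod (cnj (zroot b (cnj x) k)) = cmod (zroot b x k)"
  proof (rule root_modulus_unique[OF b])
    fix s :: complex assume s: "s \<noteq> 0"
    have "(\<Prod>i<p+1. s - 1 / cnj (zroot b (cnj x) i)) = cnj (\<Prod>i<p+1. cnj s - 1 / zroot b (cnj x) i)" by simp
    also have "\<dots> = s ^ (p + 1) * poly (symbol_poly b x) (1 / s)"
      using symbol_poly_prod[OF b, of "cnj s" "cnj x"] symbol_poly_cnj[of b x "1 / s"] s by (simp del: prod.lessThan_Suc)
    finally show "(\<Prod>i<p+1. s - 1 / cnj (zroot b (cnj x) i)) = s ^ (p + 1) * poly (symbol_poly b x) (1 / s)" .
  qed (use root_mset(2)[OF b] root_props(2)[OF b] k in auto)
  then show ?thesis by simp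
qed

text \<open>With \<open>w ^ r = cmod z\<close> the sequence \<open>cmod (u n) * w ^ n\<close> is
  periodic and so has a largest term. If \<open>w\<close> were too small, the recurrence would bound
  this term by something strictly smaller than itself.\<close>

lemma root_lower_bound:
  assumes "\<And>j. j < r \<Longrightarrow> 0 < b j" "\<And>j. j < r \<Longrightarrow> b j \<le> B" and "cmod x \<le> X" and z: "z \<noteq> 0" "symbol_f p r b z x = 0"
  shows "cmod z \<ge> (1 / (X + B + 1)) ^ r"
proof -
  obtain u where u: "floquet_solution b x z u" using z symbol_root_iff by blast
  define w where "w = cmod z powr (1 / real r)"
  have w: "w > 0" "w ^ r = cmod z" using z r by (auto simp: w_def powr_realpow[symmetric] powr_powr)
  define q where "q n = cmod (u n) * w ^ n" for n
  have per: "q (n + r) = q n" for n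
    using u w z by (simp add: q_def floquet_solution_def norm_divide power_add)
  have perm: "q (n + r * m) = q n" for n m
    by (induction m) (use per in \<open>auto simp: algebra_simps\<close>, metis add.assoc add.commute per)
  have qmod: "q n = q (n mod r)" for n using perm[of "n mod r" "n div r"] by simp
  define M where "M = Max (q ` {..<r})"
  have M: "q n \<le> M" for n unfolding M_def qmod[of n] using r by (intro Max_ge) auto
  obtain n0 where n0: "n0 < r" "q n0 = M"
  proof -
    have "q 0 \<in> q ` {..<r}" using r by auto
    then have "M \<in> q ` {..<r}" unfolding M_def by (intro Max_in) auto
    then show ?thesis using that by auto
  qed
  obtain n1 where "u n1 \<noteq> 0" using u by (auto simp: floquet_solution_def)
  then have "q n1 > 0" using w by (simp add: q_def)
  then have Mpos: "M > 0" using M[of n1] by linarith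
  have B: "B > 0" using assms(1)[of 0] assms(2)[of 0] r by linarith
  have X: "X \<ge> 0" using assms(3) norm_ge_zero order_trans by blast
  show ?thesis
  proof (rule ccontr)
    assume small: "\<not> ?thesis"
    then have "w ^ r < (1 / (X + B + 1)) ^ r" using w by simp
    then have wl: "w < 1 / (X + B + 1)" by (rule power_less_imp_less_base) (use X B in auto)
    then have w1: "w * (X + B + 1) < 1" using X B by (simp add: field_simps)
    have wle1: "w \<le> 1" using wl X B by (smt (verit) divide_le_eq_1)
    \<comment> \<open>Chosen so that \<open>n + p + 1\<close> is a periodic copy of the maximal
      place \<open>n0\<close>, far enough to the right to have \<open>p + 1\<close>
      predecessors.\<close>
    define n where "n = n0 + r * (p + 1) - (p + 1)"
    have "1 * (p + 1) \<le> r * (p + 1)" using r by (intro mult_right_mono) auto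
    then have "p + 1 \<le> n0 + r * (p + 1)" by (intro trans_le_add2) (simp only: mult_1)
    then have "n + (p + 1) = n0 + r * (p + 1)" unfolding n_def by (rule le_add_diff_inverse2)
    then have n: "n + p + 1 = n0 + r * (p + 1)" by (simp only: add.assoc)
    have "cmod (u (n + p + 1)) \<le> X * cmod (u (n + p)) + B * cmod (u n)"
    proof -
      have "u (n + p + 1) = x * u (n + p) - of_real (b (n mod r)) * u n" using u by (simp add: floquet_solution_def)
      then have "cmod (u (n + p + 1)) \<le> cmod x * cmod (u (n + p)) + \<bar>b (n mod r)\<bar> * cmod (u n)"
        by (metis norm_triangle_ineq4 norm_mult norm_of_real)
      also have "\<dots> \<le> X * cmod (u (n + p)) + B * cmod (u n)"
        using assms(1,2)[of "n mod r"] r assms(3) by (intro add_mono mult_right_mono) auto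
      finally show ?thesis .
    qed
    then have "cmod (u (n + p + 1)) * w ^ (n + p + 1) \<le> (X * cmod (u (n + p)) + B * cmod (u n)) * w ^ (n + p + 1)"
      using w by (intro mult_right_mono) auto
    then have "q (n + p + 1) \<le> X * w * q (n + p) + B * w ^ (p + 1) * q n"
      by (simp add: q_def power_add algebra_simps)
    also have "\<dots> \<le> X * w * M + B * w * M"
    proof -
      have "w ^ (p + 1) \<le> w" using w wle1 by (simp add: mult_left_le power_le_one)
      then have "B * w ^ (p + 1) * q n \<le> B * w * M"
        using M[of n] B w Mpos by (intro mult_mono) (auto simp: q_def)
      moreover have "X * w * q (n + p) \<le> X * w * M" using M X w by (intro mult_left_mono) auto
      ultimately show ?thesis by linarith
    qed
    also have "\<dots> < M"
    proof -
      have "w * (X + B) < 1" using w1 w(1) by (simp add: algebra_simps)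
      then have "M * (w * (X + B)) < M * 1" using Mpos by (rule mult_strict_left_mono)
      then show ?thesis by (simp add: algebra_simps)
    qed
    finally show False using perm[of n0 "p + 1"] n0 n by simp
  qed
qed

text \<open>\<open>sorted_roots_tendsto\<close> is applied to the reciprocals, which are bounded by
  \<open>root_lower_bound\<close> and belong to monic polynomials; the minus sign in
  \<open>h\<close> makes up for the reversed order.\<close>

theorem root_modulus_tendsto:
  assumes b: "pos_weights b" "\<And>n. pos_weights (b' n)"
    and lim: "\<And>j. j < r \<Longrightarrow> (\<lambda>n. b' n j) \<longlonglongrightarrow> b j" "x' \<longlonglongrightarrow> x" and k: "k \<le> p"
  shows "(\<lambda>n. cmod (zroot (b' n) (x' n) k)) \<longlonglongrightarrow> cmod (zroot b x k)"
proof -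
  obtain X where X: "\<And>n. cmod (x' n) \<le> X" using lim(2) by (metis convergent_imp_Bseq convergentI BseqE)
  have "\<exists>B. \<forall>n. \<forall>j<m. b' n j \<le> B" if "m \<le> r" for m
    using that
  proof (induction m)
    case (Suc m)
    then obtain B where B: "\<forall>n. \<forall>j<m. b' n j \<le> B" by auto
    obtain C where C: "\<And>n. norm (b' n m) \<le> C" using lim(1)[of m] Suc by (metis convergent_imp_Bseq convergentI BseqE Suc_le_lessD)
    show ?case using B C by (intro exI[of _ "max B C"]) (auto simp: less_Suc_eq le_max_iff_disj, meson abs_le_D1)
  qed simp
  then obtain B where B: "\<And>n j. j < r \<Longrightarrow> b' n j \<le> B" by blast
  have inf: "infinite (- {0::complex})" using infinite_UNIV_char_0[where 'a = complex]
    by (metis Compl_eq_Diff_UNIV finite.emptyI finite.insertI infinite_remove)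
  have bpos: "0 < b' n j" if "j < r" for n j using b(2) that by (simp add: pos_weights_def)
  have XB: "X + B + 1 > 0" using B[of 0 0] bpos[of 0 0] X[of 0] r norm_ge_zero[of "x' 0"] by linarith
  have "(\<lambda>n. - cmod (1 / zroot (b' n) (x' n) k)) \<longlonglongrightarrow> - cmod (1 / zroot b x k)"
  proof (rule sorted_roots_tendsto[where d = "p + 1" and h = "\<lambda>z. - cmod z" and S = "- {0}" and B = "(X + B + 1) ^ r"])
    fix n i assume i: "i < p + 1"
    have "cmod (zroot (b' n) (x' n) i) \<ge> (1 / (X + B + 1)) ^ r"
      using root_props[OF b(2)] i by (intro root_lower_bound[of "b' n", OF bpos B X[of n]]) auto
    then have "cmod (1 / zroot (b' n) (x' n) i) \<le> 1 / (1 / (X + B + 1)) ^ r"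
    proof -
      have "zroot (b' n) (x' n) i \<noteq> 0" using root_props(2)[OF b(2)] i by simp
      moreover have "0 < (1 / (X + B + 1)) ^ r" using XB by simp
      ultimately show ?thesis unfolding norm_divide norm_one using \<open>_ \<le> cmod _\<close>
        by (intro divide_left_mono mult_pos_pos) auto
    qed
    then show "cmod (1 / zroot (b' n) (x' n) i) \<le> (X + B + 1) ^ r" by (simp add: power_one_over)
  next
    fix z :: complex assume z: "z \<in> - {0}"
    show "(\<lambda>n. \<Prod>i<p+1. z - 1 / zroot (b' n) (x' n) i) \<longlonglongrightarrow> (\<Prod>i<p+1. z - 1 / zroot b x i)"
      using z by (simp only: symbol_poly_prod[OF b(1)] symbol_poly_prod[OF b(2)] Compl_iff singleton_iff not_False_eq_True)
        (intro tendsto_intros symbol_poly_tendsto lim)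
  qed (use inf k root_mset(2)[OF b(1)] root_mset(2)[OF b(2)] root_props(2)[OF b(1)] root_props(2)[OF b(2)] in
        \<open>auto simp: norm_divide intro!: continuous_intros divide_left_mono\<close>)
  then have "(\<lambda>n. inverse (cmod (1 / zroot (b' n) (x' n) k))) \<longlonglongrightarrow> inverse (cmod (1 / zroot b x k))"
    using root_props(2)[OF b(1) k] tendsto_minus_cancel by (intro tendsto_inverse) (auto dest: tendsto_minus)
  then show ?thesis by (simp add: norm_divide)
qed

lemma root_modulus_continuous:
  assumes b: "pos_weights b" and k: "k \<le> p"
  shows "continuous_on S (\<lambda>x. cmod (zroot b x k))"
  unfolding continuous_on_sequentially o_def
  using root_modulus_tendsto[where b' = "\<lambda>_. b", OF b b tendsto_const _ k] by auto

lemma symbol_poly_jointly_tendsto: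
  assumes b: "pos_weights b" and "(x' \<longlongrightarrow> x) F" "(z' \<longlongrightarrow> z) F"
  shows "((\<lambda>n. poly (symbol_poly b (x' n)) (z' n)) \<longlongrightarrow> poly (symbol_poly b x) z) F"
proof -
  have deg: "degree (symbol_poly b x) = p + 1" for x using symbol_poly_lead[OF b] by blast
  have "isCont (\<lambda>x. coeff (symbol_poly b x) k) x" for k
    using holomorphic_on_imp_continuous_on[OF symbol_poly_coeff_holomorphic[of b k UNIV]] by (simp add: continuous_on_eq_continuous_at)
  then have "((\<lambda>n. coeff (symbol_poly b (x' n)) k) \<longlongrightarrow> coeff (symbol_poly b x) k) F" for k
    using assms(2) isCont_tendsto_compose by blast
  then show ?thesis unfolding poly_altdef deg by (intro tendsto_intros assms)
qed

end

subsection \<open>Distinct moduli at commensurable arguments\<close>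

text \<open>Two close terms of a convergent subsequence of the pairs of powers differ by a common
  return time.\<close>

lemma simultaneous_recurrence:
  assumes a: "cmod a = 1" "cmod a' = 1" and e: "e > 0"
  shows "\<exists>l\<ge>1. cmod (a ^ l - 1) < e \<and> cmod (a' ^ l - 1) < e"
proof -
  define f where "f n = (a ^ n, a' ^ n)" for n :: nat
  have "norm (f n) \<le> 2" for n
  proof -
    have "norm (f n) \<le> norm (a ^ n) + norm (a' ^ n)" unfolding f_def by (rule norm_Pair_le)
    then show ?thesis using a by (simp add: norm_power)
  qed
  then have "bounded (range f)" by (auto intro: boundedI)
  then obtain l s where s: "strict_mono s" "(f \<circ> s) \<longlonglongrightarrow> l" using bounded_imp_convergent_subsequence by blast
  then have "Cauchy (f \<circ> s)" by (simp add: LIMSEQ_imp_Cauchy)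
  then obtain M where "\<And>m n. m \<ge> M \<Longrightarrow> n \<ge> M \<Longrightarrow> dist ((f \<circ> s) m) ((f \<circ> s) n) < e"
    using e unfolding Cauchy_def by blast
  then have d: "dist (f (s (Suc M))) (f (s M)) < e" by simp
  define l where "l = s (Suc M) - s M"
  have l: "l \<ge> 1" "s (Suc M) = l + s M" using s(1) by (auto simp: l_def strict_mono_Suc_iff Suc_leI less_imp_le)
  have *: "cmod (w ^ l - 1) = dist (w ^ s (Suc M)) (w ^ s M)" if "cmod w = 1" for w
  proof -
    have "w ^ s (Suc M) - w ^ s M = (w ^ l - 1) * w ^ s M" by (simp add: l power_add algebra_simps)
    then show ?thesis using that by (simp add: dist_norm norm_mult norm_power)
  qed
  have "dist (a ^ s (Suc M)) (a ^ s M) < e" "dist (a' ^ s (Suc M)) (a' ^ s M) < e"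
    using d dist_fst_le[of "f (s (Suc M))" "f (s M)"] dist_snd_le[of "f (s (Suc M))" "f (s M)"] by (auto simp: f_def)
  then show ?thesis using l(1) *[OF a(1)] *[OF a(2)] by auto
qed

lemma two_real_conditions:
  fixes \<alpha> \<alpha>1 \<beta> \<beta>1 :: complex
  obtains c c' where "c \<noteq> 0 \<or> c' \<noteq> 0" "Re (c * \<alpha>) + Re (c' * \<beta>) = 0" "Re (c * \<alpha>1) + Re (c' * \<beta>1) = 0"
proof -
  \<comment> \<open>The determinant of the two conditions as equations in \<open>c\<close> alone. If
    it vanishes, \<open>c' = 0\<close> works; otherwise \<open>c' = 1\<close> is completed by
    Cramer's rule.\<close>
  define I where "I = Im (cnj \<alpha>1 * \<alpha>)"
  show thesis
  proof (cases "I = 0")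
    case True
    show thesis
    proof (cases "\<alpha> = 0 \<and> \<alpha>1 = 0")
      case True then show thesis by (intro that[of 1 0]) auto
    next
      case False
      define c where "c = \<i> * cnj (if \<alpha> = 0 then \<alpha>1 else \<alpha>)"
      have "c \<noteq> 0" using False by (auto simp: c_def)
      then show thesis using True by (intro that[of c 0]) (auto simp: c_def I_def algebra_simps)
    qed
  next
    case False
    define A where "A = Re \<beta> / I"
    define B where "B = - Re \<beta>1 / I"
    have AB: "A * I = Re \<beta>" "B * I = - Re \<beta>1" using False by (auto simp: A_def B_def)
    define c where "c = \<i> * (of_real A * cnj \<alpha>1 + of_real B * cnj \<alpha>)"
    have "Re (c * \<alpha>) = - (A * I)" "Re (c * \<alpha>1) = B * I" by (auto simp: c_def I_def algebra_simps)
    then show thesis using AB by (intro that[of c 1]) auto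
  qed
qed

text \<open>The second-order operator with characteristic polynomial
  \<open>w ^ 2 - 2 * Re \<eta>' * w + 1\<close> annihilates the part in \<open>\<eta>'\<close>,
  while it multiplies the part in \<open>\<eta>\<close> by a nonzero real number times
  \<open>\<eta>\<close>. What is left vanishes at two successive powers of a non-real number, hence
  identically.\<close>

lemma independent_phases:
  fixes \<eta> \<eta>' :: complex
  assumes nz: "Im \<eta> \<noteq> 0" "Im \<eta>' \<noteq> 0" "Re \<eta> \<noteq> Re \<eta>'" and one: "cmod \<eta> = 1" "cmod \<eta>' = 1"
    and z: "\<And>s::int. Re (A * \<eta> powi s) + Re (B * \<eta>' powi s) = 0"
  shows "A = 0 \<and> B = 0"
proof -
  have kill: "Re (A * \<eta> powi s * (\<eta> ^ 2 - 2 * of_real c * \<eta> + 1)) + Re (B * \<eta>' powi s * (\<eta>' ^ 2 - 2 * of_real c * \<eta>' + 1)) = 0"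
    if "Im \<eta> \<noteq> 0" "Im \<eta>' \<noteq> 0" "\<And>s::int. Re (A * \<eta> powi s) + Re (B * \<eta>' powi s) = 0" for A B \<eta> \<eta>' :: complex and s :: int and c :: real
  proof -
    have n: "\<eta> \<noteq> 0" "\<eta>' \<noteq> 0" using that by auto
    have e: "w powi (s + 2) = w powi s * w ^ 2" "w powi (s + 1) = w powi s * w" if "w \<noteq> 0" for w :: complex
      using that by (simp_all add: power_int_add)
    have ex: "Re (P * (w ^ 2 - 2 * of_real c * w + 1)) = Re (P * w ^ 2) - 2 * c * Re (P * w) + Re P" for P w :: complex
    proof -
      have "P * (w ^ 2 - 2 * of_real c * w + 1) = P * w ^ 2 - of_real (2 * c) * (P * w) + P" by (simp add: algebra_simps)
      moreover have "Re (of_real a * v) = a * Re v" for a v by simp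
      ultimately show ?thesis by (simp only: minus_complex.sel plus_complex.sel)
    qed
    have "Re (A * \<eta> powi s * \<eta> ^ 2) + Re (B * \<eta>' powi s * \<eta>' ^ 2) = 0"
      "Re (A * \<eta> powi s * \<eta>) + Re (B * \<eta>' powi s * \<eta>') = 0"
      using that(3)[of "s + 2"] that(3)[of "s + 1"] unfolding e(1)[OF n(1)] e(1)[OF n(2)] e(2)[OF n(1)] e(2)[OF n(2)]
      by (simp_all only: mult.assoc)
    then have "(Re (A * \<eta> powi s * \<eta> ^ 2) + Re (B * \<eta>' powi s * \<eta>' ^ 2))
        - 2 * c * (Re (A * \<eta> powi s * \<eta>) + Re (B * \<eta>' powi s * \<eta>')) + (Re (A * \<eta> powi s) + Re (B * \<eta>' powi s)) = 0"
      by (simp only: that(3))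
    then show ?thesis unfolding ex by (simp only: distrib_left)
  qed
  have quad: "w ^ 2 - 2 * of_real (Re w) * w + 1 = 0" if "cmod w = 1" for w
  proof -
    have "w * cnj w = 1" using that by (metis complex_norm_square of_real_1 one_power2)
    moreover have "cnj w = 2 * of_real (Re w) - w" by (simp add: complex_eq_iff)
    ultimately show ?thesis by (simp add: algebra_simps power2_eq_square)
  qed
  have main: "A = 0" if h: "Im \<eta> \<noteq> 0" "Im \<eta>' \<noteq> 0" "Re \<eta> \<noteq> Re \<eta>'" "cmod \<eta> = 1" "cmod \<eta>' = 1"
    "\<And>s::int. Re (A * \<eta> powi s) + Re (B * \<eta>' powi s) = 0" for A B \<eta> \<eta>' :: complex
  proof -
    have n: "\<eta> \<noteq> 0" using h by auto
    have f: "\<eta> ^ 2 - 2 * of_real (Re \<eta>') * \<eta> + 1 = of_real (2 * (Re \<eta> - Re \<eta>')) * \<eta>"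
      using quad[OF h(4)] by (simp add: algebra_simps)
    have "Re (A * \<eta> powi s * (of_real (2 * (Re \<eta> - Re \<eta>')) * \<eta>)) = 0" for s :: int
      using kill[OF h(1,2,6), of s "Re \<eta>'"] quad[OF h(5)] f by simp
    moreover have "Re (A * \<eta> powi s * (of_real (2 * (Re \<eta> - Re \<eta>')) * \<eta>)) = 2 * (Re \<eta> - Re \<eta>') * Re (A * \<eta> powi (s + 1))" for s :: int
      using n by (simp add: power_int_add algebra_simps)
    ultimately have z: "Re (A * \<eta> powi s) = 0" for s :: int
      using h(3) by (metis diff_add_cancel mult_eq_0_iff right_minus_eq zero_neq_numeral)
    have "Re A = 0" "Re (A * \<eta>) = 0" using z[of 0] z[of 1] by auto
    then show "A = 0" using h(1) by (auto simp: complex_eq_iff)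
  qed
  show ?thesis
    using main[OF nz one z] main[of \<eta>' \<eta> B A] nz one z by (metis add.commute)
qed

section \<open>Solutions written around a ring\<close>

context shift_symbol
begin

text \<open>Dividing by \<open>x ^ n\<close> moves the whole dependence on the argument of
  \<open>x\<close> into the unimodular \<open>\<eta>\<close>, next to positive coefficients. A
  window of \<open>p + 1\<close> zeros would propagate forwards and, by the periodicity relation, to
  all places.\<close>

lemma normalized_solution:
  assumes u: "floquet_solution b x z v" and x: "x \<noteq> 0" and z: "z \<noteq> 0"
  defines "u \<equiv> \<lambda>n. v n / x ^ n" and "\<eta> \<equiv> - of_real (cmod x ^ (p + 1)) / x ^ (p + 1)"
  shows "u (n + p + 1) = u (n + p) + of_real (b (n mod r) / cmod x ^ (p + 1)) * \<eta> * u n"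
    and "u (n + r) = u n / (z * x ^ r)"
    and "\<forall>e\<le>p. u (m + e) = 0 \<Longrightarrow> False"
    and "cmod \<eta> = 1"
proof -
  have rec: "u (n + p + 1) = u (n + p) + of_real (b (n mod r) / cmod x ^ (p + 1)) * \<eta> * u n" for n
  proof -
    have "v (n + p + 1) = x * v (n + p) - of_real (b (n mod r)) * v n" using u by (simp add: floquet_solution_def)
    then have "u (n + p + 1) = (x * v (n + p) - of_real (b (n mod r)) * v n) / x ^ (n + p + 1)" by (simp add: u_def)
    also have "\<dots> = u (n + p) - of_real (b (n mod r)) / x ^ (p + 1) * u n"
      using x by (simp add: u_def field_simps power_add)
    also have "of_real (b (n mod r)) / x ^ (p + 1) = - (of_real (b (n mod r) / cmod x ^ (p + 1)) * \<eta>)"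
      using x by (simp add: \<eta>_def)
    finally show ?thesis by simp
  qed
  then show "u (n + p + 1) = u (n + p) + of_real (b (n mod r) / cmod x ^ (p + 1)) * \<eta> * u n" .
  have per: "u (n + r) = u n / (z * x ^ r)" for n
    using u by (simp add: floquet_solution_def u_def power_add)
  then show "u (n + r) = u n / (z * x ^ r)" .
  show "cmod \<eta> = 1" using x by (simp add: \<eta>_def norm_divide norm_power norm_mult)
  assume z0: "\<forall>e\<le>p. u (m + e) = 0"
  have "u (m + e) = 0" for e
  proof (induction e rule: less_induct)
    case (less e)
    show ?case
    proof (cases "e \<le> p")
      case False
      then obtain f where f: "e = f + p + 1" by (metis add.assoc add.commute le_Suc_ex not_less_eq_eq Suc_eq_plus1)
      then have "u (m + f + p) = 0" "u (m + f) = 0" using less[of "f + p"] less[of f] by (auto simp: add.assoc)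
      then show ?thesis using rec[of "m + f"] f by (simp add: add.assoc)
    qed (use z0 in auto)
  qed
  then have large: "u n = 0" if "n \<ge> m" for n using that by (metis le_add_diff_inverse)
  have "u (n + r * q) = u n / (z * x ^ r) ^ q" for n q
  proof (induction q)
    case (Suc q)
    have "u (n + r * Suc q) = u (n + r * q + r)" by (simp add: algebra_simps)
    then show ?case using Suc per[of "n + r * q"] by simp
  qed simp
  moreover have "u (n + r * m) = 0" for n using large r by (simp add: trans_le_add2)
  ultimately have "u n = 0" for n using x z by (metis divide_eq_0_iff mult_eq_0_iff power_not_zero)
  then have "v n = 0" for n using x unfolding u_def by (metis divide_eq_0_iff power_not_zero)
  then show False using u by (simp add: floquet_solution_def)
qed

lemma div_mod_shift:
  fixes a d :: int
  assumes "d > 0"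
  shows "a mod d \<noteq> 0 \<Longrightarrow> (a - 1) mod d = a mod d - 1" "a mod d \<noteq> 0 \<Longrightarrow> (a - 1) div d = a div d"
    "a mod d = 0 \<Longrightarrow> (a - 1) mod d = d - 1" "a mod d = 0 \<Longrightarrow> (a - 1) div d = a div d - 1"
proof -
  have a: "a = d * (a div d) + a mod d" by simp
  have m: "0 \<le> a mod d" "a mod d < d" using assms by auto
  { assume h: "a mod d \<noteq> 0"
    have "a - 1 = d * (a div d) + (a mod d - 1)" using a by linarith
    then show "(a - 1) mod d = a mod d - 1" "(a - 1) div d = a div d"
      using m h assms by (metis (no_types) int_mod_pos_eq int_div_pos_eq diff_ge_0_iff_ge int_one_le_iff_zero_less order_le_less zless_imp_add1_zle order_less_trans zle_diff1_eq diff_add_cancel less_add_one)+ }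
  { assume h: "a mod d = 0"
    have "a - 1 = d * (a div d - 1) + (d - 1)" using a h by (simp add: algebra_simps)
    then show "(a - 1) mod d = d - 1" "(a - 1) div d = a div d - 1"
      using assms by (metis (no_types) int_mod_pos_eq int_div_pos_eq diff_ge_0_iff_ge int_one_le_iff_zero_less less_add_one diff_add_cancel)+ }
qed

text \<open>The window \<open>u n, ..., u (n + p)\<close> repeated along the integers, each turn
  carrying a further power of \<open>\<eta>\<close>. This absorbs \<open>\<eta>\<close> and leaves a
  recursion with positive real coefficients; the sequence closes up after \<open>q\<close> turns if
  \<open>\<eta> ^ q = 1\<close>.\<close>

definition layer :: "(nat \<Rightarrow> complex) \<Rightarrow> complex \<Rightarrow> nat \<Rightarrow> int \<Rightarrow> complex" where
  "layer u \<eta> n j = u (n + nat ((j - int n) mod int (p + 1))) * \<eta> powi ((j - int n) div int (p + 1))"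

lemma layer_step:
  assumes rec: "\<And>n. u (n + p + 1) = u (n + p) + \<delta> n * \<eta> * u n" and \<eta>: "\<eta> \<noteq> 0"
  shows "layer u \<eta> (Suc n) j = (if j mod int (p + 1) = int n mod int (p + 1)
    then layer u \<eta> n (j - 1) + \<delta> n * layer u \<eta> n j else layer u \<eta> n j)"
proof -
  let ?d = "int (p + 1)" and ?a = "j - int n"
  have d: "?d > 0" by simp
  have iff: "j mod ?d = int n mod ?d \<longleftrightarrow> ?a mod ?d = 0" by (metis mod_eq_dvd_iff dvd_eq_mod_eq_0)
  have a1: "j - int (Suc n) = ?a - 1" "j - 1 - int n = ?a - 1" by simp_all
  show ?thesis
  proof (cases "?a mod ?d = 0")
    case True
    have "layer u \<eta> (Suc n) j = u (n + p + 1) * \<eta> powi (?a div ?d - 1)"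
      unfolding layer_def a1 div_mod_shift(3,4)[OF d True] by (simp add: algebra_simps)
    moreover have "layer u \<eta> n (j - 1) = u (n + p) * \<eta> powi (?a div ?d - 1)"
      unfolding layer_def a1 div_mod_shift(3,4)[OF d True] by simp
    moreover have "layer u \<eta> n j = u n * (\<eta> powi (?a div ?d - 1) * \<eta>)"
      unfolding layer_def True using \<eta> by (simp add: power_int_diff)
    ultimately show ?thesis using True rec[of n] unfolding iff by (simp add: algebra_simps)
  next
    case False
    have "0 \<le> ?a mod ?d" using d by (rule pos_mod_sign)
    then have "Suc n + nat (?a mod ?d - 1) = n + nat (?a mod ?d)" using False by linarith
    then have "layer u \<eta> (Suc n) j = layer u \<eta> n j"
      unfolding layer_def a1 div_mod_shift(1,2)[OF d False] by metis
    then show ?thesis using False unfolding iff by simp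
  qed
qed

lemma layer_ring:
  assumes "\<eta> ^ q = 1"
  shows "layer u \<eta> n (j + int ((p + 1) * q)) = layer u \<eta> n j"
proof -
  have "\<eta> \<noteq> 0 \<or> q = 0" using assms by (cases "q = 0") (auto simp: power_0_left)
  moreover have e: "j + int ((p + 1) * q) - int n = (j - int n) + int q * int (p + 1)" by (simp add: algebra_simps)
  ultimately show ?thesis using assms unfolding layer_def e
    by (auto simp: power_int_add simp del: of_nat_add of_nat_Suc)
qed

text \<open>The time \<open>(p + 1) * r * l\<close> is a multiple both of the period of the weights
  and of the length of a turn, so the layer returns to itself up to a scalar.\<close>

lemma layer_time_shift:
  assumes per: "\<And>n. u (n + r) = \<mu> * u n" and \<eta>: "\<eta> \<noteq> 0"
  shows "layer u \<eta> (n + (p + 1) * r * l) j = (\<mu> ^ (p + 1) / \<eta> ^ r) ^ l * layer u \<eta> n j"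
proof -
  have pm: "u (m + r * k) = \<mu> ^ k * u m" for m k
  proof (induction k)
    case (Suc k)
    have "u (m + r * Suc k) = u (m + r * k + r)" by (simp add: algebra_simps)
    then show ?case using Suc per by simp
  qed simp
  have e: "j - int (n + (p + 1) * r * l) = (j - int n) + (- int (r * l)) * int (p + 1)" by (simp add: algebra_simps)
  have d: "int (p + 1) \<noteq> 0" by simp
  have A: "u (n + (p + 1) * r * l + m) = \<mu> ^ ((p + 1) * l) * u (n + m)" for m
    using pm[of "n + m" "(p + 1) * l"] by (simp add: algebra_simps)
  have B: "\<eta> powi (- int (r * l) + s) = \<eta> powi s / (\<eta> ^ r) ^ l" for s
  proof -
    have "\<eta> powi (- int (r * l) + s) = \<eta> powi (- int (r * l)) * \<eta> powi s" using \<eta> by (intro power_int_add) auto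
    also have "\<eta> powi (- int (r * l)) = inverse (\<eta> ^ (r * l))" by (simp only: power_int_minus power_int_of_nat)
    finally show ?thesis by (simp only: power_mult divide_inverse) (rule mult.commute)
  qed
  have gen: "a * U * (E / f) = a / f * (U * E)" for a U E f :: complex by simp
  show ?thesis
    unfolding layer_def e mod_mult_self1 div_mult_self1[OF d] A B
    unfolding gen power_mult power_divide ..
qed

text \<open>Equal moduli would multiply both solutions by scalars of the same size \<open>L\<close>
  over a common period, so that no sign change can ever be lost, whereas \<open>c\<close> and
  \<open>c'\<close> are chosen to place two adjacent zeros in layer \<open>m\<close>.\<close>

theorem distinct_moduli:
  assumes b: "\<And>j. j < r \<Longrightarrow> 0 < b j" and x: "x \<noteq> 0" "cmod x = cmod x'"
    and z: "z \<noteq> 0" "symbol_f p r b z x = 0" and z': "z' \<noteq> 0" "symbol_f p r b z' x' = 0"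
    and \<eta>: "\<eta> = - of_real (cmod x ^ (p + 1)) / x ^ (p + 1)" "\<eta>' = - of_real (cmod x ^ (p + 1)) / x' ^ (p + 1)"
    and q: "q > 0" "\<eta> ^ q = 1" "\<eta>' ^ q = 1" and im: "Im \<eta> \<noteq> 0" "Im \<eta>' \<noteq> 0" "Re \<eta> \<noteq> Re \<eta>'"
  shows "cmod z \<noteq> cmod z'"
proof
  assume same: "cmod z = cmod z'"
  have x': "x' \<noteq> 0" using x by auto
  obtain v where v: "floquet_solution b x z v" using symbol_root_iff z by blast
  obtain v' where v': "floquet_solution b x' z' v'" using symbol_root_iff z' by blast
  define u where "u n = v n / x ^ n" for n
  define u' where "u' n = v' n / x' ^ n" for n
  define \<delta> where "\<delta> n = b (n mod r) / cmod x ^ (p + 1)" for n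
  note ns = normalized_solution[OF v x(1) z(1), folded u_def \<eta>(1) \<delta>_def]
  note ns' = normalized_solution[OF v' x' z'(1), folded u'_def x(2), folded \<eta>(2) \<delta>_def]
  have \<delta>: "\<delta> n > 0" for n unfolding \<delta>_def using b[of "n mod r"] x(1) r by (intro divide_pos_pos zero_less_power) auto
  have \<eta>0: "\<eta> \<noteq> 0" "\<eta>' \<noteq> 0" using im by auto
  define d where "d = p + 1"
  define N where "N = d * q"
  define m where "m = 2 * d + N"
  obtain c c' where c: "c \<noteq> 0 \<or> c' \<noteq> 0"
    "Re (c * layer u \<eta> m 0) + Re (c' * layer u' \<eta>' m 0) = 0"
    "Re (c * layer u \<eta> m 1) + Re (c' * layer u' \<eta>' m 1) = 0"
    using two_real_conditions by metis
  define V where "V n j = Re (c * layer u \<eta> n j) + Re (c' * layer u' \<eta>' n j)" for n j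
  have step: "V (Suc n) j = (if j mod int d = int n mod int d then V n (j - 1) + \<delta> n * V n j else V n j)" for n j
    unfolding V_def d_def layer_step[of u, OF ns(1) \<eta>0(1)] layer_step[of u', OF ns'(1) \<eta>0(2)]
    by (simp add: algebra_simps)
  have per: "ring_periodic N (V n)" for n
    unfolding ring_periodic_def V_def N_def d_def using layer_ring q by metis
  interpret smoothing N d V \<delta>
  proof unfold_locales
    show "d dvd N" unfolding N_def by (rule dvd_triv_left)
    show "d \<ge> 2" "N > 0" using p q(1) by (simp_all add: N_def d_def)
  qed (use step per \<delta> in blast)+
  define \<nu> where "\<nu> = (1 / (z * x ^ r)) ^ (p + 1) / \<eta> ^ r"
  define \<nu>' where "\<nu>' = (1 / (z' * x' ^ r)) ^ (p + 1) / \<eta>' ^ r"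
  define L where "L = cmod \<nu>"
  have L: "cmod \<nu>' = L" "L > 0"
    using same x x' z z' ns(4) ns'(4) by (auto simp: L_def \<nu>_def \<nu>'_def norm_divide norm_mult norm_power)
  have sh: "layer u \<eta> (n + d * r * l) j = \<nu> ^ l * layer u \<eta> n j" "layer u' \<eta>' (n + d * r * l) j = \<nu>' ^ l * layer u' \<eta>' n j" for n l j
  proof -
    have a: "u (n + r) = 1 / (z * x ^ r) * u n" "u' (n + r) = 1 / (z' * x' ^ r) * u' n" for n
      using ns(2) ns'(2) by simp_all
    show "layer u \<eta> (n + d * r * l) j = \<nu> ^ l * layer u \<eta> n j"
      unfolding \<nu>_def d_def by (rule layer_time_shift[of u, OF a(1) \<eta>0(1)])
    show "layer u' \<eta>' (n + d * r * l) j = \<nu>' ^ l * layer u' \<eta>' n j"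
      unfolding \<nu>'_def d_def by (rule layer_time_shift[of u', OF a(2) \<eta>0(2)])
  qed
  have const: "sign_changes N (V (Suc n)) = sign_changes N (V n)" for n
  proof -
    define \<alpha> where "\<alpha> j = c * layer u \<eta> n j" for j
    define \<alpha>' where "\<alpha>' j = c' * layer u' \<eta>' n j" for j
    define J where "J = {j \<in> {0..<int N}. V n j \<noteq> 0}"
    \<comment> \<open>A return this close to \<open>1\<close> perturbs every nonzero entry by less
      than its own size. The inserted \<open>1\<close> covers an empty \<open>J\<close>.\<close>
    define e where "e = Min (insert 1 ((\<lambda>j. \<bar>V n j\<bar> / (cmod (\<alpha> j) + cmod (\<alpha>' j) + 1)) ` J))"
    have fJ: "finite J" unfolding J_def by (rule finite_subset[of _ "{0..<int N}"]) auto
    have dpos: "cmod (\<alpha> j) + cmod (\<alpha>' j) + 1 > 0" for j by (simp add: add_nonneg_pos)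
    have e: "e > 0" unfolding e_def using fJ dpos by (subst Min_gr_iff) (auto simp: J_def)
    obtain l where l: "l \<ge> 1" "cmod ((\<nu> / L) ^ l - 1) < e" "cmod ((\<nu>' / L) ^ l - 1) < e"
      using simultaneous_recurrence[of "\<nu> / L" "\<nu>' / L" e] e L by (auto simp: norm_divide L_def)
    have pos: "V n j * V (n + d * r * l) j > 0" if nz: "V n j \<noteq> 0" for j
    proof -
      have red: "V k j = V k (j mod int N)" for k
      proof -
        have tr: "V k (a + int N * int i) = V k a" for a i
        proof (induction i)
          case (Suc i)
          have "V k (a + int N * int (Suc i)) = V k ((a + int N * int i) + int N)" by (simp add: algebra_simps)
          then show ?case using Suc smoothing.per[OF smoothing_axioms, of k] by (simp add: ring_periodic_def)
        qed simp
        show ?thesis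
        proof (cases "j div int N \<ge> 0")
          case True then show ?thesis using tr[of "j mod int N" "nat (j div int N)"] by simp
        next
          case False
          have "j + int N * int (nat (- (j div int N))) = j mod int N" using False by (simp add: minus_mult_div_eq_mod[symmetric])
          then show ?thesis using tr[of j "nat (- (j div int N))"] by simp
        qed
      qed
      define i where "i = j mod int N"
      have "N > 0" using q by (simp add: N_def d_def)
      then have iJ: "i \<in> J" using nz red[of n] by (auto simp: J_def i_def)
      have "e \<le> \<bar>V n i\<bar> / (cmod (\<alpha> i) + cmod (\<alpha>' i) + 1)" unfolding e_def using fJ iJ by (intro Min_le) auto
      then have small: "e * (cmod (\<alpha> i) + cmod (\<alpha>' i) + 1) \<le> \<bar>V n i\<bar>" using dpos[of i] by (simp add: pos_le_divide_eq)
      define Q where "Q = Re (\<alpha> i * (\<nu> / L) ^ l) + Re (\<alpha>' i * (\<nu>' / L) ^ l)"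
      have VQ: "V (n + d * r * l) i = L ^ l * Q"
      proof -
        have "V (n + d * r * l) i = Re (\<alpha> i * \<nu> ^ l) + Re (\<alpha>' i * \<nu>' ^ l)"
          unfolding V_def sh \<alpha>_def \<alpha>'_def by (simp only: ac_simps)
        moreover have "\<alpha> i * \<nu> ^ l = of_real (L ^ l) * (\<alpha> i * (\<nu> / L) ^ l)" using L by (simp add: power_divide)
        moreover have "\<alpha>' i * \<nu>' ^ l = of_real (L ^ l) * (\<alpha>' i * (\<nu>' / L) ^ l)" using L by (simp add: power_divide)
        moreover have "Re (of_real a * w) = a * Re w" for a w by simp
        ultimately show ?thesis unfolding Q_def distrib_left by (simp only:)
      qed
      have "\<bar>Q - V n i\<bar> = \<bar>Re (\<alpha> i * ((\<nu> / L) ^ l - 1)) + Re (\<alpha>' i * ((\<nu>' / L) ^ l - 1))\<bar>"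
      proof -
        have "Re (a * (w - 1)) = Re (a * w) - Re a" for a w by (simp add: algebra_simps)
        moreover have "V n i = Re (\<alpha> i) + Re (\<alpha>' i)" by (simp only: V_def \<alpha>_def \<alpha>'_def)
        ultimately show ?thesis unfolding Q_def by simp
      qed
      also have "\<dots> \<le> cmod (\<alpha> i * ((\<nu> / L) ^ l - 1)) + cmod (\<alpha>' i * ((\<nu>' / L) ^ l - 1))"
        by (rule order_trans[OF abs_triangle_ineq add_mono[OF abs_Re_le_cmod abs_Re_le_cmod]])
      also have "\<dots> \<le> cmod (\<alpha> i) * e + cmod (\<alpha>' i) * e"
        unfolding norm_mult using l by (intro add_mono mult_left_mono) auto
      also have "\<dots> < \<bar>V n i\<bar>" using small e by (simp add: algebra_simps)
      finally have "V n i * Q > 0" by (auto simp: zero_less_mult_iff abs_if split: if_splits)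
      then have "L ^ l * (V n i * Q) > 0" using L by simp
      then show ?thesis unfolding red[of n] red[of "n + d * r * l"] i_def[symmetric] VQ by (simp add: algebra_simps)
    qed
    have "sign_changes N (V n) \<le> sign_changes N (V (n + d * r * l))"
      by (rule sign_changes_semicont[of _ _ 1]) (use smoothing.per[OF smoothing_axioms] pos in auto)
    moreover have "sign_changes N (V (n + d * r * l)) \<le> sign_changes N (V (Suc n))"
      using l r by (intro sign_changes_antimono) (simp add: d_def)
    ultimately show ?thesis using sign_changes_step[of n] by linarith
  qed
  have zero: "V m j = 0" for j
    by (rule adjacent_zeros_imp_zero[of m 0]) (use const c(2,3) in \<open>auto simp: m_def V_def\<close>)
  \<comment> \<open>The turns of the vanishing layer over one residue supply the relation for all
    integer powers of \<open>\<eta>\<close> and \<open>\<eta>'\<close>.\<close>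
  have "c * u (m + e) = 0 \<and> c' * u' (m + e) = 0" if "e \<le> p" for e
  proof (rule independent_phases[OF im ns(4) ns'(4)])
    fix s :: int
    have ee: "(int m + int e + s * int (p + 1) - int m) mod int (p + 1) = int e"
      "(int m + int e + s * int (p + 1) - int m) div int (p + 1) = s"
      using that by (simp_all add: algebra_simps del: of_nat_add of_nat_Suc) 
    show "Re (c * u (m + e) * \<eta> powi s) + Re (c' * u' (m + e) * \<eta>' powi s) = 0"
      using zero[of "int m + int e + s * int (p + 1)"] unfolding V_def layer_def ee by (simp add: mult.assoc)
  qed
  then show False using c(1) ns(3)[of m] ns'(3)[of m] by auto
qed

end

subsection \<open>Constant weights\<close>

text \<open>For constant weights and unit spectral parameter the solutions are geometric sequences;
  in the variable \<open>s = w / x\<close> their ratio is determined up to conjugation by its modulus,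
  because \<open>cmod s ^ p * cmod (1 - s) = 1\<close>.\<close>

lemma cmod_determines_up_to_cnj:
  assumes "cmod s = cmod s'" "cmod (1 - s) = cmod (1 - s')"
  shows "s' = s \<or> s' = cnj s"
proof -
  have a: "Re s ^ 2 + Im s ^ 2 = Re s' ^ 2 + Im s' ^ 2" using assms(1) by (metis cmod_power2)
  have "(1 - Re s) ^ 2 + Im s ^ 2 = (1 - Re s') ^ 2 + Im s' ^ 2" using assms(2) by (metis (no_types) cmod_power2 minus_complex.sel one_complex.sel diff_0 power2_minus)
  then have "Re s = Re s'" using a by (simp add: power2_eq_square algebra_simps)
  moreover from this have "Im s' = Im s \<or> Im s' = - Im s" using a by (auto simp: power2_eq_iff)
  ultimately show ?thesis by (auto simp: complex_eq_iff)
qed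

context shift_symbol
begin

text \<open>For weights \<open>1\<close> the sequence \<open>w ^ n\<close> solves the recurrence
  exactly when \<open>w\<close> is a root of this polynomial; the root of the symbol is then
  \<open>1 / w ^ r\<close>.\<close>

definition trinomial :: "complex \<Rightarrow> complex poly" where
  "trinomial x = monom 1 (p + 1) - monom x p + 1"

lemma poly_trinomial: "poly (trinomial x) w = w ^ (p + 1) - x * w ^ p + 1"
  by (simp add: trinomial_def poly_monom)

lemma trinomial_degree: "degree (trinomial x) = p + 1" "lead_coeff (trinomial x) = 1"
proof -
  have c: "coeff (trinomial x) (p + 1) = 1" using p by (simp add: trinomial_def)
  moreover have "coeff (trinomial x) i = 0" if "i > p + 1" for i using that by (simp add: trinomial_def)
  ultimately show d: "degree (trinomial x) = p + 1" by (metis degree_le le_degree le_antisym zero_neq_one)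
  then show "lead_coeff (trinomial x) = 1" using c by simp
qed

lemma trinomial_nz: "trinomial x \<noteq> 0" "poly (trinomial x) 0 \<noteq> 0"
proof -
  show "poly (trinomial x) 0 \<noteq> 0" using p by (simp add: poly_trinomial power_0_left)
  then show "trinomial x \<noteq> 0" by auto
qed

text \<open>A double root must be \<open>p / (p + 1) * x\<close>, and inserting this makes
  \<open>x ^ (p + 1)\<close> a positive real number.\<close>

lemma trinomial_roots_distinct:
  assumes "x ^ (p + 1) \<notin> complex_of_real ` {0..}"
  shows "card {w. poly (trinomial x) w = 0} = p + 1"
proof -
  have "\<not> (poly (trinomial x) w = 0 \<and> poly (pderiv (trinomial x)) w = 0)" for w
  proof
    assume a: "poly (trinomial x) w = 0 \<and> poly (pderiv (trinomial x)) w = 0"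
    then have w0: "w \<noteq> 0" using trinomial_nz(2) by auto
    have "poly (pderiv (trinomial x)) w = of_nat (p + 1) * w ^ p - x * (of_nat p * w ^ (p - 1))"
      by (simp add: trinomial_def pderiv_add pderiv_diff pderiv_monom poly_monom algebra_simps)
    also have "w ^ p = w * w ^ (p - 1)" using p by (simp flip: power_Suc)
    finally have "w ^ (p - 1) * (of_nat (p + 1) * w - of_nat p * x) = 0" using a by (simp add: algebra_simps)
    then have "of_nat (p + 1) * w = of_nat p * x" using w0 by simp
    then have "w = of_nat p * x / of_nat (p + 1)" by (metis nonzero_mult_div_cancel_left of_nat_neq_0 Suc_eq_plus1)
    then have w: "w = of_real (p / (p + 1)) * x" by simp
    define c where "c = (real p / (p + 1)) ^ p * (1 / (p + 1))"
    have c: "c > 0" using p by (simp add: c_def)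
    have "w ^ p * (x - w) = 1" using a by (simp add: poly_trinomial algebra_simps)
    also have "x - w = of_real (1 / (p + 1)) * x"
    proof -
      have "x - w = of_real (1 - real p / (p + 1)) * x" unfolding w by (simp add: algebra_simps)
      also have "1 - real p / (p + 1) = 1 / (p + 1)" by (simp add: field_simps)
      finally show ?thesis .
    qed
    finally have "of_real c * x ^ (p + 1) = 1"
      unfolding w power_mult_distrib c_def of_real_mult of_real_power by (simp only: power_add power_one_right ac_simps)
    then have "x ^ (p + 1) = of_real (1 / c)" using c by (simp add: nonzero_eq_divide_eq mult.commute)
    then show False using assms c by (metis atLeast_iff divide_nonneg_pos image_eqI zero_le_one)
  qed
  then have rs: "rsquarefree (trinomial x)" unfolding rsquarefree_roots by blast
  have "size (proots (trinomial x)) = card {w. poly (trinomial x) w = 0}"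
  proof -
    have "count (proots (trinomial x)) w = (if w \<in> {w. poly (trinomial x) w = 0} then 1 else 0)" for w
    proof -
      have "order w (trinomial x) = 0 \<or> order w (trinomial x) = 1"
        using rs unfolding rsquarefree_def by (metis One_nat_def)
      moreover have "order w (trinomial x) \<noteq> 0 \<longleftrightarrow> poly (trinomial x) w = 0"
        using order_root[of "trinomial x" w] trinomial_nz(1)[of x] by simp
      ultimately show ?thesis using trinomial_nz(1)[of x] by (cases "order w (trinomial x) = 0") auto
    qed
    moreover have fin: "finite {w. poly (trinomial x) w = 0}" using poly_roots_finite[OF trinomial_nz(1)] .
    ultimately have "proots (trinomial x) = mset_set {w. poly (trinomial x) w = 0}"
      by (intro multiset_eqI) (simp add: count_mset_set')
    then show ?thesis by simp
  qed
  then show ?thesis using size_proots_complex[of "trinomial x"] trinomial_degree by simp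
qed

text \<open>Sorted by decreasing modulus, because \<open>z = 1 / w ^ r\<close> reverses the
  order.\<close>

definition tlist :: "complex \<Rightarrow> complex list" where
  "tlist x = (SOME ws. mset ws = proots (trinomial x) \<and> sorted (map (\<lambda>w. - cmod w) ws))"

lemma tlist:
  "mset (tlist x) = proots (trinomial x)" "sorted (map (\<lambda>w. - cmod w) (tlist x))" "length (tlist x) = p + 1"
proof -
  obtain xs where "mset xs = proots (trinomial x)" using ex_mset by blast
  then have "mset (sort_key (\<lambda>w. - cmod w) xs) = proots (trinomial x) \<and> sorted (map (\<lambda>w. - cmod w) (sort_key (\<lambda>w. - cmod w) xs))"
    by simp
  then have "mset (tlist x) = proots (trinomial x) \<and> sorted (map (\<lambda>w. - cmod w) (tlist x))"
    unfolding tlist_def by (rule someI)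
  then show *: "mset (tlist x) = proots (trinomial x)" "sorted (map (\<lambda>w. - cmod w) (tlist x))" by auto
  show "length (tlist x) = p + 1" using * size_proots_complex[of "trinomial x"] trinomial_degree by (metis size_mset)
qed

definition troot :: "complex \<Rightarrow> nat \<Rightarrow> complex" where
  "troot x k = tlist x ! k"

lemma troot_sorted: "i \<le> j \<Longrightarrow> j \<le> p \<Longrightarrow> cmod (troot x j) \<le> cmod (troot x i)"
  using sorted_nth_mono[OF tlist(2), of i j x] tlist(3)[of x] by (simp add: troot_def)

lemma troot_image: "troot x ` {..p} = {w. poly (trinomial x) w = 0}"
proof -
  have "set (tlist x) = {w. poly (trinomial x) w = 0}"
    using tlist(1)[of x] trinomial_nz(1)[of x] by (metis set_mset_mset set_count_proots)
  moreover have "set (tlist x) = troot x ` {..<p + 1}"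
    by (auto simp: set_conv_nth troot_def tlist(3))
  ultimately show ?thesis by (simp add: lessThan_Suc_atMost)
qed

lemma troot_root: "k \<le> p \<Longrightarrow> poly (trinomial x) (troot x k) = 0" "k \<le> p \<Longrightarrow> troot x k \<noteq> 0"
  using troot_image[of x] trinomial_nz(2)[of x] by (blast, metis (mono_tags) atMost_iff imageI mem_Collect_eq)

lemma troot_prod: "poly (trinomial x) z = (\<Prod>i<p+1. z - troot x i)"
proof -
  have ml: "map (troot x) [0..<p + 1] = tlist x" unfolding troot_def using map_nth[of "tlist x"] tlist(3) by metis
  have "(\<Prod>a\<in>#proots (trinomial x). [:- a, 1:]) = (\<Prod>a\<in>#mset (map (troot x) [0..<p + 1]). [:- a, 1:])"
    unfolding ml tlist(1) ..
  also have "\<dots> = (\<Prod>i\<leftarrow>[0..<p + 1]. [:- troot x i, 1:])"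
    by (simp only: prod_mset_prod_list map_map o_def flip: mset_map)
  finally have "trinomial x = (\<Prod>i\<leftarrow>[0..<p + 1]. [:- troot x i, 1:])"
    using complex_poly_decompose_multiset[of "trinomial x"] trinomial_degree by simp
  moreover have "poly (\<Prod>i\<leftarrow>[0..<n]. [:- troot x i, 1:]) z = (\<Prod>i<n. z - troot x i)" for n
    by (induction n) (simp_all add: algebra_simps)
  ultimately show ?thesis by metis
qed

lemma trinomial_modulus:
  assumes "poly (trinomial x) w = 0"
  shows "w ^ p * (x - w) = 1" "cmod w ^ p * cmod (x - w) = 1"
proof -
  show "w ^ p * (x - w) = 1" using assms by (simp add: poly_trinomial algebra_simps)
  then show "cmod w ^ p * cmod (x - w) = 1" by (metis norm_mult norm_power norm_one)
qed

lemma trinomial_root_bound: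
  assumes "cmod x = 1" "poly (trinomial x) w = 0"
  shows "cmod w \<le> 2"
proof (rule ccontr)
  assume "\<not> ?thesis"
  then have "cmod w > 2" by simp
  moreover from this have "cmod (x - w) > 1" using assms(1) norm_triangle_ineq2[of w x] norm_minus_commute[of x w] by linarith
  moreover have "cmod w ^ p \<ge> 1" using calculation by (intro one_le_power) auto
  ultimately have "1 * 1 < cmod w ^ p * cmod (x - w)" by (intro mult_le_less_imp_less) auto
  then show False using trinomial_modulus(2)[OF assms(2)] by simp
qed

lemma troot_continuous:
  assumes "k \<le> p"
  shows "continuous_on {x. cmod x = 1} (\<lambda>x. cmod (troot x k))"
  unfolding continuous_on_sequentially o_def
proof (intro allI impI ballI, elim conjE)
  fix xs x assume xs: "\<forall>n. xs n \<in> {x. cmod x = 1}" "xs \<longlonglongrightarrow> x"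
  have "(\<lambda>n. - cmod (troot (xs n) k)) \<longlonglongrightarrow> - cmod (troot x k)"
  proof (rule sorted_roots_tendsto[where d = "p + 1" and h = "\<lambda>z. - cmod z" and S = UNIV and B = 2])
    show "cmod (troot (xs n) i) \<le> 2" if "i < p + 1" for n i
      using xs that troot_root(1) by (intro trinomial_root_bound[of "xs n"]) auto
    show "(\<lambda>n. \<Prod>i<p + 1. z - troot (xs n) i) \<longlonglongrightarrow> (\<Prod>i<p + 1. z - troot x i)" for z
      unfolding troot_prod[symmetric] poly_trinomial by (intro tendsto_intros xs)
  qed (use assms troot_sorted in \<open>auto intro!: continuous_intros simp: infinite_UNIV_char_0\<close>)
  then show "(\<lambda>n. cmod (troot (xs n) k)) \<longlonglongrightarrow> cmod (troot x k)" by (simp add: tendsto_minus_cancel_left[symmetric])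
qed

text \<open>Here \<open>\<theta>\<close> is the argument of \<open>x ^ (p + 1)\<close>, not of
  \<open>x\<close>: for given \<open>cmod x\<close> the moduli of the roots depend on nothing
  else.\<close>

definition ray :: "real \<Rightarrow> complex" where
  "ray \<theta> = cis (\<theta> / (p + 1))"

lemma ray: "cmod (ray \<theta>) = 1" "ray \<theta> ^ (p + 1) = cis \<theta>" "ray \<theta> \<noteq> 0"
proof -
  have "ray \<theta> ^ (p + 1) = cis (real (p + 1) * (\<theta> / (p + 1)))" unfolding ray_def by (rule Complex.DeMoivre)
  also have "real (p + 1) * (\<theta> / (p + 1)) = \<theta>" by simp
  finally show "ray \<theta> ^ (p + 1) = cis \<theta>" .
qed (simp_all add: ray_def)

lemma ray_continuous: "continuous_on S ray"
  unfolding ray_def[abs_def] by (intro continuous_intros) auto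

lemma cis_nonreal:
  assumes "0 < \<theta>" "\<theta> < pi"
  shows "cis \<theta> \<notin> complex_of_real ` A"
  using sin_gt_zero[OF assms] by (auto simp: complex_eq_iff)

text \<open>In \<open>s = w / x\<close> the equation reads
  \<open>s ^ p * (1 - s) = cis (- \<theta>)\<close>. So \<open>cmod s\<close> fixes
  \<open>cmod (1 - s)\<close>, hence \<open>s\<close> up to conjugation and \<open>\<theta>\<close>
  up to sign.\<close>

lemma trinomial_same_modulus:
  assumes \<theta>: "0 \<le> \<theta>" "\<theta> \<le> pi" "0 \<le> \<theta>'" "\<theta>' \<le> pi"
    and w: "poly (trinomial (ray \<theta>)) w = 0" "poly (trinomial (ray \<theta>')) w' = 0" "cmod w = cmod w'"
  shows "\<theta>' = \<theta>" "w' / ray \<theta>' = w / ray \<theta> \<or> w' / ray \<theta>' = cnj (w / ray \<theta>)"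
    "(w / ray \<theta>) ^ p * (1 - w / ray \<theta>) = cis (- \<theta>)"
proof -
  define s where "s = w / ray \<theta>" define s' where "s' = w' / ray \<theta>'"
  have eq: "(w / ray \<theta>) ^ p * (1 - w / ray \<theta>) = cis (- \<theta>)" if "poly (trinomial (ray \<theta>)) w = 0" for w \<theta>
  proof -
    have "(w / ray \<theta>) ^ p * (1 - w / ray \<theta>) = w ^ p * (ray \<theta> - w) / ray \<theta> ^ (p + 1)"
      using ray(3)[of \<theta>] by (simp add: field_simps)
    then show ?thesis unfolding trinomial_modulus(1)[OF that] ray(2) by (simp add: divide_inverse)
  qed
  show e: "(w / ray \<theta>) ^ p * (1 - w / ray \<theta>) = cis (- \<theta>)" using eq[OF w(1)] .
  have e': "s' ^ p * (1 - s') = cis (- \<theta>')" using eq[OF w(2)] by (simp add: s'_def)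
  have ss: "cmod s = cmod s'" using w(3) by (simp add: s_def s'_def norm_divide ray(1))
  have m: "cmod s ^ p * cmod (1 - s) = 1" "cmod s' ^ p * cmod (1 - s') = 1"
    using arg_cong[OF e, of cmod] arg_cong[OF e', of cmod] by (simp_all add: norm_mult norm_power s_def)
  then have "cmod s ^ p \<noteq> 0" by (metis mult_zero_left zero_neq_one)
  then have "cmod (1 - s) = cmod (1 - s')" using m ss by (metis mult_cancel_left)
  then have c: "s' = s \<or> s' = cnj s" by (rule cmod_determines_up_to_cnj[OF ss])
  then show "w' / ray \<theta>' = w / ray \<theta> \<or> w' / ray \<theta>' = cnj (w / ray \<theta>)" by (simp add: s_def s'_def)
  have "cis (- \<theta>') = cis (- \<theta>) \<or> cis (- \<theta>') = cnj (cis (- \<theta>))"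
    using c
  proof
    assume "s' = cnj s"
    then have "cis (- \<theta>') = cnj (s ^ p * (1 - s))" unfolding e'[symmetric] by simp
    then show ?thesis using e by (simp add: s_def)
  qed (use e e' in \<open>simp add: s_def\<close>)
  then have "cos \<theta>' = cos \<theta>" by (auto simp: complex_eq_iff)
  then show "\<theta>' = \<theta>" using \<theta> cos_inj_pi by (metis)
qed

lemma troot_modulus_inj:
  assumes "0 < \<theta>" "\<theta> < pi" "0 \<le> \<theta>'" "\<theta>' \<le> pi" "i \<le> p" "j \<le> p"
    and eq: "cmod (troot (ray \<theta>) i) = cmod (troot (ray \<theta>') j)"
  shows "\<theta>' = \<theta> \<and> i = j"
proof -
  note t = trinomial_same_modulus[of \<theta> \<theta>', OF _ _ _ _ troot_root(1) troot_root(1) eq]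
  have th: "\<theta>' = \<theta>" using t(1) assms by simp
  have "troot (ray \<theta>) i = troot (ray \<theta>) j"
  proof (rule ccontr)
    assume ne: "troot (ray \<theta>) i \<noteq> troot (ray \<theta>) j"
    define s where "s = troot (ray \<theta>) i / ray \<theta>"
    define s' where "s' = troot (ray \<theta>) j / ray \<theta>"
    have "s' \<noteq> s" using ne ray(3) by (simp add: s_def s'_def)
    then have "s' = cnj s" using t(2) assms th by (auto simp: s_def s'_def)
    moreover have "s ^ p * (1 - s) = cis (- \<theta>)"
      using t(3) assms by (simp add: s_def)
    moreover have "s' ^ p * (1 - s') = cis (- \<theta>)"
      using trinomial_same_modulus(3)[of \<theta> \<theta>, OF _ _ _ _ troot_root(1) troot_root(1)] assms by (simp add: s'_def)
    ultimately have "cnj (cis (- \<theta>)) = cis (- \<theta>)" by (metis complex_cnj_diff complex_cnj_mult complex_cnj_one complex_cnj_power)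
    then have "sin \<theta> = 0" by (simp add: complex_eq_iff)
    then show False using sin_gt_zero assms by fastforce
  qed
  moreover have "inj_on (troot (ray \<theta>)) {..p}"
  proof (rule eq_card_imp_inj_on)
    show "card (troot (ray \<theta>) ` {..p}) = card {..p}"
      unfolding troot_image using trinomial_roots_distinct[of "ray \<theta>"] cis_nonreal assms ray(2) by simp
  qed simp
  ultimately show ?thesis using th assms(5,6) by (auto dest: inj_onD)
qed

text \<open>The \<open>p + 1\<close> numbers \<open>1 / w ^ r\<close> already have distinct moduli,
  so they exhaust the roots of the symbol.\<close>

lemma zroot_const_modulus:
  assumes \<theta>: "0 < \<theta>" "\<theta> < pi" and k: "k \<le> p"
  shows "cmod (zroot (\<lambda>_. 1) (ray \<theta>) k) = 1 / cmod (troot (ray \<theta>) k) ^ r"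
proof -
  let ?x = "ray \<theta>" and ?b = "\<lambda>_::nat. 1::real"
  have b: "pos_weights ?b" by (simp add: pos_weights_def)
  define c where "c i = 1 / troot ?x i ^ r" for i
  have inj: "inj_on c {..p}"
  proof (rule inj_onI)
    fix i j assume ij: "i \<in> {..p}" "j \<in> {..p}" "c i = c j"
    then have "cmod (troot ?x i) ^ r = cmod (troot ?x j) ^ r"
      using troot_root(2) by (simp add: c_def frac_eq_eq flip: norm_power)
    then have "cmod (troot ?x i) = cmod (troot ?x j)" by (rule power_eq_imp_eq_base) (use r in simp_all)
    then show "i = j" using troot_modulus_inj[of \<theta> \<theta> i j] ij \<theta> by auto
  qed
  have sub: "c ` {..p} \<subseteq> {z. poly (symbol_poly ?b ?x) z = 0}"
  proof
    fix z assume "z \<in> c ` {..p}"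
    then obtain i where i: "i \<le> p" "z = c i" by auto
    let ?w = "troot ?x i"
    have w: "?w \<noteq> 0" "?w ^ (p + 1) = ?x * ?w ^ p - 1" using troot_root[OF i(1), of ?x] by (auto simp: poly_trinomial algebra_simps)
    have "floquet_solution ?b ?x z (\<lambda>n. ?w ^ n)"
      unfolding floquet_solution_def
    proof (intro conjI allI)
      fix n
      have "?w ^ (n + p + 1) = ?w ^ n * ?w ^ (p + 1)" by (simp add: power_add)
      then show "?w ^ (n + p + 1) = ?x * ?w ^ (n + p) - of_real 1 * ?w ^ n" unfolding w(2) by (simp add: power_add algebra_simps)
      show "?w ^ (n + r) = ?w ^ n / z" by (simp add: i c_def power_add)
    qed (use w in auto)
    moreover have "z \<noteq> 0" using w i by (simp add: c_def)
    ultimately have "symbol_f p r ?b z ?x = 0" using symbol_root_iff by blast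
    then show "z \<in> {z. poly (symbol_poly ?b ?x) z = 0}" using symbol_root_iff_poly \<open>z \<noteq> 0\<close> by simp
  qed
  have P0: "symbol_poly ?b ?x \<noteq> 0" using poly_symbol_poly_0[of ?b ?x] by auto
  have fin: "finite {z. poly (symbol_poly ?b ?x) z = 0}" using poly_roots_finite[OF P0] .
  have "card (zroot ?b ?x ` {..p}) \<le> p + 1" using card_image_le[of "{..p}" "zroot ?b ?x"] by simp
  then have "c ` {..p} = {z. poly (symbol_poly ?b ?x) z = 0}"
    using card_image[OF inj] unfolding root_set[OF b]
    by (intro card_subset_eq[OF fin sub]) (use card_mono[OF fin sub] in simp)
  then have im: "c ` {..p} = zroot ?b ?x ` {..p}" unfolding root_set[OF b] .
  then have inj': "inj_on (zroot ?b ?x) {..p}"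
    using card_image[OF inj] by (intro eq_card_imp_inj_on) auto
  have s: "mset (map f [0..<p + 1]) = mset_set (f ` {..p})" if "inj_on f {..p}" for f :: "nat \<Rightarrow> complex"
  proof -
    have "{0..<p + 1} = {..p}" by auto
    then show ?thesis using that by (simp add: image_mset_mset_set del: upt_Suc)
  qed
  have "cmod (zroot ?b ?x k) = cmod (c k)"
  proof (rule sorted_values_unique[where d = "p + 1" and h = cmod])
    show "mset (map (zroot ?b ?x) [0..<p + 1]) = mset (map c [0..<p + 1])" unfolding s[OF inj] s[OF inj'] im ..
    show "cmod (c i) \<le> cmod (c j)" if "i \<le> j" "j < p + 1" for i j
      using that troot_sorted[of i j ?x] troot_root(2)[of j ?x] troot_root(2)[of i ?x]
      by (simp add: c_def norm_divide norm_power frac_le power_mono)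
  qed (use root_mset(2)[OF b] k in auto)
  then show ?thesis by (simp add: c_def norm_divide norm_power)
qed

text \<open>By continuity in \<open>\<theta>\<close> an inversion would produce a common modulus at
  two different indices, which \<open>troot_modulus_inj\<close> excludes at interior arguments. The
  weak form at the ends follows by passing to the limit.\<close>

lemma troot_order:
  assumes \<theta>: "0 \<le> \<theta>" "\<theta> \<le> pi" "0 \<le> \<theta>'" "\<theta>' \<le> pi" and ij: "i < j" "j \<le> p"
  shows "cmod (troot (ray \<theta>') j) \<le> cmod (troot (ray \<theta>) i)"
    and "0 < \<theta> \<Longrightarrow> \<theta> < pi \<Longrightarrow> cmod (troot (ray \<theta>') j) < cmod (troot (ray \<theta>) i)"
proof -
  have cont: "continuous_on {0..pi} (\<lambda>\<theta>. cmod (troot (ray \<theta>) k))" if "k \<le> p" for k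
    by (rule continuous_on_compose2[OF troot_continuous[OF that] ray_continuous]) (auto simp: ray)
  have strict: "cmod (troot (ray \<theta>') j) < cmod (troot (ray \<theta>) i)" if "0 < \<theta>" "\<theta> < pi" "0 \<le> \<theta>'" "\<theta>' \<le> pi" for \<theta> \<theta>'
  proof (rule ccontr)
    assume "\<not> ?thesis"
    then have ge: "cmod (troot (ray \<theta>) i) \<le> cmod (troot (ray \<theta>') j)" by simp
    have le: "cmod (troot (ray \<theta>) j) \<le> cmod (troot (ray \<theta>) i)" using troot_sorted[of i j] ij by simp
    have con: "connected ((\<lambda>\<theta>. cmod (troot (ray \<theta>) j)) ` {0..pi})"
      using ij by (intro connected_continuous_image cont) auto
    have "cmod (troot (ray \<theta>) i) \<in> (\<lambda>\<theta>. cmod (troot (ray \<theta>) j)) ` {0..pi}"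
      using connectedD_interval[OF con imageI[of \<theta>] imageI[of \<theta>'] le ge] that by auto
    then obtain t where "t \<in> {0..pi}" "cmod (troot (ray \<theta>) i) = cmod (troot (ray t) j)" by auto
    then show False using troot_modulus_inj[of \<theta> t i j] that ij by auto
  qed
  then show "0 < \<theta> \<Longrightarrow> \<theta> < pi \<Longrightarrow> cmod (troot (ray \<theta>') j) < cmod (troot (ray \<theta>) i)" using \<theta> by blast
  show "cmod (troot (ray \<theta>') j) \<le> cmod (troot (ray \<theta>) i)"
  proof (rule continuous_ge_on_closure[of "{0<..<pi}" "\<lambda>\<theta>. cmod (troot (ray \<theta>) i)"])
    show "continuous_on (closure {0<..<pi}) (\<lambda>\<theta>. cmod (troot (ray \<theta>) i))" using cont ij by simp
    show "\<theta> \<in> closure {0<..<pi}" using \<theta> by simp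
  qed (use strict \<theta> in \<open>auto intro: less_imp_le\<close>)
qed

lemma level_mono:
  fixes a c :: real
  assumes "1 \<le> c" "c < a"
  shows "c ^ p * (c - 1) < a ^ p * (a - 1)"
  using assms p by (intro mult_le_less_imp_less power_mono zero_less_power) auto

lemma trinomial_at_pi: "s ^ p * (1 - s) = - 1 \<longleftrightarrow> poly (trinomial (ray pi)) (s * ray pi) = 0"
proof -
  have e: "ray pi ^ (p + 1) = -1" using ray(2)[of pi] by simp
  have "poly (trinomial (ray pi)) (s * ray pi) = 1 - ray pi ^ (p + 1) * (s ^ p * (1 - s))"
    by (simp add: poly_trinomial power_mult_distrib algebra_simps)
  then show ?thesis unfolding e by (auto simp: add_eq_0_iff)
qed

lemma troot_level:
  assumes "k \<le> p" "0 \<le> \<theta>" "\<theta> \<le> pi"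
  shows "cmod (troot (ray \<theta>) k) ^ p * cmod (1 - troot (ray \<theta>) k / ray \<theta>) = 1"
proof -
  have "cmod (ray \<theta> - troot (ray \<theta>) k) = cmod (ray \<theta> * (1 - troot (ray \<theta>) k / ray \<theta>))"
    using ray(3) by (simp add: algebra_simps)
  then show ?thesis using trinomial_modulus(2)[OF troot_root(1)[OF assms(1)], of "ray \<theta>"] by (simp add: norm_mult ray(1))
qed

text \<open>At \<open>\<theta> = pi\<close> a positive \<open>s\<close> has to satisfy
  \<open>s ^ p * (s - 1) = 1\<close>. This is the largest modulus possible for any
  \<open>\<theta>\<close>, since \<open>s\<close> is always at distance at least
  \<open>cmod s - 1\<close> from \<open>1\<close>.\<close>

lemma positive_root:
  obtains \<sigma> :: real where "1 < \<sigma>" "\<sigma> ^ p * (\<sigma> - 1) = 1"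
    "\<And>\<theta> k. k \<le> p \<Longrightarrow> 0 \<le> \<theta> \<Longrightarrow> \<theta> \<le> pi \<Longrightarrow> cmod (troot (ray \<theta>) k) \<le> \<sigma>"
    "cmod (troot (ray pi) 0) = \<sigma>"
proof -
  have "\<exists>\<sigma>\<ge>1. \<sigma> \<le> 2 \<and> \<sigma> ^ p * (\<sigma> - 1) = (1::real)"
    by (rule IVT') (auto intro!: continuous_intros)
  then obtain \<sigma> :: real where \<sigma>: "\<sigma> \<ge> 1" "\<sigma> ^ p * (\<sigma> - 1) = 1" by blast
  have s1: "\<sigma> > 1" using \<sigma> by (cases "\<sigma> = 1") auto
  have le: "cmod (troot (ray \<theta>) k) \<le> \<sigma>" if k: "k \<le> p" "0 \<le> \<theta>" "\<theta> \<le> pi" for \<theta> k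
  proof (rule ccontr)
    let ?w = "troot (ray \<theta>) k"
    assume "\<not> ?thesis"
    then have "\<sigma> ^ p * (\<sigma> - 1) < cmod ?w ^ p * (cmod ?w - 1)" using \<sigma>(1) by (intro level_mono) auto
    also have "\<dots> \<le> cmod ?w ^ p * cmod (1 - ?w / ray \<theta>)"
      using norm_triangle_ineq2[of "?w / ray \<theta>" 1] by (intro mult_left_mono) (auto simp: norm_divide ray(1) norm_minus_commute)
    also have "\<dots> = 1" using troot_level[OF k] .
    finally show False using \<sigma>(2) by simp
  qed
  have "(of_real \<sigma> :: complex) ^ p * (1 - of_real \<sigma>) = - of_real (\<sigma> ^ p * (\<sigma> - 1))" by (simp add: algebra_simps)
  then have "of_real \<sigma> * ray pi \<in> troot (ray pi) ` {..p}" unfolding troot_image \<sigma>(2) using trinomial_at_pi by simp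
  then obtain i where i: "i \<le> p" "troot (ray pi) i = of_real \<sigma> * ray pi" by auto
  have "cmod (troot (ray pi) i) \<le> cmod (troot (ray pi) 0)" using i(1) by (intro troot_sorted) auto
  then have "cmod (troot (ray pi) 0) = \<sigma>" using le[of 0 pi] i s1 by (simp add: norm_mult ray(1))
  then show thesis using that s1 \<sigma>(2) le by blast
qed

text \<open>With a gap after an odd index \<open>k\<close>, the \<open>k + 1\<close> largest
  solutions \<open>s\<close> would be closed under conjugation. Only \<open>\<sigma>\<close> among
  them is real, since a negative solution cannot exceed any other in modulus. Their number would be
  odd, but \<open>k + 1\<close> is even.\<close>

lemma troot_pairs_at_pi:
  assumes k: "odd k" "k + 1 \<le> p"
  shows "cmod (troot (ray pi) (k + 1)) = cmod (troot (ray pi) k)"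
proof (rule ccontr)
  assume "\<not> ?thesis"
  then have gap: "cmod (troot (ray pi) (k + 1)) < cmod (troot (ray pi) k)"
    using troot_sorted[of k "k + 1" "ray pi"] k by simp
  obtain \<sigma> :: real where \<sigma>: "1 < \<sigma>" "\<sigma> ^ p * (\<sigma> - 1) = 1"
    "\<And>k. k \<le> p \<Longrightarrow> cmod (troot (ray pi) k) \<le> \<sigma>" "cmod (troot (ray pi) 0) = \<sigma>"
    using positive_root pi_ge_zero by (metis order_refl)
  define n where "n = cmod (troot (ray pi) (k + 1))"
  define W where "W = {s :: complex. s ^ p * (1 - s) = - 1}"
  define f where "f i = troot (ray pi) i / ray pi" for i
  have cf: "cmod (f i) = cmod (troot (ray pi) i)" for i by (simp add: f_def norm_divide ray(1))
  have Wf: "W = f ` {..p}"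
  proof
    show "W \<subseteq> f ` {..p}"
    proof
      fix s assume "s \<in> W"
      then have "s * ray pi \<in> troot (ray pi) ` {..p}" unfolding troot_image W_def using trinomial_at_pi by simp
      then obtain i where "i \<le> p" "s * ray pi = troot (ray pi) i" by auto
      then have "s = f i" using ray(3)[of pi] by (simp add: f_def nonzero_eq_divide_eq)
      then show "s \<in> f ` {..p}" using \<open>i \<le> p\<close> by blast
    qed
    show "f ` {..p} \<subseteq> W"
      using trinomial_at_pi troot_root(1) ray(3)[of pi] by (auto simp: W_def f_def)
  qed
  have "inj_on (troot (ray pi)) {..p}"
  proof (rule eq_card_imp_inj_on)
    have "ray pi ^ (p + 1) \<notin> complex_of_real ` {0..}" using ray(2)[of pi] by (auto simp: complex_eq_iff)
    then show "card (troot (ray pi) ` {..p}) = card {..p}" unfolding troot_image using trinomial_roots_distinct by simp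
  qed simp
  then have injf: "inj_on f {..p}" using ray(3)[of pi] by (auto simp: f_def inj_on_def)
  define A where "A = {s \<in> W. cmod s > n}"
  have Af: "A = f ` {..k}"
  proof -
    have "cmod (f i) > n \<longleftrightarrow> i \<le> k" if "i \<le> p" for i
    proof (cases "i \<le> k")
      case True then show ?thesis using gap troot_sorted[of i k "ray pi"] k by (simp add: cf n_def)
    next
      case False then show ?thesis using troot_sorted[of "k + 1" i "ray pi"] that by (simp add: cf n_def)
    qed
    then show ?thesis unfolding A_def Wf using k by auto
  qed
  have cardA: "card A = k + 1" unfolding Af using card_image[OF inj_on_subset[OF injf, of "{..k}"]] k by simp
  have finA: "finite A" unfolding Af by simp
  have cnjA: "cnj s \<in> A" if "s \<in> A" for s
  proof -
    have "cnj s ^ p * (1 - cnj s) = cnj (s ^ p * (1 - s))" by simp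
    moreover have "s ^ p * (1 - s) = - 1" using that by (simp add: A_def W_def)
    ultimately have "cnj s ^ p * (1 - cnj s) = - 1" by (simp only: complex_cnj_minus complex_cnj_one)
    then show ?thesis using that by (simp add: A_def W_def)
  qed
  have sA: "of_real \<sigma> \<in> A"
  proof -
    have "(of_real \<sigma> :: complex) ^ p * (1 - of_real \<sigma>) = - of_real (\<sigma> ^ p * (\<sigma> - 1))" by (simp add: algebra_simps)
    moreover have "n < \<sigma>" using gap \<sigma>(3)[of k] k by (simp add: n_def)
    ultimately show ?thesis using \<sigma> by (simp add: A_def W_def)
  qed
  have real_only: "s = of_real \<sigma>" if s: "s \<in> A" "Im s = 0" for s
  proof -
    obtain a where a: "s = of_real a" using s(2) by (metis complex_is_Real_iff Reals_cases)
    have "(of_real (a ^ p * (1 - a)) :: complex) = of_real (- 1)" using s(1) by (simp add: A_def W_def a)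
    then have ea: "a ^ p * (1 - a) = - 1" by (simp only: of_real_eq_iff)
    have sn: "\<bar>a\<bar> > n" using s(1) by (simp add: A_def a)
    consider "a > 0" | "a = 0" | "a < 0" by linarith
    then show ?thesis
    proof cases
      case 1
      have "a > 1"
      proof (rule ccontr)
        assume "\<not> a > 1"
        then have "a ^ p * (1 - a) \<ge> 0" using 1 by simp
        then show False using ea by simp
      qed
      then have "a = \<sigma>" using level_mono[of a \<sigma>] level_mono[of \<sigma> a] \<sigma>(1,2) ea by (simp add: algebra_simps) (metis less_irrefl less_imp_le linorder_neqE_linordered_idom)
      then show ?thesis using a by simp
    next
      case 2 then show ?thesis using ea p by (simp add: power_0_left)
    next
      \<comment> \<open>For negative \<open>a\<close> the factor \<open>cmod (1 - a)\<close> takes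
        its largest possible value \<open>1 + \<bar>a\<bar>\<close>, so no solution of smaller
        modulus can reach the level \<open>1\<close>.\<close>
      case 3
      define g where "g = f (k + 1)"
      have gW: "g \<in> W" using Wf k by (auto simp: g_def)
      have ng: "cmod g = n" by (simp add: g_def cf n_def)
      have "1 = cmod (g ^ p * (1 - g))" using gW by (simp add: W_def)
      also have "\<dots> = n ^ p * cmod (1 - g)" by (simp add: norm_mult norm_power ng)
      also have "\<dots> \<le> n ^ p * (1 + n)" using norm_triangle_ineq4[of 1 g] ng by (intro mult_left_mono) (auto simp: n_def)
      also have "\<dots> < \<bar>a\<bar> ^ p * (1 + \<bar>a\<bar>)"
        using sn p troot_root(2)[OF k(2), of "ray pi"] by (intro mult_le_less_imp_less power_mono zero_less_power) (simp_all add: n_def)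
      also have "\<dots> = \<bar>a ^ p * (1 - a)\<bar>" using 3 by (simp add: abs_mult power_abs)
      finally show ?thesis using ea by simp
    qed
  qed
  define P where "P = {s \<in> A. Im s > 0}"
  have "A = insert (of_real \<sigma>) (P \<union> cnj ` P)"
  proof
    show "A \<subseteq> insert (of_real \<sigma>) (P \<union> cnj ` P)"
    proof
      fix s assume s: "s \<in> A"
      consider "Im s = 0" | "Im s > 0" | "Im s < 0" by linarith
      then show "s \<in> insert (of_real \<sigma>) (P \<union> cnj ` P)"
      proof cases
        case 3
        then have "cnj s \<in> P" using cnjA[OF s] by (simp add: P_def)
        then have "cnj (cnj s) \<in> cnj ` P" by (rule imageI)
        then show ?thesis by simp
      qed (use s real_only in \<open>auto simp: P_def\<close>)
    qed
  qed (use sA cnjA in \<open>auto simp: P_def\<close>)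
  moreover have "finite P" using finA by (simp add: P_def)
  moreover have "of_real \<sigma> \<notin> P \<union> cnj ` P"
  proof
    assume "of_real \<sigma> \<in> P \<union> cnj ` P"
    then have "of_real \<sigma> \<in> P \<or> cnj (of_real \<sigma>) \<in> P" by (metis UnE imageE complex_cnj_cnj)
    then show False by (simp add: P_def)
  qed
  moreover have "P \<inter> cnj ` P = {}" by (auto simp: P_def)
  moreover have "card (cnj ` P) = card P" by (intro card_image) (auto simp: inj_on_def)
  ultimately have "card A = Suc (card P + card P)" by (simp add: card_Un_disjoint)
  then show False using cardA k(1) by presburger
qed

text \<open>Continuity and injectivity give strict monotonicity; the direction is read off at
  \<open>pi\<close>. There the modulus coincides with that of a neighbouring index, which bounds it
  from one side at all arguments. The first index and an odd last index are settled by the positive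
  and the negative real solution instead.\<close>

lemma troot_direction:
  assumes \<theta>: "0 < \<theta>" "\<theta> < \<theta>'" "\<theta>' < pi" and k: "k \<le> p"
  shows "even k \<Longrightarrow> cmod (troot (ray \<theta>) k) < cmod (troot (ray \<theta>') k)"
    and "odd k \<Longrightarrow> cmod (troot (ray \<theta>') k) < cmod (troot (ray \<theta>) k)"
proof -
  let ?n = "\<lambda>\<theta>. cmod (troot (ray \<theta>) k)"
  have cont: "continuous_on {\<theta>..pi} ?n"
    by (rule continuous_on_compose2[OF troot_continuous[OF k] ray_continuous]) (auto simp: ray)
  have inj: "inj_on ?n {\<theta>..pi}"
  proof (rule inj_onI)
    fix t t' assume a: "t \<in> {\<theta>..pi}" "t' \<in> {\<theta>..pi}" "?n t = ?n t'"
    show "t = t'"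
    proof (cases "t < pi")
      case True then show ?thesis using troot_modulus_inj[of t t' k k] a \<theta> k by auto
    next
      case False
      then show ?thesis using troot_modulus_inj[of t' t k k] a \<theta> k by (cases "t' < pi") auto
    qed
  qed
  have mono: "(?n \<theta> < ?n \<theta>' \<and> ?n \<theta>' < ?n pi) \<or> (?n pi < ?n \<theta>' \<and> ?n \<theta>' < ?n \<theta>)"
    by (rule continuous_inj_imp_mono[OF \<theta>(2,3) cont inj])
  { assume "even k"
    have "?n \<theta>' \<le> ?n pi"
    proof (cases "k = 0")
      case True
      then show ?thesis using positive_root \<theta> by (metis le0 less_imp_le order_trans)
    next
      case False
      then obtain l where l: "k = Suc l" "odd l" using \<open>even k\<close> by (cases k) auto
      then show ?thesis using troot_pairs_at_pi[of l] troot_order(1)[of pi \<theta>' l k] \<theta> k by auto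
    qed
    then show "?n \<theta> < ?n \<theta>'" using mono by linarith }
  { assume o: "odd k"
    have "?n pi \<le> ?n \<theta>'"
    proof (cases "k + 1 \<le> p")
      case True
      then show ?thesis using troot_pairs_at_pi[OF o] troot_order(1)[of \<theta>' pi k "k + 1"] \<theta> by auto
    next
      case False
      then have kp: "k = p" using k by simp
      have "\<exists>q\<ge>0. q \<le> 1 \<and> q ^ p * (1 + q) = (1::real)"
        by (rule IVT') (use p in \<open>auto intro!: continuous_intros simp: power_0_left\<close>)
      then obtain q :: real where q: "q \<ge> 0" "q ^ p * (1 + q) = 1" by blast
      have "(of_real (- q) :: complex) ^ p * (1 - of_real (- q)) = - of_real (q ^ p * (1 + q))"
        using o kp by (simp add: algebra_simps)
      then have "of_real (- q) * ray pi \<in> troot (ray pi) ` {..p}" unfolding troot_image q(2) using trinomial_at_pi[of "of_real (- q)"] by simp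
      then obtain i where i: "i \<le> p" "troot (ray pi) i = of_real (- q) * ray pi" by auto
      then have "?n pi \<le> q" using troot_sorted[of i p "ray pi"] q(1) by (simp add: norm_mult ray(1) kp)
      also have "q \<le> ?n \<theta>'"
      proof (rule ccontr)
        assume "\<not> ?thesis"
        then have lt: "?n \<theta>' < q" by simp
        have "1 = ?n \<theta>' ^ p * cmod (1 - troot (ray \<theta>') k / ray \<theta>')" using troot_level[OF k, of \<theta>'] \<theta> by simp
        also have "\<dots> \<le> ?n \<theta>' ^ p * (1 + ?n \<theta>')"
          using norm_triangle_ineq4[of 1 "troot (ray \<theta>') k / ray \<theta>'"] by (intro mult_left_mono) (auto simp: norm_divide ray(1))
        also have "\<dots> < q ^ p * (1 + q)"
          using lt p troot_root(2)[OF k] q(1) by (intro mult_le_less_imp_less power_mono zero_less_power) auto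
        finally show False using q(2) by simp
      qed
      finally show ?thesis .
    qed
    then show "?n \<theta>' < ?n \<theta>" using mono by linarith }
qed

subsection \<open>Monotonicity of the moduli in the argument\<close>

definition modulus :: "(nat \<Rightarrow> real) \<Rightarrow> real \<Rightarrow> nat \<Rightarrow> real \<Rightarrow> real" where
  "modulus b \<tau> k \<theta> = cmod (zroot b (of_real \<tau> * ray \<theta>) k)"

lemma modulus_continuous:
  assumes "pos_weights b" "k \<le> p"
  shows "continuous_on S (modulus b \<tau> k)"
  unfolding modulus_def[abs_def]
  by (rule continuous_on_compose2[OF root_modulus_continuous[OF assms, of UNIV]])
     (auto intro!: continuous_intros ray_continuous)

text \<open>The arguments that make \<open>\<eta>\<close> a root of unity; at \<open>0\<close> and
  \<open>pi\<close> it would be real, and its powers could not separate real and imaginary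
  parts.\<close>

definition commensurable :: "real set" where
  "commensurable = {\<theta>. 0 < \<theta> \<and> \<theta> < pi \<and> \<theta> / pi \<in> \<rat>}"

lemma modulus_distinct:
  assumes b: "pos_weights b" and \<tau>: "\<tau> > 0" and \<theta>: "\<theta> \<in> commensurable" "\<theta>' \<in> commensurable" "\<theta> \<noteq> \<theta>'"
    and ij: "i \<le> p" "j \<le> p"
  shows "modulus b \<tau> i \<theta> \<noteq> modulus b \<tau> j \<theta>'"
proof -
  have tor: "\<exists>q>0. (- cis (- \<theta>)) ^ q = 1" if "\<theta> \<in> commensurable" for \<theta>
  proof -
    have "\<theta> / pi \<in> \<rat>" using that by (simp add: commensurable_def)
    then obtain m n :: nat where mn: "n \<noteq> 0" "\<bar>\<theta> / pi\<bar> = m / n"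
      using Rats_abs_nat_div_natE \<open>\<theta> / pi \<in> \<rat>\<close> by metis
    then have t: "\<theta> * n = pi * m" using that by (simp add: commensurable_def field_simps)
    have "(- cis (- \<theta>)) ^ (2 * n) = cis (- \<theta>) ^ (2 * n)" by simp
    also have "\<dots> = cis (- (2 * pi * real m))" unfolding Complex.DeMoivre using t by (intro arg_cong[of _ _ cis]) (simp add: mult.commute)
    also have "\<dots> = 1" using cis_multiple_2pi[of "- real m"] by simp
    finally show ?thesis using mn(1) by (intro exI[of _ "2 * n"]) auto
  qed
  obtain q q' where q: "q > 0" "(- cis (- \<theta>)) ^ q = 1" "q' > 0" "(- cis (- \<theta>')) ^ q' = 1"
    using tor \<theta> by metis
  have \<eta>: "- cis (- \<theta>) = - of_real (cmod (of_real \<tau> * ray t) ^ (p + 1)) / (of_real \<tau> * ray \<theta>) ^ (p + 1)" for \<theta> t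
  proof -
    have "(of_real \<tau> * ray \<theta>) ^ (p + 1) = of_real (\<tau> ^ (p + 1)) * cis \<theta>" unfolding power_mult_distrib ray(2) of_real_power ..
    moreover have "cmod (of_real \<tau> * ray t) = \<tau>" using \<tau> by (simp add: norm_mult ray(1))
    moreover have "cis (- \<theta>) = inverse (cis \<theta>)" by simp
    ultimately show ?thesis using \<tau> by (simp only:) (simp add: field_simps)
  qed
  have pos: "\<And>j. j < r \<Longrightarrow> 0 < b j" using b by (simp add: pos_weights_def)
  show ?thesis unfolding modulus_def
  proof (rule distinct_moduli[of b, OF pos _ _ _ _ _ _ \<eta> \<eta>])
    show "(- cis (- \<theta>)) ^ (q * q') = 1" "(- cis (- \<theta>')) ^ (q * q') = 1"
      using q by (simp_all add: power_mult) (metis mult.commute power_mult power_one)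
    show "Im (- cis (- \<theta>)) \<noteq> 0" "Im (- cis (- \<theta>')) \<noteq> 0"
      using \<theta> sin_gt_zero unfolding commensurable_def by fastforce+
    show "Re (- cis (- \<theta>)) \<noteq> Re (- cis (- \<theta>'))"
      using \<theta> cos_inj_pi[of \<theta> \<theta>'] unfolding commensurable_def by auto
  qed (use q \<tau> ray root_props[OF b] ij in \<open>auto simp: norm_mult\<close>)
qed

text \<open>The order relation between two such moduli cannot change along a path of positive weights,
  so it is the one of the constant weights.\<close>

lemma modulus_less_iff:
  assumes b: "pos_weights b" and \<tau>: "\<tau> > 0" and \<theta>: "\<theta> \<in> commensurable" "\<theta>' \<in> commensurable" "\<theta> \<noteq> \<theta>'"
    and ij: "i \<le> p" "j \<le> p"
  shows "modulus b \<tau> i \<theta> < modulus b \<tau> j \<theta>' \<longleftrightarrow> modulus (\<lambda>_. 1) 1 i \<theta> < modulus (\<lambda>_. 1) 1 j \<theta>'"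
proof -
  \<comment> \<open>A segment in the convex set of positive weights, from constant weights at
    \<open>l = 0\<close> to the given ones at \<open>l = 1\<close>; \<open>T\<close> joins
    \<open>1\<close> to \<open>\<tau>\<close> in the same way.\<close>
  define B where "B l n = (1 - l) * 1 + l * b n" for l :: real and n
  define T where "T l = (1 - l) * 1 + l * \<tau>" for l :: real
  have conv: "(1 - l) * 1 + l * a > 0" if "0 \<le> l" "l \<le> 1" "a > 0" for l a :: real
    using that by (cases "l = 0") (auto intro: add_nonneg_pos)
  have pB: "pos_weights (B l)" and pT: "T l > 0" if "l \<in> {0..1}" for l
    using that b \<tau> conv by (auto simp: pos_weights_def B_def T_def)
  have c: "continuous_on {0..1} (\<lambda>l. modulus (B l) (T l) k t)" if "k \<le> p" for k t
    unfolding continuous_on_sequentially o_def modulus_def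
  proof (intro allI impI ballI, elim conjE)
    fix ls :: "nat \<Rightarrow> real" and l :: real assume l: "l \<in> {0..1}" "\<forall>n. ls n \<in> {0..1}" "ls \<longlonglongrightarrow> l"
    show "(\<lambda>n. cmod (zroot (B (ls n)) (complex_of_real (T (ls n)) * ray t) k)) \<longlonglongrightarrow> cmod (zroot (B l) (complex_of_real (T l) * ray t) k)"
      by (rule root_modulus_tendsto[OF pB pB]) (use l that in \<open>auto simp: B_def T_def intro!: tendsto_intros\<close>)
  qed
  define g where "g l = modulus (B l) (T l) i \<theta> - modulus (B l) (T l) j \<theta>'" for l
  have cg: "continuous_on {0..1} g" unfolding g_def using c ij by (intro continuous_intros) auto
  have gnz: "g l \<noteq> 0" if "l \<in> {0..1}" for l
    using modulus_distinct[OF pB[OF that] pT[OF that] \<theta> ij] by (simp add: g_def)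
  have con: "connected (g ` {0..1})" using cg by (intro connected_continuous_image) auto
  have "g 0 < 0 \<longleftrightarrow> g 1 < 0"
  proof (rule ccontr)
    assume "\<not> ?thesis"
    then have "0 \<in> g ` {0..1}"
      using connectedD_interval[OF con imageI[of 0] imageI[of 1], of 0] connectedD_interval[OF con imageI[of 1] imageI[of 0], of 0] by fastforce
    then show False using gnz by auto
  qed
  moreover have "B 0 = (\<lambda>_. 1)" "B 1 = b" "T 0 = 1" "T 1 = \<tau>" by (auto simp: B_def T_def)
  ultimately show ?thesis by (simp add: g_def)
qed

lemma commensurable_dense:
  assumes "0 \<le> a" "a < b" "b \<le> pi" "x \<in> {a..b}"
  shows "x \<in> closure (commensurable \<inter> {a<..<b})"
  unfolding closure_approachable
proof (intro allI impI)
  fix e :: real assume e: "e > 0"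
  have "max a (x - e) < min b (x + e)" using assms e by auto
  then have "max a (x - e) / pi < min b (x + e) / pi" by (intro divide_strict_right_mono) auto
  then obtain q where q: "q \<in> \<rat>" "max a (x - e) / pi < q" "q < min b (x + e) / pi" using Rats_dense_in_real by blast
  then have "max a (x - e) < q * pi" "q * pi < min b (x + e)" by (auto simp: field_simps)
  moreover from this have "q * pi < 1 * pi" "0 * pi < q * pi" using assms by linarith+
  then have "q < 1" "0 < q" unfolding mult_less_cancel_right_pos[OF pi_gt_zero] by auto
  ultimately have "q * pi \<in> commensurable \<inter> {a<..<b}" "dist (q * pi) x < e"
    using q(1) assms by (auto simp: commensurable_def dist_real_def)
  then show "\<exists>y\<in>commensurable \<inter> {a<..<b}. dist y x < e" by blast
qed

text \<open>Strictness survives the passage to the limit because two more points of the dense set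
  fit between \<open>\<theta>\<close> and \<open>\<theta>'\<close>.\<close>

lemma dense_strict_mono:
  fixes f :: "real \<Rightarrow> real"
  assumes cont: "continuous_on UNIV f" and mono: "\<And>s t. s \<in> commensurable \<Longrightarrow> t \<in> commensurable \<Longrightarrow> s < t \<Longrightarrow> f s < f t"
    and \<theta>: "0 \<le> \<theta>" "\<theta> < \<theta>'" "\<theta>' \<le> pi"
  shows "f \<theta> < f \<theta>'"
proof -
  have D: "\<exists>q\<in>commensurable. a < q \<and> q < c" if "0 \<le> a" "a < c" "c \<le> pi" for a c
    using commensurable_dense[OF that, of a] that unfolding closure_approachable by (auto dest!: spec[of _ 1])
  obtain q1 where q1: "q1 \<in> commensurable" "\<theta> < q1" "q1 < \<theta>'" using D[of \<theta> \<theta>'] \<theta> by auto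
  obtain q2 where q2: "q2 \<in> commensurable" "q1 < q2" "q2 < \<theta>'" using D[of q1 \<theta>'] q1 \<theta> by auto
  have "f \<theta> \<le> f q1"
  proof (rule continuous_le_on_closure[where S = "commensurable \<inter> {\<theta><..<q1}" and f = f and x = \<theta>])
    show "\<theta> \<in> closure (commensurable \<inter> {\<theta><..<q1})" using q1 \<theta> by (intro commensurable_dense) auto
    show "continuous_on (closure (commensurable \<inter> {\<theta><..<q1})) f" using cont continuous_on_subset by blast
    show "f x \<le> f q1" if "x \<in> commensurable \<inter> {\<theta><..<q1}" for x using mono[of x q1] that q1 by auto
  qed
  moreover have "f q2 \<le> f \<theta>'"
  proof (rule continuous_ge_on_closure[where S = "commensurable \<inter> {q2<..<\<theta>'}" and f = f and x = \<theta>'])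
    show "\<theta>' \<in> closure (commensurable \<inter> {q2<..<\<theta>'})" using q1 q2 \<theta> by (intro commensurable_dense) auto
    show "continuous_on (closure (commensurable \<inter> {q2<..<\<theta>'})) f" using cont continuous_on_subset by blast
    show "f q2 \<le> f x" if "x \<in> commensurable \<inter> {q2<..<\<theta>'}" for x using mono[of q2 x] that q2 by auto
  qed
  ultimately show ?thesis using mono[OF q1(1) q2(1,2)] by linarith
qed

lemma modulus_const:
  assumes "0 < \<theta>" "\<theta> < pi" "k \<le> p"
  shows "modulus (\<lambda>_. 1) 1 k \<theta> = 1 / cmod (troot (ray \<theta>) k) ^ r"
  using zroot_const_modulus[OF assms] by (simp add: modulus_def)

theorem modulus_strict_mono:
  assumes b: "pos_weights b" and \<tau>: "\<tau> > 0" and \<theta>: "0 \<le> \<theta>" "\<theta> < \<theta>'" "\<theta>' \<le> pi" and k: "k \<le> p"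
  shows "even k \<Longrightarrow> modulus b \<tau> k \<theta>' < modulus b \<tau> k \<theta>"
    and "odd k \<Longrightarrow> modulus b \<tau> k \<theta> < modulus b \<tau> k \<theta>'"
proof -
  have inv: "1 / c ^ r < 1 / a ^ r" if "0 < a" "a < c" for a c :: real
    using that r by (intro divide_strict_left_mono power_strict_mono) auto
  have nz: "cmod (troot (ray t) k) > 0" for t using troot_root(2)[OF k] by simp
  { assume e: "even k"
    have "- modulus b \<tau> k \<theta> < - modulus b \<tau> k \<theta>'"
    proof (rule dense_strict_mono[OF _ _ \<theta>])
      fix s t assume st: "s \<in> commensurable" "t \<in> commensurable" "s < t"
      then have "modulus (\<lambda>_. 1) 1 k t < modulus (\<lambda>_. 1) 1 k s"
        using inv[OF nz troot_direction(1)[of s t k]] e k by (simp add: modulus_const commensurable_def)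
      then show "- modulus b \<tau> k s < - modulus b \<tau> k t" using modulus_less_iff[OF b \<tau>, of t s k k] st k by simp
    qed (intro continuous_intros modulus_continuous b k)
    then show "modulus b \<tau> k \<theta>' < modulus b \<tau> k \<theta>" by simp }
  { assume e: "odd k"
    show "modulus b \<tau> k \<theta> < modulus b \<tau> k \<theta>'"
    proof (rule dense_strict_mono[OF _ _ \<theta>])
      fix s t assume st: "s \<in> commensurable" "t \<in> commensurable" "s < t"
      then have "modulus (\<lambda>_. 1) 1 k s < modulus (\<lambda>_. 1) 1 k t"
        using inv[OF nz troot_direction(2)[of s t k]] e k by (simp add: modulus_const commensurable_def)
      then show "modulus b \<tau> k s < modulus b \<tau> k t" using modulus_less_iff[OF b \<tau>, of s t k k] st k by simp
    qed (intro modulus_continuous b k) }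
qed

theorem modulus_order:
  assumes b: "pos_weights b" and \<tau>: "\<tau> > 0" and \<theta>: "0 \<le> \<theta>" "\<theta> \<le> pi" "0 \<le> \<theta>'" "\<theta>' \<le> pi" and ij: "i < j" "j \<le> p"
  shows "modulus b \<tau> i \<theta> \<le> modulus b \<tau> j \<theta>'"
proof -
  have rat: "modulus b \<tau> i s \<le> modulus b \<tau> j t" if "s \<in> commensurable" "t \<in> commensurable" for s t
  proof (cases "s = t")
    case True then show ?thesis using root_mset(2)[OF b] ij by (simp add: modulus_def)
  next
    case False
    have "cmod (troot (ray t) j) < cmod (troot (ray s) i)" "0 < cmod (troot (ray t) j)"
      using troot_order(2)[of s t i j] that ij troot_root(2)[of j "ray t"] by (auto simp: commensurable_def)
    moreover from this have "0 < cmod (troot (ray s) i)" by linarith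
    ultimately have "1 / cmod (troot (ray s) i) ^ r < 1 / cmod (troot (ray t) j) ^ r"
      using r by (intro divide_strict_left_mono power_strict_mono mult_pos_pos zero_less_power) auto
    then have "modulus (\<lambda>_. 1) 1 i s < modulus (\<lambda>_. 1) 1 j t" using that ij by (simp add: modulus_const commensurable_def)
    then show ?thesis using modulus_less_iff[OF b \<tau> that False, of i j] ij by simp
  qed
  have cl: "x \<in> closure commensurable" if "0 \<le> x" "x \<le> pi" for x
    using commensurable_dense[of 0 pi x] that closure_mono[of "commensurable \<inter> {0<..<pi}" commensurable] by auto
  have step: "modulus b \<tau> i s \<le> modulus b \<tau> j \<theta>'" if "s \<in> commensurable" for s
    by (rule continuous_ge_on_closure[OF modulus_continuous[OF b ij(2)] cl]) (use rat that \<theta> in auto)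
  show ?thesis
    by (rule continuous_le_on_closure[OF modulus_continuous[OF b] cl]) (use step \<theta> ij in auto)
qed

text \<open>The modulus of root \<open>k\<close> grows strictly towards the one end of
  \<open>[0, pi]\<close> where ties are allowed, and even its value there does not exceed any value
  of the next root.\<close>

corollary modulus_less:
  assumes b: "pos_weights b" and \<tau>: "\<tau> > 0" and \<theta>: "0 \<le> \<theta>" "\<theta> \<le> pi" and k: "k < p"
    and good: "even k \<Longrightarrow> \<theta> \<noteq> 0" "odd k \<Longrightarrow> \<theta> \<noteq> pi"
  shows "modulus b \<tau> k \<theta> < modulus b \<tau> (k + 1) \<theta>"
proof (cases "even k")
  case True
  then have "modulus b \<tau> k \<theta> < modulus b \<tau> k 0" using modulus_strict_mono(1)[OF b \<tau>, of 0 \<theta> k] \<theta> good k by auto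
  also have "\<dots> \<le> modulus b \<tau> (k + 1) \<theta>" using \<theta> k by (intro modulus_order b \<tau>) auto
  finally show ?thesis .
next
  case False
  then have "modulus b \<tau> k \<theta> < modulus b \<tau> k pi" using modulus_strict_mono(2)[OF b \<tau>, of \<theta> pi k] \<theta> good k by auto
  also have "\<dots> \<le> modulus b \<tau> (k + 1) \<theta>" using \<theta> k by (intro modulus_order b \<tau>) auto
  finally show ?thesis .
qed

end

subsection \<open>Analytic tools\<close>

lemma sin_zero_continuous_constant:
  fixes f :: "'a::topological_space \<Rightarrow> real"
  assumes T: "connected T" "continuous_on T f" and z: "\<And>x. x \<in> T \<Longrightarrow> sin (f x) = 0"
    and xy: "x \<in> T" "y \<in> T"
  shows "f x = f y"
proof -
  have "f constant_on T"
  proof (rule continuous_discrete_range_constant[OF T])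
    fix x assume x: "x \<in> T"
    have "pi \<le> norm (f y - f x)" if "y \<in> T" "f y \<noteq> f x" for y
    proof -
      obtain i j :: int where "f x = of_int i * pi" "f y = of_int j * pi"
        using z[OF x] z[OF \<open>y \<in> T\<close>] unfolding sin_zero_iff_int2 by blast
      then have e: "f y - f x = of_int (j - i) * pi" by (simp add: algebra_simps)
      then have "j - i \<noteq> 0" using that(2) by auto
      then have "1 \<le> \<bar>real_of_int (j - i)\<bar>" by linarith
      then have "1 * pi \<le> \<bar>real_of_int (j - i)\<bar> * pi" by (intro mult_right_mono) auto
      then show ?thesis unfolding e by (simp add: abs_mult)
    qed
    then show "\<exists>e>0. \<forall>y. y \<in> T \<and> f y \<noteq> f x \<longrightarrow> e \<le> norm (f y - f x)" using pi_gt_zero by blast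
  qed
  then show ?thesis using xy by (metis constant_on_def)
qed

text \<open>Near \<open>w0\<close> the values lie close to finitely many points that are far apart;
  on a connected set they cannot jump from one to another.\<close>

lemma finite_cluster_tendsto:
  fixes f :: "'a::real_normed_vector \<Rightarrow> 'b::metric_space"
  assumes C: "convex C" "continuous_on C f" and w0: "w0 \<in> closure C" and R: "finite R"
    and near: "\<And>e. e > 0 \<Longrightarrow> \<exists>d>0. \<forall>w\<in>C. dist w w0 < d \<longrightarrow> (\<exists>\<rho>\<in>R. dist (f w) \<rho> < e)"
  shows "\<exists>\<rho>\<in>R. (f \<longlongrightarrow> \<rho>) (at w0 within C)"
proof -
  obtain e0 where e0: "e0 > 0" "\<And>\<rho> \<rho>'. \<rho> \<in> R \<Longrightarrow> \<rho>' \<in> R \<Longrightarrow> \<rho> \<noteq> \<rho>' \<Longrightarrow> 2 * e0 \<le> dist \<rho> \<rho>'"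
  proof -
    have "\<exists>d>0. \<forall>y\<in>R. y \<noteq> x \<longrightarrow> d \<le> dist x y" for x using finite_set_avoid[OF R] by blast
    then obtain d where d: "\<And>x. d x > 0" "\<And>x y. y \<in> R \<Longrightarrow> y \<noteq> x \<Longrightarrow> d x \<le> dist x y" by metis
    define e where "e = Min (insert 1 (d ` R))"
    have "e > 0" unfolding e_def using R d by (subst Min_gr_iff) auto
    moreover have "e \<le> d x" if "x \<in> R" for x unfolding e_def using R that by (intro Min_le) auto
    moreover have "2 * (e / 2) \<le> dist \<rho> \<rho>'" if "\<rho> \<in> R" "\<rho>' \<in> R" "\<rho> \<noteq> \<rho>'" for \<rho> \<rho>'
      using calculation(2)[OF that(1)] d(2)[of \<rho>' \<rho>] that by simp
    ultimately show ?thesis using that[of "e / 2"] by simp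
  qed
  obtain d0 where d0: "d0 > 0" "\<And>w. w \<in> C \<Longrightarrow> dist w w0 < d0 \<Longrightarrow> \<exists>\<rho>\<in>R. dist (f w) \<rho> < e0" using near[OF e0(1)] by blast
  obtain c where c: "c \<in> C" "dist c w0 < d0" using w0 d0(1) unfolding closure_approachable by blast
  obtain \<rho> where \<rho>: "\<rho> \<in> R" "dist (f c) \<rho> < e0" using d0(2)[OF c] by blast
  let ?D = "C \<inter> ball w0 d0"
  have con: "connected ((\<lambda>w. dist (f w) \<rho>) ` ?D)"
    using C by (intro connected_continuous_image continuous_intros convex_connected convex_Int) (auto intro: continuous_on_subset)
  have near_\<rho>: "dist (f w) \<rho> < e0" if w: "w \<in> ?D" for w
  proof (rule ccontr)
    assume "\<not> ?thesis"
    then have "e0 \<in> (\<lambda>w. dist (f w) \<rho>) ` ?D"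
      using connectedD_interval[OF con imageI[of c] imageI[OF w], of e0] c \<rho>(2) by (auto simp: dist_commute)
    then obtain v where v: "v \<in> ?D" "dist (f v) \<rho> = e0" by auto
    then obtain \<rho>' where \<rho>': "\<rho>' \<in> R" "dist (f v) \<rho>' < e0" using d0(2)[of v] by (auto simp: dist_commute)
    then have "\<rho> \<noteq> \<rho>'" using v by auto
    then show False using e0(2)[OF \<rho>(1) \<rho>'(1)] dist_triangle3[of \<rho> \<rho>' "f v"] v \<rho>' by simp
  qed
  have "(f \<longlongrightarrow> \<rho>) (at w0 within C)"
    unfolding tendsto_iff eventually_at
  proof (intro allI impI)
    fix e :: real assume "e > 0"
    then obtain d where d: "d > 0" "\<And>w. w \<in> C \<Longrightarrow> dist w w0 < d \<Longrightarrow> \<exists>\<rho>\<in>R. dist (f w) \<rho> < min e e0"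
      using near[of "min e e0"] e0(1) by auto
    have "dist (f w) \<rho> < e" if w: "w \<in> C" "dist w w0 < min d d0" for w
    proof -
      obtain \<rho>' where \<rho>': "\<rho>' \<in> R" "dist (f w) \<rho>' < min e e0" using d(2)[of w] w by auto
      have "dist (f w) \<rho> < e0" using near_\<rho>[of w] w by (auto simp: dist_commute)
      then have "\<rho>' = \<rho>" using e0(2)[OF \<rho>(1) \<rho>'(1)] dist_triangle3[of \<rho> \<rho>' "f w"] \<rho>' by fastforce
      then show ?thesis using \<rho>' by simp
    qed
    then show "\<exists>d>0. \<forall>x\<in>C. x \<noteq> w0 \<and> dist x w0 < d \<longrightarrow> dist (f x) \<rho> < e"
      using d(1) d0(1) by (intro exI[of _ "min d d0"]) auto
  qed
  then show ?thesis using \<rho>(1) by blast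
qed

lemma continuous_on_limit_extension:
  fixes f g :: "'a::metric_space \<Rightarrow> 'b::metric_space"
  assumes S: "S \<subseteq> closure C" and lim: "\<And>w. w \<in> S \<Longrightarrow> (f \<longlongrightarrow> g w) (at w within C)"
    and nt: "\<And>w. w \<in> S \<Longrightarrow> at w within C \<noteq> bot"
  shows "continuous_on S g"
  unfolding continuous_on_iff
proof (intro ballI allI impI)
  fix w e assume w: "w \<in> S" and e: "(e::real) > 0"
  obtain d where d: "d > 0" "\<And>v. v \<in> C \<Longrightarrow> v \<noteq> w \<Longrightarrow> dist v w < d \<Longrightarrow> dist (f v) (g w) < e / 2"
    using lim[OF w] e unfolding tendsto_iff eventually_at by (metis half_gt_zero)
  have "dist (g v) (g w) < e" if v: "v \<in> S" "dist v w < d" for v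
  proof (cases "v = w")
    case False
    have "eventually (\<lambda>u. u \<in> C \<and> dist (f u) (g w) \<le> e / 2) (at v within C)"
      unfolding eventually_at
    proof (intro exI[of _ "min (dist v w) (d - dist v w)"] conjI ballI impI)
      fix u assume u: "u \<in> C" "u \<noteq> v \<and> dist u v < min (dist v w) (d - dist v w)"
      then have "u \<noteq> w" by (auto simp: dist_commute)
      moreover have "dist u w < d" using dist_triangle[of u w v] u by auto
      ultimately show "u \<in> C" "dist (f u) (g w) \<le> e / 2" using d(2)[of u] u by auto
    qed (use False v in auto)
    then have "eventually (\<lambda>u. dist (f u) (g w) \<le> e / 2) (at v within C)" by (rule eventually_mono) simp
    then have "dist (g v) (g w) \<le> e / 2"
      by (rule tendsto_upperbound[OF tendsto_dist[OF lim[OF v(1)] tendsto_const[of "g w"]] _ nt[OF v(1)]])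
    then show ?thesis using e by simp
  qed (use e in simp)
  then show "\<exists>d>0. \<forall>x'\<in>S. dist x' w < d \<longrightarrow> dist (g x') (g w) < e" using d(1) by blast
qed

text \<open>A decreasing derivative with a negative value, or with a positive lower bound, would
  make \<open>T\<close> unbounded. Boundedness of a primitive thus yields the limit of
  \<open>h\<close>.\<close>

lemma bounded_imp_monotone_derivative_null:
  fixes T :: "real \<Rightarrow> real"
  assumes der: "\<And>s. (T has_real_derivative h s) (at s)"
    and bd: "\<And>s. a \<le> s \<Longrightarrow> \<bar>T s\<bar> \<le> M"
    and mono: "\<And>s t. s \<le> t \<Longrightarrow> h t \<le> h s"
  shows "h s \<ge> 0" and "e > 0 \<Longrightarrow> \<exists>t\<ge>s. h t < e"
proof -
  show "h s \<ge> 0"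
  proof (rule ccontr)
    assume neg: "\<not> ?thesis"
    define t where "t = max a s"
    have t: "h t < 0" "a \<le> t" using mono[of s t] neg by (auto simp: t_def)
    define n where "n = (2 * M + 1) / - h t"
    have M: "M \<ge> 0" using bd[of a] by simp
    have n: "n > 0" using t M by (auto simp: n_def intro: divide_pos_neg)
    obtain c where c: "t < c" "c < t + n" "T (t + n) - T t = n * h c"
      using MVT2[of t "t + n" T h] der n by auto
    have "n * h c \<le> n * h t" using mono[of t c] c n by (intro mult_left_mono) auto
    also have "\<dots> = - (2 * M + 1)" using t by (simp add: n_def)
    finally show False using c(3) bd[of t] bd[of "t + n"] t n by simp
  qed
  show "\<exists>t\<ge>s. h t < e" if e: "e > 0"
  proof (rule ccontr)
    assume "\<not> ?thesis"
    then have ge: "h t \<ge> e" if "t \<ge> s" for t using that by force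
    define t where "t = max a s"
    define n where "n = (2 * M + 1) / e"
    have M: "M \<ge> 0" using bd[of a] by simp
    have n: "n > 0" using e M by (auto simp: n_def)
    obtain c where c: "t < c" "c < t + n" "T (t + n) - T t = n * h c"
      using MVT2[of t "t + n" T h] der n by auto
    have "2 * M + 1 = n * e" using e by (simp add: n_def)
    also have "\<dots> \<le> n * h c" using ge[of c] c n by (intro mult_left_mono) (auto simp: t_def)
    finally have "2 * M + 1 \<le> T (t + n) - T t" using c(3) by simp
    moreover have "a \<le> t" by (simp add: t_def)
    ultimately show False using bd[of t] bd[of "t + n"] n by simp
  qed
qed

text \<open>The point \<open>w0\<close> lies on the boundary of the domain; Schwarz reflection makes
  it an interior point, where the maximum modulus principle applies.\<close>

lemma reflected_maximum_constant:
  assumes d: "d > 0" and w0: "Im w0 = 0"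
    and hol: "f holomorphic_on (ball w0 d \<inter> {z. 0 < Im z})" and cont: "continuous_on (ball w0 d \<inter> {z. 0 \<le> Im z}) f"
    and real: "\<And>z. z \<in> ball w0 d \<Longrightarrow> Im z = 0 \<Longrightarrow> Im (f z) = 0"
    and max: "\<And>z. z \<in> ball w0 d \<Longrightarrow> 0 \<le> Im z \<Longrightarrow> cmod (f z) \<le> cmod (f w0)"
    and z: "z \<in> ball w0 d" "0 \<le> Im z"
  shows "f z = f w0"
proof -
  let ?g = "\<lambda>z. if 0 \<le> Im z then f z else cnj (f (cnj z))"
  have cb: "cnj z \<in> ball w0 d" if "z \<in> ball w0 d" for z
  proof -
    have "cnj w0 = w0" using w0 by (simp add: complex_eq_iff)
    then have "cmod (w0 - cnj z) = cmod (cnj (w0 - z))" by simp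
    then show ?thesis using that by (simp add: dist_norm del: complex_cnj_diff)
  qed
  have "?g holomorphic_on ball w0 d"
  proof (rule Schwarz_reflection[OF _ _ hol cont])
    show "cnj ` ball w0 d \<subseteq> ball w0 d" using cb by blast
  qed (use real in \<open>auto simp: complex_is_Real_iff\<close>)
  then have "?g constant_on ball w0 d"
  proof (rule maximum_modulus_principle)
    show "cmod (?g z) \<le> cmod (?g w0)" if "z \<in> ball w0 d" for z
      using max[of z] max[of "cnj z"] cb[OF that] that w0 by auto
  qed (use d in auto)
  then obtain c where c: "\<And>v. v \<in> ball w0 d \<Longrightarrow> ?g v = c" unfolding constant_on_def by blast
  have "?g z = ?g w0" using c[OF z(1)] c[of w0] d by simp
  then show ?thesis using z w0 by simp
qed

text \<open>Near \<open>z\<close> a continuous logarithm is the principal one of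
  \<open>f v / f z\<close> plus a constant; closeness within \<open>pi\<close> selects the
  branch.\<close>

lemma continuous_log_holomorphic:
  assumes f: "f holomorphic_on S" and S: "open S" and g: "continuous_on S g" and e: "\<And>z. z \<in> S \<Longrightarrow> f z = exp (g z)"
  shows "g holomorphic_on S"
  unfolding holomorphic_on_open[OF S]
proof (intro ballI)
  fix z assume z: "z \<in> S"
  obtain d where d: "d > 0" "ball z d \<subseteq> S" using S z open_contains_ball by blast
  obtain e where e': "e > 0" "\<And>v. v \<in> S \<Longrightarrow> dist v z < e \<Longrightarrow> dist (g v) (g z) < pi"
    using g z pi_gt_zero unfolding continuous_on_iff by blast
  define B where "B = ball z (min d e)"
  have B: "open B" "z \<in> B" "B \<subseteq> S" using d e' by (auto simp: B_def)
  have close: "g v = Ln (f v / f z) + g z" if "v \<in> B" for v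
  proof -
    have "\<bar>Im (g v - g z)\<bar> < pi"
    proof -
      have "v \<in> S" using that B(3) by blast
      then have "cmod (g v - g z) < pi" using e'(2)[of v] that by (simp add: B_def dist_norm norm_minus_commute)
      then show ?thesis using abs_Im_le_cmod[of "g v - g z"] by linarith
    qed
    then have "Ln (exp (g v - g z)) = g v - g z" by (intro Ln_exp) auto
    then show ?thesis using that B(3) e[of v] e[OF z] by (auto simp: exp_diff subset_iff)
  qed
  have "f field_differentiable at z" using f S z holomorphic_on_imp_differentiable_at by blast
  then obtain f' where "(f has_field_derivative f') (at z)" by (auto simp: field_differentiable_def)
  then have "((\<lambda>v. Ln (f v / f z) + g z) has_field_derivative (f' / f z)) (at z)"
    using e[OF z] by (auto intro!: derivative_eq_intros)
  then have "(g has_field_derivative (f' / f z)) (at z)"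
    by (rule has_field_derivative_transform_within_open[OF _ B(1,2)]) (use close in auto)
  then show "\<exists>f'. (g has_field_derivative f') (at z)" by blast
qed

subsection \<open>Local regularity of the roots\<close>

context shift_symbol
begin

lemma symbol_poly_altdef:
  assumes "pos_weights b"
  shows "poly (symbol_poly b x) z = (\<Sum>m\<le>p + 1. coeff (symbol_poly b x) m * z ^ m)"
  unfolding poly_altdef symbol_poly_lead(1)[OF assms] ..

lemma root_modulus_isCont: "pos_weights b \<Longrightarrow> i \<le> p \<Longrightarrow> ((\<lambda>x. cmod (zroot b x i)) \<longlongrightarrow> cmod (zroot b x0 i)) (at x0)"
  using root_modulus_continuous[of b i UNIV] by (simp add: continuous_on_eq_continuous_at isCont_def)

lemma symbol_coeff_isCont: "((\<lambda>x. coeff (symbol_poly b x) m) \<longlongrightarrow> coeff (symbol_poly b x0) m) (at x0)"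
  using holomorphic_on_imp_continuous_on[OF symbol_poly_coeff_holomorphic[of b m UNIV]]
  by (simp add: continuous_on_eq_continuous_at isCont_def)

text \<open>At a root for \<open>x\<close>, the polynomial for \<open>x0\<close> equals the
  difference of the two polynomials, which tends to \<open>0\<close> since the coefficients converge
  and the root stays bounded.\<close>

lemma nearby_root_product_null:
  assumes b: "pos_weights b" and i: "i \<le> p"
  shows "((\<lambda>x. \<Prod>j<p + 1. cmod (zroot b x i - zroot b x0 j)) \<longlongrightarrow> 0) (at x0)"
proof -
  define l where "l = lead_coeff (symbol_poly b x0)"
  have l: "l \<noteq> 0" using symbol_poly_lead(2)[OF b] by (simp add: l_def)
  define h where "h x = (\<Sum>m\<le>p + 1. cmod (coeff (symbol_poly b x0) m - coeff (symbol_poly b x) m) * cmod (zroot b x i) ^ m) / cmod l" for x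
  have "(h \<longlongrightarrow> (\<Sum>m\<le>p + 1. cmod (coeff (symbol_poly b x0) m - coeff (symbol_poly b x0) m) * cmod (zroot b x0 i) ^ m) / cmod l) (at x0)"
    unfolding h_def using l by (intro tendsto_intros symbol_coeff_isCont root_modulus_isCont b i) auto
  then have h0: "(h \<longlongrightarrow> 0) (at x0)" by simp
  have bd: "(\<Prod>j<p + 1. cmod (zroot b x i - zroot b x0 j)) \<le> h x" for x
  proof -
    have "poly (symbol_poly b x0) (zroot b x i) = poly (symbol_poly b x0) (zroot b x i) - poly (symbol_poly b x) (zroot b x i)"
      using root_props(1)[OF b i] by simp
    also have "\<dots> = (\<Sum>m\<le>p + 1. (coeff (symbol_poly b x0) m - coeff (symbol_poly b x) m) * zroot b x i ^ m)"
      unfolding symbol_poly_altdef[OF b] sum_subtractf[symmetric] by (simp add: algebra_simps)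
    finally have e: "l * (\<Prod>j<p + 1. zroot b x i - zroot b x0 j) = (\<Sum>m\<le>p + 1. (coeff (symbol_poly b x0) m - coeff (symbol_poly b x) m) * zroot b x i ^ m)"
      unfolding symbol_poly_prod_lead[OF b, of x0] l_def .
    have "cmod l * (\<Prod>j<p + 1. cmod (zroot b x i - zroot b x0 j)) = cmod (l * (\<Prod>j<p + 1. zroot b x i - zroot b x0 j))"
      unfolding norm_mult prod_norm ..
    also have "\<dots> \<le> (\<Sum>m\<le>p + 1. cmod (coeff (symbol_poly b x0) m - coeff (symbol_poly b x) m) * cmod (zroot b x i) ^ m)"
      unfolding e by (rule order_trans[OF norm_sum]) (simp only: norm_mult norm_power order_refl)
    finally show ?thesis using l by (simp add: h_def field_simps)
  qed
  show ?thesis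
    by (rule tendsto_sandwich[OF _ _ tendsto_const h0]) (use bd in \<open>auto intro!: always_eventually prod_nonneg simp del: prod.lessThan_Suc\<close>)
qed

lemma root_near_limit_roots:
  assumes b: "pos_weights b" and i: "i \<le> p" and e: "e > 0"
  shows "\<exists>d>0. \<forall>x. dist x x0 < d \<longrightarrow> (\<exists>j\<le>p. dist (zroot b x i) (zroot b x0 j) < e)"
proof -
  obtain d where d: "d > 0" "\<And>x. x \<noteq> x0 \<Longrightarrow> dist x x0 < d \<Longrightarrow> \<bar>\<Prod>j<p + 1. cmod (zroot b x i - zroot b x0 j)\<bar> < e ^ (p + 1)"
  proof -
    have "0 < e ^ (p + 1)" using e by (rule zero_less_power)
    then obtain d where "d > 0" "\<forall>x\<in>UNIV. x \<noteq> x0 \<and> dist x x0 < d \<longrightarrow> dist (\<Prod>j<p + 1. cmod (zroot b x i - zroot b x0 j)) 0 < e ^ (p + 1)"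
      using nearby_root_product_null[OF b i, of x0] unfolding tendsto_iff eventually_at by blast
    then show ?thesis using that[of d] unfolding dist_real_def diff_zero by blast
  qed
  have "\<exists>j\<le>p. dist (zroot b x i) (zroot b x0 j) < e" if "dist x x0 < d" for x
  proof (cases "x = x0")
    case True then show ?thesis using i e by auto
  next
    case False
    show ?thesis
    proof (rule ccontr)
      assume "\<not> ?thesis"
      then have "e \<le> cmod (zroot b x i - zroot b x0 j)" if "j \<in> {..<p + 1}" for j
        using that by (simp add: dist_norm not_less less_Suc_eq_le)
      then have "(\<Prod>j<p + 1. e) \<le> (\<Prod>j<p + 1. cmod (zroot b x i - zroot b x0 j))" using e by (intro prod_mono) auto
      then show False using d(2)[OF False that] by simp
    qed
  qed
  then show ?thesis using d(1) by blast
qed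

definition distinct_root_moduli :: "(nat \<Rightarrow> real) \<Rightarrow> complex \<Rightarrow> bool" where
  "distinct_root_moduli b x \<longleftrightarrow> (\<forall>i<p. cmod (zroot b x i) < cmod (zroot b x (i + 1)))"

lemma distinct_root_moduli_less:
  assumes "distinct_root_moduli b x" "i < j" "j \<le> p"
  shows "cmod (zroot b x i) < cmod (zroot b x j)"
  using assms(2,3)
proof (induction j)
  case (Suc j)
  have "cmod (zroot b x j) < cmod (zroot b x (j + 1))" using Suc assms(1) by (simp add: distinct_root_moduli_def)
  then show ?case using Suc by (cases "i = j") auto
qed simp

lemma distinct_root_moduli_neq:
  assumes "distinct_root_moduli b x" "i \<noteq> j" "i \<le> p" "j \<le> p"
  shows "cmod (zroot b x i) \<noteq> cmod (zroot b x j)"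
  using distinct_root_moduli_less[OF assms(1), of i j] distinct_root_moduli_less[OF assms(1), of j i] assms by (cases "i < j") auto

text \<open>In the product of distances to the roots at \<open>x0\<close>, every factor except that
  of \<open>i\<close> is bounded below by a difference of moduli, which stays away from
  \<open>0\<close>.\<close>

lemma root_isCont:
  assumes b: "pos_weights b" and i: "i \<le> p" and dis: "distinct_root_moduli b x0"
  shows "((\<lambda>x. zroot b x i) \<longlongrightarrow> zroot b x0 i) (at x0)"
proof -
  define G where "G x = (\<Prod>j\<in>{..<p + 1} - {i}. \<bar>cmod (zroot b x i) - cmod (zroot b x0 j)\<bar>)" for x
  have "(G \<longlongrightarrow> (\<Prod>j\<in>{..<p + 1} - {i}. \<bar>cmod (zroot b x0 i) - cmod (zroot b x0 j)\<bar>)) (at x0)"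
    unfolding G_def by (intro tendsto_intros root_modulus_isCont b i)
  then have G: "(G \<longlongrightarrow> G x0) (at x0)" by (simp add: G_def)
  have G0: "G x0 > 0" unfolding G_def using distinct_root_moduli_neq[OF dis, of i] i by (intro prod_pos) auto
  have ev: "eventually (\<lambda>x. G x > 0) (at x0)" using G G0 by (rule order_tendstoD(1))
  have le: "cmod (zroot b x i - zroot b x0 i) \<le> (\<Prod>j<p + 1. cmod (zroot b x i - zroot b x0 j)) / G x" if "G x > 0" for x
  proof -
    have "G x \<le> (\<Prod>j\<in>{..<p + 1} - {i}. cmod (zroot b x i - zroot b x0 j))"
      unfolding G_def by (intro prod_mono) (auto intro: norm_triangle_ineq3)
    then have "cmod (zroot b x i - zroot b x0 i) * G x \<le> cmod (zroot b x i - zroot b x0 i) * (\<Prod>j\<in>{..<p + 1} - {i}. cmod (zroot b x i - zroot b x0 j))"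
      by (intro mult_left_mono) auto
    also have "\<dots> = (\<Prod>j<p + 1. cmod (zroot b x i - zroot b x0 j))" using i by (intro prod.remove[symmetric]) auto
    finally show ?thesis unfolding pos_le_divide_eq[OF that] .
  qed
  have "((\<lambda>x. (\<Prod>j<p + 1. cmod (zroot b x i - zroot b x0 j)) / G x) \<longlongrightarrow> 0 / G x0) (at x0)"
    by (rule tendsto_divide[OF nearby_root_product_null[OF b i] G]) (use G0 in simp)
  then have lim: "((\<lambda>x. (\<Prod>j<p + 1. cmod (zroot b x i - zroot b x0 j)) / G x) \<longlongrightarrow> 0) (at x0)" by (simp only: div_0)
  have "eventually (\<lambda>x. cmod (zroot b x i - zroot b x0 i) \<le> (\<Prod>j<p + 1. cmod (zroot b x i - zroot b x0 j)) / G x) (at x0)"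
    using ev by (rule eventually_mono) (rule le)
  then have "((\<lambda>x. zroot b x i - zroot b x0 i) \<longlongrightarrow> 0) (at x0)"
    using lim by (rule Lim_null_comparison)
  then show ?thesis by (rule LIM_zero_cancel)
qed

text \<open>Dividing the same product by its factors with \<open>j \<noteq> i\<close> expresses the
  difference quotient of the root through those of the coefficients.\<close>

lemma root_differentiable:
  assumes b: "pos_weights b" and i: "i \<le> p" and dis: "distinct_root_moduli b x0"
  shows "(\<lambda>x. zroot b x i) field_differentiable at x0"
proof -
  let ?c = "\<lambda>x. coeff (symbol_poly b x)" and ?z = "\<lambda>x. zroot b x i"
  define l where "l = lead_coeff (symbol_poly b x0)"
  have l: "l \<noteq> 0" using symbol_poly_lead(2)[OF b] by (simp add: l_def)
  have "\<exists>c'. ((\<lambda>x. ?c x m) has_field_derivative c') (at x0)" for m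
    using symbol_poly_coeff_holomorphic[of b m UNIV] by (simp add: holomorphic_on_def field_differentiable_def)
  then obtain c' where c': "\<And>m. ((\<lambda>x. ?c x m) has_field_derivative c' m) (at x0)" by metis
  note zlim = root_isCont[OF b i dis]
  define D where "D x = (\<Sum>m\<le>p + 1. (?c x m - ?c x0 m) / (x - x0) * ?z x ^ m)" for x
  have D: "(D \<longlongrightarrow> (\<Sum>m\<le>p + 1. c' m * ?z x0 ^ m)) (at x0)"
    unfolding D_def using c' by (intro tendsto_sum tendsto_mult tendsto_power zlim) (simp add: has_field_derivative_iff)
  define R where "R x = (\<Prod>j\<in>{..<p + 1} - {i}. ?z x - zroot b x0 j)" for x
  have "(R \<longlongrightarrow> (\<Prod>j\<in>{..<p + 1} - {i}. ?z x0 - zroot b x0 j)) (at x0)" unfolding R_def by (intro tendsto_intros zlim)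
  then have R: "(R \<longlongrightarrow> R x0) (at x0)" by (simp add: R_def)
  have "\<forall>j\<in>{..<p + 1} - {i}. ?z x0 - zroot b x0 j \<noteq> 0"
    using distinct_root_moduli_neq[OF dis, of i] i by fastforce
  then have R0: "R x0 \<noteq> 0" unfolding R_def by (subst prod_zero_iff) auto
  have eq: "(?z x - ?z x0) / (x - x0) = - D x / (l * R x)" if "x \<noteq> x0" "R x \<noteq> 0" for x
  proof -
    have "l * ((?z x - ?z x0) * R x) = l * (\<Prod>j<p + 1. ?z x - zroot b x0 j)"
      unfolding R_def using i by (intro arg_cong[of _ _ "\<lambda>y. l * y"] prod.remove[symmetric]) auto
    also have "\<dots> = poly (symbol_poly b x0) (?z x) - poly (symbol_poly b x) (?z x)"
      unfolding symbol_poly_prod_lead[OF b, of x0] l_def using root_props(1)[OF b i] by simp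
    also have "\<dots> = - (\<Sum>m\<le>p + 1. (?c x m - ?c x0 m) * ?z x ^ m)"
      unfolding symbol_poly_altdef[OF b] sum_subtractf[symmetric] sum_negf[symmetric] by (simp add: algebra_simps)
    also have "\<dots> = - (x - x0) * D x" unfolding D_def sum_distrib_left sum_negf[symmetric] using that(1) by (intro sum.cong) (auto simp: field_simps)
    finally have "l * R x * (?z x - ?z x0) = - D x * (x - x0)" by (simp add: algebra_simps)
    then show ?thesis using l that nonzero_divide_eq_eq[of "x - x0" "?z x - ?z x0"] nonzero_eq_divide_eq[of "l * R x" "?z x - ?z x0" "- D x / (x - x0)"]
      by (simp add: divide_simps) (simp add: algebra_simps)
  qed
  have ev: "eventually (\<lambda>x. - D x / (l * R x) = (?z x - ?z x0) / (x - x0)) (at x0)"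
  proof -
    have "eventually (\<lambda>x. R x \<noteq> 0) (at x0)" using R R0 by (rule tendsto_imp_eventually_ne)
    moreover have "eventually (\<lambda>x. x \<noteq> x0) (at x0)" by (rule eventually_neq_at_within)
    ultimately show ?thesis by eventually_elim (simp add: eq)
  qed
  have "((\<lambda>x. - D x / (l * R x)) \<longlongrightarrow> - (\<Sum>m\<le>p + 1. c' m * ?z x0 ^ m) / (l * R x0)) (at x0)"
    using l R0 by (intro tendsto_intros D R) auto
  then have "((\<lambda>x. (?z x - ?z x0) / (x - x0)) \<longlongrightarrow> - (\<Sum>m\<le>p + 1. c' m * ?z x0 ^ m) / (l * R x0)) (at x0)"
    using ev by (rule Lim_transform_eventually)
  then have "(?z has_field_derivative (- (\<Sum>m\<le>p + 1. c' m * ?z x0 ^ m) / (l * R x0))) (at x0)"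
    by (simp only: has_field_derivative_iff)
  then show ?thesis unfolding field_differentiable_def by blast
qed

end

subsection \<open>Roots along a sector in logarithmic coordinates\<close>

lemma linear_factors_proportional:
  fixes c c' :: "nat \<Rightarrow> complex"
  assumes "\<And>s. (\<Prod>i<d. s - c i) = q * (\<Prod>i<d. s - c' i)"
  shows "mset (map c [0..<d]) = mset (map c' [0..<d])"
proof -
  define A where "A f = (\<Prod>i<d. [:- f i, 1:])" for f :: "nat \<Rightarrow> complex"
  have pA: "poly (A f) s = (\<Prod>i<d. s - f i)" for f s by (simp add: A_def poly_prod)
  have lA: "lead_coeff (A f) = 1" for f unfolding A_def by (simp add: lead_coeff_prod)
  have "poly (A c) = poly (Polynomial.smult q (A c'))" using assms by (simp add: pA fun_eq_iff)
  then have "A c = Polynomial.smult q (A c')" by (simp only: poly_eq_poly_eq_iff)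
  then have "q = 1" using lA[of c] lA[of c'] by (cases "q = 0") (simp_all add: lead_coeff_smult)
  then show ?thesis using assms by (intro linear_factors_eq_imp_mset_eq[where S = UNIV]) (auto simp: infinite_UNIV_char_0)
qed

context shift_symbol
begin

text \<open>On a ray through a \<open>2 (p + 1)\<close>-th root of unity the roots, suitably rotated, come in
  conjugate pairs, so those of small modulus have a real product.\<close>

lemma partial_product_real:
  assumes b: "pos_weights b" and u: "cmod u = 1" "u ^ (2 * (p + 1)) = 1" and x: "x = of_real \<tau> * u"
    and a: "\<And>s. poly (symbol_poly b x) s = l * (\<Prod>i<p + 1. s - a i)"
    and srt: "\<And>i j. i \<le> j \<Longrightarrow> j \<le> p \<Longrightarrow> cmod (a i) \<le> cmod (a j)"
    and m: "m \<le> p + 1" "0 < m \<Longrightarrow> m \<le> p \<Longrightarrow> cmod (a (m - 1)) < cmod (a m)"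
  shows "Im (\<Prod>i<m. u ^ r * a i) = 0"
proof (cases "m = 0")
  case False
  define c where "c i = u ^ r * a i" for i
  define v where "v = cnj u ^ r"
  define U where "U = (u ^ r) ^ (p + 1)"
  have uv: "u * cnj u = 1" using u(1) by (simp add: complex_norm_square[symmetric])
  then have vu: "v * u ^ r = 1" "u ^ r * v = 1" by (simp_all add: v_def power_mult_distrib[symmetric] mult.commute)
  have u0: "u \<noteq> 0" using u(1) by auto
  have l0: "l \<noteq> 0"
  proof
    assume "l = 0"
    then have "poly (symbol_poly b x) s = 0" for s using a by simp
    then show False using poly_symbol_poly_0 by (metis zero_neq_one)
  qed
  have c1: "l * (\<Prod>i<p + 1. s - c i) = U * poly (symbol_poly b x) (v * s)" for s
  proof -
    have "(\<Prod>i<p + 1. s - c i) = (\<Prod>i<p + 1. u ^ r * (v * s - a i))"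
      by (intro prod.cong refl) (simp add: c_def right_diff_distrib mult.assoc[symmetric] vu)
    also have "\<dots> = U * (\<Prod>i<p + 1. v * s - a i)" unfolding prod.distrib U_def by simp
    finally show ?thesis unfolding a by simp
  qed
  have g: "cnj u ^ 2 * x = cnj x" unfolding x 
  proof -
    have "cnj u ^ 2 * (of_real \<tau> * u) = of_real \<tau> * cnj u * (u * cnj u)" by (simp add: power2_eq_square)
    then show "cnj u ^ 2 * (of_real \<tau> * u) = cnj (of_real \<tau> * u)" using uv by simp
  qed
  have "(cnj u ^ 2) ^ (p + 1) = cnj (u ^ (2 * (p + 1)))" unfolding complex_cnj_power power_mult ..
  then have g1: "(cnj u ^ 2) ^ (p + 1) = 1" unfolding u(2) by simp
  \<comment> \<open>Conjugation followed by the rotation from \<open>cnj x\<close> back to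
    \<open>x\<close> permutes the roots; in the coordinates \<open>c\<close> this is plain
    conjugation.\<close>
  have sym: "cnj (poly (symbol_poly b x) (v * cnj s)) = poly (symbol_poly b x) (v * s)" for s
  proof -
    have "cnj (poly (symbol_poly b x) (v * cnj s)) = poly (symbol_poly b (cnj x)) (cnj (v * cnj s))"
      unfolding symbol_poly_cnj ..
    also have "\<dots> = poly (symbol_poly b x) ((cnj u ^ 2) ^ r * (u ^ r * s))"
      unfolding symbol_poly_rotate[OF g1] g by (simp add: v_def)
    also have "(cnj u ^ 2) ^ r * (u ^ r * s) = v * s"

    proof -
      have "(cnj u ^ 2) ^ r * (u ^ r * s) = v * (v * u ^ r) * s" by (simp add: v_def power2_eq_square power_mult_distrib)
      then show ?thesis using vu(1) by simp
    qed
    finally show ?thesis .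
  qed
  define q where "q = (U / l) * cnj l / cnj U"
  have U0: "U \<noteq> 0" using u0 by (simp add: U_def)
  have "(\<Prod>i<p + 1. s - c i) = q * (\<Prod>i<p + 1. s - cnj (c i))" for s
  proof -
    have "cnj l * (\<Prod>i<p + 1. s - cnj (c i)) = cnj (l * (\<Prod>i<p + 1. cnj s - c i))" by simp
    also have "\<dots> = cnj U * poly (symbol_poly b x) (v * s)" unfolding c1 complex_cnj_mult sym ..
    finally have "poly (symbol_poly b x) (v * s) = cnj l / cnj U * (\<Prod>i<p + 1. s - cnj (c i))" using U0 by (simp add: field_simps)
    moreover have "(\<Prod>i<p + 1. s - c i) = U / l * poly (symbol_poly b x) (v * s)"
      using c1[of s] l0 by (simp add: nonzero_eq_divide_eq mult.commute del: prod.lessThan_Suc)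
    ultimately show ?thesis by (simp add: q_def)
  qed
  then have ms: "mset (map c [0..<p + 1]) = mset (map (\<lambda>i. cnj (c i)) [0..<p + 1])"
    by (rule linear_factors_proportional)
  \<comment> \<open>The gap in modulus lets the threshold \<open>t\<close> select the first
    \<open>m\<close> members from the multiset, and conjugation respects this selection.\<close>
  define t where "t = cmod (c (m - 1))"
  have cc: "cmod (c i) = cmod (a i)" for i by (simp add: c_def norm_mult norm_power u(1))
  have sel: "cmod (c i) \<le> t \<longleftrightarrow> i < m" if "i < p + 1" for i
  proof (cases "i < m")
    case True then show ?thesis using srt[of i "m - 1"] m(1) by (simp add: cc t_def)
  next
    case F: False
    then have "cmod (a (m - 1)) < cmod (a m)" using m(2) False that by simp
    also have "\<dots> \<le> cmod (a i)" using srt[of m i] F that by simp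
    finally show ?thesis using F by (simp add: cc t_def)
  qed
  have fl: "filter (\<lambda>i. i < m) [0..<p + 1] = [0..<m]"
  proof -
    have "[0..<p + 1] = [0..<m] @ [m..<p + 1]" using upt_add_eq_append[of 0 m "p + 1 - m"] m(1) by simp
    moreover have "filter (\<lambda>i. i < m) [0..<m] = [0..<m]" by (rule filter_True) simp
    moreover have "filter (\<lambda>i. i < m) [m..<p + 1] = []" by (rule filter_False) (auto simp only: set_upt atLeastLessThan_iff)
    ultimately show ?thesis by (simp only: filter_append append_Nil2)
  qed
  have part: "prod_mset (filter_mset (\<lambda>z. cmod z \<le> t) (mset (map f [0..<p + 1]))) = (\<Prod>i<m. f i)"
    if f: "\<And>i. cmod (f i) = cmod (c i)" for f :: "nat \<Rightarrow> complex"
  proof -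
    have "filter (\<lambda>z. cmod z \<le> t) (map f [0..<p + 1]) = map f (filter (\<lambda>i. i < m) [0..<p + 1])"
      unfolding filter_map o_def f by (intro arg_cong[of _ _ "map f"] filter_cong refl) (use sel in \<open>simp only: set_upt atLeastLessThan_iff\<close>)
    then have "filter_mset (\<lambda>z. cmod z \<le> t) (mset (map f [0..<p + 1])) = mset (map f [0..<m])"
      unfolding fl mset_filter[symmetric] by simp
    then show ?thesis by (simp only: prod_mset_prod_list) (simp add: prod.distinct_set_conv_list[symmetric] atLeast0LessThan)
  qed
  have "(\<Prod>i<m. c i) = (\<Prod>i<m. cnj (c i))" using part[of c] part[of "\<lambda>i. cnj (c i)"] unfolding ms by simp
  also have "\<dots> = cnj (\<Prod>i<m. c i)" by simp
  finally have "(\<Prod>i<m. c i) \<in> \<real>" by (metis Reals_cnj_iff)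
  then show ?thesis by (simp add: c_def complex_is_Real_iff)
qed simp

end

locale root_strip = shift_symbol +
  fixes b :: "nat \<Rightarrow> real" and k :: nat
  assumes b: "pos_weights b" and k: "k < p"
begin

definition width :: real where "width = pi / real (p + 1)"

text \<open>The strip is mapped to one of the two sectors of angle \<open>width\<close> adjacent to the positive axis,
  so that its lower edge is the ray on which the moduli of the roots \<open>k\<close> and \<open>k + 1\<close> can agree.\<close>

definition orient :: complex where "orient = (if even k then 1 else cis (- width))"
definition point :: "complex \<Rightarrow> complex" where "point w = orient * exp w"
text \<open>The absolute value of the argument of \<open>point w ^ (p + 1)\<close> at height
  \<open>Im w = \<psi>\<close>; for odd \<open>k\<close> the sector lies below the axis and the
  height is measured from the other end.\<close>

definition angle :: "real \<Rightarrow> real" where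
  "angle \<psi> = (if even k then real (p + 1) * \<psi> else pi - real (p + 1) * \<psi>)"
definition strip :: "complex set" where "strip = {w. 0 \<le> Im w \<and> Im w \<le> width}"
definition ostrip :: "complex set" where "ostrip = {w. 0 < Im w \<and> Im w < width}"

lemma width: "0 < width" "real (p + 1) * width = pi" by (simp_all add: width_def)

lemma orient: "cmod orient = 1" "orient \<noteq> 0" "orient ^ (2 * (p + 1)) = 1"
proof -
  have "cis (- width) ^ (2 * (p + 1)) = cis (2 * pi * (- 1))"
    unfolding Complex.DeMoivre using width(2) by (intro arg_cong[of _ _ cis]) (simp add: algebra_simps)
  also have "\<dots> = 1" by (rule cis_multiple_2pi) simp
  finally show "orient ^ (2 * (p + 1)) = 1" by (simp add: orient_def)
qed (auto simp: orient_def)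

lemma angle_bounds:
  assumes "0 \<le> \<psi>" "\<psi> \<le> width"
  shows "0 \<le> angle \<psi>" "angle \<psi> \<le> pi"
    "angle \<psi> = 0 \<longleftrightarrow> \<psi> = (if even k then 0 else width)" "angle \<psi> = pi \<longleftrightarrow> \<psi> = (if even k then width else 0)"
proof -
  have "real (p + 1) * \<psi> \<le> real (p + 1) * width" using assms(2) by (rule mult_left_mono) simp
  then show "0 \<le> angle \<psi>" "angle \<psi> \<le> pi" using assms(1) unfolding width(2) by (auto simp: angle_def simp del: of_nat_add)
  have "real (p + 1) * \<psi> = pi \<longleftrightarrow> \<psi> = width" unfolding width(2)[symmetric] by auto
  then show "angle \<psi> = 0 \<longleftrightarrow> \<psi> = (if even k then 0 else width)" "angle \<psi> = pi \<longleftrightarrow> \<psi> = (if even k then width else 0)"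
    by (auto simp: angle_def)
qed

lemma point_modulus:
  assumes "i \<le> p"
  shows "cmod (zroot b (point w) i) = modulus b (exp (Re w)) i (angle (Im w))"
proof (cases "even k")
  case True
  have "ray (angle (Im w)) = cis (Im w)" using True by (simp add: ray_def angle_def)
  then show ?thesis using True by (simp add: modulus_def point_def orient_def exp_eq_polar)
next
  case False
  have "angle (Im w) / real (p + 1) = width - Im w" using False by (simp add: angle_def width_def diff_divide_distrib)
  then have "cnj (of_real (exp (Re w)) * ray (angle (Im w))) = of_real (exp (Re w)) * cis (Im w - width)"
    by (simp add: ray_def cis_cnj)
  moreover have "point w = of_real (exp (Re w)) * cis (Im w - width)"
    using False by (simp add: point_def orient_def exp_eq_polar cis_mult)
  ultimately show ?thesis
    using root_modulus_cnj[OF b assms, of "of_real (exp (Re w)) * ray (angle (Im w))"] by (simp add: modulus_def)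
qed

text \<open>Ties of indices with the parity of \<open>k\<close> can occur only on the lower edge,
  those of the other parity only on the upper edge; the last two hypotheses exclude exactly these
  cases.\<close>

lemma modulus_gap:
  assumes w: "w \<in> strip" and i: "i < p" and "Im w = 0 \<Longrightarrow> even i \<noteq> even k" "Im w = width \<Longrightarrow> even i = even k"
  shows "cmod (zroot b (point w) i) < cmod (zroot b (point w) (i + 1))"
proof -
  have a: "0 \<le> Im w" "Im w \<le> width" using w by (auto simp: strip_def)
  have ne: "even i \<Longrightarrow> angle (Im w) \<noteq> 0" "odd i \<Longrightarrow> angle (Im w) \<noteq> pi"
    using assms(3,4) unfolding angle_bounds(3,4)[OF a] by (auto split: if_splits)
  have "modulus b (exp (Re w)) i (angle (Im w)) < modulus b (exp (Re w)) (i + 1) (angle (Im w))"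
    by (rule modulus_less[OF b _ angle_bounds(1,2)[OF a] i ne]) auto
  then show ?thesis using point_modulus[of i w] point_modulus[of "i + 1" w] i by simp
qed

lemma modulus_vertical:
  assumes w: "w \<in> strip" "w' \<in> strip" "Re w = Re w'" "Im w < Im w'" and i: "i \<le> p"
  shows "even i = even k \<Longrightarrow> cmod (zroot b (point w') i) < cmod (zroot b (point w) i)"
    and "even i \<noteq> even k \<Longrightarrow> cmod (zroot b (point w) i) < cmod (zroot b (point w') i)"
proof -
  have a: "0 \<le> angle (Im w)" "angle (Im w) \<le> pi" "0 \<le> angle (Im w')" "angle (Im w') \<le> pi"
    using w angle_bounds(1,2) by (auto simp: strip_def)
  have lt: "real (p + 1) * Im w < real (p + 1) * Im w'" using w(4) by (rule mult_strict_left_mono) simp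
  have m: "angle (Im w) < angle (Im w')" if "even k" using lt that unfolding angle_def by simp
  have m': "angle (Im w') < angle (Im w)" if "odd k" using lt that unfolding angle_def by simp
  note mono = modulus_strict_mono[OF b exp_gt_zero[of "Re w"] _ _ _ i]
  show "even i = even k \<Longrightarrow> cmod (zroot b (point w') i) < cmod (zroot b (point w) i)"
    unfolding point_modulus[OF i] w(3)[symmetric] using mono(1)[OF a(1) m a(4)] mono(2)[OF a(3) m' a(2)] by (cases "even k") auto
  show "even i \<noteq> even k \<Longrightarrow> cmod (zroot b (point w) i) < cmod (zroot b (point w') i)"
    unfolding point_modulus[OF i] w(3)[symmetric] using mono(2)[OF a(1) m a(4)] mono(1)[OF a(3) m' a(2)] by (cases "even k") auto
qed

lemma strip_topology: "convex strip" "convex ostrip" "open ostrip" "ostrip \<subseteq> strip" "interior strip = ostrip" "closure ostrip = strip"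
proof -
  have s: "strip = {w. 0 \<le> Im w} \<inter> {w. Im w \<le> width}" "ostrip = {w. 0 < Im w} \<inter> {w. Im w < width}"
    by (auto simp: strip_def ostrip_def)
  show c: "convex strip" unfolding s by (intro convex_Int convex_halfspace_Im_ge convex_halfspace_Im_le)
  show "convex ostrip" unfolding s by (intro convex_Int convex_halfspace_Im_gt convex_halfspace_Im_lt)
  show o: "open ostrip" unfolding s by (intro open_Int open_halfspace_Im_gt open_halfspace_Im_lt)
  show sub: "ostrip \<subseteq> strip" by (auto simp: strip_def ostrip_def)
  show int: "interior strip = ostrip"
  proof
    show "interior strip \<subseteq> ostrip"
    proof
      fix w assume "w \<in> interior strip"
      then obtain e where e: "e > 0" "cball w e \<subseteq> strip" unfolding mem_interior_cball by blast
      have "w + \<i> * of_real e \<in> cball w e" "w - \<i> * of_real e \<in> cball w e"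
        using e(1) by (simp_all add: dist_norm norm_mult)
      then have "w + \<i> * of_real e \<in> strip" "w - \<i> * of_real e \<in> strip" using e(2) by auto
      then show "w \<in> ostrip" using e(1) by (simp add: strip_def ostrip_def)
    qed
  qed (use o sub in \<open>simp add: interior_maximal\<close>)
  have "Complex 0 (width / 2) \<in> ostrip" using width(1) by (simp add: ostrip_def)
  then have "closure (interior strip) = closure strip" using convex_closure_interior[OF c] unfolding int by auto
  moreover have "closed strip" unfolding s by (intro closed_Int closed_halfspace_Im_ge closed_halfspace_Im_le)
  ultimately show "closure ostrip = strip" unfolding int by simp
qed

lemma at_within_ostrip: "w \<in> strip \<Longrightarrow> at w within ostrip \<noteq> bot"
proof -
  assume "w \<in> strip"
  then have "w \<in> ostrip \<or> w islimpt ostrip" using strip_topology(6) by (auto simp: closure_def)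
  then have "w islimpt ostrip" using strip_topology(3) interior_limit_point[of w ostrip] by (auto simp: interior_open)
  then show ?thesis by (simp add: trivial_limit_within)
qed

text \<open>The factor \<open>orient ^ r\<close> makes the set of roots symmetric under plain
  conjugation on the lower edge.\<close>

definition raw :: "nat \<Rightarrow> complex \<Rightarrow> complex" where "raw i w = orient ^ r * zroot b (point w) i"
text \<open>On an edge \<open>zroot\<close> chooses arbitrarily among tied roots; limits from the
  open strip give a continuous choice.\<close>

definition branch :: "nat \<Rightarrow> complex \<Rightarrow> complex" where "branch i w = Lim (at w within ostrip) (raw i)"

lemma cmod_raw: "cmod (raw i w) = cmod (zroot b (point w) i)"
  by (simp add: raw_def norm_mult norm_power orient(1))

lemma distinct_ostrip:
  assumes "w \<in> ostrip"
  shows "distinct_root_moduli b (point w)"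
  unfolding distinct_root_moduli_def
proof (intro allI impI)
  fix i assume "i < p"
  then show "cmod (zroot b (point w) i) < cmod (zroot b (point w) (i + 1))"
    using assms strip_topology(4) by (intro modulus_gap) (auto simp: ostrip_def)
qed

lemma raw_holomorphic:
  assumes i: "i \<le> p"
  shows "raw i holomorphic_on ostrip"
proof -
  have "raw i field_differentiable (at w)" if "w \<in> ostrip" for w
  proof -
    obtain D where D: "((\<lambda>x. zroot b x i) has_field_derivative D) (at (point w))"
      using root_differentiable[OF b i distinct_ostrip[OF \<open>w \<in> ostrip\<close>]] by (auto simp: field_differentiable_def)
    have P: "(point has_field_derivative (orient * exp w)) (at w)" unfolding point_def by (auto intro!: derivative_eq_intros)
    have "((\<lambda>w. zroot b (point w) i) has_field_derivative D * (orient * exp w)) (at w)"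
      using DERIV_chain2[OF D P] .
    then have "(raw i has_field_derivative orient ^ r * (D * (orient * exp w))) (at w)"
      unfolding raw_def[abs_def] by (rule DERIV_cmult)
    then show ?thesis by (auto simp: field_differentiable_def)
  qed
  then show ?thesis using field_differentiable_at_within unfolding holomorphic_on_def by blast
qed

lemma point_tendsto: "(point \<longlongrightarrow> point w) (at w within S)"
  unfolding point_def by (intro tendsto_intros)

text \<open>Near a boundary point \<open>raw i\<close> stays close to the finitely many roots there,
  which by \<open>finite_cluster_tendsto\<close> forces a limit.\<close>

lemma branch_tendsto:
  assumes i: "i \<le> p" and w: "w \<in> strip"
  shows "(raw i \<longlongrightarrow> branch i w) (at w within ostrip)"
proof -
  have "\<exists>\<rho>\<in>(\<lambda>j. raw j w) ` {..p}. (raw i \<longlongrightarrow> \<rho>) (at w within ostrip)"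
  proof (rule finite_cluster_tendsto)
    fix e :: real assume e: "e > 0"
    obtain d where d: "d > 0" "\<And>x. dist x (point w) < d \<Longrightarrow> \<exists>j\<le>p. dist (zroot b x i) (zroot b (point w) j) < e"
      using root_near_limit_roots[OF b i e, of "point w"] by blast
    have "continuous (at w) point" using point_tendsto[of w UNIV] by (simp add: isCont_def)
    then obtain d' where d': "d' > 0" "\<And>v. dist v w < d' \<Longrightarrow> dist (point v) (point w) < d"
      using d(1) unfolding continuous_at_eps_delta by blast
    have dd: "dist (raw i v) (raw j w) = dist (zroot b (point v) i) (zroot b (point w) j)" for v j
      unfolding raw_def dist_norm right_diff_distrib[symmetric] by (simp add: norm_mult norm_power orient(1))
    show "\<exists>d>0. \<forall>v\<in>ostrip. dist v w < d \<longrightarrow> (\<exists>\<rho>\<in>(\<lambda>j. raw j w) ` {..p}. dist (raw i v) \<rho> < e)"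
      using d(2) d' by (intro exI[of _ d']) (auto simp: dd)
  qed (use strip_topology w raw_holomorphic[OF i] in \<open>auto simp: holomorphic_on_imp_continuous_on\<close>)
  then show ?thesis using tendsto_Lim[OF at_within_ostrip[OF w]] unfolding branch_def by metis
qed

lemma branch_interior:
  assumes i: "i \<le> p" and w: "w \<in> ostrip"
  shows "branch i w = raw i w"
proof -
  have "(raw i \<longlongrightarrow> raw i w) (at w within ostrip)"
    using holomorphic_on_imp_continuous_on[OF raw_holomorphic[OF i]] w by (simp add: continuous_on_def)
  then show ?thesis unfolding branch_def using w strip_topology(4) by (intro tendsto_Lim at_within_ostrip) auto
qed

lemma branch_continuous: "i \<le> p \<Longrightarrow> continuous_on strip (branch i)"
  by (rule continuous_on_limit_extension[where C = ostrip and f = "raw i"])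
     (use branch_tendsto at_within_ostrip strip_topology(6) in auto)

lemma branch_holomorphic: "i \<le> p \<Longrightarrow> branch i holomorphic_on ostrip"
  using raw_holomorphic[of i] holomorphic_cong[OF refl, of ostrip "branch i" "raw i"] branch_interior by blast

lemma branch_modulus:
  assumes i: "i \<le> p" and w: "w \<in> strip"
  shows "cmod (branch i w) = cmod (zroot b (point w) i)"
proof -
  have "((\<lambda>v. cmod (zroot b (point v) i)) \<longlongrightarrow> cmod (zroot b (point w) i)) (at w within ostrip)"
    using isCont_tendsto_compose[OF _ point_tendsto, of w "\<lambda>x. cmod (zroot b x i)"] root_modulus_isCont[OF b i]
    by (simp add: isCont_def)
  moreover have "((\<lambda>v. cmod (zroot b (point v) i)) \<longlongrightarrow> cmod (branch i w)) (at w within ostrip)"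
    using tendsto_norm[OF branch_tendsto[OF i w]] by (simp only: cmod_raw)
  ultimately show ?thesis using tendsto_unique[OF at_within_ostrip[OF w]] by blast
qed

lemma branch_nz: "i \<le> p \<Longrightarrow> w \<in> strip \<Longrightarrow> branch i w \<noteq> 0"
  using branch_modulus[of i w] root_props(2)[OF b, of i] by auto

text \<open>Passing to the limit in the factorisation shows that on the edges, too, the branches
  list all roots with multiplicity.\<close>

lemma branch_poly:
  assumes w: "w \<in> strip"
  shows "poly (symbol_poly b (point w)) s = lead_coeff (symbol_poly b 0) * (\<Prod>i<p + 1. s - branch i w / orient ^ r)"
proof -
  have e: "poly (symbol_poly b (point v)) s = lead_coeff (symbol_poly b 0) * (\<Prod>i<p + 1. s - raw i v / orient ^ r)" for v
    unfolding symbol_poly_prod_lead[OF b, of "point v"] symbol_poly_lead(3)[OF b, of "point v" 0]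
    using orient(2) by (simp add: raw_def)
  have l: "((\<lambda>v. lead_coeff (symbol_poly b 0) * (\<Prod>i<p + 1. s - raw i v / orient ^ r)) \<longlongrightarrow>
      lead_coeff (symbol_poly b 0) * (\<Prod>i<p + 1. s - branch i w / orient ^ r)) (at w within ostrip)"
    using w orient(2) by (intro tendsto_intros branch_tendsto) auto
  have "((\<lambda>v. poly (symbol_poly b (point v)) s) \<longlongrightarrow> poly (symbol_poly b (point w)) s) (at w within ostrip)"
    by (intro symbol_poly_jointly_tendsto b point_tendsto tendsto_const)
  then show ?thesis using l unfolding e by (rule tendsto_unique[OF at_within_ostrip[OF w]])
qed

definition lg :: "nat \<Rightarrow> complex \<Rightarrow> complex" where
  "lg i = (SOME g. continuous_on strip g \<and> (\<forall>w\<in>strip. branch i w = exp (g w)))"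

lemma lg:
  assumes "i \<le> p"
  shows "continuous_on strip (lg i)" "w \<in> strip \<Longrightarrow> branch i w = exp (lg i w)" "lg i holomorphic_on ostrip"
    "w \<in> strip \<Longrightarrow> Re (lg i w) = ln (cmod (zroot b (point w) i))"
proof -
  have "contractible strip" using strip_topology(1) by (rule convex_imp_contractible)
  then obtain g where "continuous_on strip g" "\<And>w. w \<in> strip \<Longrightarrow> branch i w = exp (g w)"
    using continuous_logarithm_on_contractible[OF branch_continuous[OF assms]] branch_nz[OF assms] by blast
  then have "continuous_on strip g \<and> (\<forall>w\<in>strip. branch i w = exp (g w))" by blast
  then have *: "continuous_on strip (lg i) \<and> (\<forall>w\<in>strip. branch i w = exp (lg i w))" unfolding lg_def by (rule someI[where P = "\<lambda>g. continuous_on strip g \<and> (\<forall>w\<in>strip. branch i w = exp (g w))"])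
  then show "continuous_on strip (lg i)" and e: "w \<in> strip \<Longrightarrow> branch i w = exp (lg i w)" for w by auto
  show "lg i holomorphic_on ostrip"
    by (rule continuous_log_holomorphic[OF branch_holomorphic[OF assms] strip_topology(3)])
       (use * strip_topology(4) continuous_on_subset in auto)
  show "Re (lg i w) = ln (cmod (zroot b (point w) i))" if "w \<in> strip"
    using branch_modulus[OF assms that] e[OF that] by (metis ln_exp norm_exp_eq_Re)
qed

end

subsection \<open>Growth of the roots\<close>

context shift_symbol
begin

text \<open>Comparing the three terms of the recurrence where \<open>cmod (u n) * w ^ n\<close> is largest.\<close>

lemma root_balance:
  assumes bnd: "\<And>j. j < r \<Longrightarrow> \<beta> \<le> b j" "\<And>j. j < r \<Longrightarrow> b j \<le> B" "0 < \<beta>" and z: "z \<noteq> 0" "symbol_f p r b z x = 0"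
  shows "\<exists>w>0. w ^ r = cmod z \<and> cmod x * w \<le> 1 + B * w ^ (p + 1) \<and> \<beta> * w ^ (p + 1) \<le> 1 + cmod x * w"
proof -
  obtain u where u: "floquet_solution b x z u" using z symbol_root_iff by blast
  define w where "w = cmod z powr (1 / real r)"
  have w: "w > 0" "w ^ r = cmod z" using z r by (auto simp: w_def powr_realpow[symmetric] powr_powr)
  define q where "q n = cmod (u n) * w ^ n" for n
  have per: "q (n + r) = q n" for n
    using u w z by (simp add: q_def floquet_solution_def norm_divide power_add)
  have perm: "q (n + r * m) = q n" for n m
    by (induction m) (use per in \<open>auto simp: algebra_simps\<close>, metis add.assoc add.commute per)
  have qmod: "q n = q (n mod r)" for n using perm[of "n mod r" "n div r"] by simp
  define M where "M = Max (q ` {..<r})"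
  have M: "q n \<le> M" for n unfolding M_def qmod[of n] using r by (intro Max_ge) auto
  obtain n0 where n0: "n0 < r" "q n0 = M"
  proof -
    have "q 0 \<in> q ` {..<r}" using r by auto
    then have "M \<in> q ` {..<r}" unfolding M_def by (intro Max_in) auto
    then show ?thesis using that by auto
  qed
  obtain n1 where "u n1 \<noteq> 0" using u by (auto simp: floquet_solution_def)
  then have "q n1 > 0" using w by (simp add: q_def)
  then have Mpos: "M > 0" using M[of n1] by linarith
  define c where "c n = b (n mod r)" for n
  have c: "\<beta> \<le> c n" "c n \<le> B" "0 < c n" for n
  proof -
    have "n mod r < r" using r by simp
    then show "\<beta> \<le> c n" "c n \<le> B" unfolding c_def using bnd by auto
    then show "0 < c n" using bnd(3) by linarith
  qed
  have rec: "u (n + p + 1) = x * u (n + p) - of_real (c n) * u n" for n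
    using u by (simp add: floquet_solution_def c_def)
  have split: "cmod x * w * q (n + p) = cmod (x * u (n + p)) * w ^ (n + p + 1)"
    "c n * w ^ (p + 1) * q n = cmod (of_real (c n) * u n) * w ^ (n + p + 1)" for n
    using c(3)[of n] by (simp_all add: q_def norm_mult power_add)
  have wn: "w ^ n \<ge> 0" for n using w(1) by simp
  have r1: "cmod x * w * q (n + p) \<le> q (n + p + 1) + c n * w ^ (p + 1) * q n" for n
  proof -
    have "cmod (x * u (n + p)) \<le> cmod (u (n + p + 1)) + cmod (of_real (c n) * u n)"
      using norm_triangle_ineq[of "u (n + p + 1)" "of_real (c n) * u n"] unfolding rec[of n] by simp
    then show ?thesis unfolding split q_def[of "n + p + 1"] distrib_right[symmetric] using wn by (rule mult_right_mono)
  qed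
  have r2: "c n * w ^ (p + 1) * q n \<le> q (n + p + 1) + cmod x * w * q (n + p)" for n
  proof -
    have "cmod (of_real (c n) * u n) \<le> cmod (u (n + p + 1)) + cmod (x * u (n + p))"
      using norm_triangle_ineq4[of "x * u (n + p)" "u (n + p + 1)"] unfolding rec[of n] by simp
    then show ?thesis unfolding split q_def[of "n + p + 1"] distrib_right[symmetric] using wn by (rule mult_right_mono)
  qed
  \<comment> \<open>The upper bound for \<open>cmod x * w\<close> needs the largest term at
    \<open>n2 + p\<close>, a periodic copy of \<open>n0\<close>; the bound for
    \<open>w ^ (p + 1)\<close> needs it at \<open>n0\<close> itself.\<close>
  define n2 where "n2 = n0 + r * p - p"
  have "p \<le> r * p" using mult_le_mono1[OF r, of p] by simp
  then have "n2 + p = n0 + r * p" unfolding n2_def by (intro le_add_diff_inverse2 trans_le_add2)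
  then have n2: "q (n2 + p) = M" using perm[of n0 p] n0(2) by simp
  have "0 \<le> c n2 * w ^ (p + 1)" using c(3)[of n2] w(1) by (intro mult_nonneg_nonneg) auto
  then have "c n2 * w ^ (p + 1) * q n2 \<le> c n2 * w ^ (p + 1) * M" by (rule mult_left_mono[OF M])
  then have "cmod x * w * M \<le> M + c n2 * w ^ (p + 1) * M"
    using r1[of n2] M[of "n2 + p + 1"] unfolding n2 by linarith
  also have "\<dots> \<le> M + B * w ^ (p + 1) * M" using c(2)[of n2] w(1) Mpos by (intro add_left_mono mult_right_mono) auto
  finally have "cmod x * w * M \<le> (1 + B * w ^ (p + 1)) * M" by (simp add: algebra_simps)
  then have A: "cmod x * w \<le> 1 + B * w ^ (p + 1)" using Mpos by (rule mult_right_le_imp_le)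
  have "\<beta> * w ^ (p + 1) * M \<le> c n0 * w ^ (p + 1) * M" using c(1)[of n0] w(1) Mpos by (intro mult_right_mono) auto
  also have "\<dots> \<le> M + cmod x * w * M"
    using r2[of n0] M[of "n0 + p + 1"] mult_left_mono[OF M[of "n0 + p"], of "cmod x * w"] w(1) unfolding n0(2) by auto
  finally have "\<beta> * w ^ (p + 1) * M \<le> (1 + cmod x * w) * M" by (simp add: algebra_simps)
  then have "\<beta> * w ^ (p + 1) \<le> 1 + cmod x * w" using Mpos by (rule mult_right_le_imp_le)
  then show ?thesis using A w by blast
qed

text \<open>The constant and the leading coefficient of \<open>symbol_poly\<close> do not depend on
  \<open>x\<close>, so neither does the product of the roots.\<close>

lemma root_moduli_product:
  assumes b: "pos_weights b"
  shows "(\<Sum>i\<le>p. ln (cmod (zroot b x i))) = - ln (cmod (lead_coeff (symbol_poly b 0)))"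
proof -
  define l where "l = lead_coeff (symbol_poly b 0)"
  have l: "l \<noteq> 0" using symbol_poly_lead(2)[OF b] by (simp add: l_def)
  have nz: "zroot b x i \<noteq> 0" if "i \<le> p" for i using root_props(2)[OF b that] .
  have "1 = l * (\<Prod>i<p + 1. 0 - zroot b x i)"
    using symbol_poly_prod_lead[OF b, of x 0] unfolding poly_symbol_poly_0 symbol_poly_lead(3)[OF b, of x 0] l_def .
  then have "1 = cmod (l * (\<Prod>i<p + 1. 0 - zroot b x i))" by simp
  also have "\<dots> = cmod l * (\<Prod>i\<le>p. cmod (zroot b x i))" by (simp add: norm_mult prod_norm[symmetric] lessThan_Suc_atMost del: prod.lessThan_Suc)
  finally have "ln 1 = ln (cmod l * (\<Prod>i\<le>p. cmod (zroot b x i)))" by simp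
  also have "\<dots> = ln (cmod l) + ln (\<Prod>i\<le>p. cmod (zroot b x i))" using l nz by (intro ln_mult_pos prod_pos) auto
  also have "ln (\<Prod>i\<le>p. cmod (zroot b x i)) = (\<Sum>i\<le>p. ln (cmod (zroot b x i)))" using nz by (intro ln_prod) auto
  finally show ?thesis by (simp add: l_def)
qed

text \<open>By the balance each root is either of order \<open>cmod x powr (- r)\<close> or of order \<open>cmod x powr (r / p)\<close>;
  since the product of all roots is constant, exactly one is small.\<close>

lemma root_growth:
  assumes b: "pos_weights b"
  shows "\<exists>M X0. 1 \<le> X0 \<and> (\<forall>x i. X0 \<le> cmod x \<longrightarrow> i \<le> p \<longrightarrow>
    \<bar>ln (cmod (zroot b x i)) - (if i = 0 then - real r else real r / real p) * ln (cmod x)\<bar> \<le> M)"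
proof -
  define \<beta> where "\<beta> = Min (b ` {..<r})"
  define B where "B = Max (b ` {..<r})"
  have rne: "b ` {..<r} \<noteq> {}" using r by (auto simp: lessThan_empty_iff)
  have bnd: "\<And>j. j < r \<Longrightarrow> \<beta> \<le> b j" "\<And>j. j < r \<Longrightarrow> b j \<le> B" by (auto simp: \<beta>_def B_def)
  have \<beta>: "0 < \<beta>" unfolding \<beta>_def using rne b by (subst Min_gr_iff) (auto simp: pos_weights_def)
  have B: "0 < B" using \<beta> bnd[of 0] r by force
  have p0: "0 < real p" and r0: "0 < real r" using p r by auto
  \<comment> \<open>\<open>\<kappa>\<close> is the fixed sum of the \<open>y j\<close> introduced
    below, \<open>M1\<close> the error in their upper bound \<open>a / p + M1\<close>, and beyond
    \<open>a0\<close> the assumption that all \<open>p + 1\<close> roots are large contradicts the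
    sum \<open>\<kappa>\<close>.\<close>
  define \<kappa> where "\<kappa> = - ln (cmod (lead_coeff (symbol_poly b 0))) / r"
  define M1 where "M1 = \<bar>ln (2 / \<beta>)\<bar> / p"
  define a0 where "a0 = real p * \<bar>\<kappa>\<bar> + \<bar>ln (2 * B)\<bar> + 1"
  define M where "M = \<bar>\<kappa>\<bar> + ln 2 + real p * M1"
  have M1: "M1 \<ge> 0" by (simp add: M1_def)
  have main: "\<bar>ln (cmod (zroot b x i)) - (if i = 0 then - real r else real r / real p) * ln (cmod x)\<bar> \<le> r * M"
    if X: "exp a0 \<le> cmod x" and i: "i \<le> p" for x i
  proof -
    define a where "a = ln (cmod x)"
    have xpos: "0 < cmod x" using X exp_gt_zero[of a0] by linarith
    have aa: "a0 \<le> a" using X xpos unfolding a_def by (simp add: ln_ge_iff)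
    have "0 \<le> real p * \<bar>\<kappa>\<bar>" by simp
    then have a1: "a \<ge> 1" using aa abs_ge_zero[of "ln (2 * B)"] unfolding a0_def by linarith
    have "\<exists>w>0. w ^ r = cmod (zroot b x j) \<and> cmod x * w \<le> 1 + B * w ^ (p + 1) \<and> \<beta> * w ^ (p + 1) \<le> 1 + cmod x * w" if "j \<le> p" for j
      by (rule root_balance[OF bnd \<beta>]) (use root_props[OF b that] in auto)
    then obtain w where w: "\<And>j. j \<le> p \<Longrightarrow> 0 < w j" "\<And>j. j \<le> p \<Longrightarrow> w j ^ r = cmod (zroot b x j)"
      "\<And>j. j \<le> p \<Longrightarrow> cmod x * w j \<le> 1 + B * w j ^ (p + 1)" "\<And>j. j \<le> p \<Longrightarrow> \<beta> * w j ^ (p + 1) \<le> 1 + cmod x * w j"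
      by metis
    define y where "y j = ln (w j)" for j
    have ry: "real r * y j = ln (cmod (zroot b x j))" if "j \<le> p" for j
      using w(1,2)[OF that] by (simp add: y_def ln_realpow flip: w(2)[OF that])
    have sum: "(\<Sum>j\<le>p. y j) = \<kappa>"
    proof -
      have "real r * (\<Sum>j\<le>p. y j) = (\<Sum>j\<le>p. ln (cmod (zroot b x j)))" unfolding sum_distrib_left by (intro sum.cong) (auto simp: ry)
      then show ?thesis unfolding root_moduli_product[OF b] \<kappa>_def using r0 by (simp add: field_simps)
    qed
    have up: "y j \<le> a / p + M1" if j: "j \<le> p" for j
    proof (cases "1 \<le> cmod x * w j")
      case True
      have "w j * (\<beta> * w j ^ p) \<le> w j * (2 * cmod x)" using w(4)[OF j] True by (simp add: mult_ac)
      then have "\<beta> * w j ^ p \<le> 2 * cmod x" using w(1)[OF j] by simp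
      then have "w j ^ p \<le> 2 / \<beta> * cmod x" using \<beta> by (simp add: field_simps)
      moreover have "0 < w j ^ p" "0 < 2 / \<beta> * cmod x" using w(1)[OF j] \<beta> xpos by auto
      ultimately have "ln (w j ^ p) \<le> ln (2 / \<beta> * cmod x)" by (simp only: ln_le_cancel_iff)
      also have "\<dots> = ln (2 / \<beta>) + a" unfolding a_def using \<beta> xpos by (intro ln_mult_pos) auto
      finally have "real p * y j \<le> \<bar>ln (2 / \<beta>)\<bar> + a" using w(1)[OF j] by (simp add: y_def ln_realpow)
      then have "y j \<le> (\<bar>ln (2 / \<beta>)\<bar> + a) / p" using p0 by (simp add: pos_le_divide_eq mult.commute)
      then show ?thesis by (simp add: M1_def add_divide_distrib)
    next
      case False
      then have "ln (cmod x * w j) \<le> 0" using w(1)[OF j] xpos by simp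
      then have "a + y j \<le> 0" unfolding a_def y_def using w(1)[OF j] xpos by (simp add: ln_mult_pos)
      moreover have "0 \<le> a / p" using a1 by simp
      ultimately show ?thesis using a1 M1 by linarith
    qed
    \<comment> \<open>If the smallest root were not small, all roots would be of the large kind, and
      their logarithms would add up to more than \<open>\<kappa>\<close>.\<close>
    have y0: "y 0 \<le> ln 2 - a"
    proof (rule ccontr)
      assume "\<not> ?thesis"
      then have "ln 2 < ln (w 0 * cmod x)" unfolding a_def y_def using w(1)[of 0] xpos by (simp add: ln_mult_pos)
      then have big0: "2 < w 0 * cmod x" using w(1)[of 0] xpos by simp
      have low: "(a - ln (2 * B)) / p \<le> y j" if j: "j \<le> p" for j
      proof -
        have "w 0 ^ r \<le> w j ^ r" using root_mset(2)[OF b _ j, of 0 x] w(2)[of 0] w(2)[OF j] by simp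
        then have "w 0 \<le> w j" using w(1)[OF j] w(1)[of 0] r by simp
        then have "w 0 * cmod x \<le> w j * cmod x" by (rule mult_right_mono) simp
        then have "2 < cmod x * w j" using big0 by (simp add: mult.commute)
        then have "w j * cmod x \<le> w j * (2 * B * w j ^ p)" using w(3)[OF j] by (simp add: mult_ac)
        then have "cmod x \<le> 2 * B * w j ^ p" using w(1)[OF j] by simp
        moreover have "0 < 2 * B * w j ^ p" using B w(1)[OF j] by simp
        ultimately have "a \<le> ln (2 * B * w j ^ p)" unfolding a_def using xpos by (simp only: ln_le_cancel_iff)
        also have "\<dots> = ln (2 * B) + real p * y j" unfolding y_def using B w(1)[OF j] by (simp add: ln_mult_pos ln_realpow)
        finally show ?thesis using p0 by (simp add: pos_divide_le_eq mult.commute)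
      qed
      have "(\<Sum>j\<le>p. (a - ln (2 * B)) / p) \<le> (\<Sum>j\<le>p. y j)" by (intro sum_mono low) auto
      then have "real (p + 1) * ((a - ln (2 * B)) / p) \<le> \<kappa>" unfolding sum by simp
      then have "real (p + 1) * (a - ln (2 * B)) \<le> real p * \<kappa>" using p0 by (simp add: field_simps)
      moreover have "1 * (a - ln (2 * B)) \<le> real (p + 1) * (a - ln (2 * B))"
      proof (rule mult_right_mono)
        show "0 \<le> a - ln (2 * B)" using aa \<open>0 \<le> real p * \<bar>\<kappa>\<bar>\<close> abs_ge_self[of "ln (2 * B)"] unfolding a0_def by linarith
      qed simp
      moreover have "real p * \<kappa> \<le> real p * \<bar>\<kappa>\<bar>" by (intro mult_left_mono) auto
      ultimately show False using aa by (simp add: a0_def)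
    qed
    \<comment> \<open>As the sum is fixed, upper bounds for the other terms become a lower bound for
      each single one.\<close>
    have s0: "(\<Sum>j\<le>p. y j) = y 0 + (\<Sum>j\<in>{..p} - {0}. y j)" by (rule sum.remove) auto
    have ub: "(\<Sum>j\<in>J. y j) \<le> card J * (a / p + M1)" if "J \<subseteq> {..p}" for J
      using sum_mono[of J y "\<lambda>_. a / p + M1"] up that by (auto simp: subset_iff)
    have "\<bar>y i - (if i = 0 then -1 else 1 / p) * a\<bar> \<le> M"
    proof (cases "i = 0")
      case True
      have "(\<Sum>j\<in>{..p} - {0}. y j) \<le> p * (a / p + M1)" using ub[of "{..p} - {0}"] by simp
      then have "(\<Sum>j\<in>{..p} - {0}. y j) \<le> a + p * M1" using p0 by (simp add: algebra_simps)
      moreover have "0 \<le> p * M1" using M1 p0 by simp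
      moreover have "0 \<le> ln (2::real)" by simp
      ultimately have "\<bar>y 0 - (-1) * a\<bar> \<le> M"
        unfolding M_def abs_le_iff using y0 s0[unfolded sum] abs_ge_self[of \<kappa>] abs_ge_minus_self[of \<kappa>] by linarith
      then show ?thesis using True by simp
    next
      case False
      have "(\<Sum>j\<in>{..p} - {0}. y j) = y i + (\<Sum>j\<in>{..p} - {0} - {i}. y j)" using False i by (intro sum.remove) auto
      moreover have "(\<Sum>j\<in>{..p} - {0} - {i}. y j) \<le> (p - 1) * (a / p + M1)"
      proof -
        have "{..p} - {0} - {i} \<subseteq> {..p}" by auto
        moreover have "card ({..p} - {0} - {i}) = p - 1" using False i by (simp add: card_Diff_singleton_if)
        ultimately show ?thesis using ub by metis
      qed
      moreover have "real (p - 1) * (a / p + M1) = a - a / p + p * M1 - M1"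
        using p0 p by (simp add: of_nat_diff field_simps)
      ultimately have "\<kappa> - ln 2 + a / p - p * M1 + M1 \<le> y i" using y0 s0 sum by linarith
      moreover have "M1 \<le> p * M1" using mult_right_mono[of 1 "real p" M1] M1 p by simp
      moreover have "0 \<le> ln (2::real)" by simp
      ultimately have "\<bar>y i - a / p\<bar> \<le> M"
        unfolding M_def abs_le_iff using up[OF i] M1 abs_ge_self[of \<kappa>] abs_ge_minus_self[of \<kappa>] by linarith
      then show ?thesis using False by simp
    qed
    then have "r * \<bar>y i - (if i = 0 then -1 else 1 / p) * a\<bar> \<le> r * M" by (intro mult_left_mono) auto
    moreover have "r * \<bar>y i - (if i = 0 then -1 else 1 / p) * a\<bar> = \<bar>r * (y i - (if i = 0 then -1 else 1 / p) * a)\<bar>"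
      using r0 by (simp add: abs_mult)
    moreover have "r * (y i - (if i = 0 then -1 else 1 / p) * a) = ln (cmod (zroot b x i)) - (if i = 0 then - real r else real r / real p) * ln (cmod x)"
      unfolding ry[OF i, symmetric] a_def by (simp add: algebra_simps)
    ultimately show ?thesis by simp
  qed
  have "1 \<le> exp a0" using p0 by (simp add: a0_def)
  then show ?thesis using main by blast
qed

text \<open>Near the origin no power of \<open>cmod x\<close> has to be split off: by compactness
  the moduli stay bounded and away from \<open>0\<close>.\<close>

lemma root_log_bounded:
  assumes b: "pos_weights b"
  shows "\<exists>M. \<forall>x i. cmod x \<le> 1 \<longrightarrow> i \<le> p \<longrightarrow> \<bar>ln (cmod (zroot b x i))\<bar> \<le> M"
proof -
  have "\<exists>M. \<forall>x. cmod x \<le> 1 \<longrightarrow> \<bar>ln (cmod (zroot b x i))\<bar> \<le> M" if i: "i \<le> p" for i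
  proof -
    have "continuous_on (cball 0 1) (\<lambda>x. ln (cmod (zroot b x i)))"
      using root_props(2)[OF b i] by (intro continuous_on_ln root_modulus_continuous b i) auto
    then have "bounded ((\<lambda>x. ln (cmod (zroot b x i))) ` cball 0 1)"
      by (intro compact_imp_bounded compact_continuous_image) auto
    then obtain M where M: "\<forall>x\<in>cball 0 1. \<bar>ln (cmod (zroot b x i))\<bar> \<le> M" unfolding bounded_iff by auto
    show ?thesis by (intro exI[of _ M]) (use M in \<open>auto simp: dist_norm\<close>)
  qed
  then obtain M where M: "\<And>i x. i \<le> p \<Longrightarrow> cmod x \<le> 1 \<Longrightarrow> \<bar>ln (cmod (zroot b x i))\<bar> \<le> M i" by metis
  have "M i \<le> (\<Sum>i\<le>p. \<bar>M i\<bar>)" if "i \<le> p" for i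
    using member_le_sum[of i "{..p}" "\<lambda>i. \<bar>M i\<bar>"] that by fastforce
  then show ?thesis using M by (meson order_trans)
qed

end

subsection \<open>The phase of a root along the ray of possible ties\<close>

lemma line_derivative:
  fixes g :: "complex \<Rightarrow> complex"
  assumes D: "(g has_field_derivative D) (at (a + of_real t * v) within S)" and S: "\<And>s. s \<in> J \<Longrightarrow> a + of_real s * v \<in> S"
  shows "((\<lambda>s. g (a + of_real s * v)) has_vector_derivative v * D) (at t within J)"
proof -
  have l: "((\<lambda>s. a + of_real s * v) has_vector_derivative v) (at t within J)"
    by (auto intro!: derivative_eq_intros simp: has_vector_derivative_def scaleR_conv_of_real)
  have "(\<lambda>s. a + of_real s * v) ` J \<subseteq> S" using S by auto
  then have "(g has_field_derivative D) (at (a + of_real t * v) within (\<lambda>s. a + of_real s * v) ` J)"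
    by (rule has_field_derivative_subset[OF D])
  then show ?thesis using field_vector_diff_chain_within[OF l] by (simp add: o_def)
qed

lemma has_vector_derivative_Im:
  "(f has_vector_derivative D) F \<Longrightarrow> ((\<lambda>s. Im (f s)) has_real_derivative Im D) F"
  using bounded_linear.has_vector_derivative[OF bounded_linear_Im] has_real_derivative_iff_has_vector_derivative by blast

lemma has_vector_derivative_Re:
  "(f has_vector_derivative D) F \<Longrightarrow> ((\<lambda>s. Re (f s)) has_real_derivative Re D) F"
  using bounded_linear.has_vector_derivative[OF bounded_linear_Re] has_real_derivative_iff_has_vector_derivative by blast

context root_strip
begin

text \<open>The phase of the product of the \<open>m\<close> smallest roots; unlike a single phase
  it is known modulo \<open>pi\<close> on an edge where these roots are separated from the
  rest.\<close>

definition psum :: "nat \<Rightarrow> complex \<Rightarrow> real" where "psum m w = (\<Sum>i<m. Im (lg i w))"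

text \<open>This is \<open>partial_product_real\<close> for the direction \<open>u\<close> of the
  edge. The term with \<open>Im w\<close> makes up for the difference between the rotation by
  \<open>u ^ r\<close> and the rotation by \<open>orient ^ r\<close> already contained in each of
  the \<open>m\<close> branches.\<close>

lemma psum_edge:
  assumes w: "w \<in> strip" and edge: "Im w = 0 \<or> Im w = width" and m: "m \<le> p + 1"
    and gap: "0 < m \<Longrightarrow> m \<le> p \<Longrightarrow> (even (m - 1) = even k) = (Im w = width)"
  shows "sin (psum m w + real (r * m) * Im w) = 0"
proof -
  define u where "u = orient * cis (Im w)"
  have "cis (Im w) ^ (2 * (p + 1)) = cis (2 * pi * (if Im w = 0 then 0 else 1))"
    unfolding Complex.DeMoivre using width(2) edge by (intro arg_cong[of _ _ cis]) (auto simp: algebra_simps)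
  also have "\<dots> = 1" by (rule cis_multiple_2pi) simp
  finally have u2: "u ^ (2 * (p + 1)) = 1" unfolding u_def power_mult_distrib orient(3) by simp
  have u1: "cmod u = 1" by (simp add: u_def norm_mult orient(1))
  have x: "point w = of_real (exp (Re w)) * u" by (simp add: point_def u_def exp_eq_polar)
  have lt: "i \<le> p" if "i < m" for i using that m by simp
  have ne: "width \<noteq> 0" using width(1) by simp
  have "Im (\<Prod>i<m. u ^ r * (branch i w / orient ^ r)) = 0"
  proof (rule partial_product_real[OF b u1 u2 x branch_poly[OF w] _ m])
    show "cmod (branch i w / orient ^ r) \<le> cmod (branch j w / orient ^ r)" if "i \<le> j" "j \<le> p" for i j
      using root_mset(2)[OF b that] that by (simp add: norm_divide norm_power orient(1) branch_modulus w)
    show "cmod (branch (m - 1) w / orient ^ r) < cmod (branch m w / orient ^ r)" if mm: "0 < m" "m \<le> p"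
    proof -
      have "cmod (zroot b (point w) (m - 1)) < cmod (zroot b (point w) (m - 1 + 1))"
        by (rule modulus_gap[OF w]) (use mm gap[OF mm] ne in auto)
      then show ?thesis using mm by (simp add: norm_divide norm_power orient(1) branch_modulus w)
    qed
  qed
  also have "(\<Prod>i<m. u ^ r * (branch i w / orient ^ r)) = (\<Prod>i<m. exp (lg i w + \<i> * of_real (real r * Im w)))"
  proof (intro prod.cong refl)
    fix i assume "i \<in> {..<m}"
    then have "branch i w = exp (lg i w)" using lg(2)[OF lt w] by simp
    moreover have "u ^ r = orient ^ r * exp (\<i> * of_real (real r * Im w))"
      unfolding u_def power_mult_distrib Complex.DeMoivre by (simp add: cis_conv_exp)
    ultimately show "u ^ r * (branch i w / orient ^ r) = exp (lg i w + \<i> * of_real (real r * Im w))"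
      using orient(2) by (simp add: exp_add)
  qed
  also have "\<dots> = exp (\<Sum>i<m. lg i w + \<i> * of_real (real r * Im w))" by (simp add: exp_sum)
  finally have "sin (Im (\<Sum>i<m. lg i w + \<i> * of_real (real r * Im w))) = 0" by (simp add: Im_exp)
  moreover have "Im (\<Sum>i<m. lg i w + \<i> * of_real (real r * Im w)) = psum m w + real (r * m) * Im w"
    by (simp add: psum_def sum.distrib)
  ultimately show ?thesis by simp
qed

lemma line_in_strip: "0 \<le> \<psi> \<Longrightarrow> \<psi> \<le> width \<Longrightarrow> Complex \<sigma> \<psi> \<in> strip"
  by (simp add: strip_def)

lemma lg_line_continuous:
  assumes "i \<le> p" "0 \<le> \<psi>" "\<psi> \<le> width"
  shows "continuous_on UNIV (\<lambda>\<sigma>. lg i (Complex \<sigma> \<psi>))"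
proof -
  have "continuous_on UNIV (\<lambda>\<sigma>. of_real \<sigma> + \<i> * of_real \<psi>)" by (intro continuous_intros)
  then have "continuous_on UNIV (\<lambda>\<sigma>. Complex \<sigma> \<psi>)" by (simp add: Complex_eq)
  then show ?thesis
    by (rule continuous_on_compose2[OF lg(1)[OF assms(1)]]) (use line_in_strip[OF assms(2,3)] in auto)
qed

lemma psum_edge_constant:
  assumes edge: "\<psi> = 0 \<or> \<psi> = width" and m: "m \<le> p + 1"
    and gap: "0 < m \<Longrightarrow> m \<le> p \<Longrightarrow> (even (m - 1) = even k) = (\<psi> = width)"
  shows "psum m (Complex \<sigma> \<psi>) = psum m (Complex \<sigma>' \<psi>)"
proof -
  have \<psi>: "0 \<le> \<psi>" "\<psi> \<le> width" using edge width(1) by auto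
  have "psum m (Complex \<sigma> \<psi>) + real (r * m) * \<psi> = psum m (Complex \<sigma>' \<psi>) + real (r * m) * \<psi>"
  proof (rule sin_zero_continuous_constant[where T = UNIV and f = "\<lambda>\<sigma>. psum m (Complex \<sigma> \<psi>) + real (r * m) * \<psi>" and x = \<sigma> and y = \<sigma>'])
    show "continuous_on UNIV (\<lambda>\<sigma>. psum m (Complex \<sigma> \<psi>) + real (r * m) * \<psi>)"
      unfolding psum_def using m \<psi> by (intro continuous_intros lg_line_continuous) auto
    show "sin (psum m (Complex \<sigma> \<psi>) + real (r * m) * \<psi>) = 0" for \<sigma>
      using psum_edge[of "Complex \<sigma> \<psi>" m] line_in_strip[OF \<psi>] edge m gap by simp
  qed auto
  then show ?thesis by simp
qed

definition phase :: "real \<Rightarrow> real" where "phase \<sigma> = Im (lg k (of_real \<sigma>))"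

text \<open>Inside the strip \<open>Re (lg k)\<close> decreases upwards, so by the Cauchy-Riemann
  equations \<open>Im (lg k)\<close> increases to the right. The ray itself is reached by a limit
  from above, since only continuity is known there.\<close>

lemma phase_mono:
  assumes "\<sigma> \<le> \<sigma>'"
  shows "phase \<sigma> \<le> phase \<sigma>'"
proof -
  have kp: "k \<le> p" using k by simp
  have inner: "Im (lg k (Complex \<sigma> \<psi>)) \<le> Im (lg k (Complex \<sigma>' \<psi>))" if \<psi>: "0 < \<psi>" "\<psi> < width" for \<psi>
  proof -
    define A where "A = \<i> * complex_of_real \<psi>"
    have "\<exists>D. ((\<lambda>s. Im (lg k (A + of_real s * 1))) has_real_derivative D) (at s) \<and> 0 \<le> D" for s
    proof -
      have o: "A + of_real s * 1 \<in> ostrip" using \<psi> by (simp add: A_def ostrip_def)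
      then obtain D where D: "(lg k has_field_derivative D) (at (A + of_real s * 1))"
        using lg(3)[OF kp] strip_topology(3) by (auto simp: holomorphic_on_open)
      have "((\<lambda>s. Im (lg k (A + of_real s * 1))) has_real_derivative Im (1 * D)) (at s)"
        using D by (intro has_vector_derivative_Im line_derivative[where S = UNIV]) auto
      moreover have "Im D \<ge> 0"
      proof -
        have e: "of_real s + of_real \<psi> * \<i> = A + of_real s * 1" by (simp add: A_def)
        have "((\<lambda>t. Re (lg k (of_real s + of_real t * \<i>))) has_real_derivative Re (\<i> * D)) (at \<psi>)"
          using D unfolding e[symmetric] by (intro has_vector_derivative_Re line_derivative[where S = UNIV]) auto
        then have "((\<lambda>t. - Re (lg k (of_real s + of_real t * \<i>))) has_real_derivative - Re (\<i> * D)) (at \<psi>)"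
          by (rule DERIV_minus)
        moreover have "mono_on {0<..<width} (\<lambda>t. - Re (lg k (of_real s + of_real t * \<i>)))"
        proof (rule mono_onI)
          fix t t' assume t: "t \<in> {0<..<width}" "t' \<in> {0<..<width}" "t \<le> t'"
          let ?w = "\<lambda>t. complex_of_real s + of_real t * \<i>"
          have st: "?w t \<in> strip" "?w t' \<in> strip" using t by (auto simp: strip_def)
          have "cmod (zroot b (point (?w t')) k) \<le> cmod (zroot b (point (?w t)) k)"
            using modulus_vertical(1)[OF st _ _ kp] t by (cases "t = t'") auto
          moreover have "zroot b (point (?w t')) k \<noteq> 0" using root_props(2)[OF b kp] .
          ultimately show "- Re (lg k (?w t)) \<le> - Re (lg k (?w t'))" using st by (simp add: lg(4)[OF kp] root_props(2)[OF b kp])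
        qed
        ultimately have "- Re (\<i> * D) \<ge> 0" using \<psi> by (intro mono_on_imp_deriv_nonneg) (auto simp: interior_open)
        then show ?thesis by simp
      qed
      ultimately show ?thesis by auto
    qed
    then have "Im (lg k (A + of_real \<sigma> * 1)) \<le> Im (lg k (A + of_real \<sigma>' * 1))"
      by (intro DERIV_nonneg_imp_nondecreasing[OF assms]) blast
    moreover have "Complex s \<psi> = A + of_real s * 1" for s by (simp add: A_def Complex_eq)
    ultimately show ?thesis by simp
  qed
  have lim: "((\<lambda>\<psi>. Im (lg k (Complex s \<psi>))) \<longlongrightarrow> phase s) (at 0 within {0<..<width})" for s
  proof -
    have "continuous_on {0..width} (\<lambda>\<psi>. of_real s + \<i> * of_real \<psi>)" by (intro continuous_intros)
    then have "continuous_on {0..width} (\<lambda>\<psi>. Complex s \<psi>)" by (simp add: Complex_eq)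
    then have "continuous_on {0..width} (\<lambda>\<psi>. Im (lg k (Complex s \<psi>)))"
      by (intro continuous_on_Im continuous_on_compose2[OF lg(1)[OF kp]]) (auto simp: strip_def)
    then have "((\<lambda>\<psi>. Im (lg k (Complex s \<psi>))) \<longlongrightarrow> Im (lg k (Complex s 0))) (at 0 within {0..width})"
      using width(1) by (simp add: continuous_on_def)
    then have "((\<lambda>\<psi>. Im (lg k (Complex s \<psi>))) \<longlongrightarrow> Im (lg k (Complex s 0))) (at 0 within {0<..<width})"
      by (rule tendsto_within_subset) auto
    then show ?thesis by (simp add: phase_def complex_of_real_def)
  qed
  have nt: "at 0 within {0<..<width} \<noteq> bot" using width(1) by (simp add: trivial_limit_within islimpt_greaterThanLessThan1)
  show ?thesis
    by (rule tendsto_le[OF nt lim lim]) (auto simp: eventually_at_filter inner)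
qed

lemma phase_continuous: "continuous_on UNIV phase"
  using lg_line_continuous[of k 0] k width(1) unfolding phase_def[abs_def] complex_of_real_def
  by (intro continuous_on_Im) auto

text \<open>The difference of the phases at the two edges is the derivative of a function that stays bounded
  where the moduli are comparable to a power of \<open>exp w\<close>; this replaces an integration around a rectangle.\<close>

lemma edge_difference_primitive:
  obtains T where "\<And>\<sigma>. (T has_real_derivative psum (k + 1) (Complex \<sigma> width) - e * width - psum (k + 1) (of_real \<sigma>)) (at \<sigma>)"
    "\<And>\<sigma> M. (\<And>i x. i \<le> k \<Longrightarrow> cmod x = exp \<sigma> \<Longrightarrow> \<bar>ln (cmod (zroot b x i)) - d i * ln (cmod x)\<bar> \<le> M) \<Longrightarrow>
       (\<Sum>i\<le>k. d i) = e \<Longrightarrow> \<bar>T \<sigma>\<bar> \<le> real (k + 1) * M * width"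
proof -
  \<comment> \<open>With \<open>e\<close> the total growth exponent of the roots
    \<open>0, ..., k\<close>, the real part of \<open>E\<close> stays bounded although the single
    logarithms may not.\<close>
  define E where "E w = (\<Sum>i\<le>k. lg i w) - of_real e * w" for w
  have kp: "i \<le> p" if "i \<le> k" for i using that k by simp
  have cE: "continuous_on strip E" unfolding E_def using kp by (intro continuous_intros lg(1)) auto
  have "E holomorphic_on ostrip" unfolding E_def using kp by (intro holomorphic_intros lg(3)) auto
  then have "E field_differentiable at w" if "w \<in> interior strip - {}" for w
    using that strip_topology(3,5) holomorphic_on_imp_differentiable_at by auto
  then obtain g where g: "\<And>w. w \<in> strip \<Longrightarrow> (g has_field_derivative E w) (at w within strip)"
    using holomorphic_convex_primitive[OF strip_topology(1) finite.emptyI cE] by blast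
  define T where "T \<sigma> = Im (g (\<i> * of_real width + of_real \<sigma> * 1)) - Im (g (0 + of_real \<sigma> * 1))" for \<sigma>
  have ImE: "Im (E w) = psum (k + 1) w - e * Im w" for w
    by (simp add: E_def psum_def lessThan_Suc_atMost)
  have "(T has_real_derivative psum (k + 1) (Complex \<sigma> width) - e * width - psum (k + 1) (of_real \<sigma>)) (at \<sigma>)" for \<sigma>
  proof -
    have "((\<lambda>\<sigma>. Im (g (a + of_real \<sigma> * 1))) has_real_derivative Im (1 * E (a + of_real \<sigma> * 1))) (at \<sigma>)"
      if "0 \<le> Im a" "Im a \<le> width" for a
      using that by (intro has_vector_derivative_Im line_derivative[where S = strip] g) (auto simp: strip_def)
    from this[of "\<i> * of_real width"] this[of 0]
    have "(T has_real_derivative Im (1 * E (\<i> * of_real width + of_real \<sigma> * 1)) - Im (1 * E (0 + of_real \<sigma> * 1))) (at \<sigma>)"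
      unfolding T_def[abs_def] using width(1) by (intro DERIV_diff) auto
    moreover have "\<i> * of_real width + of_real \<sigma> * 1 = Complex \<sigma> width" by (simp add: Complex_eq)
    ultimately show ?thesis by (simp add: ImE)
  qed
  moreover have "\<bar>T \<sigma>\<bar> \<le> real (k + 1) * M * width"
    if bd: "\<And>i x. i \<le> k \<Longrightarrow> cmod x = exp \<sigma> \<Longrightarrow> \<bar>ln (cmod (zroot b x i)) - d i * ln (cmod x)\<bar> \<le> M" and e: "(\<Sum>i\<le>k. d i) = e"
    for \<sigma> M
  proof -
    have ReE: "\<bar>Re (E w)\<bar> \<le> real (k + 1) * M" if w: "w \<in> strip" "Re w = \<sigma>" for w
    proof -
      have pm: "cmod (point w) = exp \<sigma>" using w(2) by (simp add: point_def norm_mult orient(1))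
      have "Re (E w) = (\<Sum>i\<le>k. Re (lg i w)) - (\<Sum>i\<le>k. d i) * \<sigma>" using w(2) by (simp add: E_def e)
      also have "\<dots> = (\<Sum>i\<le>k. ln (cmod (zroot b (point w) i)) - d i * ln (cmod (point w)))"
        unfolding sum_subtractf sum_distrib_right pm using lg(4)[OF kp w(1)] by simp
      finally have "\<bar>Re (E w)\<bar> \<le> (\<Sum>i\<le>k. \<bar>ln (cmod (zroot b (point w) i)) - d i * ln (cmod (point w))\<bar>)"
        by (simp only: sum_abs)
      also have "\<dots> \<le> (\<Sum>i\<le>k. M)" by (intro sum_mono bd[OF _ pm]) simp
      finally show ?thesis by simp
    qed
    \<comment> \<open>\<open>T \<sigma>\<close> is the change of \<open>Im g\<close> across the
      strip; the mean value theorem expresses it through \<open>Re E\<close> at one point, the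
      quantity just bounded.\<close>
    have "\<exists>x\<in>{0<..<width}. Im (g (of_real \<sigma> + of_real width * \<i>)) - Im (g (of_real \<sigma> + of_real 0 * \<i>)) = (\<lambda>h. Im (\<i> * E (of_real \<sigma> + of_real x * \<i>)) * h) (width - 0)"
    proof (rule mvt_simple[OF width(1), where f = "\<lambda>t. Im (g (of_real \<sigma> + of_real t * \<i>))" and f' = "\<lambda>x h. Im (\<i> * E (of_real \<sigma> + of_real x * \<i>)) * h"])
      fix t assume t: "0 \<le> t" "t \<le> width"
      have "((\<lambda>t. Im (g (of_real \<sigma> + of_real t * \<i>))) has_real_derivative Im (\<i> * E (of_real \<sigma> + of_real t * \<i>))) (at t within {0..width})"
        using t by (intro has_vector_derivative_Im line_derivative[where S = strip] g) (auto simp: strip_def)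
      then show "((\<lambda>t. Im (g (of_real \<sigma> + of_real t * \<i>))) has_derivative (\<lambda>h. Im (\<i> * E (of_real \<sigma> + of_real t * \<i>)) * h)) (at t within {0..width})"
        by (simp add: has_field_derivative_def)
    qed
    then obtain t where t: "t \<in> {0<..<width}" "T \<sigma> = Re (E (of_real \<sigma> + of_real t * \<i>)) * width"
      by (auto simp: T_def add.commute mult.commute)
    then show ?thesis unfolding t(2) abs_mult using ReE[of "of_real \<sigma> + of_real t * \<i>"] width(1)
      by (simp add: strip_def mult_right_mono)
  qed
  ultimately show thesis using that by blast
qed

text \<open>The phase of the first \<open>k\<close> roots is constant on the lower edge, that of the
  first \<open>k + 1\<close> on the upper edge, both known modulo \<open>pi\<close>. The edge
  difference for \<open>k + 1\<close> roots is therefore a constant minus the phase of root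
  \<open>k\<close>, and a bounded primitive forces its limit at each end to be given by the growth
  exponents there.\<close>

theorem phase_profile:
  obtains B :: "real \<Rightarrow> real" where "continuous_on UNIV B" "\<And>s t. s \<le> t \<Longrightarrow> B t \<le> B s"
    "\<And>s. real r * real k / real p \<le> B s" "\<And>s. B s \<le> real r * real (k + 1) / real (p + 1)"
    "\<And>e s. e > 0 \<Longrightarrow> \<exists>t\<ge>s. B t < real r * real k / real p + e"
    "\<And>e s. e > 0 \<Longrightarrow> \<exists>t\<le>s. real r * real (k + 1) / real (p + 1) - e < B t"
    "\<And>s. B s \<in> \<int> \<longleftrightarrow> Im (branch k (of_real s)) = 0"
proof -
  have z: "complex_of_real s = Complex s 0" for s by (simp add: complex_of_real_def)
  define D0 where "D0 = psum k (Complex 0 0)"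
  define C where "C = psum (k + 1) (Complex 0 width)"
  have p0: "real p > 0" using p by simp
  have D0: "psum k (of_real s) = D0" for s
    unfolding D0_def z using k width(1) by (intro psum_edge_constant) auto
  have C: "psum (k + 1) (Complex s width) = C" for s
    unfolding C_def using k by (intro psum_edge_constant) auto
  have "sin D0 = 0" using psum_edge[of "Complex 0 0" k] k width(1) by (simp add: D0_def strip_def)
  moreover have "sin (C + real (r * (k + 1)) * width) = 0"
    using psum_edge[of "Complex 0 width" "k + 1"] k width(1) by (simp add: C_def strip_def)
  ultimately obtain n m :: int where nm: "D0 = of_int n * pi" "C + real (r * (k + 1)) * width = of_int m * pi"
    unfolding sin_zero_iff_int2 by blast
  have tot: "psum (k + 1) (of_real s) = D0 + phase s" for s
    using D0[of s] by (simp add: psum_def phase_def)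
  \<comment> \<open>The integer \<open>m - n\<close> normalises the profile so that its limits are
    exactly \<open>A\<close> at \<open>-\<infinity>\<close> and \<open>K\<close> at
    \<open>\<infinity>\<close>.\<close>
  define B where "B s = of_int (m - n) - phase s / pi" for s
  have wd: "width = pi / real (p + 1)" by (simp add: width_def)
  define A where "A = real r * real (k + 1) / real (p + 1)"
  define K where "K = real r * real k / real p"
  have CB: "C - (D0 + phase s) = pi * (B s - A)" for s
  proof -
    have "C = of_int m * pi - real r * real (k + 1) * width" using nm(2) unfolding of_nat_mult by linarith
    moreover have "pi * B s = of_int m * pi - of_int n * pi - phase s" by (simp add: B_def algebra_simps)
    moreover have "pi * A = real r * real (k + 1) * width" by (simp add: wd A_def)
    ultimately show ?thesis unfolding nm(1) right_diff_distrib by linarith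
  qed
  \<comment> \<open>The sum of the growth exponents at infinity: \<open>- r\<close> for root
    \<open>0\<close> and \<open>r / p\<close> for each of the following \<open>k\<close>
    roots.\<close>
  define e where "e = real r * real k / real p - real r"
  have ee: "e * width = - (pi * (A - K))"
    unfolding e_def wd A_def K_def using p0 by (simp add: divide_simps) (simp add: algebra_simps)
  have anti: "B t \<le> B s" if "s \<le> t" for s t
    using phase_mono[OF that] by (simp add: B_def divide_right_mono)
  have hi: "0 \<le> h s" "e' > 0 \<Longrightarrow> \<exists>t\<ge>s. h t < e'"
    if h: "\<And>s. h s = pi * (B s - K)" for h s e'
  proof -
    obtain M X0 where M: "1 \<le> X0" "\<And>x i. X0 \<le> cmod x \<Longrightarrow> i \<le> p \<Longrightarrow>
      \<bar>ln (cmod (zroot b x i)) - (if i = 0 then - real r else real r / real p) * ln (cmod x)\<bar> \<le> M"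
      using root_growth[OF b] by blast
    obtain T where T: "\<And>\<sigma>. (T has_real_derivative psum (k + 1) (Complex \<sigma> width) - e * width - psum (k + 1) (of_real \<sigma>)) (at \<sigma>)"
      "\<And>\<sigma> M. (\<And>i x. i \<le> k \<Longrightarrow> cmod x = exp \<sigma> \<Longrightarrow> \<bar>ln (cmod (zroot b x i)) - (if i = 0 then - real r else real r / real p) * ln (cmod x)\<bar> \<le> M) \<Longrightarrow>
       (\<Sum>i\<le>k. if i = 0 then - real r else real r / real p) = e \<Longrightarrow> \<bar>T \<sigma>\<bar> \<le> real (k + 1) * M * width"
      using edge_difference_primitive[of e "\<lambda>i. if i = 0 then - real r else real r / real p"] by blast
    have "(\<Sum>i\<le>k. if i = 0 then - real r else real r / real p) = e"
      unfolding atMost_atLeast0 sum.atLeast_Suc_atMost[OF le0] by (simp add: e_def)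
    then have bd: "\<bar>T s\<bar> \<le> real (k + 1) * M * width" if "ln X0 \<le> s" for s
    proof (rule T(2)[rotated])
      fix i x assume ix: "i \<le> k" "cmod x = exp s"
      have "exp (ln X0) \<le> exp s" using that by simp
      then have "X0 \<le> exp s" using M(1) by simp
      then show "\<bar>ln (cmod (zroot b x i)) - (if i = 0 then - real r else real r / real p) * ln (cmod x)\<bar> \<le> M"
        using ix k by (intro M(2)) auto
    qed
    have der: "(T has_real_derivative h s) (at s)" for s
    proof -
      have "psum (k + 1) (Complex s width) - e * width - psum (k + 1) (of_real s) = h s"
        unfolding C tot h using CB[of s] ee unfolding right_diff_distrib by linarith
      then show ?thesis using T(1)[of s] by simp
    qed
    have mono: "h t \<le> h s" if "s \<le> t" for s t unfolding h using anti[OF that] by (intro mult_left_mono) auto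
    show "0 \<le> h s" "e' > 0 \<Longrightarrow> \<exists>t\<ge>s. h t < e'"
      using bounded_imp_monotone_derivative_null[of T h "ln X0", OF der bd mono] by blast+
  qed
  \<comment> \<open>The same argument at the origin, where all growth exponents are
    \<open>0\<close>; the substitution of \<open>- s\<close> for \<open>s\<close> turns the left end
    into a right end.\<close>
  have lo: "0 \<le> h s" "e' > 0 \<Longrightarrow> \<exists>t\<ge>s. h t < e'"
    if h: "\<And>s. h s = - (pi * (B (- s) - A))" for h s e'
  proof -
    obtain M where M: "\<And>x i. cmod x \<le> 1 \<Longrightarrow> i \<le> p \<Longrightarrow> \<bar>ln (cmod (zroot b x i))\<bar> \<le> M" using root_log_bounded[OF b] by blast
    obtain T where T: "\<And>\<sigma>. (T has_real_derivative psum (k + 1) (Complex \<sigma> width) - 0 * width - psum (k + 1) (of_real \<sigma>)) (at \<sigma>)"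
      "\<And>\<sigma> M. (\<And>i x. i \<le> k \<Longrightarrow> cmod x = exp \<sigma> \<Longrightarrow> \<bar>ln (cmod (zroot b x i)) - 0 * ln (cmod x)\<bar> \<le> M) \<Longrightarrow>
       (\<Sum>i\<le>k. 0) = (0::real) \<Longrightarrow> \<bar>T \<sigma>\<bar> \<le> real (k + 1) * M * width"
      using edge_difference_primitive[of 0 "\<lambda>i. 0"] by blast
    have bd: "\<bar>T (- s)\<bar> \<le> real (k + 1) * M * width" if "0 \<le> s" for s
    proof (rule T(2))
      fix i x assume ix: "i \<le> k" "cmod x = exp (- s)"
      then show "\<bar>ln (cmod (zroot b x i)) - 0 * ln (cmod x)\<bar> \<le> M" using M[of x i] that k by simp
    qed simp
    have der: "((\<lambda>s. T (- s)) has_real_derivative h s) (at s)" for s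
    proof -
      have e: "psum (k + 1) (Complex (- s) width) - 0 * width - psum (k + 1) (of_real (- s)) = - h s"
        unfolding C tot h using CB[of "- s"] by simp
      have d: "(T has_real_derivative - h s) (at (- s))" using T(1)[of "- s"] by (rule DERIV_cong) (rule e)
      have "((\<lambda>s. T (- s)) has_real_derivative (- h s) * (- 1)) (at s)"
        by (rule DERIV_chain2[where f = T and g = uminus, OF d]) (rule DERIV_minus[OF DERIV_ident])
      then show ?thesis by simp
    qed
    have mono: "h t \<le> h s" if "s \<le> t" for s t
      unfolding h using mult_left_mono[OF anti[of "- t" "- s"], of pi] that by (simp add: algebra_simps)
    show "0 \<le> h s" "e' > 0 \<Longrightarrow> \<exists>t\<ge>s. h t < e'"
      using bounded_imp_monotone_derivative_null[of "\<lambda>s. T (- s)" h 0, OF der bd mono] by blast+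
  qed
  show thesis
  proof (rule that[of B])
    show "continuous_on UNIV B" unfolding B_def by (intro continuous_intros phase_continuous) auto
    show "B t \<le> B s" if "s \<le> t" for s t using anti[OF that] .
    show "real r * real k / real p \<le> B s" for s
    proof -
      have "pi * K \<le> pi * B s"
        using hi(1)[of "\<lambda>s. pi * (B s - K)" s, OF refl] unfolding right_diff_distrib by linarith
      then show ?thesis by (simp only: mult_le_cancel_left_pos[OF pi_gt_zero] K_def)
    qed
    show "B s \<le> real r * real (k + 1) / real (p + 1)" for s
    proof -
      have "pi * B s \<le> pi * A"
        using lo(1)[of "\<lambda>s. - (pi * (B (- s) - A))" "- s", OF refl] unfolding right_diff_distrib minus_minus by linarith
      then show ?thesis by (simp only: mult_le_cancel_left_pos[OF pi_gt_zero] A_def)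
    qed
    show "\<exists>t\<ge>s. B t < real r * real k / real p + e" if e: "e > 0" for e s
    proof -
      obtain t where "t \<ge> s" "pi * (B t - K) < pi * e"
        using hi(2)[of "\<lambda>s. pi * (B s - K)" "pi * e" s, OF refl mult_pos_pos[OF pi_gt_zero e]] by blast
      then show ?thesis unfolding mult_less_cancel_left_pos[OF pi_gt_zero] K_def by (intro exI[of _ t]) simp
    qed
    show "\<exists>t\<le>s. real r * real (k + 1) / real (p + 1) - e < B t" if e: "e > 0" for e s
    proof -
      obtain t where t: "t \<ge> - s" "- (pi * (B (- t) - A)) < pi * e"
        using lo(2)[of "\<lambda>s. - (pi * (B (- s) - A))" "pi * e" "- s", OF refl mult_pos_pos[OF pi_gt_zero e]] by blast
      have "pi * (A - B (- t)) < pi * e" using t(2) unfolding right_diff_distrib by linarith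
      then have "A - B (- t) < e" unfolding mult_less_cancel_left_pos[OF pi_gt_zero] .
      then show ?thesis using t(1) unfolding A_def by (intro exI[of _ "- t"]) auto
    qed
    show "B s \<in> \<int> \<longleftrightarrow> Im (branch k (of_real s)) = 0" for s
    proof -
      have "branch k (of_real s) = exp (lg k (of_real s))" using k width(1) by (intro lg(2)) (auto simp: strip_def)
      then have "Im (branch k (of_real s)) = 0 \<longleftrightarrow> sin (phase s) = 0" by (simp add: Im_exp phase_def)
      also have "\<dots> \<longleftrightarrow> phase s / pi \<in> \<int>"
        unfolding sin_zero_iff_int2 Ints_def by (auto simp: field_simps)
      also have "\<dots> \<longleftrightarrow> B s \<in> \<int>" unfolding B_def by (metis Ints_diff Ints_of_int diff_diff_eq2 add_diff_cancel_left')
      finally show ?thesis by simp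
    qed
  qed
qed

text \<open>On the ray both \<open>psum k\<close> and \<open>psum (k + 2)\<close> are multiples of
  \<open>pi\<close>, because the gaps below \<open>k\<close> and above \<open>k + 1\<close> are
  strict there.\<close>

lemma pair_product_real: "Im (branch k (of_real s) * branch (k + 1) (of_real s)) = 0"
proof -
  have st: "complex_of_real s \<in> strip" using width(1) by (simp add: strip_def)
  have "sin (psum k (of_real s)) = 0" using psum_edge[OF st, of k] k width(1) by simp
  moreover have "sin (psum (k + 2) (of_real s)) = 0" using psum_edge[OF st, of "k + 2"] k width(1) by simp
  ultimately have "sin (psum (k + 2) (of_real s) - psum k (of_real s)) = 0" by (simp add: sin_diff)
  moreover have "psum (k + 2) (of_real s) - psum k (of_real s) = Im (lg k (of_real s) + lg (k + 1) (of_real s))"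
    by (simp add: psum_def numeral_2_eq_2)
  moreover have "branch k (of_real s) * branch (k + 1) (of_real s) = exp (lg k (of_real s) + lg (k + 1) (of_real s))"
    using lg(2)[OF _ st, of k] lg(2)[OF _ st, of "k + 1"] k by (simp add: exp_add)
  ultimately show ?thesis by (simp add: Im_exp)
qed

end

subsection \<open>The tie set on its ray\<close>

context root_strip
begin

definition ratio :: "complex \<Rightarrow> complex" where "ratio w = branch k w / branch (k + 1) w"

lemma real_in_strip: "complex_of_real s \<in> strip"
  using width(1) by (simp add: strip_def)

text \<open>The indices \<open>k\<close> and \<open>k + 1\<close> have opposite parity, so their
  moduli move in opposite directions.\<close>

lemma ratio_vertical:
  assumes "w \<in> strip" "w' \<in> strip" "Re w = Re w'" "Im w < Im w'"
  shows "cmod (ratio w') < cmod (ratio w)"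
proof -
  have a: "cmod (branch k w') < cmod (branch k w)"
    using modulus_vertical(1)[OF assms, of k] k assms by (simp add: branch_modulus)
  have b: "cmod (branch (k + 1) w) < cmod (branch (k + 1) w')"
    using modulus_vertical(2)[OF assms, of "k + 1"] k assms by (simp add: branch_modulus)
  have "0 < cmod (branch (k + 1) w)" using branch_nz[of "k + 1" w] k assms by simp
  moreover have "0 \<le> cmod (branch k w')" by simp
  ultimately show ?thesis unfolding ratio_def norm_divide using a b by (intro frac_less) auto
qed

lemma ratio_regular: "continuous_on strip ratio" "ratio holomorphic_on ostrip"
proof -
  show "continuous_on strip ratio"
    unfolding ratio_def[abs_def] using k branch_nz by (intro continuous_on_divide branch_continuous) auto
  show "ratio holomorphic_on ostrip"
    unfolding ratio_def[abs_def] using k branch_nz strip_topology(4) by (intro holomorphic_on_divide branch_holomorphic) auto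
qed

text \<open>Where the root \<open>k\<close> is real on the ray, the ratio extends across the ray by reflection, and its
  modulus decreases away from the ray. Hence a maximum along the ray would be a local maximum of a
  holomorphic function.\<close>

lemma no_weighted_maximum:
  assumes s0: "a < s0" "s0 < c"
    and real: "\<And>s. a < s \<Longrightarrow> s < c \<Longrightarrow> Im (branch k (of_real s)) = 0"
    and max: "\<And>s. a < s \<Longrightarrow> s < c \<Longrightarrow> cmod (ratio (of_real s)) * exp (d * s) \<le> cmod (ratio (of_real s0)) * exp (d * s0)"
  shows False
proof -
  define \<delta> where "\<delta> = min (min (s0 - a) (c - s0)) width"
  have \<delta>: "0 < \<delta>" "\<delta> \<le> width" using s0 width(1) by (auto simp: \<delta>_def)
  define f where "f w = ratio w * exp (of_real d * w)" for w
  have nf: "cmod (f w) = cmod (ratio w) * exp (d * Re w)" for w by (simp add: f_def norm_mult)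
  have ball: "\<bar>Im z\<bar> < \<delta>" "a < Re z" "Re z < c" if "z \<in> ball (of_real s0) \<delta>" for z
    using that abs_Im_le_cmod[of "z - of_real s0"] abs_Re_le_cmod[of "z - of_real s0"]
    by (auto simp: \<delta>_def dist_norm norm_minus_commute)
  have sub: "ball (of_real s0) \<delta> \<inter> {z. 0 < Im z} \<subseteq> ostrip" "ball (of_real s0) \<delta> \<inter> {z. 0 \<le> Im z} \<subseteq> strip"
    using ball(1) \<delta>(2) by (fastforce simp: ostrip_def strip_def)+
  define z0 where "z0 = of_real s0 + \<i> * of_real (\<delta> / 2)"
  have z0: "z0 \<in> ball (of_real s0) \<delta>" "0 < Im z0" using \<delta>(1) by (auto simp: z0_def dist_norm norm_mult)
  have "f z0 = f (of_real s0)"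
  proof (rule reflected_maximum_constant[of \<delta> "of_real s0" f z0])
    show "f holomorphic_on ball (of_real s0) \<delta> \<inter> {z. 0 < Im z}"
      unfolding f_def[abs_def] using holomorphic_on_subset[OF ratio_regular(2) sub(1)] by (intro holomorphic_intros)
    show "continuous_on (ball (of_real s0) \<delta> \<inter> {z. 0 \<le> Im z}) f"
      unfolding f_def[abs_def] using continuous_on_subset[OF ratio_regular(1) sub(2)] by (intro continuous_intros)
    show "Im (f z) = 0" if z: "z \<in> ball (of_real s0) \<delta>" "Im z = 0" for z
    proof -
      define s where "s = Re z"
      have zs: "z = of_real s" using z(2) by (simp add: s_def complex_eq_iff)
      have "branch k z \<in> \<real>" using real[of s] ball[OF z(1)] by (simp add: zs complex_is_Real_iff)
      moreover have "branch k z * branch (k + 1) z \<in> \<real>" using pair_product_real[of s] by (simp add: zs complex_is_Real_iff)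
      moreover have "branch k z \<noteq> 0" using branch_nz[of k z] k real_in_strip[of s] by (simp add: zs)
      ultimately have "branch (k + 1) z \<in> \<real>" by (metis Reals_divide nonzero_mult_div_cancel_left)
      then have "ratio z \<in> \<real>" using \<open>branch k z \<in> \<real>\<close> by (simp add: ratio_def)
      moreover have "exp (complex_of_real d * z) \<in> \<real>" unfolding zs of_real_mult[symmetric] exp_of_real by simp
      ultimately have "f z \<in> \<real>" unfolding f_def by (rule Reals_mult)
      then show ?thesis by (simp add: complex_is_Real_iff)
    qed
    show "cmod (f z) \<le> cmod (f (of_real s0))" if z: "z \<in> ball (of_real s0) \<delta>" "0 \<le> Im z" for z
    proof -
      have "z \<in> strip" using sub(2) z by blast
      then have "cmod (ratio z) \<le> cmod (ratio (of_real (Re z)))"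
      proof (cases "Im z = 0")
        case True
        then have "complex_of_real (Re z) = z" by (simp add: complex_eq_iff)
        then show ?thesis by simp
      next
        case False
        then show ?thesis using ratio_vertical[OF real_in_strip \<open>z \<in> strip\<close>, of "Re z"] z(2) by simp
      qed
      then have "cmod (f z) \<le> cmod (ratio (of_real (Re z))) * exp (d * Re z)" unfolding nf by (rule mult_right_mono) simp
      also have "\<dots> \<le> cmod (f (of_real s0))" unfolding nf using max[of "Re z"] ball[OF z(1)] by simp
      finally show ?thesis .
    qed
  qed (use z0 \<delta>(1) in auto)
  then have "cmod (ratio z0) * exp (d * s0) = cmod (ratio (of_real s0)) * exp (d * s0)"
    using nf[of z0] nf[of "of_real s0"] by (simp add: z0_def)
  moreover have "z0 \<in> strip" using sub(2) z0 by auto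
  then have "cmod (ratio z0) < cmod (ratio (of_real s0))"
    using ratio_vertical[OF real_in_strip, of z0 s0] z0(2) by (simp add: z0_def)
  ultimately show False by simp
qed

definition tie :: "real \<Rightarrow> bool" where
  "tie s \<longleftrightarrow> cmod (zroot b (point (of_real s)) k) = cmod (zroot b (point (of_real s)) (k + 1))"

lemma cmod_ratio: "cmod (ratio (of_real s)) \<le> 1" "cmod (ratio (of_real s)) = 1 \<longleftrightarrow> tie s" "0 < cmod (ratio (of_real s))"
proof -
  have m: "cmod (branch k (of_real s)) = cmod (zroot b (point (of_real s)) k)" "cmod (branch (k + 1) (of_real s)) = cmod (zroot b (point (of_real s)) (k + 1))"
    using branch_modulus[OF _ real_in_strip[of s], of k] branch_modulus[OF _ real_in_strip[of s], of "k + 1"] k by auto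
  have nz: "branch k (of_real s) \<noteq> 0" "branch (k + 1) (of_real s) \<noteq> 0" using branch_nz[OF _ real_in_strip] k by auto
  have le: "cmod (branch k (of_real s)) \<le> cmod (branch (k + 1) (of_real s))" unfolding m using root_mset(2)[OF b] k by simp
  show "cmod (ratio (of_real s)) \<le> 1" using le nz by (simp add: ratio_def norm_divide)
  show "cmod (ratio (of_real s)) = 1 \<longleftrightarrow> tie s" unfolding ratio_def norm_divide tie_def m[symmetric] using nz by auto
  show "0 < cmod (ratio (of_real s))" using nz by (simp add: ratio_def)
qed

text \<open>The conjugate of the rotated root is another root of the same modulus. The strict gaps
  below \<open>k\<close> and above \<open>k + 1\<close> leave only the index \<open>k + 1\<close>
  for it.\<close>

lemma nonreal_imp_tie:
  assumes nr: "Im (branch k (of_real s)) \<noteq> 0"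
  shows "tie s"
proof -
  define x where "x = point (of_real s)"
  define z where "z = branch k (of_real s)"
  note st = real_in_strip[of s]
  have kp: "k \<le> p" using k by simp
  have oo: "orient * cnj orient = 1" using orient(1) by (simp add: complex_norm_square[symmetric])
  have g1: "(cnj orient ^ 2) ^ (p + 1) = 1"
  proof -
    have "(cnj orient ^ 2) ^ (p + 1) = cnj (orient ^ (2 * (p + 1)))" unfolding complex_cnj_power power_mult ..
    then show ?thesis unfolding orient(3) by simp
  qed
  have gx: "cnj orient ^ 2 * x = cnj x"
  proof -
    have "cnj orient ^ 2 * x = (orient * cnj orient) * (cnj orient * exp (of_real s))" by (simp add: x_def point_def power2_eq_square)
    then show ?thesis unfolding oo by (simp add: x_def point_def exp_cnj)
  qed
  have "(\<Prod>i<p + 1. z / orient ^ r - branch i (of_real s) / orient ^ r) = 0"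
    by (rule prod_zero) (use kp in \<open>auto simp: z_def intro!: bexI[of _ k]\<close>)
  then have "poly (symbol_poly b x) (z / orient ^ r) = 0" unfolding x_def branch_poly[OF st] by simp
  then have "cnj (poly (symbol_poly b x) (z / orient ^ r)) = 0" by simp
  then have "poly (symbol_poly b x) ((cnj orient ^ 2) ^ r * cnj (z / orient ^ r)) = 0"
    unfolding symbol_poly_cnj[symmetric] gx[symmetric] symbol_poly_rotate[OF g1] .
  moreover have "(cnj orient ^ 2) ^ r * cnj (z / orient ^ r) = cnj z / orient ^ r"
  proof -
    have inv: "cnj orient ^ r * orient ^ r = 1" unfolding power_mult_distrib[symmetric] using oo by (simp add: mult.commute)
    have "cnj orient \<noteq> 0" using orient(2) by simp
    then have "(cnj orient ^ 2) ^ r * cnj (z / orient ^ r) = cnj orient ^ r * cnj z"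
      by (simp add: power2_eq_square power_mult_distrib)
    also have "\<dots> = cnj z / orient ^ r" using inv orient(2) by (simp add: field_simps)
    finally show ?thesis .
  qed
  ultimately have "poly (symbol_poly b x) (cnj z / orient ^ r) = 0" by simp
  moreover have "lead_coeff (symbol_poly b 0) \<noteq> 0" using symbol_poly_lead(2)[OF b] .
  ultimately have "(\<Prod>i<p + 1. cnj z / orient ^ r - branch i (of_real s) / orient ^ r) = 0"
    unfolding x_def branch_poly[OF st] by simp
  then obtain i where i: "i \<le> p" "cnj z / orient ^ r = branch i (of_real s) / orient ^ r"
    unfolding prod_zero_iff[OF finite_lessThan] by (auto simp: less_Suc_eq_le)
  then have bi: "branch i (of_real s) = cnj z" using orient(2) by (simp add: field_simps)
  have eq: "cmod (zroot b x i) = cmod (zroot b x k)"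
    using branch_modulus[OF i(1) st] branch_modulus[OF kp st] unfolding bi x_def z_def by simp
  have "i \<noteq> k" using bi nr by (auto simp: z_def complex_eq_iff)
  have "\<not> i < k"
  proof
    assume "i < k"
    then have "cmod (zroot b x i) \<le> cmod (zroot b x (k - 1))" using root_mset(2)[OF b] kp by simp
    also have "\<dots> < cmod (zroot b x (k - 1 + 1))"
      unfolding x_def using \<open>i < k\<close> k width(1) by (intro modulus_gap[OF st]) auto
    finally show False using eq \<open>i < k\<close> by simp
  qed
  moreover have "\<not> k + 1 < i"
  proof
    assume ki: "k + 1 < i"
    have "cmod (zroot b x k) \<le> cmod (zroot b x (k + 1))" using root_mset(2)[OF b] k by simp
    also have "\<dots> < cmod (zroot b x (k + 1 + 1))"
      unfolding x_def using ki i(1) width(1) by (intro modulus_gap[OF st]) auto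
    also have "\<dots> \<le> cmod (zroot b x i)" using root_mset(2)[OF b] ki i(1) by simp
    finally show False using eq by simp
  qed
  ultimately have "i = k + 1" using \<open>i \<noteq> k\<close> by simp
  then show ?thesis using eq by (simp add: tie_def x_def)
qed

text \<open>At a tie the ratio has modulus \<open>1\<close>, its largest value. If root
  \<open>k\<close> were real in a whole neighbourhood, \<open>no_weighted_maximum\<close> with
  \<open>d = 0\<close> would apply.\<close>

lemma tie_in_closure:
  assumes "tie s0"
  shows "s0 \<in> closure {s. Im (branch k (of_real s)) \<noteq> 0}"
proof (rule ccontr)
  assume "\<not> ?thesis"
  then obtain e where e: "e > 0" "\<And>s. dist s s0 < e \<Longrightarrow> Im (branch k (of_real s)) = 0"
    unfolding closure_approachable by auto
  show False
  proof (rule no_weighted_maximum[of "s0 - e" s0 "s0 + e" 0])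
    show "cmod (ratio (of_real s)) * exp (0 * s) \<le> cmod (ratio (of_real s0)) * exp (0 * s0)" for s
      using cmod_ratio(1)[of s] cmod_ratio(2)[of s0] assms by simp
  qed (use e in \<open>auto simp: dist_real_def\<close>)
qed

lemma ratio_line_continuous: "continuous_on S (\<lambda>s. cmod (ratio (of_real s)))"
  by (intro continuous_on_norm continuous_on_compose2[OF ratio_regular(1)] continuous_intros) (use real_in_strip in auto)

text \<open>The weight \<open>exp (d * s)\<close> turns the supremum \<open>1\<close> of the ratio at the origin into a maximum.\<close>

lemma nonreal_near_origin:
  assumes lim: "((\<lambda>s. cmod (ratio (of_real s))) \<longlongrightarrow> 1) at_bot"
  shows "\<exists>s\<le>s1. Im (branch k (of_real s)) \<noteq> 0"
proof (rule ccontr)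
  assume "\<not> ?thesis"
  then have real: "\<And>s. s \<le> s1 \<Longrightarrow> Im (branch k (of_real s)) = 0" by auto
  define m where "m s = cmod (ratio (of_real s))" for s
  define s2 where "s2 = s1 - 1"
  have m2: "0 < m s2" "m s2 < 1"
  proof -
    have "\<not> tie s2"
    proof
      assume "tie s2"
      then have "\<exists>s\<in>{s. Im (branch k (of_real s)) \<noteq> 0}. dist s2 s < 1"
        by (intro closure_approachableD tie_in_closure) auto
      then obtain s where s: "Im (branch k (of_real s)) \<noteq> 0" "\<bar>s2 - s\<bar> < 1" by (auto simp: dist_real_def)
      then have "s \<le> s1" by (simp add: s2_def abs_less_iff)
      then show False using real s(1) by blast
    qed
    then show "0 < m s2" "m s2 < 1" using cmod_ratio[of s2] by (auto simp: m_def)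
  qed
  have "eventually (\<lambda>s. m s > m s2) at_bot" using order_tendstoD(1)[OF lim m2(2)] by (simp add: m_def)
  then obtain s4 where s4: "\<And>s. s \<le> s4 \<Longrightarrow> m s > m s2" unfolding eventually_at_bot_linorder by blast
  \<comment> \<open>Left of \<open>s2\<close> there is \<open>s3\<close> with a larger ratio, and
    \<open>d\<close> is so small that the weight does not reverse this. Finally \<open>s5\<close> is
    so far left that the weight alone is below \<open>\<phi> s3\<close>. The maximum of
    \<open>\<phi>\<close> over \<open>[s5, s2]\<close> is thus interior.\<close>
  define s3 where "s3 = min s4 (s2 - 1)"
  have s3: "s3 < s2" "m s2 < m s3" using s4[of s3] by (auto simp: s3_def)
  define L where "L = ln (m s3) - ln (m s2)"
  have L: "L > 0" using s3(2) m2(1) by (simp add: L_def)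
  define d where "d = L / (2 * (s2 - s3))"
  have d: "0 < d" "d * (s2 - s3) < L" using L s3(1) by (auto simp: d_def field_simps)
  define \<phi> where "\<phi> s = m s * exp (d * s)" for s
  have m3: "0 < m s3" using s3(2) m2(1) by linarith
  have "ln (m s2) + d * s2 < ln (m s3) + d * s3" using d(2) by (simp add: L_def algebra_simps)
  then have "exp (ln (m s2) + d * s2) < exp (ln (m s3) + d * s3)" by simp
  then have p32: "\<phi> s2 < \<phi> s3" using m2(1) m3 by (simp add: \<phi>_def exp_add)
  define s5 where "s5 = min (s3 - 1) ((ln (\<phi> s3) - 1) / d)"
  have \<phi>3: "0 < \<phi> s3" using m3 by (simp add: \<phi>_def)
  have "d * s5 \<le> d * ((ln (\<phi> s3) - 1) / d)" using d(1) by (intro mult_left_mono) (auto simp: s5_def)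
  then have "d * s5 < ln (\<phi> s3)" using d(1) by simp
  then have "exp (d * s5) < exp (ln (\<phi> s3))" by simp
  then have "exp (d * s5) < \<phi> s3" using \<phi>3 by simp
  moreover have "\<phi> s5 \<le> 1 * exp (d * s5)" unfolding \<phi>_def m_def by (intro mult_right_mono cmod_ratio) simp
  ultimately have p53: "\<phi> s5 < \<phi> s3" by simp
  have s53: "s5 < s3" by (simp add: s5_def)
  have "\<exists>x\<in>{s5..s2}. \<forall>y\<in>{s5..s2}. \<phi> y \<le> \<phi> x"
    unfolding \<phi>_def m_def using s53 s3(1) by (intro continuous_attains_sup continuous_intros ratio_line_continuous) auto
  then obtain x where x: "x \<in> {s5..s2}" "\<And>y. y \<in> {s5..s2} \<Longrightarrow> \<phi> y \<le> \<phi> x" by blast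
  have "\<phi> s3 \<le> \<phi> x" using x(2)[of s3] s53 s3(1) by simp
  then have "x \<noteq> s5" "x \<noteq> s2" using p53 p32 by auto
  then show False
    using no_weighted_maximum[of s5 x s2 d] x real by (auto simp: \<phi>_def m_def s2_def)
qed

subsection \<open>Decomposition into intervals\<close>

definition sign :: real where "sign = (-1) ^ k"
text \<open>The \<open>(p + 1)\<close>-st root of \<open>y\<close> on the lower edge of the sector,
  including \<open>y = 0\<close>, which the logarithmic coordinate misses.\<close>

definition ray_point :: "real \<Rightarrow> complex" where "ray_point y = orient * of_real (root (p + 1) (sign * y))"
definition tie_set :: "real set" where
  "tie_set = {y. 0 \<le> sign * y \<and> cmod (zroot b (ray_point y) k) = cmod (zroot b (ray_point y) (k + 1))}"

lemma sign: "sign * sign = 1" "\<bar>sign\<bar> = 1" "sign = 1 \<or> sign = -1" "sign * (sign * y) = y"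
proof -
  show "sign = 1 \<or> sign = -1" by (cases "even k") (auto simp: sign_def)
  then show "sign * sign = 1" "\<bar>sign\<bar> = 1" "sign * (sign * y) = y" by auto
qed

lemma orient_power: "orient ^ (p + 1) = of_real sign"
proof (cases "even k")
  case False
  have "orient ^ (p + 1) = cis (real (p + 1) * - width)" using False unfolding orient_def by (simp only: if_False Complex.DeMoivre)
  also have "real (p + 1) * - width = - pi" using width(2) by simp
  finally show ?thesis using False by (simp add: sign_def complex_eq_iff)
qed (simp add: orient_def sign_def)

lemma ray_point_power: "0 \<le> sign * y \<Longrightarrow> ray_point y ^ (p + 1) = of_real y"
proof -
  assume "0 \<le> sign * y"
  then have "root (p + 1) (sign * y) ^ (p + 1) = sign * y" by (intro real_root_pow_pos2) auto
  then have "ray_point y ^ (p + 1) = of_real sign * of_real (sign * y)"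
    unfolding ray_point_def power_mult_distrib orient_power of_real_power[symmetric] by simp
  then show ?thesis using sign(1) by (simp flip: of_real_mult mult.assoc)
qed

definition log_point :: "real \<Rightarrow> real" where "log_point y = ln (sign * y) / real (p + 1)"

lemma ray_point_log: "0 < sign * y \<Longrightarrow> ray_point y = point (of_real (log_point y))"
proof -
  assume pos: "0 < sign * y"
  have "root (p + 1) (sign * y) = exp (log_point y)"
    unfolding log_point_def using pos by (intro real_root_pos_unique) (auto simp: exp_of_nat_mult[symmetric] simp del: power_Suc)
  then show ?thesis by (simp add: ray_point_def point_def exp_of_real)
qed

lemma tie_set_pos: "0 < sign * y \<Longrightarrow> y \<in> tie_set \<longleftrightarrow> tie (log_point y)"
  by (simp add: tie_set_def tie_def ray_point_log)

lemma tie_set_closed: "closed tie_set"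
proof -
  have "continuous_on UNIV ray_point" unfolding ray_point_def[abs_def]
    by (intro continuous_on_mult continuous_on_of_real continuous_on_real_root continuous_on_const continuous_on_id)
  then have "continuous_on UNIV (\<lambda>y. cmod (zroot b (ray_point y) i))" if "i \<le> p" for i
    by (rule continuous_on_compose2[OF root_modulus_continuous[OF b that, of UNIV]]) auto
  then have "closed {y. cmod (zroot b (ray_point y) k) = cmod (zroot b (ray_point y) (k + 1))}"
    using k by (intro closed_Collect_eq) auto
  moreover have "closed {y. 0 \<le> sign * y}" by (intro closed_Collect_le continuous_intros)
  ultimately show ?thesis unfolding tie_set_def by (rule closed_Collect_conj[rotated])
qed

text \<open>Rotation and conjugation reduce a nonzero \<open>x\<close> to an argument of
  \<open>x ^ (p + 1)\<close> in \<open>[0, pi]\<close>, where \<open>modulus_less\<close> leaves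
  only the end belonging to the parity of \<open>k\<close>. The origin lies on every ray and is
  treated separately.\<close>

lemma Gamma_tilde_eq: "Gamma_tilde p r b k = of_real ` tie_set"
proof
  show "of_real ` tie_set \<subseteq> Gamma_tilde p r b k"
  proof
    fix v :: complex assume "v \<in> of_real ` tie_set"
    then obtain y where y: "y \<in> tie_set" "v = of_real y" by blast
    then have "ray_point y \<in> Gamma_set p r b k" "v = ray_point y ^ (p + 1)"
      using ray_point_power[of y] by (auto simp: tie_set_def Gamma_set_def)
    then show "v \<in> Gamma_tilde p r b k" unfolding Gamma_tilde_def by blast
  qed
  show "Gamma_tilde p r b k \<subseteq> of_real ` tie_set"
  proof
    fix v assume "v \<in> Gamma_tilde p r b k"
    then obtain x where x: "cmod (zroot b x k) = cmod (zroot b x (k + 1))" "v = x ^ (p + 1)"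
      by (auto simp: Gamma_tilde_def Gamma_set_def)
    show "v \<in> of_real ` tie_set"
    proof (cases "x = 0")
      case True
      have "ray_point 0 = 0" by (simp add: ray_point_def)
      then have "0 \<in> tie_set" using x(1) True by (simp add: tie_set_def)
      moreover have "v = of_real 0" using x(2) True by simp
      ultimately show ?thesis by blast
    next
      case False
      define \<tau> where "\<tau> = cmod x"
      define \<alpha> where "\<alpha> = Arg (x ^ (p + 1))"
      define \<theta> where "\<theta> = \<bar>\<alpha>\<bar>"
      have \<tau>: "\<tau> > 0" using False by (simp add: \<tau>_def)
      have \<theta>: "0 \<le> \<theta>" "\<theta> \<le> pi" using Arg_bounded[of "x ^ (p + 1)"] by (auto simp: \<theta>_def \<alpha>_def)
      have xp: "x ^ (p + 1) = of_real (\<tau> ^ (p + 1)) * cis \<alpha>"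
        using Arg_eq[of "x ^ (p + 1)"] False unfolding \<alpha>_def \<tau>_def norm_power[symmetric] by (simp add: cis_conv_exp)
      define u where "u = of_real \<tau> * ray \<theta>"
      have u: "u ^ (p + 1) = of_real (\<tau> ^ (p + 1)) * cis \<theta>" unfolding u_def power_mult_distrib ray(2) of_real_power ..
      have u0: "u \<noteq> 0" using \<tau> ray(3) by (simp add: u_def)
      have mod: "cmod (zroot b x i) = modulus b \<tau> i \<theta>" if i: "i \<le> p" for i
      proof -
        have key: "cmod (zroot b x i) = cmod (zroot b v i)" if v: "v ^ (p + 1) = x ^ (p + 1)" "v \<noteq> 0" for v
        proof -
          have "(x / v) ^ (p + 1) = 1" unfolding power_divide v(1) using False by simp
          from root_modulus_rotate[OF b this i, of v] show ?thesis using v(2) by simp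
        qed
        show ?thesis
        proof (cases "\<alpha> \<ge> 0")
          case True
          then have "u ^ (p + 1) = x ^ (p + 1)" unfolding u xp by (simp add: \<theta>_def)
          then show ?thesis using key[of u] u0 by (simp add: modulus_def u_def)
        next
          case F: False
          have "cnj u ^ (p + 1) = cnj (u ^ (p + 1))" by simp
          also have "\<dots> = x ^ (p + 1)" unfolding u xp using F by (simp add: \<theta>_def cis_cnj)
          finally show ?thesis using key[of "cnj u"] u0 root_modulus_cnj[OF b i, of u] by (simp add: modulus_def u_def)
        qed
      qed
      have eq: "modulus b \<tau> k \<theta> = modulus b \<tau> (k + 1) \<theta>" using x(1) mod[of k] mod[of "k + 1"] k by simp
      have \<theta>k: "\<theta> = (if even k then 0 else pi)"
        using modulus_less[OF b \<tau> \<theta> k] eq by (cases "even k") fastforce+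
      have "- pi < \<alpha>" using Arg_bounded[of "x ^ (p + 1)"] by (simp add: \<alpha>_def)
      then have ca: "cis \<alpha> = of_real sign"
        using \<theta>k by (cases "even k"; cases "\<alpha> \<ge> 0") (auto simp: \<theta>_def sign_def complex_eq_iff)
      define y where "y = sign * \<tau> ^ (p + 1)"
      have sy: "sign * y = \<tau> ^ (p + 1)" by (simp only: y_def sign(4))
      have ypos: "0 < sign * y" unfolding sy using \<tau> by simp
      have "log_point y = ln \<tau>" unfolding log_point_def sy ln_realpow by simp
      moreover have "angle 0 = \<theta>" using \<theta>k by (simp add: angle_def)
      ultimately have "tie (log_point y)"
        using eq point_modulus[of k "of_real (ln \<tau>)"] point_modulus[of "k + 1" "of_real (ln \<tau>)"] k \<tau> by (simp add: tie_def)
      then have "y \<in> tie_set" using tie_set_pos[OF ypos] by simp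
      moreover have "v = of_real y" unfolding x(2) xp ca y_def by simp
      ultimately show ?thesis by blast
    qed
  qed
qed

text \<open>The profile takes every value strictly between \<open>K\<close> and \<open>A\<close>, so
  it enters the open band from \<open>j\<close> to \<open>j + 1\<close> exactly when
  \<open>\<lfloor>K\<rfloor> \<le> j\<close> and \<open>j < \<lceil>A\<rceil>\<close>; this is the
  origin of the count.\<close>

theorem interval_decomposition:
  defines "n \<equiv> interval_count p r k"
  shows "0 \<le> n"
    and "\<exists>I. Gamma_tilde p r b k = (\<Union>j\<in>{1..nat n}. complex_of_real ` I j) \<and>
       (\<forall>j\<in>{1..nat n}. proper_interval (I j)) \<and>
       (\<forall>i\<in>{1..nat n}. \<forall>j\<in>{1..nat n}. i \<noteq> j \<longrightarrow> disjoint_up_to_endpoints (I i) (I j)) \<and>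
       (real (k * r) / real p \<notin> \<nat> \<longrightarrow> (\<exists>j\<in>{1..nat n}. extends_to_signed_infinity k (I j)))"
    and "real (k + 1) / real (p + 1) * real r \<notin> \<nat> - {0} \<Longrightarrow> 0 \<in> Gamma_tilde p r b k"
proof -
  define K where "K = real r * real k / real p"
  define A where "A = real r * real (k + 1) / real (p + 1)"
  obtain B where B: "continuous_on UNIV B" "\<And>s t. s \<le> t \<Longrightarrow> B t \<le> B s" "\<And>s. K \<le> B s" "\<And>s. B s \<le> A"
    "\<And>e s. e > 0 \<Longrightarrow> \<exists>t\<ge>s. B t < K + e" "\<And>e s. e > 0 \<Longrightarrow> \<exists>t\<le>s. A - e < B t"
    "\<And>s. B s \<in> \<int> \<longleftrightarrow> Im (branch k (of_real s)) = 0"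
    using phase_profile unfolding K_def A_def by blast
  define N where "N = \<lfloor>K\<rfloor>"
  have p0: "real p > 0" and r0: "real r > 0" using p r by auto
  have n: "n = \<lceil>A\<rceil> - N" by (simp add: n_def interval_count_def N_def K_def A_def mult.commute)
  have KA: "K < A"
  proof -
    have "real k * real (p + 1) < real (k + 1) * real p" using k by (simp add: algebra_simps)
    then have "real k / real p < real (k + 1) / real (p + 1)" using p0 by (simp add: divide_simps)
    then have "real r * (real k / real p) < real r * (real (k + 1) / real (p + 1))" using r0 by (rule mult_strict_left_mono)
    then show ?thesis by (simp add: K_def A_def)
  qed
  have "N \<le> \<lceil>A\<rceil>" unfolding N_def using KA by linarith
  then show n0: "0 \<le> n" unfolding n by simp
  define f where "f y = B (log_point y)" for y
  define V where "V j = {y. 0 < sign * y \<and> of_int j < f y \<and> f y < of_int j + 1}" for j :: int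
  define J where "J = {N..<\<lceil>A\<rceil>}"
  have cf: "continuous_on {y. 0 < sign * y} f"
    unfolding f_def log_point_def by (intro continuous_on_compose2[OF B(1)] continuous_intros) auto
  have oV: "open (V j)" for j
  proof -
    have "V j = {y. 0 < sign * y} \<inter> f -` {of_int j<..<of_int j + 1}" by (auto simp: V_def)
    moreover have "open {y. 0 < sign * y}" by (intro open_Collect_less continuous_intros)
    ultimately show ?thesis using continuous_open_preimage[OF cf] by simp
  qed
  have fanti: "f y \<le> f x" if "0 < sign * x" "sign * x \<le> sign * y" for x y
  proof -
    have "ln (sign * x) \<le> ln (sign * y)" using that by simp
    then show ?thesis unfolding f_def log_point_def by (intro B(2) divide_right_mono) auto
  qed
  have iV: "is_interval (V j)" for j
    unfolding is_interval_1
  proof (intro ballI allI impI)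
    fix a c x assume ac: "a \<in> V j" "c \<in> V j" "a \<le> x \<and> x \<le> c"
    have "(sign * a \<le> sign * x \<and> sign * x \<le> sign * c) \<or> (sign * c \<le> sign * x \<and> sign * x \<le> sign * a)"
      using ac(3) sign(3) by auto
    then show "x \<in> V j"
    proof
      assume o: "sign * a \<le> sign * x \<and> sign * x \<le> sign * c"
      then have "0 < sign * x" using ac(1) by (auto simp: V_def)
      then show ?thesis using fanti[of a x] fanti[of x c] ac o by (auto simp: V_def)
    next
      assume o: "sign * c \<le> sign * x \<and> sign * x \<le> sign * a"
      then have "0 < sign * x" using ac(2) by (auto simp: V_def)
      then show ?thesis using fanti[of c x] fanti[of x a] ac o by (auto simp: V_def)
    qed
  qed
  have disj: "V i \<inter> V j = {}" if "i \<noteq> j" for i j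
  proof -
    have False if "y \<in> V i" "y \<in> V j" for y
    proof -
      have "of_int i < (of_int (j + 1) :: real)" "of_int j < (of_int (i + 1) :: real)" using that by (auto simp: V_def)
      then have "i < j + 1" "j < i + 1" by (simp_all only: of_int_less_iff)
      then show False using \<open>i \<noteq> j\<close> by simp
    qed
    then show ?thesis by blast
  qed
  \<comment> \<open>The inverse of \<open>log_point\<close> on the half-line
    \<open>0 < sign * y\<close>.\<close>
  define Y where "Y s = sign * exp (real (p + 1) * s)" for s
  have Y: "0 < sign * Y s" "log_point (Y s) = s" "sign * Y s = exp (real (p + 1) * s)" for s
  proof -
    show e: "sign * Y s = exp (real (p + 1) * s)" by (simp only: Y_def sign(4))
    show "0 < sign * Y s" unfolding e by simp
    show "log_point (Y s) = s" unfolding log_point_def e by simp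
  qed
  have YV: "Y s \<in> V j \<longleftrightarrow> of_int j < B s \<and> B s < of_int j + 1" for s j by (simp add: V_def f_def Y)
  have neV: "V j \<noteq> {}" if "j \<in> J" for j
  proof -
    have "of_int j < A" using that by (simp add: J_def less_ceiling_iff)
    moreover have "K < of_int j + 1" using that unfolding J_def N_def by (simp add: floor_le_iff) 
    ultimately obtain v where v: "max (of_int j) K < v" "v < min (of_int j + 1) A" using KA dense[of "max (of_int j) K" "min (of_int j + 1) A"] by auto
    obtain t1 where t1: "B t1 < v" using B(5)[of "v - K" 0] v by auto
    obtain t2 where t2: "v < B t2" using B(6)[of "A - v" 0] v by auto
    have "connected (range B)" using B(1) by (intro connected_continuous_image) auto
    then have "v \<in> range B" using connectedD_interval[of "range B" "B t1" "B t2" v] t1 t2 by auto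
    then obtain s where "B s = v" by auto
    then have "Y s \<in> V j" using YV v by simp
    then show ?thesis by blast
  qed
  have cover: "y \<in> (\<Union>j\<in>J. V j)" if "0 < sign * y" "f y \<notin> \<int>" for y
  proof -
    define j where "j = \<lfloor>f y\<rfloor>"
    have j: "of_int j \<le> f y" "f y < of_int j + 1" by (auto simp: j_def)
    have "of_int j \<noteq> f y" using that(2) by (metis Ints_of_int)
    then have j': "of_int j < f y" using j by simp
    have "N \<le> j" unfolding N_def j_def f_def by (rule floor_mono) (rule B(3))
    moreover have "of_int j < A" using j' B(4)[of "log_point y"] unfolding f_def by linarith
    ultimately have "j \<in> J" by (simp add: J_def less_ceiling_iff)
    then show ?thesis using that(1) j' j(2) by (auto simp: V_def)
  qed
  have nonint: "f y \<notin> \<int>" if "y \<in> V j" for y j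
  proof
    assume "f y \<in> \<int>"
    then obtain i where "f y = of_int i" by (auto elim: Ints_cases)
    then have "of_int j < (of_int i :: real)" "of_int i < (of_int (j + 1) :: real)" using that by (auto simp: V_def)
    then show False by (simp only: of_int_less_iff)
  qed
  have VT: "V j \<subseteq> tie_set" for j
  proof
    fix y assume y: "y \<in> V j"
    then have "tie (log_point y)" using nonint[OF y] B(7) nonreal_imp_tie by (simp add: f_def)
    then show "y \<in> tie_set" using tie_set_pos y by (simp add: V_def)
  qed
  \<comment> \<open>The logarithmic coordinate does not see the origin. A tie at
    \<open>x = 0\<close> makes the ratio tend to \<open>1\<close>, and
    \<open>nonreal_near_origin\<close> then supplies points of the bands arbitrarily close to
    \<open>0\<close>.\<close>
  have T0: "0 \<in> closure (\<Union>j\<in>J. V j)" if z: "0 \<in> tie_set"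
    unfolding closure_approachable
  proof (intro allI impI)
    fix e :: real assume e: "e > 0"
    have z0: "cmod (zroot b 0 k) = cmod (zroot b 0 (k + 1))" using z by (simp add: tie_set_def ray_point_def)
    have "((\<lambda>s. cmod (ratio (of_real s))) \<longlongrightarrow> cmod (zroot b 0 k) / cmod (zroot b 0 (k + 1))) at_bot"
    proof -
      have ex: "((\<lambda>s. exp s) \<longlongrightarrow> (0::real)) at_bot" by (rule exp_at_bot)
      have "((\<lambda>s. orient * of_real (exp s)) \<longlongrightarrow> orient * of_real 0) at_bot" by (intro tendsto_intros ex)
      then have pt: "((\<lambda>s. point (of_real s)) \<longlongrightarrow> 0) at_bot" by (simp add: point_def exp_of_real)
      have "((\<lambda>s. cmod (zroot b (point (of_real s)) i)) \<longlongrightarrow> cmod (zroot b 0 i)) at_bot" if "i \<le> p" for i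
        using isCont_tendsto_compose[OF _ pt, of "\<lambda>x. cmod (zroot b x i)"] root_modulus_isCont[OF b that, of 0] by (simp add: isCont_def)
      then have "((\<lambda>s. cmod (zroot b (point (of_real s)) k) / cmod (zroot b (point (of_real s)) (k + 1))) \<longlongrightarrow> cmod (zroot b 0 k) / cmod (zroot b 0 (k + 1))) at_bot"
        using k root_props(2)[OF b, of "k + 1" 0] by (intro tendsto_divide) auto
      then show ?thesis using branch_modulus[OF _ real_in_strip] k by (simp add: ratio_def norm_divide)
    qed
    then have lim: "((\<lambda>s. cmod (ratio (of_real s))) \<longlongrightarrow> 1) at_bot" using z0 root_props(2)[OF b, of "k + 1" 0] k by simp
    obtain s where s: "s \<le> ln (e / 2) / real (p + 1)" "Im (branch k (of_real s)) \<noteq> 0" using nonreal_near_origin[OF lim] by blast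
    have "real (p + 1) * s \<le> ln (e / 2)" using s(1) by (simp add: pos_le_divide_eq mult.commute)
    then have "exp (real (p + 1) * s) \<le> exp (ln (e / 2))" by simp
    then have "dist (Y s) 0 < e" using e sign(2) by (simp add: Y_def abs_mult)
    moreover have "Y s \<in> (\<Union>j\<in>J. V j)" using s(2) B(7) Y by (intro cover) (auto simp: f_def)
    ultimately show "\<exists>y\<in>(\<Union>j\<in>J. V j). dist y 0 < e" by blast
  qed
  have clY: "Y s \<in> closure (\<Union>j\<in>J. V j)" if "tie s" for s
  proof -
    have "continuous_on UNIV Y" unfolding Y_def[abs_def] by (intro continuous_intros)
    then have "Y ` closure {s. Im (branch k (of_real s)) \<noteq> 0} \<subseteq> closure (\<Union>j\<in>J. V j)"
    proof (intro image_closure_subset)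
      show "Y ` {s. Im (branch k (of_real s)) \<noteq> 0} \<subseteq> closure (\<Union>j\<in>J. V j)"
      proof
        fix y assume "y \<in> Y ` {s. Im (branch k (of_real s)) \<noteq> 0}"
        then obtain s where s: "Im (branch k (of_real s)) \<noteq> 0" "y = Y s" by blast
        have "f (Y s) \<notin> \<int>" unfolding f_def Y(2) B(7) by (rule s(1))
        then have "y \<in> (\<Union>j\<in>J. V j)" unfolding s(2) by (rule cover[OF Y(1)])
        then show "y \<in> closure (\<Union>j\<in>J. V j)" by (rule subsetD[OF closure_subset])
      qed
    qed (auto intro: continuous_on_subset)
    then show ?thesis using tie_in_closure[OF that] by blast
  qed
  have union: "tie_set = (\<Union>j\<in>J. closure (V j))"
  proof -
    have "tie_set \<subseteq> closure (\<Union>j\<in>J. V j)"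
    proof
      fix y assume y: "y \<in> tie_set"
      then have "0 \<le> sign * y" by (simp add: tie_set_def)
      then consider "sign * y = 0" | "0 < sign * y" by linarith
      then show "y \<in> closure (\<Union>j\<in>J. V j)"
      proof cases
        case 1
        then have "y = 0" using sign(3) by auto
        then show ?thesis using T0 y by simp
      next
        case 2
        have "Y (log_point y) = y"
        proof -
          have "real (p + 1) * log_point y = ln (sign * y)" by (simp add: log_point_def)
          then have "Y (log_point y) = sign * (sign * y)" unfolding Y_def using 2 by simp
          then show ?thesis by (simp only: sign(4))
        qed
        moreover have "tie (log_point y)" using tie_set_pos[OF 2] y by simp
        ultimately show ?thesis using clY by metis
      qed
    qed
    also have "closure (\<Union>j\<in>J. V j) = (\<Union>j\<in>J. closure (V j))" 
    proof -
      have "finite F \<Longrightarrow> closure (\<Union>j\<in>F. V j) = (\<Union>j\<in>F. closure (V j))" for F by (induction F rule: finite_induct) auto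
      then show ?thesis by (simp add: J_def)
    qed
    finally have "tie_set \<subseteq> (\<Union>j\<in>J. closure (V j))" .
    moreover have "closure (V j) \<subseteq> tie_set" for j using VT tie_set_closed by (rule closure_minimal)
    ultimately show ?thesis by blast
  qed
  \<comment> \<open>The shift lets the numbering start at \<open>1\<close> with the lowest band,
    that of \<open>N\<close>.\<close>
  define I where "I j = closure (V (N + int j - 1))" for j
  have idx: "(\<lambda>j. N + int j - 1) ` {1..nat n} = J"
  proof
    show "(\<lambda>j. N + int j - 1) ` {1..nat n} \<subseteq> J" using n0 by (auto simp: J_def n)
    show "J \<subseteq> (\<lambda>j. N + int j - 1) ` {1..nat n}"
    proof
      fix j assume "j \<in> J"
      then have "nat (j - N + 1) \<in> {1..nat n}" "j = N + int (nat (j - N + 1)) - 1" by (auto simp: J_def n)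
      then show "j \<in> (\<lambda>j. N + int j - 1) ` {1..nat n}" by blast
    qed
  qed
  \<comment> \<open>Closing an open convex band adds only frontier points, so overlaps of the
    closures can lie only on the frontiers.\<close>
  have int: "interior (closure (V j)) = V j" for j
    using convex_interior_closure[of "V j"] iV oV by (simp add: is_interval_convex interior_open)
  have U: "tie_set = (\<Union>j\<in>{1..nat n}. I j)" unfolding union idx[symmetric] I_def by blast
  show "\<exists>I. Gamma_tilde p r b k = (\<Union>j\<in>{1..nat n}. complex_of_real ` I j) \<and>
       (\<forall>j\<in>{1..nat n}. proper_interval (I j)) \<and>
       (\<forall>i\<in>{1..nat n}. \<forall>j\<in>{1..nat n}. i \<noteq> j \<longrightarrow> disjoint_up_to_endpoints (I i) (I j)) \<and>
       (real (k * r) / real p \<notin> \<nat> \<longrightarrow> (\<exists>j\<in>{1..nat n}. extends_to_signed_infinity k (I j)))"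
  proof (intro exI[of _ I] conjI ballI impI)
    show "Gamma_tilde p r b k = (\<Union>j\<in>{1..nat n}. complex_of_real ` I j)" unfolding Gamma_tilde_eq U by blast
  next
    fix j assume "j \<in> {1..nat n}"
    then have "V (N + int j - 1) \<noteq> {}" using idx by (intro neV) blast
    moreover have "is_interval (closure (V (N + int j - 1)))"
      using iV by (simp add: is_interval_convex_1 convex_closure)
    ultimately show "proper_interval (I j)" by (simp add: proper_interval_def I_def int)
  next
    fix i j assume ij: "i \<in> {1..nat n}" "j \<in> {1..nat n}" "i \<noteq> j"
    have out: "x \<notin> V c" if "x \<in> closure (V d)" "c \<noteq> d" for x c d
      using that disj[of c d] oV[of c] open_Int_closure_eq_empty[of "V c" "V d"] by blast
    show "disjoint_up_to_endpoints (I i) (I j)"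
      unfolding disjoint_up_to_endpoints_def frontier_def I_def int closure_closure
      using out[of _ "N + int j - 1" "N + int i - 1"] out[of _ "N + int i - 1" "N + int j - 1"] ij by auto
  next
    assume "real (k * r) / real p \<notin> \<nat>"
    then have "K \<notin> \<nat>" by (simp add: K_def mult.commute)
    have "of_int N \<noteq> K"
    proof
      assume "of_int N = K"
      moreover have "0 \<le> N" by (simp add: N_def K_def)
      ultimately have "K = of_nat (nat N)" by simp
      then show False using \<open>K \<notin> \<nat>\<close> by simp
    qed
    then have NK: "of_int N < K" "K < of_int N + 1" unfolding N_def using floor_correct[of K] by linarith+
    \<comment> \<open>Now \<open>K\<close> lies strictly inside the lowest band, and the profile
      decreases towards \<open>K\<close>, so all sufficiently large \<open>s\<close> belong to this
      band.\<close>
    obtain t where t: "B t < of_int N + 1" using B(5)[of "of_int N + 1 - K" 0] NK by auto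
    have big: "Y s \<in> I 1" if "t \<le> s" for s
    proof -
      have "Y s \<in> V N" unfolding YV using B(2)[OF that] t B(3)[of s] NK by auto
      then show ?thesis using closure_subset by (auto simp: I_def)
    qed
    have unb: "\<exists>y\<in>I 1. M < sign * y" for M
    proof -
      define s where "s = max t (\<bar>M\<bar>)"
      have "M \<le> s" "0 \<le> s" by (auto simp: s_def)
      then have "M < 1 + real (p + 1) * s" using mult_right_mono[of 1 "real (p + 1)" s] by simp
      also have "\<dots> \<le> exp (real (p + 1) * s)" by (rule exp_ge_add_one_self)
      finally show ?thesis using Y(3)[of s] big[of s] by (intro bexI[of _ "Y s"]) (auto simp: s_def)
    qed
    have "extends_to_signed_infinity k (I 1)"
    proof (cases "even k")
      case True
      have "\<not> bdd_above (I 1)"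
      proof
        assume "bdd_above (I 1)"
        then obtain M where "\<And>y. y \<in> I 1 \<Longrightarrow> y \<le> M" by (auto simp: bdd_above_def)
        then show False using unb[of M] True by (force simp: sign_def)
      qed
      then show ?thesis using True by (simp add: extends_to_signed_infinity_def)
    next
      case False
      have "\<not> bdd_below (I 1)"
      proof
        assume "bdd_below (I 1)"
        then obtain M where "\<And>y. y \<in> I 1 \<Longrightarrow> M \<le> y" by (auto simp: bdd_below_def)
        then show False using unb[of "- M"] False by (force simp: sign_def)
      qed
      then show ?thesis using False by (simp add: extends_to_signed_infinity_def)
    qed
    moreover have "N < \<lceil>A\<rceil>" using NK(1) KA by (simp add: less_ceiling_iff)
    then have "1 \<in> {1..nat n}" by (simp add: n)
    ultimately show "\<exists>j\<in>{1..nat n}. extends_to_signed_infinity k (I j)" by blast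
  qed
  show "0 \<in> Gamma_tilde p r b k" if "real (k + 1) / real (p + 1) * real r \<notin> \<nat> - {0}"
  proof -
    have A0: "0 < A" using r0 by (simp add: A_def)
    have "real (k + 1) / real (p + 1) * real r = A" by (simp add: A_def)
    then have AN: "A \<notin> \<nat>" using that A0 by auto
    define q where "q = \<lfloor>A\<rfloor>"
    have "of_int q \<noteq> A"
    proof
      assume "of_int q = A"
      moreover have "0 \<le> q" using A0 by (simp add: q_def)
      ultimately have "A = of_nat (nat q)" by simp
      then show False using AN by simp
    qed
    then have q: "of_int q < A" "A < of_int q + 1" unfolding q_def using floor_correct[of A] by linarith+
    obtain t where t: "of_int q < B t" using B(6)[of "A - of_int q" 0] q by auto
    \<comment> \<open>Now \<open>A\<close> lies strictly inside the band of \<open>q\<close>, so all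
      points of the ray near the origin are ties; closedness of the tie set adds the origin
      itself.\<close>
    have "0 \<in> closure tie_set"
      unfolding closure_approachable
    proof (intro allI impI)
      fix e :: real assume e: "e > 0"
      define s where "s = min t (ln (e / 2) / real (p + 1))"
      have "Y s \<in> V q" unfolding YV using B(2)[of s t] t B(4)[of s] q by (auto simp: s_def)
      then have "Y s \<in> tie_set" using VT by blast
      moreover have "real (p + 1) * s \<le> ln (e / 2)"
      proof -
        have "s \<le> ln (e / 2) / real (p + 1)" by (simp add: s_def)
        then show ?thesis by (simp add: pos_le_divide_eq mult.commute)
      qed
      then have "exp (real (p + 1) * s) \<le> exp (ln (e / 2))" by simp
      then have "dist (Y s) 0 < e" using e sign(2) by (simp add: Y_def abs_mult)
      ultimately show "\<exists>y\<in>tie_set. dist y 0 < e" by blast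
    qed
    then have "of_real 0 \<in> complex_of_real ` tie_set" using tie_set_closed by (intro imageI) (simp add: closure_closed)
    then show ?thesis unfolding Gamma_tilde_eq by simp
  qed
qed

lemma Gamma_tilde_signed: "Gamma_tilde p r b k \<subseteq> complex_of_real ` {y. 0 \<le> sign * y}"
  unfolding Gamma_tilde_eq by (auto simp: tie_set_def)

end

theorem theorem2p2:
  fixes p r k :: nat and a b :: "nat \<Rightarrow> real"
  assumes "p \<ge> 1" and "r \<ge> 1"
    and "\<And>n. a n > 0"
    and "\<And>j. j < r \<Longrightarrow> (\<lambda>n. a (r * n + j)) \<longlonglongrightarrow> b j"
    and "\<And>j. j < r \<Longrightarrow> b j > 0"
    and "k \<le> p - 1"
  shows "(even k \<longrightarrow> Gamma_tilde p r b k \<subseteq> complex_of_real ` {0..}) \<and>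
    (odd k \<longrightarrow> Gamma_tilde p r b k \<subseteq> complex_of_real ` {..0}) \<and>
    interval_count p r k \<ge> 0 \<and>
    (\<exists>I :: nat \<Rightarrow> real set.
       Gamma_tilde p r b k = (\<Union>j\<in>{1..nat (interval_count p r k)}. complex_of_real ` I j) \<and>
       (\<forall>j\<in>{1..nat (interval_count p r k)}. proper_interval (I j)) \<and>
       (\<forall>i\<in>{1..nat (interval_count p r k)}. \<forall>j\<in>{1..nat (interval_count p r k)}.
          i \<noteq> j \<longrightarrow> disjoint_up_to_endpoints (I i) (I j)) \<and>
       (real (k * r) / real p \<notin> \<nat> \<longrightarrow>
          (\<exists>j\<in>{1..nat (interval_count p r k)}. extends_to_signed_infinity k (I j)))) \<and>
    (real (k + 1) / real (p + 1) * real r \<notin> \<nat> - {0} \<longrightarrow> 0 \<in> Gamma_tilde p r b k)"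
proof -
  interpret shift_symbol p r using assms(1,2) by unfold_locales
  have "pos_weights b" using assms(5) by (simp add: pos_weights_def)
  moreover have "k < p" using assms(1,6) by simp
  ultimately interpret root_strip p r b k by unfold_locales
  have "even k \<longrightarrow> Gamma_tilde p r b k \<subseteq> complex_of_real ` {0..}" "odd k \<longrightarrow> Gamma_tilde p r b k \<subseteq> complex_of_real ` {..0}"
    using Gamma_tilde_signed by (auto simp: sign_def)
  then show ?thesis using interval_decomposition by simp
qed

end
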